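(* Let $(\mathsf{Samp},\mathsf{Ver})$ be an efficiently verifiable one-way puzzle (EV-OWPuzz). Suppose the marginal distribution of the puzzle $s$ output by $\mathsf{Samp}(1^\lambda)$ is $\epsilon$-close (in statistical distance) to the uniform distribution over $\{0,1\}^{m(\lambda)}$, where $m(\lambda)$ is the puzzle length and $\epsilon=\epsilon_\lambda$ is negligible in $\lambda$. Then there is a statistically $2\epsilon$-hiding and computationally sum-binding QCCC bit commitment scheme.
   Context: QPT means quantum polynomial time; $\mathrm{negl}(\lambda)$ denotes a negligible function. EV-OWPuzz: a pair of QPT algorithms $(\mathsf{Samp},\mathsf{Ver})$, where $\mathsf{Samp}(1^\lambda)$ outputs a pair of classical strings $(s,k)$ ($s$ is the puzzle, $k$ the key) and $\mathsf{Ver}(s,k)$ outputs a bit, such that (Correctness) $\Pr_{(s,k)\gets\mathsf{Samp}(1^\lambda)}[\mathsf{Ver}(s,k)=1]\ge 1-\mathrm{negl}(\lambda)$; (Security) for every QPT algorithm $\mathcal A$ with (polynomial-length classical) advice $c$, $\Pr_{(s,k)\gets\mathsf{Samp}(1^\lambda)}[\mathsf{Ver}(s,\mathcal A(s,c))=1]\le \mathrm{negl}(\lambda)$. QCCC (quantum-computation classical-communication) bit commitment: an efficient two-phase protocol between a committer $C$ and a receiver $R$, who compute quantumly but exchange only classical messages and share no initial entanglement. Commit stage: both receive $1^\lambda$, $C$ gets a bit $b$; they interact and produce a transcript $z$, and end with private quantum states $\rho_C,\rho_R$. Opening stage: both receive $z$ and their private states, interact and produce a transcript $d$; at the end $R$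 outputs a message or rejects. - Correctness: for each $b$, when both parties are honest, $R$ outputs $b$ with probability at least $1-\mathrm{negl}(\lambda)$. - Statistical $\epsilon'$-hiding: for every (unbounded) adversarial receiver $R'$, the commit-stage transcripts of the interaction of $R'$ with the honest $C$ for $b=0$ and for $b=1$ are at statistical distance at most $\epsilon'$. - Computational sum-binding: every QPT adversarial committer $C'$ wins the following game with probability at most $(1+\delta)/2$ for a negligible $\delta$: $C'$ (receiving no bit) interacts with the honest $R$ in the commit stage; then a uniformly random bit $b$ is sampled and given to $C'$; $C'$ and the honest $R$ run the opening stage; $C'$ wins if $R$ outputs $b$. *)

theory Defs
  imports
    "HOL-Probability.Probability"
    "HOL-Computational_Algebra.Polynomial"
begin

section \<open>Deterministic polynomial time\<close>

text \<open>
  The classical machine model, used only to express uniformity of circuit families: structured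
  programs over finitely many stacks of bits, every elementary instruction and every test costing
  one step.  Such programs and multi-tape Turing machines simulate each other with polynomial
  overhead.
\<close>

datatype com =
    Push nat bool
  | Pop nat
  | Seq com com
  | Case nat com com com \<comment> \<open>stack empty / top bit 0 / top bit 1\<close>
  | While nat com        \<comment> \<open>loop as long as the stack is nonempty\<close>

type_synonym store = "nat \<Rightarrow> bool list"

inductive exec :: "com \<Rightarrow> store \<Rightarrow> nat \<Rightarrow> store \<Rightarrow> bool" where
  Push: "exec (Push x b) s 1 (s(x := b # s x))"
| Pop: "exec (Pop x) s 1 (s(x := tl (s x)))"
| Seq: "exec c1 s t1 s1 \<Longrightarrow> exec c2 s1 t2 s2 \<Longrightarrow> exec (Seq c1 c2) s (t1 + t2) s2"
| Case_Nil: "s x = [] \<Longrightarrow> exec c1 s t s' \<Longrightarrow> exec (Case x c1 c2 c3) s (Suc t) s'"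
| Case_False: "s x = False # bs \<Longrightarrow> exec c2 s t s' \<Longrightarrow> exec (Case x c1 c2 c3) s (Suc t) s'"
| Case_True: "s x = True # bs \<Longrightarrow> exec c3 s t s' \<Longrightarrow> exec (Case x c1 c2 c3) s (Suc t) s'"
| While_Nil: "s x = [] \<Longrightarrow> exec (While x c) s 1 s"
| While_Cons: "s x \<noteq> [] \<Longrightarrow> exec c s t1 s1 \<Longrightarrow> exec (While x c) s1 t2 s2
    \<Longrightarrow> exec (While x c) s (Suc (t1 + t2)) s2"

text \<open>The program receives the security parameter in unary on stack 0 and leaves its output there.\<close>

definition poly_time :: "(nat \<Rightarrow> bool list) \<Rightarrow> bool" where
  "poly_time f \<longleftrightarrow> (\<exists>c. \<exists>p :: nat poly. \<forall>n. \<exists>t s.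
     exec c ((\<lambda>_. [])(0 := replicate n True)) t s \<and> t \<le> poly p n \<and> s 0 = f n)"


section \<open>Quantum states, gates and measurements\<close>

text \<open>
  A vector of n qubits is given by its amplitudes in the computational basis, indexed by the bit
  strings of length n; all other amplitudes are 0.  Wire i is position i of the bit string.
\<close>

type_synonym qvec = "bool list \<Rightarrow> complex"

definition qspace :: "nat \<Rightarrow> qvec set" where
  "qspace n = {\<psi>. \<forall>x. length x \<noteq> n \<longrightarrow> \<psi> x = 0}"

definition norm_sq :: "nat \<Rightarrow> qvec \<Rightarrow> real" where
  "norm_sq n \<psi> = (\<Sum>x | length x = n. (cmod (\<psi> x))\<^sup>2)"

definition empty_state :: qvec where
  "empty_state = (\<lambda>x. if x = [] then 1 else 0)"

text \<open>
  An operation is applicable at every number of qubits.  On a finite-dimensional space, a linear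
  norm-preserving endomorphism is unitary.
\<close>

definition unitary_op :: "(qvec \<Rightarrow> qvec) \<Rightarrow> bool" where
  "unitary_op U \<longleftrightarrow> (\<forall>n.
     (\<forall>\<psi>\<in>qspace n. U \<psi> \<in> qspace n \<and> norm_sq n (U \<psi>) = norm_sq n \<psi>) \<and>
     (\<forall>\<phi>\<in>qspace n. \<forall>\<psi>\<in>qspace n. \<forall>a b.
        U (\<lambda>x. a * \<phi> x + b * \<psi> x) = (\<lambda>x. a * U \<phi> x + b * U \<psi> x)))"

datatype gate = Hadamard nat | TGate nat | CNOT nat nat

text \<open>Gates addressing nonexistent wires, or a CNOT whose wires coincide, act as the identity.\<close>

fun apply_gate :: "gate \<Rightarrow> qvec \<Rightarrow> qvec" where
  "apply_gate (Hadamard i) \<psi> = (\<lambda>x. if i < length x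
     then (\<psi> (x[i := False]) + (if x ! i then -1 else 1) * \<psi> (x[i := True])) / complex_of_real (sqrt 2)
     else \<psi> x)"
| "apply_gate (TGate i) \<psi> = (\<lambda>x. if i < length x \<and> x ! i then cis (pi / 4) * \<psi> x else \<psi> x)"
| "apply_gate (CNOT i j) \<psi> = (\<lambda>x. if i < length x \<and> j < length x \<and> i \<noteq> j \<and> x ! i
     then \<psi> (x[j := \<not> x ! j]) else \<psi> x)"

text \<open>Born rule for measuring all wires, and for measuring the first k wires.\<close>

definition born :: "qvec \<Rightarrow> bool list pmf" where
  "born \<psi> = embed_pmf (\<lambda>x. (cmod (\<psi> x))\<^sup>2)"

definition measure_wires :: "nat \<Rightarrow> qvec \<Rightarrow> (bool list \<times> qvec) pmf" where
  "measure_wires k \<psi> = (let p = map_pmf (take k) (born \<psi>) in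
     map_pmf (\<lambda>y. (y, \<lambda>x. \<psi> (y @ x) / complex_of_real (sqrt (pmf p y)))) p)"

text \<open>The state in which j fresh zero wires and the basis state x are prepended to the given one.\<close>

definition load :: "nat \<Rightarrow> bool list \<Rightarrow> qvec \<Rightarrow> qvec" where
  "load j x \<psi> = (\<lambda>y. if take (j + length x) y = replicate j False @ x
     then \<psi> (drop (j + length x) y) else 0)"


section \<open>Quantum machines\<close>

text \<open>
  One activation of a machine on classical input x and private state \<open>\<psi>\<close>: the wires are, in this
  order, the output wires and the ancillas (all initially 0), the input, and the private state.
  After the operation, the output wires are measured and the remaining wires are the new private
  state.  Nothing is ever discarded, so that private states stay pure; by purification this is no
  restriction.
\<close>

datatype activation = Activation (act_out: nat) (act_anc: nat) (act_op: "qvec \<Rightarrow> qvec")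

definition activate :: "activation \<Rightarrow> bool list \<Rightarrow> qvec \<Rightarrow> (bool list \<times> qvec) pmf" where
  "activate A x \<psi> = measure_wires (act_out A) (act_op A (load (act_out A + act_anc A) x \<psi>))"

datatype circuit = Circuit (n_out: nat) (n_anc: nat) (gates: "gate list")

definition act :: "circuit \<Rightarrow> activation" where
  "act C = Activation (n_out C) (n_anc C) (fold apply_gate (gates C))"

text \<open>
  Activations preserve normalization, so that \<open>embed_pmf\<close> in \<open>born\<close> is always applied
  to a probability distribution, and circuits are a special case of unitary operations.
\<close>

lemma finite_len: "finite {x :: bool list. length x = n}"
  using finite_lists_length_eq[of "UNIV :: bool set" n] by simp

lemma pmf_born:
  assumes "\<psi> \<in> qspace n" "norm_sq n \<psi> = 1"
  shows "pmf (born \<psi>) x = (cmod (\<psi> x))\<^sup>2"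
  unfolding born_def
proof (rule pmf_embed_pmf)
  let ?S = "{x :: bool list. length x = n}"
  let ?f = "\<lambda>x. (cmod (\<psi> x))\<^sup>2"
  have "(\<integral>\<^sup>+ x. ennreal (?f x) \<partial>count_space UNIV)
      = (\<integral>\<^sup>+ x. ennreal (?f x) * indicator ?S x \<partial>count_space UNIV)"
    using assms(1) by (intro nn_integral_cong) (auto simp: qspace_def indicator_def)
  also have "\<dots> = (\<integral>\<^sup>+ x. ennreal (?f x) \<partial>count_space ?S)"
    by (simp add: nn_integral_count_space_indicator)
  also have "\<dots> = (\<Sum>x\<in>?S. ennreal (?f x))"
    by (rule nn_integral_count_space_finite) (rule finite_len)
  also have "\<dots> = ennreal (norm_sq n \<psi>)" by (simp add: norm_sq_def sum_ennreal)
  finally show "(\<integral>\<^sup>+ x. ennreal (?f x) \<partial>count_space UNIV) = 1" using assms(2) by simp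
qed simp

lemma sum_pair_flip:
  fixes f :: "bool list \<Rightarrow> real"
  assumes i: "i < n"
  shows "(\<Sum>x | length x = n. f x) = (\<Sum>x | length x = n. f (x[i := False]) + f (x[i := True])) / 2"
proof -
  let ?S = "{x :: bool list. length x = n}"
  have b: "bij_betw (\<lambda>x. x[i := \<not> x ! i]) ?S ?S"
    using i by (intro bij_betw_byWitness[where f'="\<lambda>x. x[i := \<not> x ! i]"]) auto
  have "(\<Sum>x\<in>?S. f (x[i := \<not> x ! i])) = (\<Sum>x\<in>?S. f x)"
    using sum.reindex_bij_betw[OF b, of f] by simp
  moreover have "f (x[i := False]) + f (x[i := True]) = f x + f (x[i := \<not> x ! i])"
    if "length x = n" for x
    using list_update_id[of x i] by (cases "x ! i") auto
  hence "(\<Sum>x\<in>?S. f (x[i := False]) + f (x[i := True])) = (\<Sum>x\<in>?S. f x) + (\<Sum>x\<in>?S. f (x[i := \<not> x ! i]))"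
    by (simp add: sum.distrib[symmetric])
  ultimately show ?thesis by simp
qed

lemma parallelogram: "(cmod (a + b))\<^sup>2 + (cmod (a - b))\<^sup>2 = 2 * ((cmod a)\<^sup>2 + (cmod b)\<^sup>2)"
  unfolding cmod_power2 by (simp add: power2_eq_square algebra_simps)

lemma norm_hadamard:
  assumes "i < n"
  shows "norm_sq n (apply_gate (Hadamard i) \<psi>) = norm_sq n \<psi>"
proof -
  have "norm_sq n (apply_gate (Hadamard i) \<psi>) =
    (\<Sum>x | length x = n. (cmod (apply_gate (Hadamard i) \<psi> (x[i := False])))\<^sup>2
       + (cmod (apply_gate (Hadamard i) \<psi> (x[i := True])))\<^sup>2) / 2"
    unfolding norm_sq_def by (rule sum_pair_flip[OF assms])
  also have "\<dots> = (\<Sum>x | length x = n. (cmod (\<psi> (x[i := False])))\<^sup>2 + (cmod (\<psi> (x[i := True])))\<^sup>2) / 2"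
    using assms parallelogram
    by (intro arg_cong[where f="\<lambda>x. x/2"] sum.cong refl)
      (simp add: norm_divide power_divide add_divide_distrib[symmetric])
  also have "\<dots> = norm_sq n \<psi>" unfolding norm_sq_def by (rule sum_pair_flip[OF assms, symmetric])
  finally show ?thesis .
qed

lemma norm_cnot:
  "norm_sq n (apply_gate (CNOT i j) \<psi>) = norm_sq n \<psi>"
proof -
  let ?S = "{x :: bool list. length x = n}"
  let ?g = "\<lambda>x. if i < length x \<and> j < length x \<and> i \<noteq> j \<and> x ! i then x[j := \<not> x ! j] else x"
  have b: "bij_betw ?g ?S ?S"
    by (intro bij_betw_byWitness[where f'="?g"]) (auto)
  have "norm_sq n (apply_gate (CNOT i j) \<psi>) = (\<Sum>x\<in>?S. (cmod (\<psi> (?g x)))\<^sup>2)"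
    unfolding norm_sq_def by (intro sum.cong) auto
  also have "\<dots> = norm_sq n \<psi>" unfolding norm_sq_def
    by (rule sum.reindex_bij_betw[OF b, of "\<lambda>x. (cmod (\<psi> x))\<^sup>2"])
  finally show ?thesis .
qed

lemma norm_gate: "norm_sq n (apply_gate g \<psi>) = norm_sq n \<psi>"
proof (cases g)
  case (Hadamard i)
  thus ?thesis
    using norm_hadamard[of i n] by (cases "i < n") (auto simp: norm_sq_def intro!: sum.cong)
next
  case (TGate i)
  thus ?thesis by (auto simp: norm_sq_def norm_mult intro!: sum.cong)
next
  case (CNOT i j)
  show ?thesis unfolding CNOT by (rule norm_cnot)
qed

lemma unitary_gate: "unitary_op (apply_gate g)"
  unfolding unitary_op_def
proof (intro allI conjI ballI)
  fix n \<psi> assume "\<psi> \<in> qspace n"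
  thus "apply_gate g \<psi> \<in> qspace n" by (cases g) (auto simp: qspace_def)
next
  fix n \<psi> show "norm_sq n (apply_gate g \<psi>) = norm_sq n \<psi>" by (rule norm_gate)
next
  fix \<phi> \<psi> and a b :: complex
  show "apply_gate g (\<lambda>x. a * \<phi> x + b * \<psi> x) = (\<lambda>x. a * apply_gate g \<phi> x + b * apply_gate g \<psi> x)"
    by (cases g) (auto simp: fun_eq_iff field_simps)
qed

lemma unitary_circuit: "unitary_op (act_op (act C))"
proof -
  have "unitary_op (fold apply_gate gs)" for gs
  proof (induction gs)
    case (Cons g gs)
    have "fold apply_gate gs (apply_gate g (\<lambda>x. a * \<phi> x + b * \<psi> x)) =
        (\<lambda>x. a * fold apply_gate gs (apply_gate g \<phi>) x + b * fold apply_gate gs (apply_gate g \<psi>) x)"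
      if "\<phi> \<in> qspace n" "\<psi> \<in> qspace n" for n \<phi> \<psi> a b
    proof -
      have 1: "apply_gate g (\<lambda>x. a * \<phi> x + b * \<psi> x) = (\<lambda>x. a * apply_gate g \<phi> x + b * apply_gate g \<psi> x)"
        using unitary_gate[of g] that by (simp add: unitary_op_def)
      have "apply_gate g \<phi> \<in> qspace n" "apply_gate g \<psi> \<in> qspace n"
        using unitary_gate[of g] that by (simp_all add: unitary_op_def)
      thus ?thesis unfolding 1 using Cons.IH by (simp add: unitary_op_def)
    qed
    thus ?case using unitary_gate[of g] Cons.IH by (simp add: unitary_op_def)
  qed (simp add: unitary_op_def)
  thus ?thesis by (simp add: act_def)
qed

lemma load_state:
  assumes "\<psi> \<in> qspace n" "norm_sq n \<psi> = 1"
  shows "load j x \<psi> \<in> qspace (j + length x + n)" "norm_sq (j + length x + n) (load j x \<psi>) = 1"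
proof -
  let ?k = "j + length x" and ?p = "replicate j False @ x"
  show "load j x \<psi> \<in> qspace (?k + n)"
    using assms(1) by (auto simp: load_def qspace_def dest: arg_cong[where f=length])
  have "norm_sq (?k + n) (load j x \<psi>) = (\<Sum>y\<in>(@) ?p ` {y. length y = n}. (cmod (load j x \<psi> y))\<^sup>2)"
    unfolding norm_sq_def
  proof (intro sum.mono_neutral_right ballI)
    fix y assume y: "y \<in> {y. length y = ?k + n} - (@) ?p ` {y. length y = n}"
    have "take ?k y \<noteq> ?p"
    proof
      assume "take ?k y = ?p"
      hence "y = ?p @ drop ?k y" by (metis append_take_drop_id)
      moreover have "length (drop ?k y) = n" using y by simp
      ultimately show False using y by blast
    qed
    thus "(cmod (load j x \<psi> y))\<^sup>2 = 0" by (simp add: load_def)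
  qed (auto simp: finite_len)
  also have "\<dots> = norm_sq n \<psi>"
    unfolding norm_sq_def by (subst sum.reindex) (auto simp: inj_on_def load_def)
  finally show "norm_sq (?k + n) (load j x \<psi>) = 1" using assms(2) by simp
qed

lemma measure_state:
  assumes "\<psi> \<in> qspace (k + n)" "norm_sq (k + n) \<psi> = 1" "(y, \<phi>) \<in> set_pmf (measure_wires k \<psi>)"
  shows "length y = k" "\<phi> \<in> qspace n" "norm_sq n \<phi> = 1"
proof -
  let ?p = "map_pmf (take k) (born \<psi>)"
  have y: "y \<in> set_pmf ?p" and \<phi>: "\<phi> = (\<lambda>x. \<psi> (y @ x) / complex_of_real (sqrt (pmf ?p y)))"
    using assms(3) by (auto simp: measure_wires_def Let_def)
  from y obtain x where "x \<in> set_pmf (born \<psi>)" "y = take k x" by auto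
  hence "\<psi> x \<noteq> 0" by (auto simp: set_pmf_eq pmf_born[OF assms(1,2)])
  hence "length x = k + n" using assms(1) by (auto simp: qspace_def)
  thus len: "length y = k" using \<open>y = take k x\<close> by simp
  show "\<phi> \<in> qspace n" using assms(1) len by (auto simp: \<phi> qspace_def)
  have eq: "take k -` {y} \<inter> set_pmf (born \<psi>) = (@) y ` {x. length x = n} \<inter> set_pmf (born \<psi>)"
  proof (intro equalityI subsetI)
    fix w assume w: "w \<in> take k -` {y} \<inter> set_pmf (born \<psi>)"
    hence "\<psi> w \<noteq> 0" by (auto simp: set_pmf_eq pmf_born[OF assms(1,2)])
    hence "length w = k + n" using assms(1) by (auto simp: qspace_def)
    hence "length (drop k w) = n" by simp
    moreover have "w = y @ drop k w" using w by auto
    ultimately show "w \<in> (@) y ` {x. length x = n} \<inter> set_pmf (born \<psi>)" using w by blast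
  qed (use len in auto)
  have "pmf ?p y = measure (born \<psi>) (take k -` {y})" by (simp add: pmf_map)
  also have "\<dots> = measure (born \<psi>) ((@) y ` {x. length x = n})"
    by (metis eq measure_Int_set_pmf)
  also have "\<dots> = (\<Sum>w\<in>(@) y ` {x. length x = n}. (cmod (\<psi> w))\<^sup>2)"
    by (simp add: measure_measure_pmf_finite finite_len pmf_born[OF assms(1,2)])
  also have "\<dots> = (\<Sum>x | length x = n. (cmod (\<psi> (y @ x)))\<^sup>2)"
    by (subst sum.reindex) (auto simp: inj_on_def)
  finally have p: "pmf ?p y = (\<Sum>x | length x = n. (cmod (\<psi> (y @ x)))\<^sup>2)" .
  have "pmf ?p y > 0" using y by (rule pmf_positive)
  thus "norm_sq n \<phi> = 1"
    unfolding \<phi> norm_sq_def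
    by (simp add: norm_divide power_divide sum_divide_distrib[symmetric] p[symmetric] del: pmf_map)
qed

definition run :: "circuit \<Rightarrow> bool list \<Rightarrow> bool list pmf" where
  "run C x = map_pmf fst (activate (act C) x empty_state)"

definition enc_nat :: "nat \<Rightarrow> bool list" where
  "enc_nat n = replicate n True @ [False]"

definition enc_list :: "('a \<Rightarrow> bool list) \<Rightarrow> 'a list \<Rightarrow> bool list" where
  "enc_list e xs = concat (map (\<lambda>x. True # e x) xs) @ [False]"

fun enc_gate :: "gate \<Rightarrow> bool list" where
  "enc_gate (Hadamard i) = [False, False] @ enc_nat i"
| "enc_gate (TGate i) = [False, True] @ enc_nat i"
| "enc_gate (CNOT i j) = [True, False] @ enc_nat i @ enc_nat j"

definition enc_circuit :: "circuit \<Rightarrow> bool list" where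
  "enc_circuit C = enc_nat (n_out C) @ enc_nat (n_anc C) @ enc_list enc_gate (gates C)"

text \<open>
  An interactive quantum machine is, for each value of the security parameter, the list of the
  circuits for its successive activations.  It is QPT if these lists are uniformly computable in
  polynomial time; as the encoding is in unary, the number of wires is then polynomial as well.
\<close>

definition QPT_machine :: "(nat \<Rightarrow> circuit list) \<Rightarrow> bool" where
  "QPT_machine M \<longleftrightarrow> poly_time (\<lambda>n. enc_list enc_circuit (M n))"

definition QPT :: "(nat \<Rightarrow> circuit) \<Rightarrow> bool" where
  "QPT A \<longleftrightarrow> QPT_machine (\<lambda>n. [A n])"


section \<open>Efficiently verifiable one-way puzzles\<close>

definition negl :: "(nat \<Rightarrow> real) \<Rightarrow> bool" where
  "negl f \<longleftrightarrow> (\<forall>c. \<forall>\<^sub>F n in sequentially. \<bar>f n\<bar> < 1 / real n ^ c)"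

definition stat_dist :: "'a pmf \<Rightarrow> 'a pmf \<Rightarrow> real" where
  "stat_dist p q = (\<Sum>\<^sub>\<infinity>x. \<bar>pmf p x - pmf q x\<bar>) / 2"

definition poly_length :: "(nat \<Rightarrow> bool list) \<Rightarrow> bool" where
  "poly_length c \<longleftrightarrow> (\<exists>p :: nat poly. \<forall>n. length (c n) \<le> poly p n)"

definition samp_dist :: "(nat \<Rightarrow> nat) \<Rightarrow> (nat \<Rightarrow> circuit) \<Rightarrow> nat \<Rightarrow> (bool list \<times> bool list) pmf" where
  "samp_dist m Samp n = map_pmf (\<lambda>y. (take (m n) y, drop (m n) y)) (run (Samp n) [])"

definition verify :: "(nat \<Rightarrow> circuit) \<Rightarrow> nat \<Rightarrow> bool list \<Rightarrow> bool list \<Rightarrow> bool pmf" where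
  "verify Ver n s k = map_pmf (\<lambda>v. v = [True]) (run (Ver n) (s @ k))"

text \<open>
  m and l are the lengths of the puzzle and of the key.  That m is polynomial-time computable is
  what makes the output wires of Samp an encoding of a pair of strings.
\<close>

definition EV_OWPuzz ::
    "(nat \<Rightarrow> nat) \<Rightarrow> (nat \<Rightarrow> nat) \<Rightarrow> (nat \<Rightarrow> circuit) \<Rightarrow> (nat \<Rightarrow> circuit) \<Rightarrow> bool" where
  "EV_OWPuzz m l Samp Ver \<longleftrightarrow>
     QPT Samp \<and> QPT Ver \<and> poly_time (\<lambda>n. replicate (m n) True) \<and>
     (\<forall>n. n_out (Samp n) = m n + l n \<and> n_out (Ver n) = 1) \<and>
     (\<exists>\<nu>. negl \<nu> \<and> (\<forall>n.
        pmf (do {(s, k) \<leftarrow> samp_dist m Samp n; verify Ver n s k}) True \<ge> 1 - \<nu> n)) \<and>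
     (\<forall>A c. QPT A \<and> (\<forall>n. n_out (A n) = l n) \<and> poly_length c \<longrightarrow>
        negl (\<lambda>n. pmf (do {
          (s, k) \<leftarrow> samp_dist m Samp n;
          k' \<leftarrow> run (A n) (s @ c n);
          verify Ver n s k'}) True))"


section \<open>QCCC bit commitments\<close>

text \<open>
  Each round consists of a message of the committer (first machine) and a message of the receiver
  (second machine); as messages may be empty, this covers every order of speaking.  x is the
  pending input of the committer, y that of the receiver, who gets it together with the
  committer's next message.  Since the parties share no entanglement and exchange classical messages
  only, their joint state, conditioned on the transcript, is a product state throughout.
\<close>

fun interact :: "activation list \<Rightarrow> activation list \<Rightarrow> bool list \<Rightarrow> bool list \<Rightarrow> qvec \<Rightarrow> qvec
    \<Rightarrow> (bool list list \<times> qvec \<times> qvec) pmf" where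
  "interact (C # Cs) (R # Rs) x y \<psi>C \<psi>R = do {
     (c, \<psi>C') \<leftarrow> activate C x \<psi>C;
     (r, \<psi>R') \<leftarrow> activate R (y @ c) \<psi>R;
     (z, \<phi>C, \<phi>R) \<leftarrow> interact Cs Rs r [] \<psi>C' \<psi>R';
     return_pmf (c # r # z, \<phi>C, \<phi>R)}"
| "interact _ _ x y \<psi>C \<psi>R = return_pmf ([], \<psi>C, \<psi>R)"

record commitment =
  commit_C :: "nat \<Rightarrow> circuit list"
  commit_R :: "nat \<Rightarrow> circuit list"
  open_C :: "nat \<Rightarrow> circuit list"
  open_R :: "nat \<Rightarrow> circuit list"

text \<open>Commit stage: the committer's input is [b] if honest and [] if adversarial.\<close>

definition commit_stage :: "activation list \<Rightarrow> activation list \<Rightarrow> bool list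
    \<Rightarrow> (bool list list \<times> qvec \<times> qvec) pmf" where
  "commit_stage Cs Rs x = interact Cs Rs x [] empty_state empty_state"

text \<open>
  Opening stage: both parties receive the commit transcript z; the committer's additional input x is
  [] if honest and [b] if adversarial.  The outcome of the receiver's last activation is not a
  message but its final decision.
\<close>

definition decision :: "bool list \<Rightarrow> bool option" where
  "decision v = (case v of [accept, b] \<Rightarrow> if accept then Some b else None | _ \<Rightarrow> None)"

definition open_stage :: "activation list \<Rightarrow> activation list \<Rightarrow> bool list
    \<Rightarrow> bool list list \<times> qvec \<times> qvec \<Rightarrow> bool option pmf" where
  "open_stage Cs Rs x = (\<lambda>(z, \<psi>C, \<psi>R).
     map_pmf (\<lambda>(d, _, _). decision (last d)) (interact Cs Rs (concat z @ x) (concat z) \<psi>C \<psi>R))"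

definition efficient_protocol :: "commitment \<Rightarrow> bool" where
  "efficient_protocol S \<longleftrightarrow>
     QPT_machine (commit_C S) \<and> QPT_machine (commit_R S) \<and>
     QPT_machine (open_C S) \<and> QPT_machine (open_R S) \<and>
     (\<forall>n. length (commit_C S n) = length (commit_R S n) \<and>
          length (open_C S n) = length (open_R S n) \<and>
          open_R S n \<noteq> [] \<and> n_out (last (open_R S n)) = 2)"

definition honest_output :: "commitment \<Rightarrow> nat \<Rightarrow> bool \<Rightarrow> bool option pmf" where
  "honest_output S n b =
     commit_stage (map act (commit_C S n)) (map act (commit_R S n)) [b] \<bind>
     open_stage (map act (open_C S n)) (map act (open_R S n)) []"

definition correct :: "commitment \<Rightarrow> bool" where
  "correct S \<longleftrightarrow> (\<exists>\<nu>. negl \<nu> \<and>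
     (\<forall>n b. pmf (honest_output S n b) (Some b) \<ge> 1 - \<nu> n))"

definition QCCC_commitment :: "commitment \<Rightarrow> bool" where
  "QCCC_commitment S \<longleftrightarrow> efficient_protocol S \<and> correct S"

text \<open>
  Adversaries follow the message format of the protocol, that is, its number of rounds and its
  message lengths, and are otherwise arbitrary.
\<close>

definition commit_transcript :: "commitment \<Rightarrow> nat \<Rightarrow> activation list \<Rightarrow> bool \<Rightarrow> bool list list pmf" where
  "commit_transcript S n R' b = map_pmf fst (commit_stage (map act (commit_C S n)) R' [b])"

definition statistically_hiding :: "(nat \<Rightarrow> real) \<Rightarrow> commitment \<Rightarrow> bool" where
  "statistically_hiding \<epsilon>' S \<longleftrightarrow> (\<forall>n R'.
     (\<forall>A\<in>set R'. unitary_op (act_op A)) \<and> map act_out R' = map n_out (commit_R S n) \<longrightarrow>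
     stat_dist (commit_transcript S n R' False) (commit_transcript S n R' True) \<le> \<epsilon>' n)"

definition binding_game :: "commitment \<Rightarrow> (nat \<Rightarrow> circuit list) \<Rightarrow> (nat \<Rightarrow> circuit list) \<Rightarrow> nat
    \<Rightarrow> bool pmf" where
  "binding_game S commit_C' open_C' n = do {
     w \<leftarrow> commit_stage (map act (commit_C' n)) (map act (commit_R S n)) [];
     b \<leftarrow> pmf_of_set UNIV;
     v \<leftarrow> open_stage (map act (open_C' n)) (map act (open_R S n)) [b] w;
     return_pmf (v = Some b)}"

definition computationally_sum_binding :: "commitment \<Rightarrow> bool" where
  "computationally_sum_binding S \<longleftrightarrow> (\<forall>commit_C' open_C'.
     QPT_machine commit_C' \<and> QPT_machine open_C' \<and>
     (\<forall>n. map n_out (commit_C' n) = map n_out (commit_C S n) \<and>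
          map n_out (open_C' n) = map n_out (open_C S n)) \<longrightarrow>
     (\<exists>\<delta>. negl \<delta> \<and>
        (\<forall>n. pmf (binding_game S commit_C' open_C' n) True \<le> (1 + \<delta> n) / 2)))"

end

theory Submission
  imports Defs
begin

text \<open>
 The scheme is interactive hashing with a puzzle as the hashed string. The committer runs the
 sampler and keeps puzzle and key in superposition. In m + 1 rounds it sends a bit and receives a
 uniformly random challenge of m bits. Its first bit is 0. Each further bit is the next entry of the
 puzzle s, masked by the inner product of the later entries with the corresponding part of the
 preceding challenge; the last one is masked by the committed bit b instead. To open, the committer
 sends b and the key. The receiver finds s by back substitution and runs the verifier, so
 correctness is that of the puzzle (\<open>solve_record\<close>, \<open>honest_success\<close>).

 Hiding: the transcript does not change if the committer measures s at the start
 (\<open>meas_interact\<close>). If s is uniformly random, so is each of its answers, given the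
 later entries of s, and the transcripts for both values of b have the same distribution
 (\<open>full_committer_uniform\<close>). Replacing the uniform distribution by that of the sampled
 puzzle costs \<open>\<epsilon>\<close> for each b.

 Binding: a committer that wins with probability (1 + \<open>dl\<close>)/2 is turned into an
 inverter for uniformly random, hence for sampled puzzles. For a target s, the inverter simulates
 the whole game coherently and has to steer it to answers that are consistent with s. An answer is
 consistent with amplitude about \<open>1/sqrt 2\<close>; if it were exactly that, then one step of
 amplitude amplification per round, with a coin to make the amplitude 1/2, would be perfect
 (\<open>amplify_good\<close>). In general the amplified round has the effect of the operator 1 -
 y/2 before the round, where y/2 is the deviation of the probability of consistency from 1/2, as an
 operator. Over all targets the squared norms of the contributions of y add up to at most 1 in each
 round, because the Hadamard gates of the challenge turn the inner products with different s into
 different, hence orthogonal, bit flips (\<open>bessel\<close>). So the total squared distance of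
 the amplified states from the ideal ones stays at most 3, and r final rounds with 1 - y/5 instead
 of 1 - y/2 bring it down to 1 + 2 (4/5)^r (\<open>level_bound\<close>). A squared distance of 1 can
 take away a winning probability of at most 1/2 (\<open>accept_contraction\<close>), so some of the
 success remains (\<open>amplified_success\<close>). As 1 - y/5 is a convex combination of 1 and 1 -
 y/2, for some choice of rounds that are not amplified the success is just as large; not amplifying
 r rounds costs a factor of \<open>4^r\<close>, which is at most of the order of
 \<open>dl^-7\<close> and gives a success proportional to \<open>dl^9\<close>
 (\<open>inverter_of_committer\<close>).

 The choice of rounds depends on the security parameter in an arbitrary way. It is a
 polynomial-length advice for a universal circuit (\<open>nonuniform_security\<close>). All circuits
 used are generated in polynomial time, which is shown by closure properties of the functions
 computable by stack programs (\<open>pcomp\<close>).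
\<close>

section \<open>Gate sequences as linear maps\<close>

abbreviation "rt2 == complex_of_real (sqrt 2)"

notation (input) iff (infixr "<->" 25)

abbreviation "zeros n == replicate n False"

abbreviation ap :: "gate list => qvec => qvec" where
 "ap gs == fold apply_gate gs"

lemma ap_lin: "ap gs (%x. a * phi x + b * psi x) = (%x. a * ap gs phi x + b * ap gs psi x)"
proof (induction gs arbitrary: phi psi)
 case (Cons g gs)
 have "apply_gate g (%x. a * phi x + b * psi x) = (%x. a * apply_gate g phi x + b * apply_gate g psi x)"
  by (cases g) (auto simp: fun_eq_iff field_simps)
 thus ?case using Cons.IH by simp
qed simp

lemma ap_scale: "ap gs (%x. a * phi x) = (%x. a * ap gs phi x)"
 using ap_lin[of gs a phi 0 phi] by simp

lemma norm_ap: "norm_sq n (ap gs psi) = norm_sq n psi"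
 by (induction gs arbitrary: psi) (simp_all add: norm_gate)

lemma ap_cong:
 assumes "!!x. length x = n ==> phi x = psi x" "length x = n"
 shows "ap gs phi x = ap gs psi x"
 using assms
proof (induction gs arbitrary: phi psi)
 case (Cons g gs)
 have 1: "apply_gate g phi x = apply_gate g psi x" if "length x = n" for x
  using that Cons.prems(1) by (cases g) auto
 have "ap gs (apply_gate g phi) x = ap gs (apply_gate g psi) x"
  by (rule Cons.IH) (simp_all only: 1 Cons.prems(2))
 thus ?case by (simp only: fold_simps o_apply)
qed simp

text \<open>Gates that undo a gate; the T gate has order 8.\<close>

fun inv_gate :: "gate => gate list" where
 "inv_gate (TGate i) = replicate 7 (TGate i)"
| "inv_gate g = [g]"

definition inv_gates :: "gate list => gate list" where
 "inv_gates gs = concat (map inv_gate (rev gs))"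

lemma cis_pi4_8: "cis (pi/4) * (cis (pi/4) * (cis (pi/4) * (cis (pi/4) * (cis (pi/4) * (cis (pi/4) * (cis (pi/4) * (cis (pi/4) * z))))))) = z"
proof -
 have "cis (pi/4) ^ 8 = cis (2 * pi)" by (simp only: Complex.DeMoivre) simp
 hence "cis (pi/4) ^ 8 = 1" by simp
 thus ?thesis by (simp add: numeral_eq_Suc mult.assoc[symmetric])
qed

lemma cis_pi4_4: "cis (pi/4) * (cis (pi/4) * (cis (pi/4) * (cis (pi/4) * z))) = - z"
proof -
 have "cis (pi/4) ^ 4 = cis pi" by (simp only: Complex.DeMoivre) simp
 hence "cis (pi/4) ^ 4 = -1" by simp
 thus ?thesis by (simp add: numeral_eq_Suc mult.assoc[symmetric])
qed

lemma sqrt2_sq: "rt2 * rt2 = 2"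
 by (metis (mono_tags, opaque_lifting) abs_numeral of_real_mult of_real_numeral real_sqrt_mult_self)

lemma hadamard_twice: "apply_gate (Hadamard i) (apply_gate (Hadamard i) psi) = psi"
proof
 fix x show "apply_gate (Hadamard i) (apply_gate (Hadamard i) psi) x = psi x"
  using list_update_id[of x i]
  by (cases "x ! i") (auto simp: add_divide_distrib diff_divide_distrib sqrt2_sq)
qed

lemma inv_gate_right: "ap (inv_gate g) (apply_gate g psi) = psi"
proof (cases g)
 case (TGate i)
 thus ?thesis by (auto simp: fun_eq_iff numeral_eq_Suc cis_pi4_8)
next
 case (CNOT i j)
 have "(x[j := ~ x ! j])[j := x ! j] = x" for x :: "bool list" by simp
 with CNOT show ?thesis by (auto simp: fun_eq_iff)
qed (simp add: hadamard_twice del: apply_gate.simps)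

lemma inv_gate_left: "apply_gate g (ap (inv_gate g) psi) = psi"
proof (cases g)
 case (TGate i)
 thus ?thesis by (auto simp: fun_eq_iff numeral_eq_Suc cis_pi4_8)
next
 case (CNOT i j)
 have "(x[j := ~ x ! j])[j := x ! j] = x" for x :: "bool list" by simp
 with CNOT show ?thesis by (auto simp: fun_eq_iff)
qed (simp add: hadamard_twice del: apply_gate.simps)

lemma inv_gates_right: "ap (inv_gates gs) (ap gs psi) = psi"
 by (induction gs arbitrary: psi) (simp_all add: inv_gates_def inv_gate_right)

lemma inv_gates_left: "ap gs (ap (inv_gates gs) psi) = psi"
proof (induction gs arbitrary: psi)
 case (Cons g gs)
 have "ap (g # gs) (ap (inv_gates (g # gs)) psi) = ap gs (apply_gate g (ap (inv_gate g) (ap (inv_gates gs) psi)))"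
  by (simp add: inv_gates_def)
 thus ?case by (simp only: inv_gate_left Cons.IH)
qed (simp add: inv_gates_def)

text \<open>The real part of the inner product on the strings of length \<open>W\<close>.\<close>

definition ip :: "nat => qvec => qvec => real" where
 "ip W phi psi = (\<Sum>x | length x = W. Re (cnj (phi x) * psi x))"

lemma ip_self: "ip W psi psi = norm_sq W psi"
 unfolding ip_def norm_sq_def cmod_power2 by (intro sum.cong refl) (simp add: power2_eq_square)

lemma norm_sq_nonneg [simp]: "norm_sq W psi \<ge> 0"
 by (simp add: norm_sq_def sum_nonneg)

lemma ip_sym: "ip W phi psi = ip W psi phi"
 unfolding ip_def by (intro sum.cong refl) (simp add: algebra_simps)

lemma ip_lin_right:
 "ip W phi (%x. complex_of_real a * psi x + complex_of_real b * \<eta> x) = a * ip W phi psi + b * ip W phi \<eta>"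
 unfolding ip_def by (simp add: sum_distrib_left sum.distrib[symmetric] algebra_simps)

lemma ip_lin_left:
 "ip W (%x. complex_of_real a * psi x + complex_of_real b * \<eta> x) phi = a * ip W psi phi + b * ip W \<eta> phi"
 by (simp add: ip_sym[of W _ phi] ip_lin_right)

lemma norm_sq_lin:
 "norm_sq W (%x. complex_of_real a * psi x + complex_of_real b * \<eta> x)
  = a\<^sup>2 * norm_sq W psi + 2 * a * b * ip W psi \<eta> + b\<^sup>2 * norm_sq W \<eta>"
 unfolding ip_self[symmetric] ip_lin_right ip_lin_left
 by (simp add: ip_sym[of W \<eta> psi] algebra_simps power2_eq_square)

lemma norm_sq_scale: "norm_sq W (%x. c * psi x) = (cmod c)\<^sup>2 * norm_sq W psi"
 unfolding norm_sq_def by (simp add: norm_mult power_mult_distrib sum_distrib_left)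

lemma norm_sq_cong: "(!!x. length x = W ==> phi x = psi x) ==> norm_sq W phi = norm_sq W psi"
 unfolding norm_sq_def by (intro sum.cong) auto

lemma norm_sq_convex:
 assumes "0 <= w" "w <= 1"
 shows "norm_sq W (%x. complex_of_real (1 - w) * psi x + complex_of_real w * \<eta> x)
  <= (1 - w) * norm_sq W psi + w * norm_sq W \<eta>"
proof -
 have "0 <= norm_sq W (%x. complex_of_real 1 * psi x + complex_of_real (-1) * \<eta> x)" by (rule norm_sq_nonneg)
 hence "0 <= norm_sq W psi - 2 * ip W psi \<eta> + norm_sq W \<eta>"
  unfolding norm_sq_lin by simp
 hence "0 <= (1 - w) * w * (norm_sq W psi - 2 * ip W psi \<eta> + norm_sq W \<eta>)"
  using assms by (intro mult_nonneg_nonneg) simp_all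
 thus ?thesis unfolding norm_sq_lin by (simp add: algebra_simps power2_eq_square)
qed

lemma ip_ap: "ip W (ap gs phi) (ap gs psi) = ip W phi psi"
proof -
 have "norm_sq W (%x. complex_of_real 1 * ap gs phi x + complex_of_real 1 * ap gs psi x)
   = norm_sq W (%x. complex_of_real 1 * phi x + complex_of_real 1 * psi x)"
  using norm_ap[of W gs "%x. complex_of_real 1 * phi x + complex_of_real 1 * psi x"]
  unfolding ap_lin .
 thus ?thesis unfolding norm_sq_lin by (simp add: norm_ap)
qed

lemma ip_adjoint: "ip W (ap gs phi) psi = ip W phi (ap (inv_gates gs) psi)"
 using ip_ap[of W gs phi "ap (inv_gates gs) psi"] by (simp add: inv_gates_left)

section \<open>Locality\<close>

text \<open>The wires whose value a gate can change; phases do not count.\<close>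

fun gate_targets :: "gate => nat set" where
 "gate_targets (Hadamard i) = {i}"
| "gate_targets (TGate i) = {}"
| "gate_targets (CNOT i j) = {j}"

abbreviation targets :: "gate list => nat set" where
 "targets gs == \<Union> (gate_targets ` set gs)"

lemma ap_diag:
 assumes "!!i x b. i : targets gs ==> g (x[i := b]) = g x"
 shows "ap gs (%x. g x * psi x) = (%x. g x * ap gs psi x)"
 using assms
proof (induction gs arbitrary: psi)
 case (Cons a gs)
 have "apply_gate a (%x. g x * psi x) = (%x. g x * apply_gate a psi x)"
  using Cons.prems by (cases a) (auto simp: fun_eq_iff algebra_simps)
 moreover have "ap gs (%x. g x * apply_gate a psi x) = (%x. g x * ap gs (apply_gate a psi) x)"
  by (rule Cons.IH) (use Cons.prems in auto)
 ultimately show ?case by (simp only: fold_simps o_apply)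
qed simp

lemma targets_inv [simp]: "targets (inv_gates gs) = targets gs"
proof -
 have 1: "targets (inv_gate g) = gate_targets g" for g by (cases g) (simp_all add: numeral_eq_Suc)
 have "targets (inv_gates gs) = (\<Union>g\<in>set gs. targets (inv_gate g))"
  unfolding inv_gates_def by simp
 thus ?thesis unfolding 1 .
qed

section \<open>Renaming wires\<close>

fun rn :: "(nat => nat) => gate => gate" where
 "rn rho (Hadamard i) = Hadamard (rho i)"
| "rn rho (TGate i) = TGate (rho i)"
| "rn rho (CNOT i j) = CNOT (rho i) (rho j)"

text \<open>
 The values of the wires \<open>rho 0\<close>, ..., \<open>rho (k - 1)\<close>, and y with x
 written to these wires.
\<close>

definition pick :: "(nat => nat) => nat => bool list => bool list" where
 "pick rho k y = map (%i. y ! rho i) [0..<k]"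

definition overlay :: "(nat => nat) => nat => bool list => bool list => bool list" where
 "overlay rho k y x = map (%p. if p : rho ` {..<k} then x ! inv_into {..<k} rho p else y ! p) [0..<length y]"

lemma length_pick [simp]: "length (pick rho k y) = k"
 by (simp add: pick_def)

lemma length_overlay [simp]: "length (overlay rho k y x) = length y"
 by (simp add: overlay_def)

text \<open>
 The wires of a register of k wires are placed in one of W wires. Gates on nonexistent wires have no
 effect, so such wires have to stay nonexistent.
\<close>

locale embedding =
 fixes rho :: "nat => nat" and k W :: nat
 assumes inj: "inj_on rho {..<k}" and range: "!!i. i < k ==> rho i < W" and out: "!!i. i \<ge> k ==> rho i \<ge> W"
begin

lemma less_iff: "rho i < W <-> i < k"
 using range[of i] out[of i] by (cases "i < k") auto

lemma eq_iff: "i < k ==> j < k ==> rho i = rho j <-> i = j"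
 using inj by (auto simp: inj_on_def)

lemma overlay_nth_in: "length y = W ==> i < k ==> overlay rho k y x ! rho i = x ! i"
 using range[of i] inj by (simp add: overlay_def)

lemma overlay_nth_out: "p < length y ==> p ~: rho ` {..<k} ==> overlay rho k y x ! p = y ! p"
 by (simp add: overlay_def)

lemma overlay_eqI:
 assumes "length y = W" "length z = W" "!!i. i < k ==> z ! rho i = x ! i"
  "!!p. p < W ==> p ~: rho ` {..<k} ==> z ! p = y ! p"
 shows "overlay rho k y x = z"
proof (rule nth_equalityI)
 fix p assume p: "p < length (overlay rho k y x)"
 show "overlay rho k y x ! p = z ! p"
 proof (cases "p : rho ` {..<k}")
  case True
  then obtain i where "i < k" "p = rho i" by auto
  thus ?thesis using assms overlay_nth_in by simp
 next
  case False
  thus ?thesis using assms p overlay_nth_out by simp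
 qed
qed (use assms in simp)

lemma overlay_pick: "length y = W ==> overlay rho k y (pick rho k y) = y"
 by (rule overlay_eqI) (simp_all add: pick_def)

lemma overlay_update:
 assumes "length y = W" "length x = k" "i < k"
 shows "(overlay rho k y x)[rho i := b] = overlay rho k y (x[i := b])"
 using assms
 by (intro overlay_eqI[symmetric]) (auto simp: overlay_nth_in overlay_nth_out nth_list_update eq_iff range)

lemma gate_overlay:
 assumes "length y = W" "length x = k"
 shows "apply_gate (rn rho g) psi (overlay rho k y x) = apply_gate g (%x. psi (overlay rho k y x)) x"
proof (cases g)
 case (Hadamard i)
 thus ?thesis using assms by (cases "i < k") (simp_all add: less_iff overlay_nth_in overlay_update)
next
 case (TGate i)
 thus ?thesis using assms by (cases "i < k") (simp_all add: less_iff overlay_nth_in)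
next
 case (CNOT i j)
 thus ?thesis using assms
  by (cases "i < k & j < k") (auto simp add: less_iff overlay_nth_in overlay_update eq_iff simp del: assms)
qed

lemma ap_overlay:
 assumes "length y = W" "length x = k"
 shows "ap (map (rn rho) gs) psi (overlay rho k y x) = ap gs (%x. psi (overlay rho k y x)) x"
 using assms(2)
proof (induction gs arbitrary: psi x)
 case (Cons g gs)
 have "ap (map (rn rho) gs) (apply_gate (rn rho g) psi) (overlay rho k y x) =
   ap gs (%x. apply_gate (rn rho g) psi (overlay rho k y x)) x"
  by (rule Cons.IH[OF Cons.prems])
 also have "... = ap gs (apply_gate g (%x. psi (overlay rho k y x))) x"
  by (rule ap_cong[OF _ Cons.prems]) (rule gate_overlay[OF assms(1)])
 finally show ?case by (simp only: fold_simps o_apply list.map)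
qed simp

text \<open>Running a renamed circuit on the large register is running the circuit on the selected wires.\<close>

lemma ap_rename:
 assumes "length y = W"
 shows "ap (map (rn rho) gs) psi y = ap gs (%x. psi (overlay rho k y x)) (pick rho k y)"
 using ap_overlay[OF assms length_pick[of rho k y], of gs psi] by (simp only: overlay_pick[OF assms])

end

lemma targets_rn: "targets (map (rn rho) gs) = rho ` targets gs"
proof -
 have 1: "gate_targets (rn rho g) = rho ` gate_targets g" for g by (cases g) auto
 have "targets (map (rn rho) gs) = (\<Union>g\<in>set gs. gate_targets (rn rho g))" by simp
 thus ?thesis unfolding 1 by (simp add: image_UN)
qed

section \<open>Reversible classical computation\<close>

lemma update_True [simp]: "x ! b ==> x[b := True] = x"
 and update_False [simp]: "~ x ! b ==> x[b := False] = x"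
 using list_update_id[of x b] by metis+

definition x_gates :: "nat => gate list" where
 "x_gates t = [Hadamard t, TGate t, TGate t, TGate t, TGate t, Hadamard t]"

lemma ap_x:
 assumes "t < length x"
 shows "ap (x_gates t) psi x = psi (x[t := ~ x ! t])"
 using assms list_update_id[of x t]
 by (cases "x ! t") (auto simp: x_gates_def add_divide_distrib[symmetric] diff_divide_distrib[symmetric] cis_pi4_4 sqrt2_sq)

lemma ap_T_power:
 "ap (replicate n (TGate i)) psi x = (if i < length x & x ! i then cis (pi/4) ^ n * psi x else psi x)"
proof (induction n arbitrary: psi)
 case (Suc n)
 have "ap (replicate (Suc n) (TGate i)) psi = ap (replicate n (TGate i)) (apply_gate (TGate i) psi)"
  by (simp only: replicate_Suc fold_simps o_apply)
 thus ?case by (simp only: Suc.IH) simp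
qed simp

text \<open>A power of the phase \<open>cis (pi/4)\<close> controlled by the parity of two wires.\<close>

definition parity_phase :: "nat => nat => nat => gate list" where
 "parity_phase n a b = [CNOT a b] @ replicate n (TGate b) @ [CNOT a b]"

lemma ap_parity_phase:
 assumes "a < length x" "b < length x" "a ~= b"
 shows "ap (parity_phase n a b) psi x = (if x ! a ~= x ! b then cis (pi/4) ^ n * psi x else psi x)"
proof -
 have "ap (parity_phase n a b) psi x =
   apply_gate (CNOT a b) (ap (replicate n (TGate b)) (apply_gate (CNOT a b) psi)) x"
  by (simp only: parity_phase_def fold_append fold_simps o_apply append.simps)
 also have "... = (if x ! a ~= x ! b then cis (pi/4) ^ n * psi x else psi x)"
  unfolding apply_gate.simps(3) using assms list_update_id[of x b]
  by (auto simp: ap_T_power simp del: replicate.simps fold_replicate)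
 finally show ?thesis .
qed

text \<open>
 The phase -1 if all of three wires are set is a product of phases of parities; Hadamard gates make
 it a Toffoli gate.
\<close>

definition ccz_gates :: "nat => nat => nat => gate list" where
 "ccz_gates a b c = [TGate a, TGate b, TGate c] @ parity_phase 7 a b @ parity_phase 7 b c @
   parity_phase 7 a c @ [CNOT a b] @ parity_phase 1 b c @ [CNOT a b]"

definition ccx_gates :: "nat => nat => nat => gate list" where
 "ccx_gates a b c = [Hadamard c] @ ccz_gates a b c @ [Hadamard c]"

lemma cis_pi4_pow: "cis (pi/4) ^ 8 = 1" "cis (pi/4) ^ 4 = -1"
 using cis_pi4_8[of 1] cis_pi4_4[of 1] by (simp_all add: numeral_eq_Suc)

lemma ap_ccz:
 assumes "a < length x" "b < length x" "c < length x" "a ~= b" "b ~= c" "a ~= c"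
 shows "ap (ccz_gates a b c) psi x = (if x ! a & x ! b & x ! c then - psi x else psi x)"
proof -
 let ?w = "cis (pi/4)"
 have w: "?w * (?w ^ 7 * z) = z" "?w ^ 7 * (?w * z) = z" for z
 proof -
  have "?w ^ 7 * ?w = 1"
   using cis_pi4_pow(1) power_add[of ?w 7 1] by simp
  thus "?w * (?w ^ 7 * z) = z" "?w ^ 7 * (?w * z) = z" by (simp_all add: mult_ac)
 qed
 have w4: "?w * (?w * (?w * (?w * z))) = - z" for z by (rule cis_pi4_4)
 define psi1 where "psi1 = ap [TGate a, TGate b, TGate c] psi"
 define psi2 where "psi2 = ap (parity_phase 7 a b) psi1"
 define psi3 where "psi3 = ap (parity_phase 7 b c) psi2"
 define psi4 where "psi4 = ap (parity_phase 7 a c) psi3"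
 define psi5 where "psi5 = apply_gate (CNOT a b) psi4"
 define psi6 where "psi6 = ap (parity_phase 1 b c) psi5"
 have e4: "psi4 x = (let u = (if x ! a then 1 else 0) + (if x ! b then 1 else 0) + (if x ! c then 1 else 0);
   v = (if x ! a ~= x ! b then 7 else 0) + (if x ! b ~= x ! c then 7 else 0) + (if x ! a ~= x ! c then 7 else 0)
   in ?w ^ (u + v) * psi x)" (is "_ = ?R x")
  if "a < length x" "b < length x" "c < length x" for x
  using that assms(4-6)
  by (cases "x ! a"; cases "x ! b"; cases "x ! c")
   (simp_all add: psi4_def psi3_def psi2_def psi1_def ap_parity_phase Let_def power_add mult_ac power2_eq_square eval_nat_numeral)
 have e6: "psi6 x = (if x ! b ~= x ! c then ?w * psi5 x else psi5 x)"
  if "a < length x" "b < length x" "c < length x" for x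
  using that assms(4-6) by (simp add: psi6_def ap_parity_phase)
 have "ap (ccz_gates a b c) psi x = apply_gate (CNOT a b) psi6 x"
  by (simp only: ccz_gates_def psi6_def psi5_def psi4_def psi3_def psi2_def psi1_def fold_append fold_simps o_apply append.simps)
 also have "... = (if x ! b ~= (x ! a ~= x ! c) then ?w * psi4 x else psi4 x)"
  using assms list_update_id[of x b] by (auto simp: e6 psi5_def)
 also have "... = (if x ! a & x ! b & x ! c then - psi x else psi x)"
 proof -
  have 1: "?w ^ 3 * ?w = -1" using cis_pi4_pow(2) power_add[of ?w 3 1] by simp
  have 2: "?w ^ 16 = 1" using cis_pi4_pow(1) power_mult[of ?w 8 2] by simp
  have 3: "?w ^ 15 * ?w = 1" using 2 power_add[of ?w 15 1] by simp
  show ?thesis using assms 1 2 3 cis_pi4_4[of 1]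
   by (cases "x ! a"; cases "x ! b"; cases "x ! c") (simp_all add: e4 mult_ac)
 qed
 finally show ?thesis .
qed

lemma ap_ccx:
 assumes "a < length x" "b < length x" "c < length x" "a ~= b" "b ~= c" "a ~= c"
 shows "ap (ccx_gates a b c) psi x = psi (if x ! a & x ! b then x[c := ~ x ! c] else x)"
proof -
 have "ap (ccx_gates a b c) psi x =
  apply_gate (Hadamard c) (ap (ccz_gates a b c) (apply_gate (Hadamard c) psi)) x"
  by (simp only: ccx_gates_def fold_append fold_simps o_apply append.simps)
 also have "... = psi (if x ! a & x ! b then x[c := ~ x ! c] else x)"
  using assms list_update_id[of x c]
  by (cases "x ! c")
   (auto simp: ap_ccz add_divide_distrib[symmetric] diff_divide_distrib[symmetric] sqrt2_sq)
 finally show ?thesis .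
qed


text \<open>A wire is negated if all of at most two control wires are set.\<close>

datatype cgate = XG (ctrls: "nat list") (tgt: nat)

text \<open>The gate is well-formed on W wires.\<close>

definition cok :: "nat => cgate => bool" where
 "cok W c <-> length (ctrls c) <= 2 & distinct (tgt c # ctrls c) & set (tgt c # ctrls c) <= {..<W}"

fun cgates :: "cgate => gate list" where
 "cgates (XG [] t) = x_gates t"
| "cgates (XG [a] t) = [CNOT a t]"
| "cgates (XG (a # b # _) t) = ccx_gates a b t"

definition cval :: "cgate => bool list => bool" where
 "cval c x <-> (\<forall>a\<in>set (ctrls c). x ! a)"

definition cact :: "cgate => bool list => bool list" where
 "cact c x = (if cval c x then x[tgt c := ~ x ! tgt c] else x)"

abbreviation cg :: "cgate list => gate list" where
 "cg cs == concat (map cgates cs)"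

lemma length_cact [simp]: "length (cact c x) = length x"
 by (simp add: cact_def)

lemma length_foldr_cact [simp]: "length (foldr cact cs x) = length x"
 by (induction cs) simp_all

lemma length_fold_cact [simp]: "length (fold cact cs x) = length x"
 by (induction cs arbitrary: x) simp_all

lemma ap_cgates:
 assumes "cok (length x) c"
 shows "ap (cgates c) psi x = psi (cact c x)"
proof (cases c)
 case (XG as t)
 consider "as = []" | a where "as = [a]" | a b where "as = [a, b]"
  using assms unfolding XG cok_def by (cases as; cases "tl as"; cases "tl (tl as)") auto
 thus ?thesis
  using assms by cases (auto simp: XG cok_def ap_x ap_ccx cact_def cval_def)
qed

lemma ap_cg:
 assumes "!!c. c : set cs ==> cok (length x) c"
 shows "ap (cg cs) psi x = psi (foldr cact cs x)"
 using assms
proof (induction cs arbitrary: psi)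
 case (Cons c cs)
 have "ap (cg (c # cs)) psi x = ap (cg cs) (ap (cgates c) psi) x" by simp
 also have "... = ap (cgates c) psi (foldr cact cs x)" using Cons by simp
 also have "... = psi (cact c (foldr cact cs x))" using Cons.prems by (simp add: ap_cgates)
 finally show ?case by simp
qed simp

lemma cact_twice: "cok (length x) c ==> cact c (cact c x) = x"
 by (cases c) (auto simp: cok_def cact_def cval_def nth_list_update)

lemma foldr_fold_cact:
 "(!!c. c : set cs ==> cok (length x) c) ==> foldr cact cs (fold cact cs x) = x"
proof (induction cs arbitrary: x)
 case (Cons c cs)
 have "foldr cact (c # cs) (fold cact (c # cs) x) = cact c (foldr cact cs (fold cact cs (cact c x)))" by simp
 also have "... = cact c (cact c x)" using Cons by simp
 also have "... = x" using Cons.prems by (simp add: cact_twice)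
 finally show ?case .
qed simp

text \<open>The sign is flipped where the computation \<open>cs\<close> sets wire z; afterwards it is undone.\<close>

definition reflection :: "cgate list => nat => gate list" where
 "reflection cs z = cg cs @ replicate 4 (TGate z) @ cg (rev cs)"

lemma ap_reflection:
 assumes ok: "!!c. c : set cs ==> cok (length x) c" and z: "z < length x"
 shows "ap (reflection cs z) psi x = (if fold cact cs x ! z then - psi x else psi x)"
proof -
 have "ap (reflection cs z) psi x = ap (cg (rev cs)) (ap (replicate 4 (TGate z)) (ap (cg cs) psi)) x"
  by (simp add: reflection_def del: replicate.simps fold_replicate)
 also have "... = ap (replicate 4 (TGate z)) (ap (cg cs) psi) (fold cact cs x)"
  using ok by (subst ap_cg) (simp_all add: foldr_conv_fold)
 also have "... = (if fold cact cs x ! z then -1 else 1) * ap (cg cs) psi (fold cact cs x)"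
  using z by (simp add: ap_T_power cis_pi4_pow del: replicate.simps fold_replicate)
 also have "ap (cg cs) psi (fold cact cs x) = psi x"
  using ok by (simp add: ap_cg foldr_fold_cact)
 finally show ?thesis by simp
qed

text \<open>Computing into wire t only: the parity of the values of the controls is added to it.\<close>

definition parity :: "bool list => bool" where
 "parity bs = foldr (~=) bs False"

lemma parity_simps [simp]: "parity [] = False" "parity (b # bs) = (b ~= parity bs)"
 by (simp_all add: parity_def)

lemma parity_append [simp]: "parity (xs @ ys) = (parity xs ~= parity ys)"
 by (induction xs) auto

lemma foldr_cact_target:
 assumes "!!c. c : set cs ==> tgt c = t & cok (length x) c"
 shows "foldr cact cs x = x[t := (x ! t ~= parity (map (%c. cval c x) cs))]"
 using assms
proof (induction cs)
 case (Cons c cs)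
 let ?x = "x[t := (x ! t ~= parity (map (%c. cval c x) cs))]"
 have IH: "foldr cact cs x = ?x" using Cons by simp
 have c: "tgt c = t" "t < length x" "t ~: set (ctrls c)"
  using Cons.prems[of c] by (auto simp: cok_def)
 have "cval c ?x = cval c x" using c by (auto simp: cval_def nth_list_update)
 hence "cact c ?x = x[t := (x ! t ~= parity (map (%c. cval c x) (c # cs)))]"
  using c by (auto simp: cact_def)
 thus ?case using IH by simp
qed simp

lemma fold_cact_target:
 assumes "!!c. c : set cs ==> tgt c = t & cok (length x) c"
 shows "fold cact cs x = x[t := (x ! t ~= parity (map (%c. cval c x) cs))]"
proof -
 have "parity (rev bs) = parity bs" for bs by (induction bs) auto
 thus ?thesis using foldr_cact_target[of "rev cs" t x] assms
  by (simp add: foldr_conv_fold rev_map[symmetric])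
qed

section \<open>Hadamard gates on several wires\<close>

text \<open>The wires in S are set to 0.\<close>

definition clr :: "nat set => bool list => bool list" where
 "clr S x = map (%p. x ! p & p ~: S) [0..<length x]"

lemma length_clr [simp]: "length (clr S x) = length x"
 by (simp add: clr_def)

lemma clr_nth: "p < length x ==> clr S x ! p <-> x ! p & p ~: S"
 by (simp add: clr_def)

lemma clr_empty [simp]: "clr {} x = x"
 by (rule nth_equalityI) (simp_all add: clr_nth)

lemma clr_update: "w < length x ==> (clr S x)[w := False] = clr (insert w S) x"
proof (rule nth_equalityI)
 fix p assume "w < length x" "p < length ((clr S x)[w := False])"
 thus "(clr S x)[w := False] ! p = clr (insert w S) x ! p"
  by (cases "p = w") (simp_all add: clr_nth)
qed simp

lemma ap_H_zero:
 assumes "distinct ws" "set ws <= {..<length x}"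
  and "!!y w. length y = length x ==> w : set ws ==> y ! w ==> psi y = 0"
 shows "ap (map Hadamard ws) psi x = psi (clr (set ws) x) / rt2 ^ length ws"
 using assms
proof (induction ws arbitrary: psi)
 case (Cons w ws)
 let ?phi = "apply_gate (Hadamard w) psi"
 have w: "w < length x" "w ~: set ws" using Cons.prems by auto
 have phi: "?phi y = psi (y[w := False]) / rt2" if "length y = length x" for y
  using Cons.prems(3)[of "y[w := True]" w] that w by simp
 have "ap (map Hadamard (w # ws)) psi x = ap (map Hadamard ws) ?phi x"
  by (simp del: apply_gate.simps)
 also have "... = ?phi (clr (set ws) x) / rt2 ^ length ws"
 proof (rule Cons.IH)
  fix y v assume y: "length y = length x" "v : set ws" "y ! v"
  have "y[w := False] ! v" using y w by (metis nth_list_update_neq)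
  thus "?phi y = 0" using phi[OF y(1)] Cons.prems(3)[of "y[w := False]" v] y by simp
 qed (use Cons.prems in auto)
 also have "(clr (set ws) x)[w := False] = clr (set (w # ws)) x"
  using w by (simp add: clr_update)
 hence "?phi (clr (set ws) x) = psi (clr (set (w # ws)) x) / rt2"
  by (subst phi) simp_all
 finally show ?case by simp
qed simp

abbreviation flip :: "nat => bool list => bool list" where
 "flip w x == x[w := ~ x ! w]"

lemma ap_H_flip_other:
 "w ~: set ws ==> ap (map Hadamard ws) (%x. psi (flip w x)) x = ap (map Hadamard ws) psi (flip w x)"
proof (induction ws arbitrary: psi)
 case (Cons v ws)
 have "apply_gate (Hadamard v) (%x. psi (flip w x)) = (%x. apply_gate (Hadamard v) psi (flip w x))"
  using Cons.prems by (auto simp: fun_eq_iff list_update_swap)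
 thus ?case using Cons by (simp del: apply_gate.simps)
qed simp

text \<open>HZ = XH: a sign on a wire before the Hadamard gates flips that wire afterwards.\<close>

lemma ap_H_sign:
 assumes "distinct ws" "w : set ws" "w < length x"
 shows "ap (map Hadamard ws) (%x. (if x ! w then -1 else 1) * psi x) x = ap (map Hadamard ws) psi (flip w x)"
proof -
 obtain us vs where ws: "ws = us @ w # vs" using assms(2) by (metis split_list)
 let ?sg = "%x :: bool list. if x ! w then -1 else 1 :: complex"
 let ?u = "ap (map Hadamard us) psi"
 have 1: "ap (map Hadamard us) (%x. ?sg x * psi x) = (%x. ?sg x * ?u x)"
 proof (rule ap_diag)
  fix i x b assume "i : targets (map Hadamard us)"
  hence "i ~= w" using assms(1) ws by auto
  thus "?sg (x[i := b]) = ?sg x" by simp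
 qed
 have 2: "apply_gate (Hadamard w) (%x. ?sg x * ?u x) y = apply_gate (Hadamard w) ?u (flip w y)"
  if "length y = length x" for y using that assms(3) by simp
 have "ap (map Hadamard ws) (%x. ?sg x * psi x) x
   = ap (map Hadamard vs) (apply_gate (Hadamard w) (%x. ?sg x * ?u x)) x"
  by (simp only: ws map_append fold_append list.map fold_simps o_apply 1)
 also have "... = ap (map Hadamard vs) (%y. apply_gate (Hadamard w) ?u (flip w y)) x"
  by (rule ap_cong[OF 2]) simp_all
 also have "... = ap (map Hadamard vs) (apply_gate (Hadamard w) ?u) (flip w x)"
  using assms(1) ws by (intro ap_H_flip_other) simp
 finally show ?thesis by (simp add: ws del: apply_gate.simps)
qed

section \<open>Amplitude amplification against a hidden target\<close>

text \<open>The projection to the span of the basis states in Q.\<close>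

definition proj :: "(bool list => bool) => qvec => qvec" where
 "proj Q psi = (%x. if Q x then psi x else 0)"

lemma proj_proj [simp]: "proj Q (proj Q psi) = proj Q psi"
 by (simp add: proj_def fun_eq_iff)

lemma proj_conj: "proj Q (proj R psi) = proj (%x. Q x & R x) psi"
 by (auto simp add: proj_def fun_eq_iff)

lemma proj_commute: "proj Q (proj R psi) = proj R (proj Q psi)"
 by (auto simp add: proj_def fun_eq_iff)

lemma proj_eqI: "(!!x. psi x ~= 0 ==> Q x) ==> proj Q psi = psi"
 by (auto simp: proj_def fun_eq_iff)

lemma proj_eqD: "proj Q psi = psi ==> psi x ~= 0 ==> Q x"
 by (metis proj_def)

lemma proj_lin: "proj Q (%x. a * phi x + b * psi x) = (%x. a * proj Q phi x + b * proj Q psi x)"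
 by (auto simp: proj_def fun_eq_iff)

lemma proj_scale: "proj Q (%x. a * phi x) = (%x. a * proj Q phi x)"
 by (auto simp: proj_def fun_eq_iff)

lemma norm_proj_le: "norm_sq W (proj Q psi) <= norm_sq W psi"
 unfolding norm_sq_def proj_def by (intro sum_mono) auto

lemma ip_proj: "ip W (proj Q phi) psi = ip W phi (proj Q psi)"
 unfolding ip_def proj_def by (intro sum.cong) auto

lemma ip_proj_self: "ip W (proj Q phi) (proj Q psi) = ip W phi (proj Q psi)"
 by (simp add: ip_proj)

lemma ap_proj:
 assumes "!!i x b. i : targets gs ==> Q (x[i := b]) = Q x"
 shows "ap gs (proj Q psi) = proj Q (ap gs psi)"
proof -
 have 1: "proj Q phi = (%x. (if Q x then 1 else 0) * phi x)" for phi by (auto simp: proj_def)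
 show ?thesis unfolding 1 by (rule ap_diag) (simp add: assms)
qed

text \<open>
 A level is a circuit \<open>gs\<close> that starts on states in the range of the projection Z and
 is followed by the projection G, with the result \<open>good\<close>.  The operator \<open>compr\<close> is the compression to the range of Z of
 the probability of G.
\<close>

definition compr :: "gate list => (bool list => bool) => (bool list => bool) => qvec => qvec" where
 "compr gs Z G psi = proj Z (ap (inv_gates gs) (proj G (ap gs psi)))"

definition good :: "gate list => (bool list => bool) => qvec => qvec" where
 "good gs G psi = proj G (ap gs psi)"

abbreviation lc :: "real => qvec => real => qvec => qvec" where
 "lc a phi b psi == (%x. complex_of_real a * phi x + complex_of_real b * psi x)"

lemma good_lc: "good gs G (lc a phi b psi) = lc a (good gs G phi) b (good gs G psi)"
 unfolding good_def ap_lin proj_lin ..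

lemma compr_lc: "compr gs Z G (lc a phi b psi) = lc a (compr gs Z G phi) b (compr gs Z G psi)"
 unfolding compr_def ap_lin proj_lin ..

lemma good_le: "norm_sq W (good gs G psi) <= norm_sq W psi"
 using norm_proj_le[of W G "ap gs psi"] by (simp add: good_def norm_ap)

lemma ip_compr:
 assumes "proj Z phi = phi"
 shows "ip W phi (compr gs Z G psi) = ip W (good gs G phi) (good gs G psi)"
proof -
 have "ip W phi (compr gs Z G psi) = ip W phi (ap (inv_gates gs) (proj G (ap gs psi)))"
  by (simp only: compr_def ip_proj[symmetric] assms)
 also have "... = ip W (ap gs phi) (proj G (ap gs psi))" by (simp only: ip_adjoint)
 finally show ?thesis by (simp only: good_def ip_proj_self)
qed

text \<open>
 With y = \<open>dev\<close> twice the deviation of \<open>compr\<close> from 1/2, the operator 1 - cy followed by the level.  It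
 can be implemented for c = 0 (run the level) and c = 1/2 (amplify the amplitude once).
\<close>

definition damped :: "real => gate list => (bool list => bool) => (bool list => bool) => qvec => qvec" where
 "damped c gs Z G psi = good gs G (lc (1 + c) psi (- 2 * c) (compr gs Z G psi))"

definition dev :: "gate list => (bool list => bool) => (bool list => bool) => qvec => qvec" where
 "dev gs Z G psi = lc 2 (compr gs Z G psi) (-1) psi"

lemma damped_lc: "damped c gs Z G (lc a phi b psi) = lc a (damped c gs Z G phi) b (damped c gs Z G psi)"
 unfolding damped_def compr_lc good_lc by (simp add: fun_eq_iff algebra_simps)

lemma damped_0: "damped 0 gs Z G psi = good gs G psi"
 by (simp add: damped_def)

lemma damped_alt: "damped c gs Z G psi = lc 1 (good gs G psi) (- c) (good gs G (dev gs Z G psi))"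
 unfolding damped_def dev_def good_lc by (simp add: fun_eq_iff algebra_simps)

lemma norm_damped:
 assumes "proj Z psi = psi"
 shows "norm_sq W (damped (1/2) gs Z G psi) <= 1/2 * norm_sq W psi"
  and "norm_sq W (damped (1/5) gs Z G psi) <= 16/25 * norm_sq W psi"
proof -
 let ?T = "compr gs Z G" and ?G = "good gs G"
 define t0 t1 t2 t3 where t: "t0 = norm_sq W psi" "t1 = norm_sq W (?G psi)"
  "t2 = norm_sq W (?T psi)" "t3 = norm_sq W (?G (?T psi))"
 have ZT: "proj Z (?T psi) = ?T psi" by (simp add: compr_def)
 have i1: "ip W psi (?T psi) = t1" by (simp add: ip_compr[OF assms] t ip_self)
 have i2: "ip W (?G psi) (?G (?T psi)) = t2"
  using ip_compr[OF ZT, of W gs G psi] by (simp add: t ip_self ip_sym)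
 have n: "norm_sq W (lc a psi b (?T psi)) = a\<^sup>2 * t0 + 2 * a * b * t1 + b\<^sup>2 * t2" for a b
  by (simp only: norm_sq_lin i1 t)
 have g: "norm_sq W (?G (lc a psi b (?T psi))) = a\<^sup>2 * t1 + 2 * a * b * t2 + b\<^sup>2 * t3" for a b
  by (simp only: good_lc norm_sq_lin i2 t)
 have le: "a\<^sup>2 * t1 + 2 * a * b * t2 + b\<^sup>2 * t3 <= a\<^sup>2 * t0 + 2 * a * b * t1 + b\<^sup>2 * t2" for a b
  using good_le[of W gs G "lc a psi b (?T psi)"] unfolding n g .
 have pos: "0 <= a\<^sup>2 * t0 + 2 * a * b * t1 + b\<^sup>2 * t2" for a b
  using norm_sq_nonneg[of W "lc a psi b (?T psi)"] unfolding n .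
 show "norm_sq W (damped (1/2) gs Z G psi) <= 1/2 * norm_sq W psi"
  using le[of "-1" 2] pos[of "-1" 2] unfolding damped_def g t(1)[symmetric]
  by (simp add: power2_eq_square)
 show "norm_sq W (damped (1/5) gs Z G psi) <= 16/25 * norm_sq W psi"
  using le[of 1 "-1"] pos[of 1 "-1"] unfolding damped_def g t(1)[symmetric]
  by (simp add: power2_eq_square)
qed

lemma norm_sq_young:
 assumes "0 < w" "w < 1"
 shows "norm_sq W (lc 1 phi 1 psi) <= norm_sq W phi / w + norm_sq W psi / (1 - w)"
proof -
 have 1: "lc 1 phi 1 psi = lc (1 - (1 - w)) (%x. complex_of_real (1/w) * phi x) (1 - w)
   (%x. complex_of_real (1/(1-w)) * psi x)"
  using assms by (auto simp: fun_eq_iff simp del: of_real_diff)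
 have "norm_sq W (lc 1 phi 1 psi) <= w * ((1/w)\<^sup>2 * norm_sq W phi) + (1 - w) * ((1/(1-w))\<^sup>2 * norm_sq W psi)"
  using assms norm_sq_convex[of "1 - w" W "%x. complex_of_real (1/w) * phi x" "%x. complex_of_real (1/(1-w)) * psi x"]
  unfolding 1 norm_sq_scale norm_of_real power2_abs by simp
 also have "... = norm_sq W phi / w + norm_sq W psi / (1 - w)"
  using assms by (simp add: power2_eq_square)
 finally show ?thesis .
qed

text \<open>One level of the comparison of the ideal vector \<open>Phi\<close> with its damped version \<open>L\<close>.\<close>

lemma level_step:
 fixes W :: nat and gs :: "gate list" and G Z :: "bool list => bool"
 assumes "proj Z Phi = Phi" "proj Z L = L" and c: "c = 1/2 | c = 1/5"
 defines "De == lc 1 Phi (-1) L" and "De' == lc 1 (good gs G Phi) (-1) (damped c gs Z G L)"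
  and "e == norm_sq W (good gs G (dev gs Z G Phi))"
 shows "norm_sq W De' <= (if c = 1/2 then 3/4 * e + 3/4 * norm_sq W De else 1/5 * e + 4/5 * norm_sq W De)"
proof -
 have Z: "proj Z De = De" unfolding De_def proj_lin assms(1,2) ..
 have "De' = lc 1 (%x. complex_of_real c * good gs G (dev gs Z G Phi) x) 1 (damped c gs Z G De)"
  unfolding De'_def De_def damped_lc unfolding damped_alt[of c gs Z G Phi]
  by (simp add: fun_eq_iff algebra_simps)
 moreover have "norm_sq W (lc 1 (%x. complex_of_real c * good gs G (dev gs Z G Phi) x) 1 (damped c gs Z G De))
   <= c\<^sup>2 * e / w + norm_sq W (damped c gs Z G De) / (1 - w)" if "0 < w" "w < 1" for w
  using norm_sq_young[OF that, of W "%x. complex_of_real c * good gs G (dev gs Z G Phi) x"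
   "damped c gs Z G De"] unfolding norm_sq_scale norm_of_real power2_abs e_def .
 ultimately have *: "norm_sq W De' <= c\<^sup>2 * e / w + norm_sq W (damped c gs Z G De) / (1 - w)"
  if "0 < w" "w < 1" for w using that by simp
 from c show ?thesis
 proof
  assume c: "c = 1/2"
  show ?thesis using *[of "1/3"] norm_damped(1)[OF Z, of W gs G] unfolding c by (simp add: power2_eq_square)
 next
  assume c: "c = 1/5"
  show ?thesis using *[of "1/5"] norm_damped(2)[OF Z, of W gs G] unfolding c by (simp add: power2_eq_square)
 qed
qed

text \<open>
 Amplitude amplification with a coin wire, which brings the success amplitude from 1/sqrt 2
 down to 1/2 before it is amplified to 1.
\<close>

definition sgn_flip :: "(bool list => bool) => qvec => qvec" where
 "sgn_flip Q psi = (%x. (if Q x then -1 else 1) * psi x)"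

definition amplify :: "nat => gate list => (bool list => bool) => (bool list => bool) => qvec => qvec" where
 "amplify w gs Z G psi = ap (Hadamard w # gs) (sgn_flip (%x. Z x & ~ x ! w)
   (ap (inv_gates (Hadamard w # gs)) (sgn_flip (%x. G x & ~ x ! w) (ap (Hadamard w # gs) psi))))"

lemma sgn_flip_proj: "sgn_flip Q psi = lc 1 psi (-2) (proj Q psi)"
 by (auto simp: sgn_flip_def proj_def fun_eq_iff)

lemma ap_cons: "ap (g # gs) psi = ap gs (apply_gate g psi)"
 by simp

lemma sqrt2_half: "complex_of_real (1 / sqrt 2) * complex_of_real (1 / sqrt 2) = complex_of_real (1/2)"
 unfolding of_real_mult[symmetric] by simp

lemma amplify_good:
 assumes psi: "proj Z psi = psi" and w: "proj (%x. w < length x & ~ x ! w) psi = psi"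
  and tg: "w ~: targets gs" and Zw: "!!x b. Z (x[w := b]) = Z x" and Gw: "!!x b. G (x[w := b]) = G x"
 shows "proj (%x. G x & ~ x ! w) (amplify w gs Z G psi) = (%x. - rt2 * damped (1/2) gs Z G psi x)"
  and "proj (%x. G x & ~ x ! w) (ap (Hadamard w # gs) psi) = (%x. complex_of_real (1 / sqrt 2) * good gs G psi x)"
proof -
 let ?A = "Hadamard w # gs"
 let ?P = "proj (%x. Z x & ~ x ! w)" and ?G = "proj (%x. G x & ~ x ! w)"
 let ?c = "%x :: bool list. w < length x & ~ x ! w"
 let ?h = "complex_of_real (1 / sqrt 2)"
 have coin: "i : targets gs ==> (x[i := b]) ! w = x ! w" for i x b using tg by (metis nth_list_update_neq)
 have ap_coin: "ap gs (proj (%x. w < length x & ~ x ! w) phi) = proj ?c (ap gs phi)" for phi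
  by (rule ap_proj) (simp add: coin)
 have ap_ncoin: "ap gs (proj (%x. ~ x ! w) phi) = proj (%x. ~ x ! w) (ap gs phi)" for phi
  by (rule ap_proj) (simp add: coin)
 have inv_coin: "ap (inv_gates gs) (proj ?c phi) = proj ?c (ap (inv_gates gs) phi)" for phi
  by (rule ap_proj) (simp add: coin)
 have had: "proj (%x. ~ x ! w) (apply_gate (Hadamard w) phi) = (%x. ?h * phi x)" if phi: "proj ?c phi = phi" for phi
 proof
  fix x
  have "phi x = 0" if "~ ?c x" using proj_eqD[OF phi, of x] that by auto
  moreover have "phi (x[w := True]) = 0" if "w < length x"
   using proj_eqD[OF phi, of "x[w := True]"] that by auto
  ultimately show "proj (%x. ~ x ! w) (apply_gate (Hadamard w) phi) x = ?h * phi x"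
   using phi w by (cases "?c x") (auto simp: proj_def)
 qed
 have GA: "?G (ap ?A phi) = (%x. ?h * good gs G phi x)" if phi: "proj ?c phi = phi" for phi
 proof -
  have "?G (ap ?A phi) = proj G (proj (%x. ~ x ! w) (ap gs (apply_gate (Hadamard w) phi)))"
   by (simp only: proj_conj ap_cons)
  also have "... = proj G (ap gs (%x. ?h * phi x))" by (simp only: ap_ncoin[symmetric] had[OF phi])
  finally show ?thesis by (simp only: ap_scale proj_scale good_def)
 qed
 show free: "?G (ap ?A psi) = (%x. ?h * good gs G psi x)" by (rule GA[OF w])
 have inv: "ap (inv_gates ?A) phi = apply_gate (Hadamard w) (ap (inv_gates gs) phi)" for phi
  by (simp add: inv_gates_def del: apply_gate.simps)
 have gc: "proj ?c (good gs G psi) = good gs G psi"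
  by (simp only: good_def proj_commute[of _ G] ap_coin[symmetric] w)
 have N: "?P (ap (inv_gates ?A) (?G (ap ?A psi))) = (%x. complex_of_real (1/2) * compr gs Z G psi x)"
 proof -
  have 1: "proj ?c (ap (inv_gates gs) (good gs G psi)) = ap (inv_gates gs) (good gs G psi)"
   using inv_coin[of "good gs G psi"] gc by simp
  have "?P (ap (inv_gates ?A) (?G (ap ?A psi)))
    = proj Z (proj (%x. ~ x ! w) (%x. ?h * apply_gate (Hadamard w) (ap (inv_gates gs) (good gs G psi)) x))"
   unfolding free ap_scale inv by (simp only: proj_conj)
  also have "... = (%x. ?h * (?h * compr gs Z G psi x))"
   by (simp only: proj_scale had[OF 1] compr_def good_def[symmetric])
  finally show ?thesis by (simp only: mult.assoc[symmetric] sqrt2_half)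
 qed
 let ?a = "ap ?A psi"
 have Ppsi: "?P psi = psi"
  by (rule proj_eqI) (use proj_eqD[OF w] proj_eqD[OF psi] in blast)
 have s1: "ap (inv_gates ?A) (sgn_flip (%x. G x & ~ x ! w) ?a) = lc 1 psi (-2) (ap (inv_gates ?A) (?G ?a))"
  unfolding sgn_flip_proj ap_lin inv_gates_right ..
 have s2: "sgn_flip (%x. Z x & ~ x ! w) (lc 1 psi (-2) (ap (inv_gates ?A) (?G ?a)))
   = lc 1 (lc (-1) psi 2 (compr gs Z G psi)) (-2) (ap (inv_gates ?A) (?G ?a))"
  unfolding sgn_flip_proj proj_lin Ppsi N by (simp add: fun_eq_iff)
 have cpsi: "proj ?c (compr gs Z G psi) = compr gs Z G psi"
 proof -
  have "proj ?c (ap (inv_gates gs) (good gs G psi)) = ap (inv_gates gs) (good gs G psi)"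
   using inv_coin[of "good gs G psi"] gc by simp
  moreover have "compr gs Z G psi = proj Z (ap (inv_gates gs) (good gs G psi))"
   by (simp only: compr_def good_def)
  ultimately show ?thesis by (simp only: proj_commute[of ?c Z])
 qed
 have "amplify w gs Z G psi = lc 1 (lc (-1) ?a 2 (ap ?A (compr gs Z G psi))) (-2) (?G ?a)"
  unfolding amplify_def s1 s2 ap_lin inv_gates_left ..
 hence "?G (amplify w gs Z G psi) = lc 1 (lc (-1) (?G ?a) 2 (?G (ap ?A (compr gs Z G psi)))) (-2) (?G ?a)"
  by (simp only: proj_lin proj_proj)
 also have "... = (%x. ?h * (- 3 * good gs G psi x + 2 * good gs G (compr gs Z G psi) x))"
  unfolding free GA[OF cpsi] by (simp add: fun_eq_iff algebra_simps)
 also have "... = (%x. - rt2 * damped (1/2) gs Z G psi x)"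
 proof -
  have "1 / sqrt 2 = sqrt 2 / 2" by (simp add: field_simps)
  hence "?h = rt2 / 2" by (simp only: of_real_divide of_real_numeral)
  thus ?thesis unfolding damped_def good_lc
   by (simp only:) (simp add: fun_eq_iff algebra_simps)
 qed
 finally show "?G (amplify w gs Z G psi) = (%x. - rt2 * damped (1/2) gs Z G psi x)" .
qed

lemma proj_damped:
 assumes "!!i x b. i : targets gs ==> Q (x[i := b]) = Q x"
 shows "proj Q (damped c gs Z G psi) = damped c gs Z G (proj Q psi)"
proof -
 have 1: "ap gs (proj Q phi) = proj Q (ap gs phi)" for phi by (rule ap_proj[OF assms])
 have 2: "ap (inv_gates gs) (proj Q phi) = proj Q (ap (inv_gates gs) phi)" for phi
  by (rule ap_proj) (simp add: assms)
 have "proj Q (good gs G phi) = good gs G (proj Q phi)" for phi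
  by (simp only: good_def 1 proj_commute[of Q G])
 moreover have "proj Q (compr gs Z G phi) = compr gs Z G (proj Q phi)" for phi
  by (simp only: compr_def 1 2 proj_commute[of Q Z] proj_commute[of G Q])
 ultimately show ?thesis by (simp only: damped_def proj_lin)
qed

lemma proj_sgn_flip: "proj Q (sgn_flip R psi) = sgn_flip R (proj Q psi)"
 by (auto simp: proj_def sgn_flip_def fun_eq_iff)

lemma proj_amplify:
 assumes "!!i x b. i : insert w (targets gs) ==> Q (x[i := b]) = Q x"
 shows "proj Q (amplify w gs Z G psi) = amplify w gs Z G (proj Q psi)"
proof -
 have 1: "proj Q (ap (Hadamard w # gs) phi) = ap (Hadamard w # gs) (proj Q phi)" for phi
  by (rule ap_proj[symmetric]) (use assms in auto)
 have 2: "proj Q (ap (inv_gates (Hadamard w # gs)) phi) = ap (inv_gates (Hadamard w # gs)) (proj Q phi)" for phi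
  by (rule ap_proj[symmetric]) (use assms in \<open>auto simp only: targets_inv\<close>, use assms in auto)
 show ?thesis by (simp only: amplify_def 1 2 proj_sgn_flip)
qed

section \<open>Many levels\<close>

text \<open>
 Level j runs \<open>A j\<close>. The wires in \<open>F j\<close> are 0 until then, and \<open>G s
 j\<close> says that the result is right for the target s, which later levels do not affect.
 Amplification of level j uses the wire \<open>coin j\<close>.
\<close>

locale levels =
 fixes W N :: nat and A :: "nat => gate list" and F :: "nat => nat set" and coin :: "nat => nat"
  and G :: "bool list => nat => bool list => bool" and SS :: "bool list set" and Om :: qvec
 assumes fin: "finite SS"
  and init: "!!j x. j < N ==> Om x ~= 0 ==> (\<forall>w\<in>F j. ~ x ! w) & coin j < length x & ~ x ! coin j"
  and fresh: "!!i j. i < j ==> j < N ==> targets (A i) \<inter> F j = {}"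
  and coin_A: "!!i j. i < N ==> j < N ==> coin i ~: targets (A j)"
  and coin_F: "!!i j. i < N ==> j < N ==> coin i ~: F j"
  and coin_inj: "inj_on coin {..<N}"
  and G_dep: "!!s i j w x b. i < j ==> j < N ==> w : targets (A j) ==> G s i (x[w := b]) = G s i x"
  and G_coin: "!!s i j x b. i < N ==> j < N ==> G s i (x[coin j := b]) = G s i x"
begin

definition Z :: "nat => bool list => bool" where
 "Z j x <-> (\<forall>w\<in>F j. ~ x ! w)"

definition Zc :: "nat => bool list => bool" where
 "Zc j x <-> coin j < length x & ~ x ! coin j"

abbreviation damp :: "bool list => nat => real => qvec => qvec" where
 "damp s j c == damped c (A j) (Z j) (G s j)"

text \<open>
 Levels from j on, with the given damping parameters; without damping, the ideal vectors for the
 target.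
\<close>

fun levs :: "bool list => nat => real list => qvec => qvec" where
 "levs s j [] psi = psi"
| "levs s j (c # cs) psi = levs s (Suc j) cs (damp s j c psi)"

lemma levs_append: "levs s j (cs @ ds) psi = levs s (j + length cs) ds (levs s j cs psi)"
 by (induction cs arbitrary: j psi) simp_all

lemma levs_lc: "levs s j cs (lc a phi b psi) = lc a (levs s j cs phi) b (levs s j cs psi)"
 by (induction cs arbitrary: j phi psi) (simp_all add: damped_lc)

lemma proj_levs:
 assumes "!!i w x b. j <= i ==> i < j + length cs ==> w : targets (A i) ==> Q (x[w := b]) = Q x"
 shows "proj Q (levs s j cs psi) = levs s j cs (proj Q psi)"
 using assms
proof (induction cs arbitrary: j psi)
 case (Cons c cs)
 have "proj Q (levs s (Suc j) cs (damp s j c psi)) = levs s (Suc j) cs (proj Q (damp s j c psi))"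
  by (rule Cons.IH) (rule Cons.prems, auto)
 also have "proj Q (damp s j c psi) = damp s j c (proj Q psi)"
  by (rule proj_damped) (rule Cons.prems, auto)
 finally show ?case by simp
qed simp

lemma proj_Z_levs:
 assumes "length cs < N" "n = length cs"
 shows "proj (Z n) (levs s 0 cs Om) = levs s 0 cs Om"
proof -
 have "proj (Z n) (levs s 0 cs Om) = levs s 0 cs (proj (Z n) Om)"
 proof (rule proj_levs)
  fix i w x b assume "i < 0 + length cs" "w : targets (A i)"
  hence "w ~: F n" using fresh[of i n] assms by auto
  thus "Z n (x[w := b]) = Z n x" unfolding Z_def by (metis nth_list_update_neq)
 qed
 also have "proj (Z n) Om = Om" using init assms by (intro proj_eqI) (auto simp: Z_def)
 finally show ?thesis .
qed

lemma proj_Zc_levs: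
 assumes "length cs < N" "n = length cs"
 shows "proj (Zc n) (levs s 0 cs Om) = levs s 0 cs Om"
proof -
 have "proj (Zc n) (levs s 0 cs Om) = levs s 0 cs (proj (Zc n) Om)"
 proof (rule proj_levs)
  fix i w x b assume "i < 0 + length cs" "w : targets (A i)"
  hence "w ~= coin n" using coin_A[of n i] assms by auto
  thus "Zc n (x[w := b]) = Zc n x" unfolding Zc_def by simp
 qed
 also have "proj (Zc n) Om = Om" using init assms by (intro proj_eqI) (auto simp: Zc_def)
 finally show ?thesis .
qed

abbreviation ideal :: "bool list => nat => qvec" where
 "ideal s n == levs s 0 (replicate n 0) Om"

text \<open>The first T levels are amplified; the others are damped less.\<close>

abbreviation schedule :: "nat => nat => real list" where
 "schedule T n == map (%j. if j < T then 1/2 else 1/5) [0..<n]"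

text \<open>
 The total squared distance d from the ideal vectors satisfies \<open>d' <= 3/4 + 3/4 * d\<close> at
 an amplified level and \<open>d' <= 1/5 + 4/5 * d\<close> at one with damping 1/5.
\<close>

lemma level_bound:
 fixes T n :: nat
 assumes bessel: "!!j. j < N ==>
   (\<Sum>s\<in>SS. norm_sq W (good (A j) (G s j) (dev (A j) (Z j) (G s j) (ideal s j)))) <= 1"
  and n: "n <= N"
 defines "d == %n. \<Sum>s\<in>SS. norm_sq W (lc 1 (ideal s n) (-1) (levs s 0 (schedule T n) Om))"
 shows "d n <= (if n <= T & 0 < T then 3 else 1 + (if T = 0 then 0 else 2) * (4/5) ^ (n - T))"
 using n
proof (induction n)
 case 0
 have "d 0 = 0" by (simp add: d_def norm_sq_def)
 thus ?case by simp
next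
 case (Suc n)
 define c :: real where "c = (if n < T then 1/2 else 1/5)"
 define e where "e = (\<Sum>s\<in>SS. norm_sq W (good (A n) (G s n) (dev (A n) (Z n) (G s n) (ideal s n))))"
 have e: "e <= 1" unfolding e_def using bessel Suc.prems by simp
 let ?L = "%s. levs s 0 (schedule T n) Om"
 have r: "replicate (Suc n) (0 :: real) = replicate n 0 @ [0]" by (simp add: replicate_append_same)
 have i: "ideal s (Suc n) = good (A n) (G s n) (ideal s n)" for s
  unfolding r levs_append by (simp add: damped_0)
 have l: "levs s 0 (schedule T (Suc n)) Om = damp s n c (?L s)" for s
  by (simp add: levs_append c_def)
 have step: "norm_sq W (lc 1 (ideal s (Suc n)) (-1) (levs s 0 (schedule T (Suc n)) Om)) <=
  (if c = 1/2 then 3/4 * norm_sq W (good (A n) (G s n) (dev (A n) (Z n) (G s n) (ideal s n)))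
    + 3/4 * norm_sq W (lc 1 (ideal s n) (-1) (?L s))
   else 1/5 * norm_sq W (good (A n) (G s n) (dev (A n) (Z n) (G s n) (ideal s n)))
    + 4/5 * norm_sq W (lc 1 (ideal s n) (-1) (?L s)))" for s
  unfolding i l using Suc.prems
  by (intro level_step proj_Z_levs) (simp_all add: c_def)
 have IH: "d n <= (if n <= T & 0 < T then 3 else 1 + (if T = 0 then 0 else 2) * (4/5) ^ (n - T))"
  using Suc by simp
 show ?case
 proof (cases "n < T")
  case True
  have "d (Suc n) <= 3/4 * e + 3/4 * d n"
   unfolding d_def e_def sum_distrib_left sum.distrib[symmetric]
   by (rule sum_mono) (use step True in \<open>simp add: c_def\<close>)
  thus ?thesis using e IH True by simp
 next
  case False
  have "d (Suc n) <= 1/5 * e + 4/5 * d n"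
   unfolding d_def e_def sum_distrib_left sum.distrib[symmetric]
   by (rule sum_mono) (use step False in \<open>simp add: c_def\<close>)
  moreover have "d n <= 1 + (if T = 0 then 0 else 2) * (4/5) ^ (n - T)"
   using IH False by (cases "n = T") auto
  moreover have "Suc n - T = Suc (n - T)" using False by simp
  ultimately show ?thesis using e False by (auto split: if_splits)
 qed
qed

text \<open>The damping 1/5 is a convex combination of the two implementable ones.\<close>

lemma damp_mix: "damp s j (1/5) psi = lc (1 - 2/5) (damp s j 0 psi) (2/5) (damp s j (1/2) psi)"
 unfolding damped_alt[of "1/5"] damped_alt[of "1/2"] damped_0
 by (simp add: fun_eq_iff algebra_simps)

lemma choose_schedule:
 fixes X :: "bool list => qvec => qvec"
 assumes X: "!!s a phi b psi. X s (lc a phi b psi) = lc a (X s phi) b (X s psi)"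
 shows "\<exists>bs. length bs = n &
  (\<Sum>s\<in>SS. norm_sq W (X s (levs s j (replicate n (1/5)) (psi s)))) <=
  (\<Sum>s\<in>SS. norm_sq W (X s (levs s j (map (%b. if b then 1/2 else 0) bs) (psi s))))"
proof (induction n arbitrary: j psi)
 case (Suc n)
 define v where "v = (%phi. \<Sum>s\<in>SS. norm_sq W (X s (levs s (Suc j) (replicate n (1/5)) (phi s))))"
 define phi where "phi = (%b s. damp s j (if b then 1/2 else 0) (psi s))"
 have "(\<Sum>s\<in>SS. norm_sq W (X s (levs s j (replicate (Suc n) (1/5)) (psi s)))) <=
   (\<Sum>s\<in>SS. (1 - 2/5) * norm_sq W (X s (levs s (Suc j) (replicate n (1/5)) (phi False s)))
    + 2/5 * norm_sq W (X s (levs s (Suc j) (replicate n (1/5)) (phi True s))))"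
  unfolding replicate_Suc levs.simps damp_mix levs_lc X
  by (rule sum_mono) (unfold phi_def if_True if_False, rule norm_sq_convex, simp_all)
 also have "... = 3/5 * v (phi False) + 2/5 * v (phi True)"
  by (simp add: v_def sum.distrib sum_distrib_left)
 also have "... <= max (v (phi False)) (v (phi True))" by (simp add: max_def)
 finally obtain b where b: "(\<Sum>s\<in>SS. norm_sq W (X s (levs s j (replicate (Suc n) (1/5)) (psi s)))) <= v (phi b)"
  by (cases "v (phi False) <= v (phi True)") (simp_all add: max_def)
 obtain bs where bs: "length bs = n" "v (phi b) <=
   (\<Sum>s\<in>SS. norm_sq W (X s (levs s (Suc j) (map (%b. if b then 1/2 else 0) bs) (phi b s))))"
  using Suc.IH[of "Suc j" "phi b"] unfolding v_def by blast
 show ?case using b bs by (intro exI[of _ "b # bs"]) (simp add: phi_def del: replicate_Suc)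
qed simp

section \<open>The amplified circuit\<close>

text \<open>
 The levels as implemented, amplified where the list says so; K says that all results are right and
 all coins are 0, which happens with the amplitude of the damped vector times \<open>ampl\<close>.
\<close>

fun circ :: "bool list => nat => bool list => qvec => qvec" where
 "circ s j [] psi = psi"
| "circ s j (b # bs) psi = circ s (Suc j) bs
   (if b then amplify (coin j) (A j) (Z j) (G s j) psi else ap (Hadamard (coin j) # A j) psi)"

lemma circ_append: "circ s j (bs @ cs) psi = circ s (j + length bs) cs (circ s j bs psi)"
 by (induction bs arbitrary: j psi) simp_all

definition K :: "bool list => nat => bool list => bool" where
 "K s n x <-> (\<forall>j<n. G s j x & ~ x ! coin j)"

definition ampl :: "bool list => complex" where
 "ampl bs = prod_list (map (%b. if b then - rt2 else complex_of_real (1 / sqrt 2)) bs)"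

lemma circ_good:
 assumes "length bs <= N"
 shows "proj (K s (length bs)) (circ s 0 bs Om) =
  (%x. ampl bs * levs s 0 (map (%b. if b then 1/2 else 0) bs) Om x)"
 using assms
proof (induction bs rule: rev_induct)
 case Nil
 show ?case by (auto simp: K_def proj_def ampl_def)
next
 case (snoc b bs)
 let ?n = "length bs"
 let ?L = "levs s 0 (map (%b. if b then 1/2 else 0) bs) Om"
 let ?\<chi> = "circ s 0 bs Om"
 let ?op = "%psi. if b then amplify (coin ?n) (A ?n) (Z ?n) (G s ?n) psi else ap (Hadamard (coin ?n) # A ?n) psi"
 let ?Q = "%x. G s ?n x & ~ x ! coin ?n"
 have n: "?n < N" using snoc.prems by simp
 have K: "K s (Suc ?n) = (%x. K s ?n x & ?Q x)" by (auto simp: K_def fun_eq_iff less_Suc_eq)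
 have Kdep: "K s ?n (x[w := c]) = K s ?n x" if "w : insert (coin ?n) (targets (A ?n))" for w x c
 proof -
  have "G s j (x[w := c]) = G s j x" "coin j ~= w" if "j < ?n" for j
   using that n \<open>w : _\<close> G_dep[of j ?n w s x c] G_coin[of j ?n s x c] coin_A[of j ?n] coin_inj
   by (auto simp: inj_on_def)
  hence "G s j (x[w := c]) = G s j x" "x[w := c] ! coin j = x ! coin j" if "j < ?n" for j
   using that by (simp_all, metis nth_list_update_neq)
  thus ?thesis by (simp add: K_def)
 qed
 have Kop: "proj (K s ?n) (?op psi) = ?op (proj (K s ?n) psi)" for psi
 proof (cases b)
  case True thus ?thesis using proj_amplify[of "coin ?n" "A ?n" "K s ?n"] Kdep by simp
 next
  case False
  have "proj (K s ?n) (ap (Hadamard (coin ?n) # A ?n) psi) = ap (Hadamard (coin ?n) # A ?n) (proj (K s ?n) psi)"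
   by (rule ap_proj[symmetric], rule Kdep) auto
  with False show ?thesis by (simp only: if_False)
 qed
 have "proj (K s (Suc ?n)) (?op ?\<chi>) = proj ?Q (proj (K s ?n) (?op ?\<chi>))"
  unfolding K by (subst proj_commute) (simp only: proj_conj)
 also have "... = proj ?Q (?op (%x. ampl bs * ?L x))"
  unfolding Kop using snoc by simp
 also have "... = (%x. ampl bs * proj ?Q (?op ?L) x)"
 proof -
  have "?op (%x. ampl bs * ?L x) = (%x. ampl bs * ?op ?L x)"
  proof (cases b)
   case True
   have sg: "sgn_flip Q (%x. a * psi x) = (%x. a * sgn_flip Q psi x)" for Q a psi
    by (auto simp: sgn_flip_def fun_eq_iff)
   show ?thesis using True by (simp only: if_True amplify_def ap_scale sg)
  next
   case False thus ?thesis by (simp only: if_False ap_scale)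
  qed
  thus ?thesis by (simp only: proj_scale)
 qed
 also have "... = (%x. ampl (bs @ [b]) * damp s ?n (if b then 1/2 else 0) ?L x)"
 proof -
  have Z: "proj (Z ?n) ?L = ?L" using n by (intro proj_Z_levs) simp_all
  have c: "proj (%x. coin ?n < length x & ~ x ! coin ?n) ?L = ?L"
   unfolding Zc_def[symmetric] using n by (intro proj_Zc_levs) simp_all
  have "Z ?n (x[coin ?n := b]) = Z ?n x" for x b
   using coin_F[OF n n] unfolding Z_def by (metis nth_list_update_neq)
  note am = amplify_good[OF Z c coin_A[OF n n] this G_coin[OF n n, of s]]
  show ?thesis using am by (cases b) (simp_all add: ampl_def damped_0 fun_eq_iff)
 qed
 finally show ?case by (simp add: circ_append levs_append del: fold_simps)
qed

lemma norm_ampl: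
 assumes "bs = replicate T True @ cs" "length bs = N" "length cs <= r"
 shows "2 ^ N / 4 ^ r <= (cmod (ampl bs))\<^sup>2"
proof -
 have c: "(cmod (ampl (b # bs)))\<^sup>2 = (if b then 2 else 1/2) * (cmod (ampl bs))\<^sup>2" for b bs
  by (simp add: ampl_def norm_mult power_mult_distrib power_divide norm_divide)
 have n: "(cmod (ampl []))\<^sup>2 = 1" by (simp add: ampl_def)
 have 1: "(cmod (ampl cs))\<^sup>2 \<ge> (1/2) ^ length cs" for cs
 proof (induction cs)
  case (Cons b cs)
  have "(1/2) * (1/2) ^ length cs <= (if b then 2 else 1/2) * (cmod (ampl cs))\<^sup>2"
   using Cons by (intro mult_mono) auto
  thus ?case by (simp only: c) simp
 qed (simp add: n)
 have 2: "(cmod (ampl (replicate T True @ cs)))\<^sup>2 = 2 ^ T * (cmod (ampl cs))\<^sup>2"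
  by (induction T) (simp_all add: c)
 have "2 ^ N / (4::real) ^ r <= 2 ^ N / 4 ^ length cs"
  using assms(3) by (intro divide_left_mono power_increasing) auto
 also have "... = 2 ^ T * (1/2) ^ length cs"
 proof -
  have "(4::real) ^ length cs = 2 ^ length cs * 2 ^ length cs" by (simp add: power_mult_distrib[symmetric])
  thus ?thesis using assms(1,2) by (auto simp: power_add power_divide)
 qed
 also have "... <= (cmod (ampl bs))\<^sup>2" unfolding assms(1) 2 using 1 by (intro mult_left_mono) auto
 finally show ?thesis .
qed

text \<open>
 If the ideal vectors, which are consistent with the target, win with probability noticeably
 above 1/2 in total, then some choice of amplified levels makes the circuit succeed.
\<close>

lemma amplified_success:
 fixes g :: "bool list => bool list => complex" and gs :: "gate list"
 defines "X == %s psi x. g s x * ap gs psi x"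
 assumes bessel: "!!j. j < N ==>
   (\<Sum>s\<in>SS. norm_sq W (good (A j) (G s j) (dev (A j) (Z j) (G s j) (ideal s j)))) <= 1"
  and Q: "proj Q Om = Om" "!!j w x b. j < N ==> w : targets (A j) ==> Q (x[w := b]) = Q x"
  and contr: "!!s psi. s : SS ==> proj Q psi = psi ==> norm_sq W (X s psi) <= 1/2 * norm_sq W psi"
  and Kdep: "!!s w x b. w : targets gs ==> K s N (x[w := b]) = K s N x"
  and dl: "0 < dl" "dl <= 1" and r: "2 * (4/5) ^ r <= dl / 8"
  and win: "(1 + dl) / 2 <= (\<Sum>s\<in>SS. norm_sq W (X s (ideal s N)))"
 shows "\<exists>bs. length bs = N & 2 ^ N / 4 ^ r * (dl\<^sup>2 / 20) <= (\<Sum>s\<in>SS. norm_sq W (X s (circ s 0 bs Om)))"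
proof -
 define T where "T = N - r"
 define L where "L s = levs s 0 (schedule T N) Om" for s
 define De where "De s = lc 1 (ideal s N) (-1) (L s)" for s
 define d where "d = (\<Sum>s\<in>SS. norm_sq W (De s))"
 define loss where "loss = (\<Sum>s\<in>SS. norm_sq W (X s (L s)))"
 have X_lc: "X s (lc a phi b psi) = lc a (X s phi) b (X s psi)" for s a phi b psi
  unfolding X_def ap_lin by (simp add: fun_eq_iff algebra_simps)
 have Qlev: "proj Q (levs s 0 cs Om) = levs s 0 cs Om" if "length cs = N" for s cs
  using Q that by (subst proj_levs) auto
 have "d <= (if N <= T & 0 < T then 3 else 1 + (if T = 0 then 0 else 2) * (4/5) ^ (N - T))"
  unfolding d_def De_def L_def by (rule level_bound[OF bessel order_refl])
 hence d: "d <= 1 + dl / 8"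
 proof (cases "T = 0")
  case False
  hence T: "N - T = r" by (simp add: T_def)
  show ?thesis
  proof (cases "r = 0")
   case False
   hence "~ N <= T" using T by simp
   thus ?thesis using \<open>d <= _\<close> r T \<open>T ~= 0\<close> by simp
  qed (use r dl in simp)
 qed (use dl in simp)
 have step: "norm_sq W (X s (ideal s N)) <= norm_sq W (X s (L s)) / (dl / (4 + dl))
   + (1/2 * norm_sq W (De s)) / (1 - dl / (4 + dl))" if "s : SS" for s
 proof -
  have "ideal s N = lc 1 (L s) 1 (De s)" by (simp add: De_def fun_eq_iff)
  hence "X s (ideal s N) = lc 1 (X s (L s)) 1 (X s (De s))" by (simp only: X_lc)
  moreover have "norm_sq W (lc 1 (X s (L s)) 1 (X s (De s))) <=
    norm_sq W (X s (L s)) / (dl / (4 + dl)) + norm_sq W (X s (De s)) / (1 - dl / (4 + dl))"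
   using dl by (intro norm_sq_young) simp_all
  moreover have "proj Q (De s) = De s" unfolding De_def proj_lin L_def by (subst (1 2) Qlev) simp_all
  hence "norm_sq W (X s (De s)) / (1 - dl / (4 + dl)) <= (1/2 * norm_sq W (De s)) / (1 - dl / (4 + dl))"
   using contr[OF that] dl by (intro divide_right_mono) (simp_all add: field_simps)
  ultimately show ?thesis by simp
 qed
 have "(1 + dl) / 2 <= loss / (dl / (4 + dl)) + (1/2 * d) / (1 - dl / (4 + dl))"
 proof -
  define p q where "p = dl / (4 + dl)" and "q = 1 - dl / (4 + dl)"
  have "(\<Sum>s\<in>SS. norm_sq W (X s (ideal s N))) <=
    (\<Sum>s\<in>SS. norm_sq W (X s (L s)) / p + (1/2 * norm_sq W (De s)) / q)"
   unfolding p_def q_def by (rule sum_mono) (rule step)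
  also have "... = loss / p + (1/2 * d) / q"
   by (simp only: loss_def d_def sum.distrib sum_divide_distrib sum_distrib_left)
  finally show ?thesis using win by (simp only: p_def q_def)
 qed
 moreover have "1 - dl / (4 + dl) = 4 / (4 + dl)" using dl by (simp add: field_simps)
 ultimately have "(1 + dl) / 2 <= loss * (4 + dl) / dl + d * (4 + dl) / 8" by simp
 moreover have "loss * (4 + dl) / dl <= loss * 5 / dl"
 proof -
  have "0 <= loss" unfolding loss_def by (simp add: sum_nonneg)
  thus ?thesis using dl by (intro divide_right_mono mult_left_mono) auto
 qed
 moreover have "d * (4 + dl) / 8 <= (1 + dl/8) * (4 + dl) / 8"
  using d dl by (intro divide_right_mono mult_right_mono) auto
 moreover have "(1 + dl/8) * (4 + dl) / 8 <= 1/2 + dl/4"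
 proof -
  have "dl * dl <= dl" using dl by (simp add: mult_left_le)
  hence "dl * dl <= dl * 4" using dl by linarith
  thus ?thesis by (simp add: algebra_simps)
 qed
 ultimately have "(1 + dl) / 2 <= loss * 5 / dl + (1/2 + dl/4)" by (meson add_mono order_trans)
 hence "dl / 4 <= loss * 5 / dl" by (simp add: add_divide_distrib)
 hence loss: "dl\<^sup>2 / 20 <= loss" using dl by (simp add: field_simps power2_eq_square)
 have TN: "T <= N" by (simp add: T_def)
 have sched: "schedule T N = replicate T (1/2) @ replicate (N - T) (1/5)"
  by (rule nth_equalityI) (use TN in \<open>auto simp: nth_append\<close>)
 obtain cs where cs: "length cs = N - T" "loss <= (\<Sum>s\<in>SS. norm_sq W (X s
   (levs s T (map (%b. if b then 1/2 else 0) cs) (levs s 0 (replicate T (1/2)) Om))))"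
  using choose_schedule[of X "N - T" T "%s. levs s 0 (replicate T (1/2)) Om", OF X_lc]
  unfolding loss_def L_def sched levs_append by auto
 define bs where "bs = replicate T True @ cs"
 have len: "length bs = N" using cs TN by (simp add: bs_def)
 let ?l = "%s. levs s 0 (map (%b. if b then 1/2 else 0) bs) Om"
 have "dl\<^sup>2 / 20 <= (\<Sum>s\<in>SS. norm_sq W (X s (?l s)))"
  using loss cs by (simp add: bs_def levs_append)
 hence "2 ^ N / 4 ^ r * (dl\<^sup>2 / 20) <= (cmod (ampl bs))\<^sup>2 * (\<Sum>s\<in>SS. norm_sq W (X s (?l s)))"
  using norm_ampl[OF bs_def len, of r] cs(1) T_def by (intro mult_mono) auto
 also have "... = (\<Sum>s\<in>SS. norm_sq W (%x. ampl bs * X s (?l s) x))"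
  by (simp add: sum_distrib_left norm_sq_scale)
 also have "... <= (\<Sum>s\<in>SS. norm_sq W (X s (circ s 0 bs Om)))"
 proof (rule sum_mono)
  fix s
  have "(%x. ampl bs * X s (?l s) x) = X s (proj (K s N) (circ s 0 bs Om))"
  proof -
   have "proj (K s N) (circ s 0 bs Om) = (%x. ampl bs * ?l s x)"
    using circ_good[of bs s] len by simp
   thus ?thesis unfolding X_def by (simp only: ap_scale) (simp add: fun_eq_iff)
  qed
  also have "... = proj (K s N) (X s (circ s 0 bs Om))"
  proof -
   have "ap gs (proj (K s N) psi) = proj (K s N) (ap gs psi)" for psi by (rule ap_proj[OF Kdep])
   thus ?thesis by (simp add: X_def proj_def fun_eq_iff)
  qed
  finally show "norm_sq W (%x. ampl bs * X s (?l s) x) <= norm_sq W (X s (circ s 0 bs Om))"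
   by (simp add: norm_proj_le)
 qed
 finally show ?thesis using len by blast
qed

end

section \<open>Measurements\<close>

abbreviation bits :: "nat => bool list set" where
 "bits k == {x. length x = k}"

lemma finite_bits [simp]: "finite (bits k)"
 by (rule finite_len)

lemma card_bits: "card (bits k) = 2 ^ k"
 using card_lists_length_eq[of "UNIV :: bool set" k] by simp

lemma bits_nonempty [simp]: "bits k ~= {}"
 using length_replicate[of k True] by blast

lemma ap_qspace: "psi : qspace n ==> ap gs psi : qspace n"
proof (induction gs arbitrary: psi)
 case (Cons g gs)
 have "apply_gate g psi : qspace n" using Cons.prems unitary_gate[of g] by (simp add: unitary_op_def)
 thus ?case using Cons.IH by simp
qed simp

text \<open>The unnormalized state left when y is measured on the first wires.\<close>

definition slice :: "bool list => qvec => qvec" where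
 "slice y Phi = (%x. Phi (y @ x))"

lemma slice_qspace: "Phi : qspace (k + n) ==> length y = k ==> slice y Phi : qspace n"
 by (auto simp: slice_def qspace_def)

lemma slice_scale: "slice y (%x. a * Phi x) = (%x. a * slice y Phi x)"
 by (simp add: slice_def)

lemma sum_bits_append:
 "(\<Sum>w\<in>bits (k + n). f w) = (\<Sum>y\<in>bits k. \<Sum>x\<in>bits n. f (y @ x))"
proof -
 have "bij_betw (%(y, x). y @ x) (bits k \<times> bits n) (bits (k + n))"
  by (rule bij_betw_byWitness[where f' = "%w. (take k w, drop k w)"]) auto
 hence "(\<Sum>w\<in>bits (k + n). f w) = (\<Sum>(y, x)\<in>bits k \<times> bits n. f (y @ x))"
  by (subst sum.reindex_bij_betw[symmetric, of "%(y, x). y @ x" "bits k \<times> bits n"])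
   (auto simp: case_prod_unfold)
 thus ?thesis by (simp add: sum.cartesian_product)
qed

lemma pmf_take_born:
 assumes "Phi : qspace (k + n)" "norm_sq (k + n) Phi = 1"
 shows "pmf (map_pmf (take k) (born Phi)) y = (if length y = k then norm_sq n (slice y Phi) else 0)"
proof -
 have p: "pmf (born Phi) w = (cmod (Phi w))\<^sup>2" for w by (rule pmf_born[OF assms])
 have S: "set_pmf (born Phi) <= bits (k + n)"
  using assms(1) by (auto simp: set_pmf_eq p qspace_def)
 have "pmf (map_pmf (take k) (born Phi)) y = measure (born Phi) (take k -` {y} \<inter> bits (k + n))"
  unfolding pmf_map by (rule measure_prob_cong_0) (use S in \<open>auto simp: set_pmf_iff\<close>)
 also have "... = (\<Sum>w\<in>take k -` {y} \<inter> bits (k + n). (cmod (Phi w))\<^sup>2)"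
  by (simp add: measure_measure_pmf_finite p)
 also have "... = (\<Sum>w\<in>bits (k + n). if take k w = y then (cmod (Phi w))\<^sup>2 else 0)"
  by (simp add: sum.inter_restrict[symmetric] sum.If_cases Int_commute vimage_def)
 also have "... = (\<Sum>y'\<in>bits k. if y' = y then norm_sq n (slice y' Phi) else 0)"
  unfolding sum_bits_append by (intro sum.cong refl) (auto simp: norm_sq_def slice_def)
 also have "... = (if length y = k then norm_sq n (slice y Phi) else 0)"
  by (simp add: sum.delta)
 finally show ?thesis .
qed

definition renorm :: "nat => qvec => qvec" where
 "renorm n psi = (%x. psi x / complex_of_real (sqrt (norm_sq n psi)))"

lemma renorm_alt: "renorm n psi = (%x. complex_of_real (1 / sqrt (norm_sq n psi)) * psi x)"
 by (simp add: renorm_def fun_eq_iff)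

lemma renorm_state:
 assumes "psi : qspace n" "norm_sq n psi ~= 0"
 shows "renorm n psi : qspace n" "norm_sq n (renorm n psi) = 1"
proof -
 show "renorm n psi : qspace n" using assms(1) by (auto simp: renorm_def qspace_def)
 have "0 < norm_sq n psi" using assms(2) norm_sq_nonneg[of n psi] by linarith
 thus "norm_sq n (renorm n psi) = 1"
  unfolding renorm_alt norm_sq_scale by (simp add: norm_divide power_divide del: of_real_divide)
qed

lemma measure_wires_alt:
 assumes "Phi : qspace (k + n)" "norm_sq (k + n) Phi = 1"
 shows "measure_wires k Phi = map_pmf (%y. (y, renorm n (slice y Phi))) (map_pmf (take k) (born Phi))"
 unfolding measure_wires_def Let_def
proof (rule pmf.map_cong0)
 fix y assume y: "y : set_pmf (map_pmf (take k) (born Phi))"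
 hence "length y = k" unfolding set_pmf_iff pmf_take_born[OF assms] by (simp split: if_splits)
 thus "(y, %x. Phi (y @ x) / complex_of_real (sqrt (pmf (map_pmf (take k) (born Phi)) y))) =
   (y, renorm n (slice y Phi))"
  using pmf_take_born[OF assms, of y] by (simp add: renorm_def slice_def)
qed

lemma pmf_bind_finite:
 assumes "finite S" "set_pmf p <= S"
 shows "pmf (bind_pmf p f) v = (\<Sum>y\<in>S. pmf p y * pmf (f y) v)"
 unfolding pmf_bind using assms by (subst integral_measure_pmf[of S]) (auto simp: mult_ac)

lemma pmf_bind_measure:
 assumes "Phi : qspace (k + n)" "norm_sq (k + n) Phi = 1"
 shows "pmf (measure_wires k Phi \<bind> f) v =
  (\<Sum>y\<in>bits k. norm_sq n (slice y Phi) * pmf (f (y, renorm n (slice y Phi))) v)"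
proof -
 let ?p = "map_pmf (take k) (born Phi)"
 have S: "set_pmf ?p <= bits k"
  unfolding set_pmf_eq pmf_take_born[OF assms] by (auto split: if_splits)
 have "pmf (measure_wires k Phi \<bind> f) v = pmf (?p \<bind> (%y. f (y, renorm n (slice y Phi)))) v"
  unfolding measure_wires_alt[OF assms] bind_map_pmf ..
 also have "... = (\<Sum>y\<in>bits k. pmf ?p y * pmf (f (y, renorm n (slice y Phi))) v)"
  by (rule pmf_bind_finite[OF _ S]) simp
 also have "... = (\<Sum>y\<in>bits k. norm_sq n (slice y Phi) * pmf (f (y, renorm n (slice y Phi))) v)"
  using pmf_take_born[OF assms] by (intro sum.cong refl) simp
 finally show ?thesis .
qed

lemma empty_state: "empty_state : qspace 0" "norm_sq 0 empty_state = 1"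
 by (auto simp: empty_state_def qspace_def norm_sq_def)

lemma activate_circuit:
 "activate (act C) x psi = measure_wires (n_out C) (ap (gates C) (load (n_out C + n_anc C) x psi))"
 by (simp add: activate_def act_def)

lemma circuit_state:
 assumes "psi : qspace n" "norm_sq n psi = 1"
 shows "ap gs (load (k + j) x psi) : qspace (k + (j + length x + n))"
  "norm_sq (k + (j + length x + n)) (ap gs (load (k + j) x psi)) = 1"
 using load_state[OF assms, of "k + j" x] by (simp_all add: ap_qspace norm_ap add.assoc)

lemma pmf_activate_bind:
 assumes "psi : qspace n" "norm_sq n psi = 1" "n' = n_anc C + length x + n"
 defines "Phi == ap (gates C) (load (n_out C + n_anc C) x psi)"
 shows "pmf (activate (act C) x psi \<bind> f) v =
  (\<Sum>y\<in>bits (n_out C). norm_sq n' (slice y Phi) * pmf (f (y, renorm n' (slice y Phi))) v)"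
 unfolding activate_circuit Phi_def assms(3)
 by (rule pmf_bind_measure[OF circuit_state[OF assms(1,2)]])

lemma pmf_run:
 "pmf (run C x) y = (if length y = n_out C
   then norm_sq (n_anc C + length x) (slice y (ap (gates C) (load (n_out C + n_anc C) x empty_state))) else 0)"
proof -
 note st = circuit_state[OF empty_state, where gs = "gates C" and k = "n_out C" and j = "n_anc C" and x = x]
 have "run C x = map_pmf (take (n_out C)) (born (ap (gates C) (load (n_out C + n_anc C) x empty_state)))"
  unfolding run_def activate_circuit measure_wires_alt[OF st] map_pmf_comp by simp
 thus ?thesis using pmf_take_born[OF st, of y] by simp
qed

text \<open>Basis states, and how they behave as private states.\<close>

definition ket :: "bool list => qvec" where
 "ket w = (%x. if x = w then 1 else 0)"

lemma ket_Nil: "ket [] = empty_state"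
 by (simp add: ket_def empty_state_def)

lemma ket_state: "ket w : qspace (length w)" "norm_sq (length w) (ket w) = 1"
 by (auto simp: ket_def qspace_def norm_sq_def)
  (simp add: if_distrib[of "%z. (cmod z)\<^sup>2"] sum.delta cong: if_cong)

lemma load_ket: "load j x (ket w) = ket (zeros j @ x @ w)"
proof
 fix y
 have "take (j + length x) y = zeros j @ x & drop (j + length x) y = w <-> y = zeros j @ x @ w"
 proof
  assume "take (j + length x) y = zeros j @ x & drop (j + length x) y = w"
  thus "y = zeros j @ x @ w" by (metis append_assoc append_take_drop_id)
 qed simp
 thus "load j x (ket w) y = ket (zeros j @ x @ w) y" by (auto simp: load_def ket_def)
qed

lemma load_empty: "load j x empty_state = ket (zeros j @ x)"
 using load_ket[of j x "[]"] by (simp add: ket_Nil)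

lemma fst_activate_ket: "map_pmf fst (activate A x (ket w)) = map_pmf fst (activate A (x @ w) empty_state)"
proof -
 have "load j x (ket w) = load j (x @ w) empty_state" for j by (simp add: load_ket load_empty)
 moreover have "map_pmf fst (measure_wires k psi) = map_pmf (take k) (born psi)" for k psi
  by (simp add: measure_wires_def Let_def map_pmf_comp)
 ultimately show ?thesis by (simp add: activate_def)
qed

text \<open>Hadamard gates on all output wires produce a uniform message.\<close>

definition coins :: "nat => circuit" where
 "coins m = Circuit m 0 (map Hadamard [0..<m])"

lemma activate_coins:
 "activate (act (coins m)) x (ket w) = map_pmf (%r. (r, ket (x @ w))) (pmf_of_set (bits m))"
proof -
 define Phi where "Phi = ap (map Hadamard [0..<m]) (ket (zeros m @ x @ w))"
 let ?n = "length x + length w"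
 have st: "Phi : qspace (m + ?n)" "norm_sq (m + ?n) Phi = 1"
  unfolding Phi_def norm_ap using ket_state[of "zeros m @ x @ w"]
  by (simp_all add: ap_qspace)
 have val: "Phi (y @ u) = ket (x @ w) u / rt2 ^ m" if "length y = m" "length u = ?n" for y u
 proof -
  have "clr {0..<m} (y @ u) = zeros m @ u"
   using that by (intro nth_equalityI) (auto simp: clr_nth nth_append)
  moreover have "Phi (y @ u) = ket (zeros m @ x @ w) (clr {0..<m} (y @ u)) / rt2 ^ m"
   unfolding Phi_def
   by (subst ap_H_zero) (use that in \<open>auto simp: ket_def nth_append\<close>)
  ultimately show ?thesis by (simp add: ket_def)
 qed
 have norm: "norm_sq ?n (slice y Phi) = 1 / 2 ^ m" if "length y = m" for y
 proof -
  have "norm_sq ?n (slice y Phi) = norm_sq ?n (%u. (1 / rt2 ^ m) * ket (x @ w) u)"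
   by (rule norm_sq_cong) (simp add: slice_def val that)
  also have "... = 1 / 2 ^ m"
   unfolding norm_sq_scale using ket_state(2)[of "x @ w"]
   by (simp add: norm_divide norm_power power_divide power_mult[symmetric] mult.commute[of m])
    (simp add: power_mult)
  finally show ?thesis .
 qed
 have p: "map_pmf (take m) (born Phi) = pmf_of_set (bits m)"
  by (rule pmf_eqI) (simp add: pmf_take_born[OF st] norm card_bits pmf_of_set[OF bits_nonempty finite_bits] indicator_def)
 have s: "renorm ?n (slice y Phi) = ket (x @ w)" if "length y = m" for y
 proof
  fix u
  have r: "sqrt (1 / 2 ^ m) = 1 / sqrt 2 ^ m" by (simp add: real_sqrt_divide real_sqrt_power)
  show "renorm ?n (slice y Phi) u = ket (x @ w) u"
  proof (cases "length u = ?n")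
   case True
   thus ?thesis unfolding renorm_def norm[OF that] r by (simp add: slice_def val that)
  next
   case False
   have "slice y Phi : qspace ?n" by (rule slice_qspace[OF st(1) that])
   hence "slice y Phi u = 0" using False by (auto simp: qspace_def)
   thus ?thesis using False by (auto simp: renorm_def ket_def)
  qed
 qed
 have "activate (act (coins m)) x (ket w) = measure_wires m Phi"
  by (simp add: activate_circuit coins_def load_ket Phi_def)
 also have "... = map_pmf (%y. (y, renorm ?n (slice y Phi))) (pmf_of_set (bits m))"
  unfolding measure_wires_alt[OF st] p ..
 also have "... = map_pmf (%r. (r, ket (x @ w))) (pmf_of_set (bits m))"
  by (rule pmf.map_cong0) (simp add: s set_pmf_of_set[OF bits_nonempty finite_bits])
 finally show ?thesis .
qed

section \<open>Coherent simulation of an interaction\<close>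

text \<open>Running a machine on the listed wires of a register of \<open>W\<close> wires.\<close>

definition wmap :: "nat => nat list => nat => nat" where
 "wmap W ws i = (if i < length ws then ws ! i else W + i)"

lemma embedding_wmap:
 assumes "distinct ws" "set ws <= {..<W}"
 shows "embedding (wmap W ws) (length ws) W"
proof
 show "inj_on (wmap W ws) {..<length ws}"
  using assms(1) by (auto simp: inj_on_def wmap_def nth_eq_iff_index_eq)
 show "!!i. i < length ws ==> wmap W ws i < W"
  using assms(2) nth_mem by (fastforce simp: wmap_def)
qed (simp add: wmap_def)

lemma wmap_image: "wmap W ws ` {..<length ws} = set ws"
 by (auto simp: wmap_def in_set_conv_nth)

lemma pick_wmap: "pick (wmap W ws) (length ws) y = map ((!) y) ws"
 by (rule nth_equalityI) (simp_all add: pick_def wmap_def)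

text \<open>
 One message on the common register: Hadamard gates on \<open>hs\<close> for the challenge, a copy
 of \<open>src\<close> in \<open>dst\<close> as input of D, and D on the wires \<open>ws\<close>.
\<close>

definition stage :: "nat => nat list => nat list => nat list => nat list => circuit => gate list" where
 "stage W hs src dst ws D =
   map Hadamard hs @ cg (map2 (%a t. XG [a] t) src dst) @ map (rn (wmap W ws)) (gates D)"

text \<open>
 A register that holds the classical record on the wires \<open>zw\<close>, the private state \<open>f t\<close> belonging
 to the record t on the wires \<open>pw\<close>, and zeros elsewhere.
\<close>

definition rep :: "nat => qvec => nat list => nat list => complex => (bool list => qvec) => bool" where
 "rep W Th zw pw \<kappa> f <-> (\<forall>y. Th y =
   (if length y = W & (\<forall>p<W. p ~: set zw Un set pw --> ~ y ! p)
   then \<kappa> * f (map ((!) y) zw) (map ((!) y) pw) else 0))"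

lemma fold_copy_nth:
 assumes "length src = length dst" "distinct dst" "set src \<inter> set dst = {}" "set dst <= {..<length y}"
 defines "y' == foldr cact (map2 (%a t. XG [a] t) src dst) y"
 shows "i < length dst ==> y' ! (dst ! i) <-> y ! (dst ! i) ~= y ! (src ! i)"
  and "p ~: set dst ==> y' ! p = y ! p"
proof -
 have *: "(\<forall>i<length dst. foldr cact (map2 (%a t. XG [a] t) src dst) y ! (dst ! i) <-> y ! (dst ! i) ~= y ! (src ! i)) &
  (\<forall>p. p ~: set dst --> foldr cact (map2 (%a t. XG [a] t) src dst) y ! p = y ! p)"
  using assms(1-4)
 proof (induction src dst rule: list_induct2)
  case (Cons a src d dst)
  let ?y = "foldr cact (map2 (%a t. XG [a] t) src dst) y"
  have IH: "\<forall>i<length dst. ?y ! (dst ! i) <-> y ! (dst ! i) ~= y ! (src ! i)"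
   "\<forall>p. p ~: set dst --> ?y ! p = y ! p"
   using Cons by auto
  have y': "foldr cact (map2 (%a t. XG [a] t) (a # src) (d # dst)) y = (if y ! a then ?y[d := ~ ?y ! d] else ?y)"
   using IH(2) Cons.prems by (auto simp: cact_def cval_def)
  have "?y[d := b] ! (dst ! i) = ?y ! (dst ! i)" if "i < length dst" for i b
   using Cons.prems that nth_mem[OF that] by (intro nth_list_update_neq) auto
  moreover have "?y[d := b] ! d = b" for b using Cons.prems by simp
  moreover have "?y ! d = y ! d" using IH(2) Cons.prems by auto
  ultimately show ?case unfolding y' using IH by (auto simp: less_Suc_eq_0_disj)
 qed simp
 show "i < length dst ==> y' ! (dst ! i) <-> y ! (dst ! i) ~= y ! (src ! i)"
  and "p ~: set dst ==> y' ! p = y ! p"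
  using * unfolding y'_def by auto
qed

text \<open>
 If the Hadamard wires and the output are added to the record, then the private states after a stage
 are those after running D on the last part of the record.
\<close>

lemma stage_rep:
 fixes D :: circuit and hs out anc dst pw :: "nat list"
 assumes Th: "rep W Th zw pw \<kappa> f"
  and dis: "distinct (zw @ hs @ out @ anc @ dst @ pw)"
  and W: "set (zw @ hs @ out @ anc @ dst @ pw) <= {..<W}"
  and src: "src = drop d (zw @ hs)" "length dst = length src"
  and D: "n_out D = length out" "n_anc D = length anc"
 defines "h == length zw + length hs"
 shows "rep W (ap (stage W hs src dst (out @ anc @ dst @ pw) D) Th) (zw @ hs @ out) (anc @ dst @ pw)
  (\<kappa> / rt2 ^ length hs)
  (%t. slice (drop h t) (ap (gates D) (load (n_out D + n_anc D) (drop d (take h t)) (f (take (length zw) t)))))"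
 unfolding rep_def
proof
 fix y :: "bool list"
 let ?ws = "out @ anc @ dst @ pw" and ?J = "n_out D + n_anc D"
 let ?st = "stage W hs src dst ?ws D"
 let ?c = "\<kappa> / rt2 ^ length hs"
 let ?cl = "\<forall>p<W. p ~: set (zw @ hs @ out) Un set (anc @ dst @ pw) --> ~ y ! p"
 have Thq: "Th : qspace W" using Th by (auto simp: rep_def qspace_def)
 show "ap ?st Th y = (if length y = W & ?cl then ?c * slice (drop h (map ((!) y) (zw @ hs @ out)))
   (ap (gates D) (load ?J (drop d (take h (map ((!) y) (zw @ hs @ out)))) (f (take (length zw) (map ((!) y) (zw @ hs @ out))))))
   (map ((!) y) (anc @ dst @ pw)) else 0)" (is "_ = ?R")
 proof (cases "length y = W")
  case False
  have "ap ?st Th : qspace W" by (rule ap_qspace[OF Thq])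
  thus ?thesis using False by (auto simp: qspace_def)
 next
  case y: True
  let ?rho = "wmap W ?ws" and ?k = "length ?ws"
  interpret embedding ?rho ?k W by (rule embedding_wmap) (use dis W in auto)
  let ?cp = "map2 (%a t. XG [a] t) src dst"
  let ?\<Psi> = "ap (cg ?cp) (ap (map Hadamard hs) Th)"
  let ?t = "map ((!) y) (zw @ hs @ out)"
  have tk: "take (length zw) ?t = map ((!) y) zw" "drop d (take h ?t) = map ((!) y) src"
   "drop h ?t = map ((!) y) out"
   by (simp_all add: h_def src(1) drop_map take_map)
  have src_sub: "set src <= set zw Un set hs" unfolding src(1) using set_drop_subset[of d "zw @ hs"] by auto
  have aux2: "(if a then k else 0) * v = (if a then k * v else 0)" for a and k v :: complex by simp
  have aux: "(if a & b then k * v else 0) / q = (if a then k / q else 0) * (if b then v else 0)"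
   for a b and k v q :: complex by simp
  have val: "?\<Psi> (overlay ?rho ?k y w) = (if ?cl then ?c else 0) * load ?J (map ((!) y) src) (f (map ((!) y) zw)) w"
   if w: "length w = ?k" for w
  proof -
   define y' where "y' = overlay ?rho ?k y w"
   have len': "length y' = W" by (simp add: y'_def y)
   have in': "y' ! (?ws ! i) = w ! i" if "i < ?k" for i
    using overlay_nth_in[OF y, of i w] that by (simp add: y'_def wmap_def)
   have out': "y' ! p = y ! p" if "p < W" "p ~: set ?ws" for p
    using overlay_nth_out[of p y w] that wmap_image[of W ?ws] by (simp add: y'_def y)
   define y2 where "y2 = foldr cact ?cp y'"
   have len2: "length y2 = W" by (simp add: y2_def len')
   have sd: "set src \<inter> set dst = {}" using src_sub dis by auto
   note cp = fold_copy_nth[of src dst y', OF _ _ sd, folded y2_def]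
   have y2d: "y2 ! (dst ! i) <-> y' ! (dst ! i) ~= y ! (src ! i)" if "i < length dst" for i
   proof -
    have "src ! i : set src" using that src(2) by simp
    hence "src ! i ~: set ?ws" "src ! i < W" using src_sub dis W by auto
    thus ?thesis using cp(1)[of i] that src(2) dis W len' out' by auto
   qed
   have y2o: "y2 ! p = y' ! p" if "p ~: set dst" for p
    using cp(2)[of p] that src(2) dis W len' by auto
   define y3 where "y3 = clr (set hs) y2"
   have len3: "length y3 = W" by (simp add: y3_def len2)
   have y3: "y3 ! p <-> y2 ! p & p ~: set hs" if "p < W" for p
    using that len2 by (simp add: y3_def clr_nth)
   have "?\<Psi> y' = ap (map Hadamard hs) Th y2"
    unfolding y2_def
   proof (rule ap_cg)
    fix c assume "c : set ?cp"
    then obtain a t where at: "c = XG [a] t" "(a, t) : set (zip src dst)" by auto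
    hence "a : set src" "t : set dst" by (auto dest: set_zip_leftD set_zip_rightD)
    thus "cok (length y') c" using at(1) sd src_sub W len' by (auto simp: cok_def)
   qed
   also have "... = Th y3 / rt2 ^ length hs"
    unfolding y3_def
   proof (rule ap_H_zero)
    fix u v assume u: "length u = length y2" "v : set hs" "u ! v"
    have "v < W" "v ~: set zw Un set pw" using u(2) W dis by auto
    thus "Th u = 0" using Th u(3) unfolding rep_def by auto
   qed (use dis W len2 in auto)
   also have "Th y3 = (if \<forall>p<W. p ~: set zw Un set pw --> ~ y3 ! p
     then \<kappa> * f (map ((!) y3) zw) (map ((!) y3) pw) else 0)"
    using Th len3 by (simp add: rep_def)
   also have "map ((!) y3) zw = map ((!) y) zw"
   proof (rule map_cong[OF refl])
    fix p assume p: "p : set zw"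
    hence "p < W" "p ~: set hs" "p ~: set dst" "p ~: set ?ws" using W dis by auto
    thus "y3 ! p = y ! p" using y3 y2o out' by simp
   qed
   also have "map ((!) y3) pw = drop (?J + length src) w"
   proof (rule nth_equalityI)
    fix i assume "i < length (map ((!) y3) pw)"
    hence i: "i < length pw" by simp
    hence m: "pw ! i : set pw" by simp
    hence "pw ! i < W" "pw ! i ~: set hs" "pw ! i ~: set dst" using W dis by auto
    hence "y3 ! (pw ! i) = y' ! (?ws ! (?J + length src + i))"
     using y3 y2o D src(2) by (simp add: nth_append)
    thus "map ((!) y3) pw ! i = drop (?J + length src) w ! i"
     using in'[of "?J + length src + i"] i w D src(2) by simp
   qed (use w D src(2) in simp)
   also have "(\<forall>p<W. p ~: set zw Un set pw --> ~ y3 ! p) <->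
     ?cl & take (?J + length (map ((!) y) src)) w = zeros ?J @ map ((!) y) src"
    (is "?A <-> ?cl & ?B")
   proof -
    have B: "?B <-> (\<forall>i<?J. ~ w ! i) & (\<forall>i<length src. w ! (?J + i) = y ! (src ! i))"
     (is "?B <-> ?B1 & ?B2")
    proof
     assume b: ?B
     have "w ! i = (zeros ?J @ map ((!) y) src) ! i" if "i < ?J + length src" for i
      using b that by (metis length_map nth_take)
     thus "?B1 & ?B2" by (auto simp: nth_append)
    next
     assume "?B1 & ?B2"
     thus ?B using w D src(2)
      by (intro nth_equalityI) (auto simp: nth_append not_less dest!: le_Suc_ex)
    qed
    have oa: "?ws ! i = (out @ anc) ! i" if "i < ?J" for i
    proof -
     have "?ws ! i = ((out @ anc) @ (dst @ pw)) ! i" by simp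
     thus ?thesis using that D by (simp only: nth_append[of "out @ anc"]) simp
    qed
    have dd: "?ws ! (?J + i) = dst ! i" if "i < length src" for i
     using that D src(2) by (simp add: nth_append)
    have e1: "?B1 <-> (\<forall>p\<in>set (out @ anc). ~ y3 ! p)"
    proof -
     have "y3 ! ((out @ anc) ! i) = w ! i" if "i < ?J" for i
     proof -
      have "(out @ anc) ! i : set (out @ anc)" using that D by (intro nth_mem) simp
      hence "(out @ anc) ! i < W" "(out @ anc) ! i ~: set hs" "(out @ anc) ! i ~: set dst"
       using W dis by auto
      thus ?thesis using y3 y2o in'[of i] oa[OF that] that D by simp
     qed
     thus ?thesis using D by (auto simp: all_set_conv_all_nth simp del: set_append)
    qed
    have e2: "?B2 <-> (\<forall>p\<in>set dst. ~ y3 ! p)"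
    proof -
     have "y3 ! (dst ! i) <-> w ! (?J + i) ~= y ! (src ! i)" if "i < length src" for i
     proof -
      have "dst ! i : set dst" using that src(2) by simp
      hence "dst ! i < W" "dst ! i ~: set hs" using W dis by auto
      thus ?thesis using y3 y2d[of i] in'[of "?J + i"] dd[OF that] that src(2) D by simp
     qed
     thus ?thesis using src(2) by (auto simp: all_set_conv_all_nth)
    qed
    have e3: "?cl <-> (\<forall>p<W. p ~: set zw Un set hs Un set ?ws --> ~ y3 ! p)"
     using y3 y2o out' by auto
    have e4: "~ y3 ! p" if "p : set hs" for p using y3[of p] that W by auto
    show ?thesis
    proof
     assume A: ?A
     have "\<forall>p\<in>set (out @ anc). ~ y3 ! p" "\<forall>p\<in>set dst. ~ y3 ! p" using A W dis by auto
     moreover have ?cl unfolding e3 using A by auto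
     ultimately show "?cl & ?B" unfolding B e1 e2 by blast
    next
     assume r: "?cl & ?B"
     show ?A
     proof (intro allI impI)
      fix p assume p: "p < W" "p ~: set zw Un set pw"
      consider "p : set hs" | "p : set (out @ anc)" | "p : set dst" | "p ~: set zw Un set hs Un set ?ws"
       using p by auto
      thus "~ y3 ! p" using r p e4 unfolding B e1 e2 e3 by cases blast+
     qed
    qed
   qed
   finally show ?thesis unfolding y'_def[symmetric]
    by (simp only: load_def length_map aux)
  qed
  have "ap ?st Th y = ap (map (rn ?rho) (gates D)) ?\<Psi> y" by (simp add: stage_def)
  also have "... = ap (gates D) (%w. ?\<Psi> (overlay ?rho ?k y w)) (map ((!) y) ?ws)"
   using ap_rename[OF y, of "gates D" ?\<Psi>] by (simp only: pick_wmap)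
  also have "... = ap (gates D) (%w. (if ?cl then ?c else 0) * load ?J (map ((!) y) src) (f (map ((!) y) zw)) w) (map ((!) y) ?ws)"
   by (rule ap_cong[of ?k]) (simp_all only: val length_map)
  also have "... = ?R" unfolding ap_scale tk using y by (simp only: slice_def map_append aux2 simp_thms)
  finally show ?thesis .
 qed
qed

lemma rep_sum:
 assumes Th: "rep W Th zw pw \<kappa> f" and dis: "distinct (zw @ pw)" and sub: "set (zw @ pw) <= {..<W}"
 shows "(\<Sum>y\<in>bits W. q (map ((!) y) zw) * (cmod (Th y))\<^sup>2) =
  (\<Sum>t\<in>bits (length zw). q t * ((cmod \<kappa>)\<^sup>2 * norm_sq (length pw) (f t)))"
proof -
 let ?ws = "zw @ pw" and ?k = "length (zw @ pw)"
 interpret embedding "wmap W ?ws" ?k W by (rule embedding_wmap[OF dis sub])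
 let ?cl = "%y. \<forall>p<W. p ~: set zw Un set pw --> ~ y ! p"
 let ?g = "%u. q (take (length zw) u) * ((cmod \<kappa>)\<^sup>2 * (cmod (f (take (length zw) u) (drop (length zw) u)))\<^sup>2)"
 have nth: "overlay (wmap W ?ws) ?k (zeros W) u ! (?ws ! i) = u ! i" if "i < ?k" for u i
  using overlay_nth_in[of "zeros W" i u] that by (simp add: wmap_def)
 have "bij_betw (%y. map ((!) y) ?ws) {y : bits W. ?cl y} (bits ?k)"
 proof (rule bij_betw_byWitness[where f' = "overlay (wmap W ?ws) ?k (zeros W)"])
  show "\<forall>y\<in>{y : bits W. ?cl y}. overlay (wmap W ?ws) ?k (zeros W) (map ((!) y) ?ws) = y"
  proof (intro ballI overlay_eqI)
   fix y i assume "y : {y : bits W. ?cl y}" "i < ?k"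
   thus "y ! wmap W ?ws i = map ((!) y) ?ws ! i" by (simp only: wmap_def nth_map if_True)
  next
   fix y p assume "y : {y : bits W. ?cl y}" "p < W" "p ~: wmap W ?ws ` {..<?k}"
   thus "y ! p = zeros W ! p" unfolding wmap_image by auto
  qed simp_all
  show "\<forall>u\<in>bits ?k. map ((!) (overlay (wmap W ?ws) ?k (zeros W) u)) ?ws = u"
  proof (intro ballI nth_equalityI)
   fix u i assume "u : bits ?k" "i < length (map ((!) (overlay (wmap W ?ws) ?k (zeros W) u)) ?ws)"
   hence "i < ?k" by simp
   thus "map ((!) (overlay (wmap W ?ws) ?k (zeros W) u)) ?ws ! i = u ! i"
    by (simp only: nth_map nth)
  qed simp
  show "overlay (wmap W ?ws) ?k (zeros W) ` bits ?k <= {y : bits W. ?cl y}"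
   using overlay_nth_out[of _ "zeros W"] wmap_image[of W ?ws] by auto
 qed auto
 hence "(\<Sum>y\<in>{y : bits W. ?cl y}. ?g (map ((!) y) ?ws)) = (\<Sum>u\<in>bits ?k. ?g u)"
  by (rule sum.reindex_bij_betw)
 moreover have "(\<Sum>y\<in>{y : bits W. ?cl y}. ?g (map ((!) y) ?ws)) =
   (\<Sum>y\<in>bits W. q (map ((!) y) zw) * (cmod (Th y))\<^sup>2)"
 proof (rule sum.mono_neutral_cong_left)
  show "\<forall>y\<in>bits W - {y : bits W. ?cl y}. q (map ((!) y) zw) * (cmod (Th y))\<^sup>2 = 0"
   using Th by (auto simp: rep_def)
  fix y assume "y : {y : bits W. ?cl y}"
  hence "Th y = \<kappa> * f (map ((!) y) zw) (map ((!) y) pw)" using Th by (simp add: rep_def)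
  thus "?g (map ((!) y) ?ws) = q (map ((!) y) zw) * (cmod (Th y))\<^sup>2"
   by (simp add: norm_mult power_mult_distrib)
 qed auto
 moreover have "(\<Sum>u\<in>bits ?k. ?g u) = (\<Sum>t\<in>bits (length zw). q t * ((cmod \<kappa>)\<^sup>2 * norm_sq (length pw) (f t)))"
  unfolding length_append sum_bits_append norm_sq_def sum_distrib_left
  by (intro sum.cong refl) auto
 ultimately show ?thesis by simp
qed

section \<open>The value of the binding game\<close>

lemma load_scale: "load j x (%y. a * psi y) = (%y. a * load j x psi y)"
 by (auto simp: load_def fun_eq_iff)

lemma norm_sq_zeroD: "psi : qspace n ==> norm_sq n psi = 0 ==> psi = (%_. 0)"
 unfolding norm_sq_def qspace_def by (subst (asm) sum_nonneg_eq_0_iff) (auto simp: fun_eq_iff)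

text \<open>
 The winning probability of a committer with the remaining activations \<open>Cs\<close>, record t, pending
 input x and unnormalized private state \<open>psi\<close>; \<open>vr t b k\<close> is the probability that the receiver
 accepts the bit b and the key k.
\<close>

fun value_from :: "nat => circuit => (bool list => bool => bool list => real) => circuit list => bool list
  => bool list => nat => qvec => real" where
 "value_from m E vr [] t x n psi = (\<Sum>b\<in>bits 1. \<Sum>k\<in>bits (n_out E).
   (1/2) * (if hd k = hd b then vr t (hd b) (tl k) else 0) *
   norm_sq (n_anc E + length (t @ b) + n) (slice k (ap (gates E) (load (n_out E + n_anc E) (t @ b) psi))))"
| "value_from m E vr (C # Cs) t x n psi = (\<Sum>c\<in>bits (n_out C). \<Sum>v\<in>bits m. (1 / 2 ^ m) *
   value_from m E vr Cs (t @ c @ v) v (n_anc C + length x + n)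
    (slice c (ap (gates C) (load (n_out C + n_anc C) x psi))))"

lemma value_from_scale:
 "value_from m E vr Cs t x n (%y. a * psi y) = (cmod a)\<^sup>2 * value_from m E vr Cs t x n psi"
proof (induction Cs arbitrary: t x n psi)
 case Nil
 show ?case
  by (simp only: value_from.simps load_scale ap_scale slice_scale norm_sq_scale sum_distrib_left)
   (intro sum.cong refl, simp add: algebra_simps)
next
 case (Cons C Cs)
 show ?case
  by (simp only: value_from.simps load_scale ap_scale slice_scale Cons.IH sum_distrib_left)
   (intro sum.cong refl, simp add: algebra_simps)
qed

lemma value_from_renorm:
 assumes "psi : qspace n"
 shows "norm_sq n psi * value_from m E vr Cs t x k (renorm n psi) = value_from m E vr Cs t x k psi"
proof (cases "norm_sq n psi = 0")
 case True
 hence "psi = (%y. 0 * psi y)" using norm_sq_zeroD[OF assms] by simp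
 hence "value_from m E vr Cs t x k psi = 0"
  using value_from_scale[of m E vr Cs t x k 0 psi] by simp
 thus ?thesis using True by simp
next
 case False
 hence "0 < norm_sq n psi" using norm_sq_nonneg[of n psi] by linarith
 thus ?thesis unfolding renorm_alt value_from_scale
  by (simp add: norm_divide power_divide del: of_real_divide)
qed

lemma interact_coins:
 "interact (C # Cs) (act (coins m) # Rs) x [] psi (ket w) =
   activate C x psi \<bind> (%(c, psi'). pmf_of_set (bits m) \<bind> (%r. interact Cs Rs r [] psi' (ket (c @ w)) \<bind>
    (%(z, phiC, phiR). return_pmf (c # r # z, phiC, phiR))))"
 by (simp add: activate_coins bind_map_pmf case_prod_unfold)

lemma pmf_bind_bits:
 "pmf (pmf_of_set (bits m) \<bind> f) v = (\<Sum>r\<in>bits m. (1 / 2 ^ m) * pmf (f r) v)"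
proof -
 have "pmf (pmf_of_set (bits m) \<bind> f) v = (\<Sum>r\<in>bits m. pmf (pmf_of_set (bits m)) r * pmf (f r) v)"
  by (rule pmf_bind_finite) (simp_all add: set_pmf_of_set[OF bits_nonempty finite_bits])
 also have "... = (\<Sum>r\<in>bits m. (1 / 2 ^ m) * pmf (f r) v)"
  by (intro sum.cong refl) (simp add: pmf_of_set[OF bits_nonempty finite_bits] card_bits)
 finally show ?thesis .
qed

lemma bits_1: "bits 1 = {[True], [False]}"
 by (auto simp: length_Suc_conv)

lemma pmf_bind_coin:
 fixes f :: "bool => 'a pmf"
 shows
 "pmf (bind_pmf (pmf_of_set UNIV) f) v = (\<Sum>b\<in>bits 1. (1/2) * pmf (f (hd b)) v)"
proof -
 have "pmf (bind_pmf (pmf_of_set UNIV) f) v = (\<Sum>b\<in>UNIV. pmf (pmf_of_set UNIV) b * pmf (f b) v)"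
  by (rule pmf_bind_finite) simp_all
 thus ?thesis unfolding bits_1 by (simp add: UNIV_bool pmf_of_set)
qed

lemma open_value:
 assumes psi: "psi : qspace n" "norm_sq n psi = 1"
  and R: "!!b k. length k = n_out E ==> pmf (map_pmf decision (run Rc (concat z @ k @ w))) (Some b)
   = (if hd k = b then vr (concat z) b (tl k) else 0)"
 shows "pmf (pmf_of_set UNIV \<bind> (%b. open_stage [act E] [act Rc] [b] (z, psi, ket w) \<bind>
  (%v. return_pmf (v = Some b)))) True = value_from m E vr [] (concat z) x n psi"
proof -
 have 1: "open_stage [act E] [act Rc] [b] (z, psi, ket w) =
   activate (act E) (concat z @ [b]) psi \<bind> (%(k, _). map_pmf decision (run Rc (concat z @ k @ w)))" for b
 proof -
  have "open_stage [act E] [act Rc] [b] (z, psi, ket w) =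
    activate (act E) (concat z @ [b]) psi \<bind> (%(k, _). map_pmf decision (map_pmf fst (activate (act Rc) (concat z @ k) (ket w))))"
   by (simp add: open_stage_def map_bind_pmf case_prod_unfold map_pmf_def[symmetric] map_pmf_comp bind_return_pmf bind_assoc_pmf)
  thus ?thesis unfolding fst_activate_ket run_def by simp
 qed
 have 2: "pmf (open_stage [act E] [act Rc] [b] (z, psi, ket w) \<bind> (%v. return_pmf (v = Some b))) True =
  (\<Sum>k\<in>bits (n_out E). norm_sq (n_anc E + length (concat z @ [b]) + n)
    (slice k (ap (gates E) (load (n_out E + n_anc E) (concat z @ [b]) psi))) *
   (if hd k = b then vr (concat z) b (tl k) else 0))" for b
 proof -
  have v: "(%v. v = Some b) -` {True} = {Some b}" by auto
  have "open_stage [act E] [act Rc] [b] (z, psi, ket w) \<bind> (%v. return_pmf (v = Some b)) =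
    activate (act E) (concat z @ [b]) psi \<bind> (%(k, _). map_pmf (%v. v = Some b) (map_pmf decision (run Rc (concat z @ k @ w))))"
   unfolding 1 by (simp add: bind_assoc_pmf case_prod_unfold map_pmf_def)
  moreover have "pmf (map_pmf (%v. v = Some b) p) True = pmf p (Some b)" for p
   unfolding pmf_map v by (simp add: pmf.rep_eq)
  ultimately show ?thesis
   using R by (simp only: pmf_activate_bind[OF psi refl] case_prod_conv) (intro sum.cong refl, simp)
 qed
 show ?thesis unfolding pmf_bind_coin 2 value_from.simps sum_distrib_left
 proof (intro sum.cong refl)
  fix b k :: "bool list" assume "b : bits 1"
  hence "[hd b] = b" by (cases b) auto
  thus "1/2 * (norm_sq (n_anc E + length (concat z @ [hd b]) + n)
    (slice k (ap (gates E) (load (n_out E + n_anc E) (concat z @ [hd b]) psi))) *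
   (if hd k = hd b then vr (concat z) (hd b) (tl k) else 0)) =
   1/2 * (if hd k = hd b then vr (concat z) (hd b) (tl k) else 0) *
   norm_sq (n_anc E + length (concat z @ b) + n) (slice k (ap (gates E) (load (n_out E + n_anc E) (concat z @ b) psi)))"
   by simp
 qed
qed

section \<open>Interactive hashing\<close>

text \<open>The inner product modulo 2.\<close>

fun dot :: "bool list => bool list => bool" where
 "dot (x # xs) (y # ys) = ((x & y) ~= dot xs ys)"
| "dot _ _ = False"

text \<open>Back substitution: every entry is determined by the later ones.\<close>

fun backsub :: "(nat => bool list => bool) => nat => bool list => bool list" where
 "backsub F 0 t = []"
| "backsub F (Suc n) t = backsub F n (F n t # t) @ [F n t]"

lemma length_backsub [simp]: "length (backsub F n t) = n"
 by (induction n arbitrary: t) simp_all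

lemma backsub_iff:
 "length u = n ==> (\<forall>i<n. (u @ t) ! i = F i (drop (Suc i) (u @ t))) <-> u = backsub F n t"
proof (induction n arbitrary: u t)
 case (Suc n)
 then obtain u' b where u: "u = u' @ [b]" "length u' = n"
  by (metis length_Suc_conv_rev)
 have "(\<forall>i<Suc n. (u @ t) ! i = F i (drop (Suc i) (u @ t))) <->
   b = F n t & (\<forall>i<n. (u' @ (b # t)) ! i = F i (drop (Suc i) (u' @ (b # t))))"
  using u(2) by (auto simp: u(1) less_Suc_eq nth_append)
 also have "... <-> b = F n t & u' = backsub F n (b # t)" using Suc.IH[OF u(2)] by blast
 also have "... <-> u = backsub F (Suc n) t" by (auto simp: u(1))
 finally show ?case .
qed simp

lemma sum_backsub:
 fixes q :: "bool list => real"
 shows "(\<Sum>u\<in>bits n. if \<forall>i<n. (u @ t) ! i = F i (drop (Suc i) (u @ t)) then q u else 0) = q (backsub F n t)"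
proof -
 have "(\<Sum>u\<in>bits n. if \<forall>i<n. (u @ t) ! i = F i (drop (Suc i) (u @ t)) then q u else 0) =
   (\<Sum>u\<in>bits n. if u = backsub F n t then q u else 0)"
 proof (rule sum.cong[OF refl])
  fix u assume "u : bits n"
  hence "length u = n" by simp
  thus "(if \<forall>i<n. (u @ t) ! i = F i (drop (Suc i) (u @ t)) then q u else 0) = (if u = backsub F n t then q u else 0)"
   by (simp only: backsub_iff)
 qed
 thus ?thesis by (simp add: sum.delta)
qed

text \<open>The entries of a record of blocks, each an answer bit followed by a challenge of m bits.\<close>

definition ans :: "nat => bool list => nat => bool" where
 "ans m t i = t ! (i * Suc m)"

definition chal :: "nat => bool list => nat => bool list" where
 "chal m t i = map (%j. t ! (i * Suc m + Suc j)) [0..<m]"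

text \<open>The puzzle that a record is consistent with if the committed bit is b.\<close>

definition solve :: "nat => bool list => bool => bool list" where
 "solve m t b = backsub (%i tl. (ans m t (Suc i) ~= dot (drop (Suc i) (chal m t i)) tl) ~= (Suc i = m & b)) m []"

text \<open>
 The wires of the coherent game. For round j: the challenge \<open>Vw j\<close> and its copy
 \<open>Vc j\<close> for the committer, the answer \<open>Cw j\<close>, the ancillas \<open>An
 j\<close>, and the coin for amplification. For the opening: the bit \<open>Bw\<close> to be opened,
 the bit \<open>OB\<close> and the key \<open>Out\<close> that the committer sends, ancillas
 \<open>OAn\<close>, and the copy \<open>Zc\<close> of the record. \<open>Scr\<close> and
 \<open>Par\<close> are scratch wires for reflections.
\<close>

datatype wire = Vw nat nat | Vc nat nat | Cw nat | An nat nat | Coin nat | Bw | OB | Out nat | OAn nat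
 | Zc nat | Scr nat | Par

abbreviation "round_wires m D j ==
 Vw j ` {..<m} Un Vc j ` {..<m} Un {Cw j, Coin j} Un An j ` {..<n_anc (D j)}"

text \<open>
 The game with a committer that runs \<open>D 0, ..., D m\<close> in the rounds and E in the
 opening, on W wires.
\<close>

locale sim =
 fixes m l W q :: nat and D :: "nat => circuit" and E :: circuit and pos :: "wire => nat"
  and wires :: "wire set"
 assumes m: "m > 0" and D: "!!j. j <= m ==> n_out (D j) = 1" and E: "n_out E = Suc l"
  and wires: "wires = (\<Union>j\<in>{..m}. round_wires m D j) Un
   {Bw, OB, Par} Un Out ` {..<l} Un OAn ` {..<n_anc E} Un Zc ` {..<Suc (Suc m * Suc m)} Un Scr ` {..<q}"
  and inj: "inj_on pos wires" and pos_less: "!!w. w : wires ==> pos w < W"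
begin

abbreviation P :: "wire list => nat list" where "P == map pos"
abbreviation Vl :: "nat => wire list" where "Vl j == map (Vw j) [0..<m]"
abbreviation Vcl :: "nat => wire list" where "Vcl j == map (Vc j) [0..<m]"
abbreviation Anl :: "nat => wire list" where "Anl j == map (An j) [0..<n_anc (D j)]"

text \<open>The record before round j, and the committer's private wires after round j.\<close>

definition zv :: "nat => wire list" where
 "zv j = concat (map (%i. Cw i # Vl i) [0..<j])"

fun pl :: "nat => wire list" where
 "pl 0 = Anl 0"
| "pl (Suc j) = Anl (Suc j) @ Vcl j @ pl j"

lemma mem_wires [simp]:
 "Vw i j : wires <-> i <= m & j < m" "Vc i j : wires <-> i <= m & j < m"
 "Cw i : wires <-> i <= m" "Coin i : wires <-> i <= m" "An i j : wires <-> i <= m & j < n_anc (D i)"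
 "Bw : wires" "OB : wires" "Par : wires" "Out j : wires <-> j < l" "OAn j : wires <-> j < n_anc E"
 "Zc j : wires <-> j < Suc (Suc m * Suc m)" "Scr j : wires <-> j < q"
 unfolding wires by (blast | simp only: Un_iff, blast)+

lemma zv_Suc: "zv (Suc j) = zv j @ Cw j # Vl j"
 by (simp add: zv_def)

lemma length_zv [simp]: "length (zv j) = j * Suc m"
 by (induction j) (simp_all add: zv_Suc zv_def[of 0])

lemma set_zv: "set (zv j) = (\<Union>i<j. insert (Cw i) (Vw i ` {..<m}))"
 by (auto simp: zv_def)

lemma set_pl: "set (pl j) = (\<Union>i\<le>j. An i ` {..<n_anc (D i)}) Un (\<Union>i<j. Vc i ` {..<m})"
proof (induction j)
 case (Suc j)
 have "set (Vcl j) = Vc j ` {..<m}" "set (Anl (Suc j)) = An (Suc j) ` {..<n_anc (D (Suc j))}"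
  by (simp_all add: atLeast0LessThan)
 thus ?case by (simp only: pl.simps set_append Suc.IH atMost_Suc lessThan_Suc UN_insert Un_ac)
qed (simp add: atLeast0LessThan)

lemma distinct_zv: "distinct (zv j)"
 by (induction j) (auto simp: zv_Suc set_zv zv_def[of 0] distinct_map inj_on_def)

lemma distinct_pl: "distinct (pl j)"
 by (induction j) (auto simp: set_pl distinct_map inj_on_def)

lemma pos_mem: "w : wires ==> S <= wires ==> pos w : pos ` S <-> w : S"
 by (rule inj_on_image_mem_iff[OF inj])

lemma pos_eq: "w : wires ==> v : wires ==> pos w = pos v <-> w = v"
 by (rule inj_on_eq_iff[OF inj])

lemma distinct_P: "distinct xs ==> set xs <= wires ==> distinct (P xs)"
 by (simp add: distinct_map inj_on_subset[OF inj])

lemma P_less: "set xs <= wires ==> set (P xs) <= {..<W}"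
 using pos_less by auto

text \<open>
 The gates of round j; below, \<open>op\<close> is the opening, \<open>Th j\<close> the state after
 round j and \<open>priv j t\<close> the committer's unnormalized private state if the record is t.
\<close>

fun st :: "nat => gate list" where
 "st 0 = stage W [] [] [] (P [Cw 0] @ P (Anl 0) @ [] @ []) (D 0)"
| "st (Suc j) = stage W (P (Vl j)) (P (Vl j)) (P (Vcl j)) (P [Cw (Suc j)] @ P (Anl (Suc j)) @ P (Vcl j) @ P (pl j)) (D (Suc j))"

abbreviation "Zl == map Zc [0..<Suc (Suc m * Suc m)]"

definition op :: "gate list" where
 "op = stage W (P (Vl m @ [Bw])) (P (zv (Suc m) @ [Bw])) (P Zl)
   (P (OB # map Out [0..<l]) @ P (map OAn [0..<n_anc E]) @ P Zl @ P (pl m)) E"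

fun Th :: "nat => qvec" where
 "Th 0 = ap (st 0) (ket (zeros W))"
| "Th (Suc j) = ap (st (Suc j)) (Th j)"

fun priv :: "nat => bool list => qvec" where
 "priv 0 = (%t. slice t (ap (gates (D 0)) (load (1 + n_anc (D 0)) [] empty_state)))"
| "priv (Suc j) = (%t. slice (drop (Suc j * Suc m) t) (ap (gates (D (Suc j)))
   (load (1 + n_anc (D (Suc j))) (drop (Suc (j * Suc m)) (take (Suc j * Suc m) t)) (priv j (take (Suc (j * Suc m)) t)))))"

lemma rep_Th:
 "j <= m ==> rep W (Th j) (P (zv j @ [Cw j])) (P (pl j)) (1 / rt2 ^ (j * m)) (priv j)"
proof (induction j)
 case 0
 have "rep W (ket (zeros W)) [] [] 1 (%_. empty_state)"
  unfolding rep_def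
 proof
  fix y :: "bool list"
  have "y = zeros W <-> length y = W & (\<forall>p<W. ~ y ! p)"
   by (auto simp: list_eq_iff_nth_eq)
  thus "ket (zeros W) y = (if length y = W & (\<forall>p<W. p ~: set [] Un set [] --> ~ y ! p)
    then 1 * empty_state (map ((!) y) []) else 0)"
   by (simp add: ket_def empty_state_def)
 qed
 moreover have "distinct (P ([Cw 0] @ Anl 0))" "set (P ([Cw 0] @ Anl 0)) <= {..<W}"
  by (intro distinct_P P_less; auto simp: distinct_map inj_on_def)+
 ultimately show ?case
  using stage_rep[of W "ket (zeros W)" "[]" "[]" 1 "%_. empty_state" "[]" "P [Cw 0]" "P (Anl 0)" "[]" "[]" 0 "D 0"]
  by (simp add: D zv_def)
next
 case (Suc j)
 let ?zw = "zv j @ [Cw j]" and ?ws = "(zv j @ [Cw j]) @ Vl j @ [Cw (Suc j)] @ Anl (Suc j) @ Vcl j @ pl j"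
 have sub: "set ?ws <= wires"
  using Suc.prems by (auto simp: set_zv set_pl)
 have dis: "distinct ?ws"
  by (auto simp: distinct_zv distinct_pl set_zv set_pl distinct_map inj_on_def)
 have "rep W (Th j) (P ?zw) (P (pl j)) (1 / rt2 ^ (j * m)) (priv j)"
  using Suc by simp
 from stage_rep[OF this, of "P (Vl j)" "P [Cw (Suc j)]" "P (Anl (Suc j))" "P (Vcl j)" "P (Vl j)" "Suc (j * Suc m)" "D (Suc j)"]
  distinct_P[OF dis sub] P_less[OF sub]
 have R: "rep W (ap (st (Suc j)) (Th j)) (P ?zw @ P (Vl j) @ P [Cw (Suc j)]) (P (Anl (Suc j)) @ P (Vcl j) @ P (pl j))
  (1 / rt2 ^ (j * m) / rt2 ^ length (P (Vl j)))
  (%t. slice (drop (length (P ?zw) + length (P (Vl j))) t) (ap (gates (D (Suc j))) (load (n_out (D (Suc j)) + n_anc (D (Suc j)))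
   (drop (Suc (j * Suc m)) (take (length (P ?zw) + length (P (Vl j))) t)) (priv j (take (length (P ?zw)) t)))))"
  using Suc.prems by (simp add: D)
 have e1: "Suc (j * Suc m) + length (P (Vl j)) = Suc j * Suc m" "length (P ?zw) = Suc (j * Suc m)" by simp_all
 have e2: "1 / rt2 ^ (j * m) / rt2 ^ length (P (Vl j)) =
   1 / rt2 ^ (Suc j * m)" by (simp add: power_add mult.commute)
 have e3: "P ?zw @ P (Vl j) @ P [Cw (Suc j)] = P (zv (Suc j) @ [Cw (Suc j)])" by (simp add: zv_Suc)
 show ?case using R[unfolded e1 e2 e3 D[OF Suc.prems]] by (simp only: Th.simps priv.simps pl.simps map_append)
qed

lemma rep_op:
 "rep W (ap op (Th m)) (P (zv (Suc m) @ [Bw] @ OB # map Out [0..<l])) (P (map OAn [0..<n_anc E] @ Zl @ pl m))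
  (1 / rt2 ^ Suc (Suc m * m))
  (%t. slice (drop (Suc (Suc m * Suc m)) t) (ap (gates E) (load (n_out E + n_anc E) (take (Suc (Suc m * Suc m)) t)
    (priv m (take (Suc (m * Suc m)) t)))))"
proof -
 let ?zw = "zv m @ [Cw m]"
 let ?ws = "?zw @ (Vl m @ [Bw]) @ (OB # map Out [0..<l]) @ map OAn [0..<n_anc E] @ Zl @ pl m"
 have sub: "set ?ws <= wires"
  by (auto simp: set_zv set_pl)
 have dis: "distinct ?ws"
  by (auto simp: distinct_zv distinct_pl set_zv set_pl distinct_map inj_on_def)
 have src: "P (zv (Suc m) @ [Bw]) = drop 0 (P ?zw @ P (Vl m @ [Bw]))" by (simp add: zv_Suc)
 have len: "length (P Zl) = length (P (zv (Suc m) @ [Bw]))" by simp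
 from stage_rep[OF rep_Th[OF order_refl] _ _ src len, where out = "P (OB # map Out [0..<l])" and
   anc = "P (map OAn [0..<n_anc E])" and D = E]
  distinct_P[OF dis sub] P_less[OF sub]
 have R: "rep W (ap op (Th m)) (P ?zw @ P (Vl m @ [Bw]) @ P (OB # map Out [0..<l])) (P (map OAn [0..<n_anc E]) @ P Zl @ P (pl m))
  (1 / rt2 ^ (m * m) / rt2 ^ length (P (Vl m @ [Bw])))
  (%t. slice (drop (length (P ?zw) + length (P (Vl m @ [Bw]))) t) (ap (gates E) (load (n_out E + n_anc E)
   (drop 0 (take (length (P ?zw) + length (P (Vl m @ [Bw]))) t)) (priv m (take (length (P ?zw)) t)))))"
  by (simp add: E op_def del: mult_Suc upt_Suc)
 have e1: "Suc (m * Suc m) + length (P (Vl m @ [Bw])) = Suc (Suc m * Suc m)" "length (P ?zw) = Suc (m * Suc m)" by simp_all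
 have e2: "1 / rt2 ^ (m * m) / rt2 ^ length (P (Vl m @ [Bw])) =
   1 / rt2 ^ Suc (Suc m * m)" by (simp add: power_add mult.commute)
 have e3: "P ?zw @ P (Vl m @ [Bw]) @ P (OB # map Out [0..<l]) = P (zv (Suc m) @ [Bw] @ OB # map Out [0..<l])"
  by (simp add: zv_Suc)
 show ?thesis using R[unfolded e1 e2 e3] by (simp only: map_append drop_0)
qed

end

context sim
begin

lemma priv_dim: "length (pl 0) = n_anc (D 0)" "length (pl (Suc j)) = n_anc (D (Suc j)) + m + length (pl j)"
 by simp_all

lemma value_from_step:
 assumes "j <= m"
 shows "value_from m E vr (map D [0..<Suc m]) [] [] 0 empty_state =
  (\<Sum>t\<in>bits (Suc (j * Suc m)). (1 / 2 ^ (j * m)) * (\<Sum>v\<in>bits m. (1 / 2 ^ m) *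
    value_from m E vr (map D [Suc j..<Suc m]) (t @ v) v (length (pl j)) (priv j t)))"
 using assms
proof (induction j)
 case 0
 have "map D [0..<Suc m] = D 0 # map D [Suc 0..<Suc m]" by (simp add: upt_conv_Cons del: upt_Suc)
 thus ?case by (simp add: D del: upt_Suc)
next
 case (Suc j)
 have Ds: "map D [Suc j..<Suc m] = D (Suc j) # map D [Suc (Suc j)..<Suc m]"
  using Suc.prems by (simp add: upt_conv_Cons del: upt_Suc)
 have n: "n_out (D (Suc j)) = 1" using D Suc.prems by simp
 let ?V = "%t. \<Sum>v'\<in>bits m. (1 / 2 ^ m) * value_from m E vr (map D [Suc (Suc j)..<Suc m]) (t @ v') v'
   (length (pl (Suc j))) (priv (Suc j) t)"
 have "(\<Sum>t\<in>bits (Suc (j * Suc m)). (1 / 2 ^ (j * m)) * (\<Sum>v\<in>bits m. (1 / 2 ^ m) *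
    value_from m E vr (map D [Suc j..<Suc m]) (t @ v) v (length (pl j)) (priv j t))) =
  (\<Sum>t\<in>bits (Suc (j * Suc m)). \<Sum>v\<in>bits m. \<Sum>c\<in>bits 1. (1 / 2 ^ (Suc j * m)) * ?V (t @ v @ c))"
 proof (rule sum.cong[OF refl])
  fix t assume "t : bits (Suc (j * Suc m))"
  hence t: "length t = Suc (j * Suc m)" by simp
  have "(1 / 2 ^ (j * m)) * ((1 / 2 ^ m) * value_from m E vr (map D [Suc j..<Suc m]) (t @ v) v (length (pl j)) (priv j t))
    = (\<Sum>c\<in>bits 1. (1 / 2 ^ (Suc j * m)) * ?V (t @ v @ c))" if v: "length v = m" for v
  proof -
   have "value_from m E vr (map D [Suc j..<Suc m]) (t @ v) v (length (pl j)) (priv j t) =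
    (\<Sum>c\<in>bits 1. \<Sum>v'\<in>bits m. (1 / 2 ^ m) * value_from m E vr (map D [Suc (Suc j)..<Suc m]) ((t @ v) @ c @ v') v'
     (n_anc (D (Suc j)) + length v + length (pl j))
     (slice c (ap (gates (D (Suc j))) (load (1 + n_anc (D (Suc j))) v (priv j t)))))"
    unfolding Ds value_from.simps n ..
   also have "... = (\<Sum>c\<in>bits 1. ?V (t @ v @ c))"
   proof (rule sum.cong[OF refl], rule sum.cong[OF refl])
    fix c v' :: "bool list"
    have "priv (Suc j) (t @ v @ c) = slice c (ap (gates (D (Suc j))) (load (1 + n_anc (D (Suc j))) v (priv j t)))"
     using t v by simp
    thus "(1 / 2 ^ m) * value_from m E vr (map D [Suc (Suc j)..<Suc m]) ((t @ v) @ c @ v') v'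
     (n_anc (D (Suc j)) + length v + length (pl j))
     (slice c (ap (gates (D (Suc j))) (load (1 + n_anc (D (Suc j))) v (priv j t)))) =
     (1 / 2 ^ m) * value_from m E vr (map D [Suc (Suc j)..<Suc m]) ((t @ v @ c) @ v') v'
      (length (pl (Suc j))) (priv (Suc j) (t @ v @ c))"
     using v by (simp only: priv_dim append_assoc)
   qed
   finally have e: "value_from m E vr (map D [Suc j..<Suc m]) (t @ v) v (length (pl j)) (priv j t) = (\<Sum>c\<in>bits 1. ?V (t @ v @ c))" .
   have p: "(1 / 2 ^ (j * m)) * ((1 / 2 ^ m) * x) = (1 / 2 ^ (Suc j * m)) * x" for x :: real
    by (simp add: power_add field_simps)
   show ?thesis unfolding p e sum_distrib_left[of "1 / 2 ^ (Suc j * m)"] ..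
  qed
  thus "(1 / 2 ^ (j * m)) * (\<Sum>v\<in>bits m. (1 / 2 ^ m) *
    value_from m E vr (map D [Suc j..<Suc m]) (t @ v) v (length (pl j)) (priv j t)) =
    (\<Sum>v\<in>bits m. \<Sum>c\<in>bits 1. (1 / 2 ^ (Suc j * m)) * ?V (t @ v @ c))"
   unfolding sum_distrib_left[of "1 / 2 ^ (j * m)"] by (intro sum.cong refl) simp
 qed
 also have "... = (\<Sum>t\<in>bits (Suc (j * Suc m) + (m + 1)). (1 / 2 ^ (Suc j * m)) * ?V t)"
  by (simp only: sum_bits_append)
 also have "Suc (j * Suc m) + (m + 1) = Suc (Suc j * Suc m)" by simp
 finally show ?case using Suc by simp
qed

lemma cmod_scale: "(cmod (1 / rt2 ^ n))\<^sup>2 = 1 / 2 ^ n"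
 by (simp add: norm_divide norm_power power_divide power_mult[symmetric] mult.commute[of n]) (simp add: power_mult)

abbreviation rec :: "bool list => bool list" where
 "rec y == map ((!) y) (P (zv (Suc m)))"
abbreviation key :: "bool list => bool list" where
 "key y == map ((!) y) (P (map Out [0..<l]))"

text \<open>The winning probability is the weight of the accepting outcomes in the coherent game.\<close>

lemma value_op:
 "value_from m E vr (map D [0..<Suc m]) [] [] 0 empty_state =
  (\<Sum>y\<in>bits W. (if y ! pos OB = y ! pos Bw then vr (rec y) (y ! pos Bw) (key y) else 0) * (cmod (ap op (Th m) y))\<^sup>2)"
proof -
 let ?L = "Suc m * Suc m" and ?zw = "P (zv (Suc m) @ [Bw] @ OB # map Out [0..<l])" and ?pw = "P (map OAn [0..<n_anc E] @ Zl @ pl m)"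
 let ?sl = "%t k. slice k (ap (gates E) (load (n_out E + n_anc E) t (priv m (take (Suc (m * Suc m)) t))))"
 let ?n = "n_anc E + Suc ?L + length (pl m)"
 let ?q = "%t. if hd (drop (Suc ?L) t) = t ! ?L then vr (take ?L t) (t ! ?L) (tl (drop (Suc ?L) t)) else 0"
 have "value_from m E vr (map D [0..<Suc m]) [] [] 0 empty_state =
  (\<Sum>t\<in>bits (Suc (m * Suc m)). (1 / 2 ^ (m * m)) * (\<Sum>v\<in>bits m. (1 / 2 ^ m) *
    value_from m E vr [] (t @ v) v (length (pl m)) (priv m t)))"
  using value_from_step[of m vr] by simp
 also have "... = (\<Sum>t\<in>bits (Suc (m * Suc m)). \<Sum>v\<in>bits m. \<Sum>b\<in>bits 1. \<Sum>k\<in>bits (Suc l).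
   ?q (((t @ v) @ b) @ k) * (1 / 2 ^ (Suc (Suc m * m)) * norm_sq ?n (?sl ((t @ v) @ b) k)))"
 proof (rule sum.cong[OF refl])
  fix t assume "t : bits (Suc (m * Suc m))"
  hence t: "length t = Suc (m * Suc m)" by simp
  have "(1 / 2 ^ (m * m)) * ((1 / 2 ^ m) * value_from m E vr [] (t @ v) v (length (pl m)) (priv m t)) =
   (\<Sum>b\<in>bits 1. \<Sum>k\<in>bits (Suc l).
   ?q (((t @ v) @ b) @ k) * (1 / 2 ^ (Suc (Suc m * m)) * norm_sq ?n (?sl ((t @ v) @ b) k)))" if "v : bits m" for v
   unfolding value_from.simps E sum_distrib_left
  proof (intro sum.cong refl)
   fix b k :: "bool list" assume "b : bits 1" "k : bits (Suc l)"
   then obtain \<beta> where b: "b = [\<beta>]" by (auto simp: length_Suc_conv)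
   have tv: "length (t @ v) = ?L" using t that by simp
   have n: "n_anc E + length ((t @ v) @ b) + length (pl m) = ?n" using tv b by simp
   have q: "?q (((t @ v) @ b) @ k) = (if hd k = hd b then vr (t @ v) (hd b) (tl k) else 0)"
   proof -
    have "drop (Suc ?L) (((t @ v) @ b) @ k) = k" "take ?L (((t @ v) @ b) @ k) = t @ v" "(((t @ v) @ b) @ k) ! ?L = \<beta>"
     using tv b by (simp_all add: nth_append del: mult_Suc append_assoc)
    thus ?thesis using b by (simp del: mult_Suc append_assoc)
   qed
   have tk: "take (Suc (m * Suc m)) ((t @ v) @ b) = t" using t by simp
   have "(2::real) ^ Suc (Suc m * m) = 2 * (2 ^ m * 2 ^ (m * m))" by (simp add: power_add)
   thus "1 / 2 ^ (m * m) * (1 / 2 ^ m * (1 / 2 * (if hd k = hd b then vr (t @ v) (hd b) (tl k) else 0) *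
     norm_sq (n_anc E + length ((t @ v) @ b) + length (pl m))
      (slice k (ap (gates E) (load (Suc l + n_anc E) ((t @ v) @ b) (priv m t)))))) =
    ?q (((t @ v) @ b) @ k) * (1 / 2 ^ Suc (Suc m * m) * norm_sq ?n (slice k (ap (gates E) (load (Suc l + n_anc E) ((t @ v) @ b)
      (priv m (take (Suc (m * Suc m)) ((t @ v) @ b)))))))"
    unfolding n q tk by (simp add: field_simps del: append_assoc)
  qed
  thus "(1 / 2 ^ (m * m)) * (\<Sum>v\<in>bits m. (1 / 2 ^ m) *
    value_from m E vr [] (t @ v) v (length (pl m)) (priv m t)) = (\<Sum>v\<in>bits m. \<Sum>b\<in>bits 1. \<Sum>k\<in>bits (Suc l).
   ?q (((t @ v) @ b) @ k) * (1 / 2 ^ (Suc (Suc m * m)) * norm_sq ?n (?sl ((t @ v) @ b) k)))"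
   unfolding sum_distrib_left[of "1 / 2 ^ (m * m)"] by (intro sum.cong refl) simp
 qed
 also have "... = (\<Sum>t\<in>bits (((Suc (m * Suc m) + m) + 1) + Suc l).
   ?q t * (1 / 2 ^ (Suc (Suc m * m)) * norm_sq ?n (?sl (take (Suc ?L) t) (drop (Suc ?L) t))))"
  unfolding sum_bits_append by (intro sum.cong refl) simp
 also have "((Suc (m * Suc m) + m) + 1) + Suc l = length ?zw" by simp
 also have "(\<Sum>t\<in>bits (length ?zw). ?q t * (1 / 2 ^ (Suc (Suc m * m)) * norm_sq ?n (?sl (take (Suc ?L) t) (drop (Suc ?L) t)))) =
  (\<Sum>t\<in>bits (length ?zw). ?q t * ((cmod (1 / rt2 ^ Suc (Suc m * m)))\<^sup>2 *
    norm_sq (length ?pw) (?sl (take (Suc ?L) t) (drop (Suc ?L) t))))"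
 proof -
  have "length ?pw = ?n" by simp
  thus ?thesis unfolding cmod_scale by (simp only:)
 qed
 also have "... = (\<Sum>y\<in>bits W. ?q (map ((!) y) ?zw) * (cmod (ap op (Th m) y))\<^sup>2)"
 proof (rule rep_sum[symmetric])
  have "?sl (take (Suc ?L) t) (drop (Suc ?L) t) = slice (drop (Suc ?L) t) (ap (gates E) (load (n_out E + n_anc E)
    (take (Suc ?L) t) (priv m (take (Suc (m * Suc m)) t))))" for t
   by (simp add: min_def)
  thus "rep W (ap op (Th m)) ?zw ?pw (1 / rt2 ^ Suc (Suc m * m))
    (%t. ?sl (take (Suc ?L) t) (drop (Suc ?L) t))"
   using rep_op by (simp only:)
  let ?ws = "(zv (Suc m) @ [Bw] @ OB # map Out [0..<l]) @ (map OAn [0..<n_anc E] @ Zl @ pl m)"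
  have sub: "set ?ws <= wires" by (auto simp: set_zv set_pl)
  have dis: "distinct ?ws" by (auto simp: distinct_zv distinct_pl set_zv set_pl distinct_map inj_on_def)
  show "distinct (?zw @ ?pw)" "set (?zw @ ?pw) <= {..<W}"
   using distinct_P[OF dis sub] P_less[OF sub] unfolding map_append by simp_all
 qed
 also have "... = (\<Sum>y\<in>bits W. (if y ! pos OB = y ! pos Bw then vr (rec y) (y ! pos Bw) (key y) else 0) * (cmod (ap op (Th m) y))\<^sup>2)"
 proof (intro sum.cong refl)
  fix y
  have z: "map ((!) y) ?zw = rec y @ [y ! pos Bw] @ (y ! pos OB) # key y" by simp
  have "length (rec y) = ?L" by simp
  hence "take ?L (map ((!) y) ?zw) = rec y" "map ((!) y) ?zw ! ?L = y ! pos Bw"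
   "drop (Suc ?L) (map ((!) y) ?zw) = (y ! pos OB) # key y"
   unfolding z by (simp_all only: take_append nth_append drop_append) simp_all
  thus "?q (map ((!) y) ?zw) * (cmod (ap op (Th m) y))\<^sup>2 =
    (if y ! pos OB = y ! pos Bw then vr (rec y) (y ! pos Bw) (key y) else 0) * (cmod (ap op (Th m) y))\<^sup>2"
   by (simp only: list.sel)
 qed
 finally show ?thesis .
qed

end

lemma targets_stage: "targets (stage W hs src dst ws C) <= set hs Un set dst Un set ws Un {W..}"
proof -
 have "targets (cg (map2 (%a t. XG [a] t) src dst)) <= set dst"
  by (auto dest: set_zip_rightD)
 moreover have "targets (map (rn (wmap W ws)) (gates C)) <= set ws Un {W..}"
  unfolding targets_rn by (auto simp: wmap_def)
 moreover have "targets (map Hadamard hs) = set hs" by auto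
 ultimately show ?thesis unfolding stage_def set_append image_Un Union_Un_distrib by blast
qed

lemma proj_good:
 assumes "!!i x b. i : targets gs ==> Q (x[i := b]) = Q x"
 shows "proj Q (good gs G psi) = good gs G (proj Q psi)"
 by (simp only: good_def ap_proj[where Q = Q, OF assms] proj_commute[of Q G])

lemma proj_dev:
 assumes "!!i x b. i : targets gs ==> Q (x[i := b]) = Q x"
 shows "proj Q (dev gs Z G psi) = dev gs Z G (proj Q psi)"
proof -
 have "ap (inv_gates gs) (proj Q phi) = proj Q (ap (inv_gates gs) phi)" for phi
  by (rule ap_proj) (simp add: assms)
 hence "proj Q (compr gs Z G phi) = compr gs Z G (proj Q phi)" for phi
  by (simp only: compr_def ap_proj[where Q = Q, OF assms] proj_commute[of Q Z] proj_commute[of G Q])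
 thus ?thesis by (simp only: dev_def proj_lin)
qed

lemma dev_alt:
 assumes "proj Z psi = psi"
 shows "dev gs Z G psi = proj Z (ap (inv_gates gs) (%x. (if G x then 1 else -1) * ap gs psi x))"
proof -
 have "(%x. (if G x then 1 else -1) * ap gs psi x) = lc 2 (proj G (ap gs psi)) (-1) (ap gs psi)"
  by (auto simp: proj_def fun_eq_iff)
 hence "ap (inv_gates gs) (%x. (if G x then 1 else -1) * ap gs psi x) =
   lc 2 (ap (inv_gates gs) (proj G (ap gs psi))) (-1) psi"
  by (simp only: ap_lin inv_gates_right)
 thus ?thesis by (simp only: proj_lin assms dev_def compr_def)
qed

text \<open>Flips the wires in a list that are selected by a bit string.\<close>

fun flips :: "nat list => bool list => bool list => bool list" where
 "flips (u # us) (b # t) x = flips us t (if b then flip u x else x)"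
| "flips _ _ x = x"

lemma length_flips [simp]: "length (flips us t x) = length x"
 by (induction us t x rule: flips.induct) simp_all

lemma flips_nth_other: "p ~: set us ==> flips us t x ! p = x ! p"
 by (induction us t x rule: flips.induct) auto

lemma flips_nth:
 "distinct us ==> set us <= {..<length x} ==> length us = length t ==> i < length us ==>
  flips us t x ! (us ! i) <-> x ! (us ! i) ~= t ! i"
proof (induction us t x arbitrary: i rule: flips.induct)
 case (1 u us b t x)
 let ?x = "if b then flip u x else x"
 show ?case
 proof (cases i)
  case 0
  thus ?thesis using 1 flips_nth_other[of u us t ?x] by auto
 next
  case (Suc k)
  hence "us ! k : set us" using 1 by simp
  hence "us ! k ~= u" using 1 by auto
  hence "?x ! (us ! k) = x ! (us ! k)" by simp
  moreover have "flips us t ?x ! (us ! k) <-> ?x ! (us ! k) ~= t ! k"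
   using 1 Suc by (intro "1.IH") auto
  ultimately show ?thesis using Suc by simp
 qed
qed simp_all

lemma ap_H_dot:
 assumes "distinct ws" "distinct us" "set us <= set ws" "set ws <= {..<length x}" "length us = length t"
 shows "ap (map Hadamard ws) (%y. (if dot (map ((!) y) us) t then -1 else 1) * psi y) x =
  ap (map Hadamard ws) psi (flips us t x)"
 using assms(5,2-4)
proof (induction us t arbitrary: x rule: list_induct2)
 case (Cons u us b t)
 let ?e = "%y. if dot (map ((!) y) us) t then -1 else 1 :: complex"
 have e: "(%y. (if dot (map ((!) y) (u # us)) (b # t) then -1 else 1) * psi y) =
   (%y. (if b & y ! u then -1 else 1) * (?e y * psi y))" by (auto simp: fun_eq_iff)
 have u: "u : set ws" "u < length x" using Cons.prems by auto
 have "ap (map Hadamard ws) (%y. (if b & y ! u then -1 else 1) * (?e y * psi y)) x =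
   ap (map Hadamard ws) (%y. ?e y * psi y) (if b then flip u x else x)"
  using ap_H_sign[OF assms(1) u, of "%y. ?e y * psi y"] by (cases b) (simp_all del: fold_map)
 also have "... = ap (map Hadamard ws) psi (flips us t (if b then flip u x else x))"
  using Cons.prems by (intro Cons.IH) auto
 finally show ?case by (simp only: e flips.simps)
qed simp

text \<open>Different flips of a state give orthogonal components where the wires are 0.\<close>

lemma sum_flips_le:
 assumes us: "distinct us" "set us <= {..<W}" and Z: "!!x u. Z x ==> u : set us ==> ~ x ! u"
 shows "(\<Sum>t\<in>bits (length us). norm_sq W (proj Z (%x. psi (flips us t x)))) <= norm_sq W psi"
proof -
 let ?S = "bits (length us) \<times> {x : bits W. Z x}"
 let ?f = "%(t, x). flips us t x"
 have inj: "inj_on ?f ?S"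
 proof (rule inj_onI)
  fix a b assume "a : ?S" "b : ?S" "?f a = ?f b"
  then obtain t x t' x' where ab: "a = (t, x)" "b = (t', x')" "length t = length us" "length t' = length us"
   "length x = W" "length x' = W" "Z x" "Z x'" and eq: "flips us t x = flips us t' x'" by (cases a; cases b) auto
  have n: "t ! i = t' ! i" if "i < length us" for i
  proof -
   have "~ x ! (us ! i)" "~ x' ! (us ! i)" using Z[OF ab(7), of "us ! i"] Z[OF ab(8), of "us ! i"] that by auto
   thus ?thesis using flips_nth[of us x t i] flips_nth[of us x' t' i] us ab eq that by auto
  qed
  hence "t = t'" using ab by (intro nth_equalityI) auto
  moreover have "x = x'"
  proof (rule nth_equalityI)
   fix p show "x ! p = x' ! p"
    using flips_nth_other[of p us t x] flips_nth_other[of p us t' x'] eq Z[OF ab(7), of p] Z[OF ab(8), of p] by auto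
  qed (use ab in simp)
  ultimately show "a = b" using ab by simp
 qed
 have "(\<Sum>t\<in>bits (length us). norm_sq W (proj Z (%x. psi (flips us t x)))) =
   (\<Sum>t\<in>bits (length us). \<Sum>x\<in>{x : bits W. Z x}. (cmod (psi (flips us t x)))\<^sup>2)"
  unfolding norm_sq_def
  by (intro sum.cong[OF refl] sum.mono_neutral_cong_right) (auto simp: proj_def)
 also have "... = (\<Sum>a\<in>?S. (cmod (psi (?f a)))\<^sup>2)"
  by (subst sum.cartesian_product) (simp add: case_prod_unfold)
 also have "... = (\<Sum>y\<in>?f ` ?S. (cmod (psi y))\<^sup>2)" by (subst sum.reindex[OF inj]) simp
 also have "... <= norm_sq W psi" unfolding norm_sq_def by (rule sum_mono2) auto
 finally show ?thesis .
qed

context sim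
begin

text \<open>The answer to the challenge of round j is consistent with s.\<close>

definition hash_ok :: "bool list => nat => bool list => bool" where
 "hash_ok s j x <-> x ! pos (Cw (Suc j)) = (s ! j ~= dot (map ((!) x) (drop (Suc j) (P (Vl j)))) (drop (Suc j) s))"

text \<open>The wires that are 0 before \<open>st (Suc j)\<close>.\<close>

abbreviation fresh :: "nat => wire set" where
 "fresh j == set (Vl j @ Vcl j @ [Cw (Suc j)] @ Anl (Suc j))"

definition freshp :: "nat => nat set" where
 "freshp j = pos ` fresh j"

lemmas [simp del] = st.simps Th.simps

lemma targets_st: "targets (st (Suc j)) <= pos ` (fresh j Un set (pl j)) Un {W..}"
 using targets_stage[of W "P (Vl j)" "P (Vl j)" "P (Vcl j)"
  "P [Cw (Suc j)] @ P (Anl (Suc j)) @ P (Vcl j) @ P (pl j)" "D (Suc j)"]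
 unfolding st.simps by (rule order_trans) auto

lemma not_target:
 assumes "i : targets (st (Suc j))" "j < m" "w : wires" "w ~: fresh j Un set (pl j)"
 shows "i ~= pos w"
proof
 assume i: "i = pos w"
 have "i < W" using pos_less assms(3) i by simp
 hence "pos w : pos ` (fresh j Un set (pl j))" using targets_st[of j] assms(1) i by auto
 moreover have "fresh j Un set (pl j) <= wires" using assms(2) by (auto simp: set_pl)
 ultimately show False using pos_mem[OF assms(3)] assms(4) by blast
qed

lemma hash_ok_update:
 assumes "!!w. w : insert (Cw (Suc i)) (set (Vl i)) ==> p ~= pos w"
 shows "hash_ok s i (x[p := b]) = hash_ok s i x"
proof -
 have "map ((!) (x[p := b])) (drop (Suc i) (P (Vl i))) = map ((!) x) (drop (Suc i) (P (Vl i)))"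
 proof (rule map_cong[OF refl])
  fix u assume "u : set (drop (Suc i) (P (Vl i)))"
  hence "u : set (P (Vl i))" by (rule in_set_dropD)
  then obtain w where "w : set (Vl i)" "u = pos w" by auto
  thus "x[p := b] ! u = x ! u" using assms by simp
 qed
 moreover have "x[p := b] ! pos (Cw (Suc i)) = x ! pos (Cw (Suc i))" using assms by simp
 ultimately show ?thesis by (simp only: hash_ok_def)
qed

lemma Th_nonzero:
 assumes "Th 0 x ~= 0" "w : wires" "w ~: insert (Cw 0) (set (Anl 0))"
 shows "~ x ! pos w" "length x = W"
proof -
 have r: "rep W (Th 0) (P [Cw 0]) (P (pl 0)) (1 / rt2 ^ (0 * m)) (priv 0)"
  using rep_Th[of 0] by (simp add: zv_def)
 hence x: "length x = W & (\<forall>p<W. p ~: set (P [Cw 0]) Un set (P (pl 0)) --> ~ x ! p)"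
  using assms(1) unfolding rep_def by (metis (no_types, lifting))
 thus "length x = W" by simp
 have "insert (Cw 0) (set (Anl 0)) <= wires" by auto
 hence "pos w ~: pos ` insert (Cw 0) (set (Anl 0))" using pos_mem assms by blast
 moreover have "set (P [Cw 0]) Un set (P (pl 0)) = pos ` insert (Cw 0) (set (Anl 0))" by auto
 ultimately show "~ x ! pos w" using x pos_less[OF assms(2)] by (simp only: ) blast
qed

sublocale lv: levels W "m - 1" "%j. st (Suc j)" freshp "%j. pos (Coin j)" hash_ok "bits m" "Th 0"
proof
 fix j x assume "j < m - 1" and x: "Th 0 x ~= 0"
 hence j: "j < m" by simp
 have "~ x ! pos w" if "w : fresh j" for w
  by (rule Th_nonzero(1)[OF x]) (use that j in auto)
 moreover have "~ x ! pos (Coin j)" "length x = W" using Th_nonzero[OF x, of "Coin j"] j by auto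
 ultimately show "(\<forall>w\<in>freshp j. ~ x ! w) & pos (Coin j) < length x & ~ x ! pos (Coin j)"
  using pos_less[of "Coin j"] j by (auto simp: freshp_def)
next
 fix i j :: nat assume "i < j" "j < m - 1"
 hence ij: "i < m" "j < m" "i < j" by simp_all
 show "targets (st (Suc i)) \<inter> freshp j = {}"
 proof (rule equals0I)
  fix p assume "p : targets (st (Suc i)) \<inter> freshp j"
  then obtain w where w: "w : fresh j" "p = pos w" "p : targets (st (Suc i))"
   by (auto simp: freshp_def)
  have "w : wires" "w ~: fresh i Un set (pl i)" using w(1) ij by (auto simp: set_pl)
  thus False using not_target[OF w(3) ij(1)] w(2) by blast
 qed
next
 fix i j :: nat assume "i < m - 1" "j < m - 1"
 hence ij: "i < m" "j < m" by simp_all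
 show "pos (Coin i) ~: targets (st (Suc j))"
 proof
  assume "pos (Coin i) : targets (st (Suc j))"
  thus False using not_target[of "pos (Coin i)" j "Coin i"] ij by (auto simp: set_pl)
 qed
 show "pos (Coin i) ~: freshp j"
  unfolding freshp_def by (subst pos_mem) (use ij in auto)
next
 show "inj_on (%j. pos (Coin j)) {..<m - 1}"
  by (rule inj_onI) (use pos_eq in auto)
next
 fix s x b i j w assume "i < j" "j < m - 1" and w: "w : targets (st (Suc j))"
 hence ij: "i < m" "j < m" "i < j" by simp_all
 show "hash_ok s i (x[w := b]) = hash_ok s i x"
 proof (rule hash_ok_update)
  fix v assume "v : insert (Cw (Suc i)) (set (Vl i))"
  thus "w ~= pos v" using ij by (intro not_target[OF w ij(2)]) (auto simp: set_pl)
 qed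
next
 fix s x b i j assume "i < m - 1" "j < m - 1"
 hence ij: "i < m" "j < m" by simp_all
 show "hash_ok s i (x[pos (Coin j) := b]) = hash_ok s i x"
 proof (rule hash_ok_update)
  fix v assume "v : insert (Cw (Suc i)) (set (Vl i))"
  thus "pos (Coin j) ~= pos v" using ij by (subst pos_eq) auto
 qed
qed simp

definition cons :: "bool list => nat => bool list => bool" where
 "cons s j x <-> (\<forall>i<j. hash_ok s i x)"

lemma cons_update:
 assumes "j <= n" "n < m" "w : targets (st (Suc n))"
 shows "cons s j (x[w := b]) = cons s j x"
proof -
 have "hash_ok s i (x[w := b]) = hash_ok s i x" if "i < j" for i
 proof (rule hash_ok_update)
  fix v assume "v : insert (Cw (Suc i)) (set (Vl i))"
  thus "w ~= pos v" using that assms by (intro not_target[OF assms(3,2)]) (auto simp: set_pl)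
 qed
 thus ?thesis by (simp add: cons_def)
qed

lemma ideal_eq: "j <= m - 1 ==> lv.ideal s j = proj (cons s j) (Th j)"
proof (induction j)
 case 0
 have "cons s 0 = (%_. True)" by (simp add: cons_def fun_eq_iff)
 thus ?case by (simp add: proj_def)
next
 case (Suc j)
 have r: "replicate (Suc j) (0 :: real) = replicate j 0 @ [0]" by (simp add: replicate_append_same)
 have "lv.ideal s (Suc j) = good (st (Suc j)) (hash_ok s j) (lv.ideal s j)"
  unfolding r lv.levs_append by (simp add: damped_0)
 also have "... = good (st (Suc j)) (hash_ok s j) (proj (cons s j) (Th j))" using Suc by simp
 also have "... = proj (cons s j) (good (st (Suc j)) (hash_ok s j) (Th j))"
  by (rule proj_good[symmetric]) (use Suc.prems in \<open>intro cons_update; simp\<close>)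
 also have "... = proj (cons s (Suc j)) (Th (Suc j))"
  by (auto simp: good_def proj_def cons_def less_Suc_eq fun_eq_iff Th.simps(2))
 finally show ?case .
qed

lemma norm_Th: "norm_sq W (Th j) = 1"
 using ket_state(2)[of "zeros W"] by (induction j) (simp_all only: Th.simps norm_ap length_replicate)

lemma Z_Th: "j < m - 1 ==> proj (lv.Z j) (Th j) = Th j"
proof (rule proj_eqI)
 fix x assume j: "j < m - 1" and x: "Th j x ~= 0"
 have "j <= m" using j by simp
 from rep_Th[OF this] x have c: "\<forall>p<W. p ~: set (P (zv j @ [Cw j])) Un set (P (pl j)) --> ~ x ! p"
  unfolding rep_def by (metis (no_types, lifting))
 have "~ x ! pos w" if w: "w : fresh j" for w
 proof -
  let ?S = "set (zv j @ [Cw j]) Un set (pl j)"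
  have "w : wires" "?S <= wires" "w ~: ?S" using w j by (auto simp: set_pl set_zv)
  hence "pos w ~: pos ` ?S" "pos w < W" using pos_mem pos_less by blast+
  thus ?thesis using c by (auto simp: image_Un)
 qed
 thus "lv.Z j x" unfolding lv.Z_def freshp_def by blast
qed

text \<open>
 The deviation from probability 1/2 is a sign that depends on the tail of s beyond j through its
 inner product with the challenge; before the Hadamard gates this is a flip of challenge wires. The
 entries of s up to j are determined by the answers, so the sum over s is one over tails.
\<close>

lemma bessel:
 assumes j: "j < m - 1"
 shows "(\<Sum>s\<in>bits m. norm_sq W (good (st (Suc j)) (hash_ok s j) (dev (st (Suc j)) (lv.Z j) (hash_ok s j) (lv.ideal s j)))) <= 1"
proof -
 let ?A = "st (Suc j)" and ?vs = "P (Vl j)" and ?us = "drop (Suc j) (P (Vl j))" and ?c = "pos (Cw (Suc j))"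
 let ?B = "cg (map2 (%a t. XG [a] t) ?vs (P (Vcl j))) @
  map (rn (wmap W (P [Cw (Suc j)] @ P (Anl (Suc j)) @ P (Vcl j) @ P (pl j)))) (gates (D (Suc j)))"
 let ?e = "%t x. if dot (map ((!) x) ?us) t then -1 else 1 :: complex"
 let ?z = "%x :: bool list. if x ! ?c then -1 else 1 :: complex"
 have A: "?A = map Hadamard ?vs @ ?B" by (simp add: st.simps stage_def)
 have jm: "j < m" using j by simp
 have vs: "distinct ?vs" "set ?vs <= {..<W}"
  by (intro distinct_P P_less; use jm in \<open>auto simp: distinct_map inj_on_def\<close>)+
 have lus: "length ?us = m - Suc j" by simp
 have us: "distinct ?us" "set ?us <= set ?vs" "set ?us <= {..<W}"
  using vs set_drop_subset[of "Suc j" ?vs] by auto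
 have B_us: "i ~: set ?vs" if "i : targets ?B" for i
 proof
  assume "i : set ?vs"
  then obtain w where w: "w : set (Vl j)" "i = pos w" by auto
  hence iW: "i < W" "w : wires" using pos_less jm by auto
  let ?ws = "P [Cw (Suc j)] @ P (Anl (Suc j)) @ P (Vcl j) @ P (pl j)"
  define S where "S = set (Cw (Suc j) # Anl (Suc j) @ Vcl j @ pl j)"
  have "?B = stage W [] ?vs (P (Vcl j)) ?ws (D (Suc j))" by (simp add: stage_def)
  hence "i : set [] Un set (P (Vcl j)) Un set ?ws Un {W..}"
   using that targets_stage[of W "[]" ?vs "P (Vcl j)" ?ws "D (Suc j)"] by (simp only:) blast
  moreover have "set [] Un set (P (Vcl j)) Un set ?ws = pos ` S" by (auto simp: S_def)
  ultimately have "i : pos ` S" using iW(1) by (simp only: Un_iff atLeast_iff) linarith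
  moreover have "S <= wires" "w ~: S" using jm w by (auto simp: set_pl S_def)
  ultimately show False using pos_mem[OF iW(2), of S] w(2) by simp
 qed
 have inv: "ap (inv_gates ?A) phi = ap (map Hadamard (rev ?vs)) (ap (inv_gates ?B) phi)" for phi
 proof -
  have h: "inv_gates (map Hadamard ws) = map Hadamard (rev ws)" for ws
   by (induction ws) (simp_all add: inv_gates_def)
  have "inv_gates (xs @ ys) = inv_gates ys @ inv_gates xs" for xs ys by (simp add: inv_gates_def)
  thus ?thesis unfolding A by (simp only: h fold_append o_apply)
 qed
 define \<xi> where "\<xi> = ap (inv_gates ?B) (%x. ?z x * ap ?A (Th j) x)"
 define \<eta> where "\<eta> t = proj (lv.Z j) (%x. if length x = W then ap (map Hadamard (rev ?vs)) \<xi> (flips ?us t x) else 0)" for t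
 have n\<xi>: "norm_sq W (ap (map Hadamard (rev ?vs)) \<xi>) = 1"
 proof -
  have "norm_sq W (%x. ?z x * ap ?A (Th j) x) = norm_sq W (ap ?A (Th j))"
   unfolding norm_sq_def by (intro sum.cong refl) (simp add: norm_mult)
  thus ?thesis by (simp only: \<xi>_def norm_ap norm_Th)
 qed
 have dev: "dev ?A (lv.Z j) (hash_ok s j) (Th j) x = (if s ! j then -1 else 1) * \<eta> (drop (Suc j) s) x"
  if s: "length s = m" and x: "length x = W" for s x
 proof -
  let ?t = "drop (Suc j) s" and ?s = "if s ! j then -1 else 1 :: complex"
  have sg: "(%x. (if hash_ok s j x then 1 else -1) * ap ?A (Th j) x) = (%x. ?s * (?e ?t x * (?z x * ap ?A (Th j) x)))"
   by (auto simp: hash_ok_def fun_eq_iff)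
  have d: "ap (inv_gates ?B) (%x. ?e ?t x * (?z x * ap ?A (Th j) x)) = (%x. ?e ?t x * \<xi> x)"
   unfolding \<xi>_def
  proof (rule ap_diag)
   fix i b and x :: "bool list" assume "i : targets (inv_gates ?B)"
   hence "i ~: set ?us" using B_us us(2) unfolding targets_inv by blast
   hence "map ((!) (x[i := b])) ?us = map ((!) x) ?us" by (intro map_cong refl nth_list_update_neq) auto
   thus "?e ?t (x[i := b]) = ?e ?t x" by (simp only:)
  qed
  have "dev ?A (lv.Z j) (hash_ok s j) (Th j) = proj (lv.Z j) (%x. ?s * ap (map Hadamard (rev ?vs)) (%x. ?e ?t x * \<xi> x) x)"
   unfolding dev_alt[OF Z_Th[OF j]] sg ap_scale inv d ..
  moreover have "ap (map Hadamard (rev ?vs)) (%x. ?e ?t x * \<xi> x) x = ap (map Hadamard (rev ?vs)) \<xi> (flips ?us ?t x)"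
   using vs us s x by (intro ap_H_dot) auto
  ultimately show ?thesis using x by (simp add: \<eta>_def proj_def)
 qed
 have term_eq: "norm_sq W (good ?A (hash_ok s j) (dev ?A (lv.Z j) (hash_ok s j) (lv.ideal s j))) =
   (\<Sum>x\<in>bits W. if cons s (Suc j) x then (cmod (ap ?A (\<eta> (drop (Suc j) s)) x))\<^sup>2 else 0)" if s: "length s = m" for s
 proof -
  have "good ?A (hash_ok s j) (dev ?A (lv.Z j) (hash_ok s j) (lv.ideal s j)) =
    proj (cons s j) (good ?A (hash_ok s j) (dev ?A (lv.Z j) (hash_ok s j) (Th j)))"
   using j by (simp only: ideal_eq[of j s] less_imp_le proj_good[where Q = "cons s j", OF cons_update[OF order_refl jm]]
     proj_dev[where Q = "cons s j", OF cons_update[OF order_refl jm]])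
  also have "... = proj (cons s (Suc j)) (ap ?A (dev ?A (lv.Z j) (hash_ok s j) (Th j)))"
   by (auto simp: good_def proj_conj cons_def less_Suc_eq proj_def fun_eq_iff)
  finally have e: "good ?A (hash_ok s j) (dev ?A (lv.Z j) (hash_ok s j) (lv.ideal s j)) =
   proj (cons s (Suc j)) (ap ?A (dev ?A (lv.Z j) (hash_ok s j) (Th j)))" .
  have "ap ?A (dev ?A (lv.Z j) (hash_ok s j) (Th j)) x = (if s ! j then -1 else 1) * ap ?A (\<eta> (drop (Suc j) s)) x"
   if "length x = W" for x
  proof -
   have "ap ?A (dev ?A (lv.Z j) (hash_ok s j) (Th j)) x = ap ?A (%x. (if s ! j then -1 else 1) * \<eta> (drop (Suc j) s) x) x"
    by (rule ap_cong[of W]) (use dev[OF s] that in simp_all)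
   thus ?thesis by (simp only: ap_scale)
  qed
  thus ?thesis unfolding e norm_sq_def by (intro sum.cong refl) (auto simp: proj_def norm_mult)
 qed
 have "(\<Sum>s\<in>bits m. norm_sq W (good ?A (hash_ok s j) (dev ?A (lv.Z j) (hash_ok s j) (lv.ideal s j)))) =
   (\<Sum>s\<in>bits (Suc j + (m - Suc j)). \<Sum>x\<in>bits W. if cons s (Suc j) x then (cmod (ap ?A (\<eta> (drop (Suc j) s)) x))\<^sup>2 else 0)"
  using jm term_eq by (intro sum.cong) auto
 also have "... = (\<Sum>x\<in>bits W. \<Sum>t\<in>bits (m - Suc j). \<Sum>u\<in>bits (Suc j).
   if cons (u @ t) (Suc j) x then (cmod (ap ?A (\<eta> (drop (Suc j) (u @ t))) x))\<^sup>2 else 0)"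
  unfolding sum_bits_append by (subst sum.swap, subst sum.swap, rule sum.cong[OF refl], subst sum.swap) (rule refl)
 \<comment> \<open>exactly one choice of the first entries is consistent with the answers\<close>
 also have "... = (\<Sum>x\<in>bits W. \<Sum>t\<in>bits (m - Suc j). (cmod (ap ?A (\<eta> t) x))\<^sup>2)"
 proof (intro sum.cong refl)
  fix x t :: "bool list"
  let ?F = "%i tl. x ! pos (Cw (Suc i)) ~= dot (map ((!) x) (drop (Suc i) (P (Vl i)))) tl"
  have "cons (u @ t) (Suc j) x <-> (\<forall>i<Suc j. (u @ t) ! i = ?F i (drop (Suc i) (u @ t)))" for u
   unfolding cons_def hash_ok_def by blast
  hence "(\<Sum>u\<in>bits (Suc j). if cons (u @ t) (Suc j) x then (cmod (ap ?A (\<eta> (drop (Suc j) (u @ t))) x))\<^sup>2 else 0) =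
   (\<Sum>u\<in>bits (Suc j). if \<forall>i<Suc j. (u @ t) ! i = ?F i (drop (Suc i) (u @ t)) then (cmod (ap ?A (\<eta> t) x))\<^sup>2 else 0)"
   by (intro sum.cong refl) auto
  thus "(\<Sum>u\<in>bits (Suc j). if cons (u @ t) (Suc j) x then (cmod (ap ?A (\<eta> (drop (Suc j) (u @ t))) x))\<^sup>2 else 0) =
   (cmod (ap ?A (\<eta> t) x))\<^sup>2"
   using sum_backsub[where F = ?F and q = "%_. (cmod (ap ?A (\<eta> t) x))\<^sup>2" and n = "Suc j" and t = t] by (rule trans)
 qed
 also have "... = (\<Sum>t\<in>bits (m - Suc j). norm_sq W (\<eta> t))"
  by (subst sum.swap) (simp only: norm_sq_def[symmetric] norm_ap)
 also have "... = (\<Sum>t\<in>bits (length ?us). norm_sq W (proj (lv.Z j) (%x. ap (map Hadamard (rev ?vs)) \<xi> (flips ?us t x))))"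
  unfolding lus by (intro sum.cong refl norm_sq_cong) (auto simp: \<eta>_def proj_def)
 also have "... <= norm_sq W (ap (map Hadamard (rev ?vs)) \<xi>)"
 proof (rule sum_flips_le[OF us(1,3)])
  fix x u assume "lv.Z j x" "u : set ?us"
  moreover have "set ?vs <= freshp j" by (auto simp: freshp_def)
  ultimately show "~ x ! u" using us(2) unfolding lv.Z_def by blast
 qed
 finally show ?thesis unfolding n\<xi> .
qed

end

text \<open>A measured Hadamard coin agrees with an independent bit with probability 1/2.\<close>

lemma norm_coin_guess:
 assumes w: "w < W" and c: "!!x b. c (x[w := b]) = c x"
  and psi: "!!x. length x = W ==> x ! w ==> psi x = 0"
 shows "norm_sq W (proj (%x. x ! w = c x) (apply_gate (Hadamard w) psi)) = 1/2 * norm_sq W psi"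
proof -
 let ?f = "%x. (cmod (proj (%x. x ! w = c x) (apply_gate (Hadamard w) psi) x))\<^sup>2"
 have h: "apply_gate (Hadamard w) psi x = psi (x[w := False]) / rt2" if "length x = W" for x
  using psi[of "x[w := True]"] that w by simp
 have f: "?f (x[w := False]) + ?f (x[w := True]) = 1/2 * (cmod (psi (x[w := False])))\<^sup>2" if "length x = W" for x
  using that w by (simp add: proj_def h c norm_divide power_divide del: apply_gate.simps)
 have g: "(cmod (psi (x[w := False])))\<^sup>2 + (cmod (psi (x[w := True])))\<^sup>2 = (cmod (psi (x[w := False])))\<^sup>2" if "length x = W" for x
  using psi[of "x[w := True]"] that w by simp
 have "norm_sq W (proj (%x. x ! w = c x) (apply_gate (Hadamard w) psi)) =
   (\<Sum>x\<in>bits W. ?f (x[w := False]) + ?f (x[w := True])) / 2"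
  unfolding norm_sq_def by (rule sum_pair_flip[OF w])
 also have "... = (\<Sum>x\<in>bits W. 1/2 * (cmod (psi (x[w := False])))\<^sup>2) / 2"
  by (intro arg_cong[where f = "%z. z / 2"] sum.cong refl f) simp
 also have "... = 1/2 * ((\<Sum>x\<in>bits W. (cmod (psi (x[w := False])))\<^sup>2 + (cmod (psi (x[w := True])))\<^sup>2) / 2)"
 proof -
  have "(\<Sum>x\<in>bits W. (cmod (psi (x[w := False])))\<^sup>2 + (cmod (psi (x[w := True])))\<^sup>2) = (\<Sum>x\<in>bits W. (cmod (psi (x[w := False])))\<^sup>2)"
   by (intro sum.cong refl g) simp
  thus ?thesis by (simp only: sum_distrib_left[symmetric])
 qed
 also have "(\<Sum>x\<in>bits W. (cmod (psi (x[w := False])))\<^sup>2 + (cmod (psi (x[w := True])))\<^sup>2) / 2 = norm_sq W psi"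
  unfolding norm_sq_def by (rule sum_pair_flip[OF w, symmetric])
 finally show ?thesis .
qed

lemma all_less_pred: "0 < (m :: nat) ==> (\<forall>i<m. Q i) <-> (\<forall>i<m - 1. Q i) & Q (m - 1)"
 by (cases m) (auto simp: less_Suc_eq)

context sim
begin

lemma zv_nth:
 assumes "i < n"
 shows "zv n ! (i * Suc m) = Cw i" "t < m ==> zv n ! (i * Suc m + Suc t) = Vw i t"
proof -
 have "zv n ! (i * Suc m) = Cw i & (\<forall>t<m. zv n ! (i * Suc m + Suc t) = Vw i t)"
  using assms
 proof (induction n)
  case (Suc n)
  show ?case
  proof (cases "i = n")
   case True
   thus ?thesis by (auto simp: zv_Suc nth_append)
  next
   case False
   hence i: "i < n" using Suc.prems by simp
   hence "Suc i * Suc m <= n * Suc m" by (intro mult_right_mono) auto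
   hence "i * Suc m + Suc t < length (zv n)" if "t < m" for t using that by simp
   moreover have "i * Suc m < length (zv n)" using i unfolding length_zv by (intro mult_strict_right_mono) auto
   ultimately show ?thesis using Suc.IH[OF i] by (auto simp: zv_Suc nth_append)
  qed
 qed simp
 thus "zv n ! (i * Suc m) = Cw i" "t < m ==> zv n ! (i * Suc m + Suc t) = Vw i t" by auto
qed

lemma ans_rec: "i <= m ==> ans m (rec y) i = y ! pos (Cw i)"
proof -
 assume i: "i <= m"
 hence "i * Suc m < length (zv (Suc m))" unfolding length_zv by (intro mult_strict_right_mono) auto
 thus ?thesis using zv_nth(1)[of i "Suc m"] i by (simp add: ans_def del: mult_Suc mult_Suc_right)
qed

lemma chal_rec: "i <= m ==> chal m (rec y) i = map ((!) y) (P (Vl i))"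
proof -
 assume i: "i <= m"
 have "Suc i * Suc m <= length (zv (Suc m))" using i unfolding length_zv by (intro mult_right_mono) auto
 hence "i * Suc m + Suc t < length (zv (Suc m))" if "t < m" for t using that by simp
 thus ?thesis using zv_nth(2)[of i "Suc m"] i by (auto simp: chal_def)
qed

text \<open>
 The amplitude of acceptance in the coherent game, including the last answer: it is consistent with
 s if it is the last entry of s masked by the bit to be opened.
\<close>

definition accept :: "(bool list => bool list => real) => bool list => bool list => complex" where
 "accept ver s x = (if x ! pos Bw = (x ! pos (Cw m) ~= s ! (m - 1)) & x ! pos OB = x ! pos Bw
   then complex_of_real (sqrt (ver s (key x))) else 0)"

lemma final_gates: "ap (st m @ op) psi = ap op (ap (st (Suc (m - 1))) psi)"
 using m by simp

lemma op_split:
 "op = map Hadamard (P (Vl m)) @ [Hadamard (pos Bw)] @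
   stage W [] (P (zv (Suc m) @ [Bw])) (P Zl) (P (OB # map Out [0..<l]) @ P (map OAn [0..<n_anc E]) @ P Zl @ P (pl m)) E"
 by (simp add: op_def stage_def del: upt_Suc)

abbreviation rest :: "gate list" where
 "rest == stage W [] (P (zv (Suc m) @ [Bw])) (P Zl) (P (OB # map Out [0..<l]) @ P (map OAn [0..<n_anc E]) @ P Zl @ P (pl m)) E"

lemma not_target_rest:
 assumes "i : targets rest" "w : wires" "w ~: {OB} Un range Out Un range OAn Un range Zc Un set (pl m)"
 shows "i ~= pos w"
proof
 assume i: "i = pos w"
 define S where "S = set ((OB # map Out [0..<l]) @ map OAn [0..<n_anc E] @ Zl @ pl m)"
 have "i : set [] Un set (P Zl) Un set (P (OB # map Out [0..<l]) @ P (map OAn [0..<n_anc E]) @ P Zl @ P (pl m)) Un {W..}"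
  using targets_stage[of W "[]" "P (zv (Suc m) @ [Bw])" "P Zl"] assms(1) by blast
 moreover have "set [] Un set (P Zl) Un set (P (OB # map Out [0..<l]) @ P (map OAn [0..<n_anc E]) @ P Zl @ P (pl m)) = pos ` S"
  unfolding S_def by (simp only: set_append set_map image_Un list.set map_append) blast
 ultimately have "i : pos ` S" using i pos_less[OF assms(2)] by (simp only: Un_iff atLeast_iff) linarith
 moreover have "S <= wires" by (auto simp: S_def set_pl)
 moreover have "w ~: S" using assms(3) by (auto simp: S_def)
 ultimately show False using pos_mem[OF assms(2), of S] i by simp
qed

text \<open>
 As the bit to be opened is random, whatever state the committer is in, it opens correctly to s with
 probability at most 1/2.
\<close>

lemma accept_contraction:
 assumes v: "!!s k. 0 <= ver s k & ver s k <= 1" and psi: "proj (%x. ~ x ! pos Bw) psi = psi"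
 shows "norm_sq W (%x. accept ver s x * ap (st m @ op) psi x) <= 1/2 * norm_sq W psi"
proof -
 let ?b = "pos Bw" and ?c = "%x. x ! pos (Cw m) ~= s ! (m - 1)"
 define phi where "phi = ap (map Hadamard (P (Vl m))) (ap (st (Suc (m - 1))) psi)"
 have bW: "?b < W" using pos_less by simp
 have bc: "?b ~= pos (Cw m)" by (subst pos_eq) auto
 have b1: "i ~= ?b" if "i : targets (st (Suc (m - 1)))" for i
  by (intro not_target[OF that]) (use m in \<open>auto simp: set_pl\<close>)
 have b2: "i ~= ?b" if "i : targets (map Hadamard (P (Vl m)))" for i
  using that by (auto simp: pos_eq)
 have phi0: "proj (%x. ~ x ! ?b) phi = phi"
 proof -
  have "proj (%x. ~ x ! ?b) phi = ap (map Hadamard (P (Vl m))) (proj (%x. ~ x ! ?b) (ap (st (Suc (m - 1))) psi))"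
   unfolding phi_def by (rule ap_proj[symmetric]) (use b2 nth_list_update_neq in metis)
  also have "proj (%x. ~ x ! ?b) (ap (st (Suc (m - 1))) psi) = ap (st (Suc (m - 1))) (proj (%x. ~ x ! ?b) psi)"
   by (rule ap_proj[symmetric]) (use b1 nth_list_update_neq in metis)
  finally show ?thesis by (simp only: psi phi_def)
 qed
 have fin: "ap (st m @ op) psi = ap rest (apply_gate (Hadamard ?b) phi)"
  unfolding final_gates by (simp only: op_split phi_def fold_append o_apply fold_simps append.simps)
 have "norm_sq W (%x. accept ver s x * ap (st m @ op) psi x) <= norm_sq W (proj (%x. x ! ?b = ?c x) (ap (st m @ op) psi))"
  unfolding norm_sq_def
 proof (rule sum_mono)
  fix x
  show "(cmod (accept ver s x * ap (st m @ op) psi x))\<^sup>2 <= (cmod (proj (%x. x ! ?b = ?c x) (ap (st m @ op) psi) x))\<^sup>2"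
   using v[of s "key x"] by (auto simp: accept_def proj_def norm_mult power_mult_distrib mult_left_le_one_le)
 qed
 also have "proj (%x. x ! ?b = ?c x) (ap (st m @ op) psi) = ap rest (proj (%x. x ! ?b = ?c x) (apply_gate (Hadamard ?b) phi))"
  unfolding fin
 proof (rule ap_proj[symmetric])
  fix i x and b :: bool assume i: "i : targets rest"
  have "i ~= ?b" "i ~= pos (Cw m)" by (intro not_target_rest[OF i]; auto simp: set_pl)+
  thus "(x[i := b] ! ?b = ?c (x[i := b])) = (x ! ?b = ?c x)" by simp
 qed
 also have "norm_sq W ... = 1/2 * norm_sq W phi"
  unfolding norm_ap
  by (rule norm_coin_guess[OF bW]) (use bc proj_eqD[OF phi0] in auto)
 finally show ?thesis by (simp only: phi_def norm_ap)
qed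

text \<open>
 Each outcome of the game is consistent with exactly one s, so the ideal vectors share the winning
 probability.
\<close>

lemma accept_total:
 assumes v: "!!s k. 0 <= ver s k & ver s k <= 1"
 shows "(\<Sum>s\<in>bits m. norm_sq W (%x. accept ver s x * ap (st m @ op) (lv.ideal s (m - 1)) x)) =
  value_from m E (%t b. ver (solve m t b)) (map D [0..<Suc m]) [] [] 0 empty_state"
proof -
 let ?Phi = "ap op (Th m)"
 have Thm: "Th m = ap (st (Suc (m - 1))) (Th (m - 1))" using Th.simps(2)[of "m - 1"] m by simp
 have cons_final: "i ~= pos w" if "i : targets (st m @ op)" "w : insert (Cw (Suc j)) (set (Vl j))" "j < m - 1" for i j w
 proof -
  from that(1) consider "i : targets (st (Suc (m - 1)))" | "i : targets (map Hadamard (P (Vl m)))" | "i = pos Bw" | "i : targets rest"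
   using m unfolding op_split by auto
  thus ?thesis
  proof cases
   case 1 thus ?thesis using that by (intro not_target[OF 1]) (auto simp: set_pl)
  next
   case 2 thus ?thesis using that by (auto simp: pos_eq)
  next
   case 3 thus ?thesis using that by (auto simp: pos_eq)
  next
   case 4 thus ?thesis using that by (intro not_target_rest[OF 4]) (auto simp: set_pl)
  qed
 qed
 have id: "ap (st m @ op) (lv.ideal s (m - 1)) = proj (cons s (m - 1)) ?Phi" for s
 proof -
  have "ap (st m @ op) (proj (cons s (m - 1)) (Th (m - 1))) = proj (cons s (m - 1)) (ap (st m @ op) (Th (m - 1)))"
  proof (rule ap_proj)
   fix i x and b :: bool assume "i : targets (st m @ op)"
   hence "hash_ok s j (x[i := b]) = hash_ok s j x" if "j < m - 1" for j
    using cons_final that by (intro hash_ok_update) blast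
   thus "cons s (m - 1) (x[i := b]) = cons s (m - 1) x" by (simp add: cons_def)
  qed
  thus ?thesis by (simp only: ideal_eq[OF order_refl] final_gates Thm)
 qed
 have pt: "(\<Sum>s\<in>bits m. (cmod (accept ver s y * proj (cons s (m - 1)) ?Phi y))\<^sup>2) =
   (if y ! pos OB = y ! pos Bw then ver (solve m (rec y) (y ! pos Bw)) (key y) else 0) * (cmod (?Phi y))\<^sup>2" for y
 proof -
  let ?b = "y ! pos Bw"
  let ?F = "%i tl. (ans m (rec y) (Suc i) ~= dot (drop (Suc i) (chal m (rec y) i)) tl) ~= (Suc i = m & ?b)"
  have c: "cons s (m - 1) y & ?b = (y ! pos (Cw m) ~= s ! (m - 1)) <-> (\<forall>i<m. (s @ []) ! i = ?F i (drop (Suc i) (s @ [])))" for s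
  proof -
   have "(\<forall>i<m. s ! i = ?F i (drop (Suc i) s)) <-> (\<forall>i<m - 1. s ! i = ?F i (drop (Suc i) s)) & s ! (m - 1) = ?F (m - 1) (drop m s)"
    using all_less_pred[OF m, of "%i. s ! i = ?F i (drop (Suc i) s)"] m by simp
   moreover have "s ! i = ?F i (drop (Suc i) s) <-> hash_ok s i y" if "i < m - 1" for i
    using that ans_rec[of "Suc i" y] chal_rec[of i y] by (auto simp: hash_ok_def drop_map)
   moreover have "s ! (m - 1) = ?F (m - 1) (drop m s) <-> ?b = (y ! pos (Cw m) ~= s ! (m - 1))"
    using m ans_rec[of m y] by (auto simp: chal_def)
   ultimately show ?thesis by (auto simp: cons_def)
  qed
  have "(\<Sum>s\<in>bits m. (cmod (accept ver s y * proj (cons s (m - 1)) ?Phi y))\<^sup>2) =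
   (\<Sum>s\<in>bits m. if \<forall>i<m. (s @ []) ! i = ?F i (drop (Suc i) (s @ []))
     then (if y ! pos OB = ?b then ver s (key y) else 0) * (cmod (?Phi y))\<^sup>2 else 0)"
  proof (rule sum.cong[OF refl])
   fix s
   show "(cmod (accept ver s y * proj (cons s (m - 1)) ?Phi y))\<^sup>2 =
    (if \<forall>i<m. (s @ []) ! i = ?F i (drop (Suc i) (s @ []))
     then (if y ! pos OB = ?b then ver s (key y) else 0) * (cmod (?Phi y))\<^sup>2 else 0)"
   proof -
    have "(cmod ((if B & C then complex_of_real (sqrt (ver s (key y))) else 0) * (if A then z else 0)))\<^sup>2 =
      (if A & B then (if C then ver s (key y) else 0) * (cmod z)\<^sup>2 else 0)" for A B C z
     using v[of s "key y"] by (cases A; cases B; cases C) (simp_all add: norm_mult power_mult_distrib)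
    thus ?thesis unfolding accept_def proj_def by (subst c[of s, symmetric])
   qed
  qed
  also have "... = (if y ! pos OB = ?b then ver (backsub ?F m []) (key y) else 0) * (cmod (?Phi y))\<^sup>2"
   by (rule sum_backsub)
  finally show ?thesis by (simp only: solve_def)
 qed
 show ?thesis
  unfolding id value_op norm_sq_def by (subst sum.swap) (simp only: pt)
qed

lemma Bw_Th: "proj (%x. ~ x ! pos Bw) (Th 0) = Th 0"
 by (rule proj_eqI) (use Th_nonzero[of _ Bw] in auto)

theorem sim_success:
 assumes v: "!!s k. 0 <= ver s k & ver s k <= 1"
  and dl: "0 < dl" "dl <= 1" and r: "2 * (4/5) ^ r <= dl / 8"
  and win: "(1 + dl) / 2 <= value_from m E (%t b. ver (solve m t b)) (map D [0..<Suc m]) [] [] 0 empty_state"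
 shows "\<exists>bs. length bs = m - 1 & 2 ^ (m - 1) / 4 ^ r * (dl\<^sup>2 / 20) <=
  (\<Sum>s\<in>bits m. \<Sum>x\<in>bits W. ver s (key x) * (cmod (ap (st m @ op) (lv.circ s 0 bs (Th 0)) x))\<^sup>2)"
proof -
 have "\<exists>bs. length bs = m - 1 & 2 ^ (m - 1) / 4 ^ r * (dl\<^sup>2 / 20) <=
  (\<Sum>s\<in>bits m. norm_sq W (%x. accept ver s x * ap (st m @ op) (lv.circ s 0 bs (Th 0)) x))"
 proof (rule lv.amplified_success[OF bessel Bw_Th _ _ _ dl r])
  fix j w x and b :: bool assume "j < m - 1" "w : targets (st (Suc j))"
  hence "w ~= pos Bw" by (intro not_target[of w j]) (auto simp: set_pl)
  thus "(~ x[w := b] ! pos Bw) = (~ x ! pos Bw)" by simp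
 next
  fix s psi assume "proj (%x. ~ x ! pos Bw) psi = psi"
  thus "norm_sq W (%x. accept ver s x * ap (st m @ op) psi x) <= 1/2 * norm_sq W psi"
   by (rule accept_contraction[OF v])
 next
  fix s w x and b :: bool assume w: "w : targets (st m @ op)"
  have nw: "w ~= pos v" if "v : insert (Coin j) (insert (Cw (Suc j)) (set (Vl j)))" "j < m - 1" for v j
  proof -
   from w consider "w : targets (st (Suc (m - 1)))" | "w : targets (map Hadamard (P (Vl m)))" | "w = pos Bw" | "w : targets rest"
    using m unfolding op_split by auto
   thus ?thesis
   proof cases
    case 1 thus ?thesis using that by (intro not_target[OF 1]) (auto simp: set_pl)
   next
    case 2 thus ?thesis using that by (auto simp: pos_eq)
   next
    case 3 thus ?thesis using that by (auto simp: pos_eq)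
   next
    case 4 thus ?thesis using that by (intro not_target_rest[OF 4]) (auto simp: set_pl)
   qed
  qed
  have "hash_ok s j (x[w := b]) = hash_ok s j x" if "j < m - 1" for j
   by (rule hash_ok_update) (rule nw[OF _ that], blast)
  moreover have "x[w := b] ! pos (Coin j) = x ! pos (Coin j)" if "j < m - 1" for j
   by (rule nth_list_update_neq) (rule nw[OF _ that], blast)
  ultimately show "lv.K s (m - 1) (x[w := b]) = lv.K s (m - 1) x" by (simp add: lv.K_def)
 next
  show "(1 + dl) / 2 <= (\<Sum>s\<in>bits m. norm_sq W (%x. accept ver s x * ap (st m @ op) (lv.ideal s (m - 1)) x))"
   using win by (simp only: accept_total[OF v])
 qed
 then obtain bs where bs: "length bs = m - 1" "2 ^ (m - 1) / 4 ^ r * (dl\<^sup>2 / 20) <=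
  (\<Sum>s\<in>bits m. norm_sq W (%x. accept ver s x * ap (st m @ op) (lv.circ s 0 bs (Th 0)) x))" by blast
 have "norm_sq W (%x. accept ver s x * phi x) <= (\<Sum>x\<in>bits W. ver s (key x) * (cmod (phi x))\<^sup>2)" for s phi
  unfolding norm_sq_def
 proof (rule sum_mono)
  fix x show "(cmod (accept ver s x * phi x))\<^sup>2 <= ver s (key x) * (cmod (phi x))\<^sup>2"
   using v[of s "key x"] by (auto simp: accept_def norm_mult power_mult_distrib)
 qed
 hence "(\<Sum>s\<in>bits m. norm_sq W (%x. accept ver s x * ap (st m @ op) (lv.circ s 0 bs (Th 0)) x)) <=
  (\<Sum>s\<in>bits m. \<Sum>x\<in>bits W. ver s (key x) * (cmod (ap (st m @ op) (lv.circ s 0 bs (Th 0)) x))\<^sup>2)"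
  by (intro sum_mono)
 thus ?thesis using bs by (intro exI[of _ bs]) auto
qed

end

section \<open>The amplified circuit as a sequence of gates\<close>

text \<open>Gates on nonexistent wires are the identity and can be dropped.\<close>

fun in_range :: "nat => gate => bool" where
 "in_range W (Hadamard i) <-> i < W"
| "in_range W (TGate i) <-> i < W"
| "in_range W (CNOT i j) <-> i < W & j < W & i ~= j"

abbreviation trim :: "nat => gate list => gate list" where
 "trim W == filter (in_range W)"

lemma ap_trim: "length x = W ==> ap (trim W gs) psi x = ap gs psi x"
proof (induction gs arbitrary: psi)
 case (Cons g gs)
 show ?case
 proof (cases "in_range W g")
  case False
  hence "apply_gate g psi y = psi y" if "length y = W" for y using that by (cases g) auto
  hence "ap gs psi x = ap gs (apply_gate g psi) x" using Cons.prems by (intro ap_cong[of W]) simp_all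
  thus ?thesis using Cons False by simp
 qed (use Cons in simp)
qed simp

lemma in_range_mono: "in_range W g ==> W <= W' ==> in_range W' g"
 by (cases g) auto

lemma cok_mono: "cok W c ==> W <= W' ==> cok W' c"
 unfolding cok_def by (meson lessThan_subset_iff subset_trans)

text \<open>A register with the classical string s attached.\<close>

definition att :: "nat => bool list => qvec => qvec" where
 "att W s psi z = (if drop W z = s then psi (take W z) else 0)"

lemma ap_att:
 assumes "\<forall>g\<in>set gs. in_range W g" "W <= length z"
 shows "ap gs (att W s psi) z = att W s (ap gs psi) z"
 using assms(1)
proof (induction gs arbitrary: psi)
 case (Cons g gs)
 have "apply_gate g (att W s psi) y = att W s (apply_gate g psi) y" if "length y = length z" for y
  using that Cons.prems assms(2) by (cases g) (auto simp: att_def take_update_swap drop_update_cancel)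
 hence "ap gs (apply_gate g (att W s psi)) z = ap gs (att W s (apply_gate g psi)) z"
  by (intro ap_cong[of "length z"]) simp_all
 thus ?case using Cons by simp
qed simp

lemma ap_att_trim: "W <= length z ==> ap (trim W gs) (att W s psi) z = att W s (ap gs psi) z"
 by (subst ap_att) (auto simp: att_def ap_trim)

lemma length_cg: "length (cg cs) <= 37 * length cs"
proof (induction cs)
 case (Cons c cs)
 have "length (cgates c) <= 37"
  by (cases c rule: cgates.cases) (simp_all add: x_gates_def ccx_gates_def ccz_gates_def parity_phase_def)
 thus ?case using Cons by simp
qed simp

lemma length_reflection: "length (reflection cs z) <= 74 * length cs + 4"
 using length_cg[of cs] length_cg[of "rev cs"] by (simp add: reflection_def)

lemma in_range_cg:
 assumes "!!c. c : set cs ==> cok W c" "g : set (cg cs)"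
 shows "in_range W g"
proof -
 obtain c where c: "c : set cs" "g : set (cgates c)" using assms(2) by auto
 show ?thesis using assms(1)[OF c(1)] c(2)
  by (cases c rule: cgates.cases) (auto simp: cok_def x_gates_def ccx_gates_def ccz_gates_def parity_phase_def)
qed

lemma in_range_reflection:
 assumes "!!c. c : set cs ==> cok W c" "z < W" "g : set (reflection cs z)"
 shows "in_range W g"
 using assms in_range_cg[of cs W g] in_range_cg[of "rev cs" W g]
 by (auto simp: reflection_def)

text \<open>Sets the last wire of \<open>sc\<close> if all wires in \<open>ws\<close> are 0.\<close>

definition ladder :: "nat list => nat list => cgate list" where
 "ladder ws sc = map (XG []) ws @ [XG [] (sc ! 0)] @ map (%k. XG [sc ! k, ws ! k] (sc ! Suc k)) [0..<length ws]"

lemma fold_nots: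
 "distinct ws ==> set ws <= {..<length x} ==>
  fold cact (map (XG []) ws) x ! p = (if p : set ws then ~ x ! p else x ! p)"
proof (induction ws arbitrary: x)
 case (Cons w ws)
 have "cact (XG [] w) x = flip w x" by (simp add: cact_def cval_def)
 thus ?case using Cons by (auto simp: nth_list_update)
qed simp

lemma fold_ladder:
 assumes "distinct (ws @ sc)" "set (ws @ sc) <= {..<length x}" "length sc = Suc (length ws)"
  and "!!p. p : set sc ==> ~ x ! p"
 shows "fold cact (ladder ws sc) x ! last sc <-> (\<forall>w\<in>set ws. ~ x ! w)"
proof -
 define x1 where "x1 = fold cact [XG [] (sc ! 0)] (fold cact (map (XG []) ws) x)"
 have sc: "sc ! k : set sc" "sc ! k < length x" "sc ! k ~: set ws" if "k <= length ws" for k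
 proof -
  show "sc ! k : set sc" using that assms(3) by simp
  thus "sc ! k < length x" "sc ! k ~: set ws" using assms(1,2) by auto
 qed
 have len: "length x1 = length x" by (simp add: x1_def)
 have s0: "x1 = flip (sc ! 0) (fold cact (map (XG []) ws) x)" by (simp add: x1_def cact_def cval_def)
 have nots: "fold cact (map (XG []) ws) x ! p = (if p : set ws then ~ x ! p else x ! p)" for p
  using assms by (intro fold_nots) auto
 have sne: "sc ! i ~= sc ! j" if "i <= length ws" "j <= length ws" "i ~= j" for i j
  using that assms by (simp add: nth_eq_iff_index_eq)
 have w1: "x1 ! (ws ! i) <-> ~ x ! (ws ! i)" if "i < length ws" for i
 proof -
  have "ws ! i : set ws" using that by simp
  hence "ws ! i ~= sc ! 0" using sc(3)[of 0] by auto
  thus ?thesis using nots \<open>ws ! i : set ws\<close> by (simp add: s0)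
 qed
 have s1: "x1 ! (sc ! k) <-> k = 0" if "k <= length ws" for k
  using that sc[OF that] sne[of k 0] assms(4) nots by (cases "k = 0") (auto simp: s0)
 have main: "n <= length ws ==>
   (\<forall>i<length ws. fold cact (map (%k. XG [sc ! k, ws ! k] (sc ! Suc k)) [0..<n]) x1 ! (ws ! i) = (~ x ! (ws ! i))) &
   (\<forall>k\<le>length ws. fold cact (map (%k. XG [sc ! k, ws ! k] (sc ! Suc k)) [0..<n]) x1 ! (sc ! k) <->
    k <= n & (\<forall>i<k. ~ x ! (ws ! i)))" for n
 proof (induction n)
  case 0
  show ?case using w1 s1 by auto
 next
  case (Suc n)
  let ?y = "fold cact (map (%k. XG [sc ! k, ws ! k] (sc ! Suc k)) [0..<n]) x1"
  have IH: "\<forall>i<length ws. ?y ! (ws ! i) = (~ x ! (ws ! i))"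
   "\<forall>k\<le>length ws. ?y ! (sc ! k) <-> k <= n & (\<forall>i<k. ~ x ! (ws ! i))" using Suc by auto
  have n: "n < length ws" using Suc.prems by simp
  have ly: "length ?y = length x" by (simp add: len)
  have y': "fold cact (map (%k. XG [sc ! k, ws ! k] (sc ! Suc k)) [0..<Suc n]) x1 =
    (if ?y ! (sc ! n) & ?y ! (ws ! n) then flip (sc ! Suc n) ?y else ?y)"
   by (simp add: cact_def cval_def)
  have wne: "sc ! Suc n ~= ws ! i" if "i < length ws" for i
   using sc(3)[of "Suc n"] that n by (metis Suc_leI nth_mem)
  have nw: "flip (sc ! Suc n) ?y ! (ws ! i) = ?y ! (ws ! i)" if "i < length ws" for i
   by (rule nth_list_update_neq[OF wne[OF that]])
  have ns: "flip (sc ! Suc n) ?y ! (sc ! k) = (if k = Suc n then ~ ?y ! (sc ! k) else ?y ! (sc ! k))" if "k <= length ws" for k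
   using that sc(2)[of "Suc n"] sne[of "Suc n" k] n ly by simp
  have c: "?y ! (sc ! n) & ?y ! (ws ! n) <-> (\<forall>i<Suc n. ~ x ! (ws ! i))" using IH n by (auto simp: less_Suc_eq)
  have no: "~ ?y ! (sc ! Suc n)" using IH(2) n by simp
  show ?case
  proof (cases "\<forall>i<Suc n. ~ x ! (ws ! i)")
   case True
   hence t: "?y ! (sc ! n) & ?y ! (ws ! n)" using c by simp
   have "flip (sc ! Suc n) ?y ! (sc ! k) <-> k <= Suc n & (\<forall>i<k. ~ x ! (ws ! i))" if "k <= length ws" for k
   proof (cases "k = Suc n")
    case False
    thus ?thesis using ns[OF that] IH(2) that by (simp add: le_Suc_eq)
   qed (use ns[OF that] no True in simp)
   thus ?thesis unfolding y' if_P[OF t] using nw IH(1) by simp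
  next
   case False
   hence t: "~ (?y ! (sc ! n) & ?y ! (ws ! n))" using c by simp
   have "?y ! (sc ! k) <-> k <= Suc n & (\<forall>i<k. ~ x ! (ws ! i))" if "k <= length ws" for k
   proof (cases "k = Suc n")
    case True
    thus ?thesis using no False by simp
   next
    case False
    thus ?thesis using IH(2) that by (simp add: le_Suc_eq)
   qed
   thus ?thesis unfolding y' if_not_P[OF t] using IH(1) by simp
  qed
 qed
 have "fold cact (ladder ws sc) x = fold cact (map (%k. XG [sc ! k, ws ! k] (sc ! Suc k)) [0..<length ws]) x1"
  by (simp add: ladder_def x1_def)
 moreover have "last sc = sc ! length ws" using assms(3) last_conv_nth[of sc] by (cases sc) auto
 ultimately show ?thesis using main[of "length ws"] by (auto simp: all_set_conv_all_nth)
qed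

lemma cok_ladder:
 assumes "distinct (ws @ sc)" "set (ws @ sc) <= {..<W}" "length sc = Suc (length ws)" "c : set (ladder ws sc)"
 shows "cok W c"
proof -
 have sc: "sc ! k : set sc" if "k <= length ws" for k using that assms(3) by simp
 have "cok W (XG [sc ! k, ws ! k] (sc ! Suc k))" if "k < length ws" for k
 proof -
  have "sc ! k ~= sc ! Suc k" using that assms(1,3) by (simp add: nth_eq_iff_index_eq)
  moreover have "ws ! k : set ws" "sc ! k : set sc" "sc ! Suc k : set sc" using that sc by auto
  ultimately show ?thesis using assms(1,2) by (auto simp: cok_def)
 qed
 moreover have "cok W (XG [] p)" if "p : set (ws @ sc)" for p using that assms(2) by (auto simp: cok_def)
 ultimately show ?thesis using assms(4) sc[of 0] by (auto simp: ladder_def)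
qed

context sim
begin

abbreviation coin_st :: "nat => gate list" where
 "coin_st j == Hadamard (pos (Coin j)) # st (Suc j)"

abbreviation fresh_list :: "nat => wire list" where
 "fresh_list j == Vl j @ Vcl j @ [Cw (Suc j)] @ Anl (Suc j)"

text \<open>The two reflections of an amplified level; the target s is on the wires from \<open>W\<close> on.\<close>

definition refl0 :: "nat => gate list" where
 "refl0 j = (let ws = P (Coin j # fresh_list j); sc = P (map Scr [0..<Suc (length ws)])
   in reflection (ladder ws sc) (last sc))"

definition hash_cg :: "nat => cgate list" where
 "hash_cg j = [XG [pos (Cw (Suc j))] (pos Par), XG [W + j] (pos Par)] @
   map (%t. XG [pos (Vw j t), W + t] (pos Par)) [Suc j..<m]"

definition reflg :: "nat => gate list" where
 "reflg j = (let ws = [pos Par, pos (Coin j)]; sc = P (map Scr [0..<3])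
   in reflection (hash_cg j @ ladder ws sc) (last sc))"

definition level_gates :: "bool => nat => gate list" where
 "level_gates b j = (if b
   then trim W (coin_st j) @ reflg j @ trim W (inv_gates (coin_st j)) @ refl0 j @ trim W (coin_st j)
   else trim W (coin_st j))"

text \<open>The scratch wires are 0.\<close>

definition scr0 :: "bool list => bool" where
 "scr0 x <-> (\<forall>w\<in>insert Par (Scr ` {..<q}). ~ x ! pos w)"

lemma parity_dot:
 assumes "length s = m" "j <= m"
 shows "parity (map (%t. f t & s ! t) [j..<m]) = dot (drop j (map f [0..<m])) (drop j s)"
 using assms(2)
proof (induction rule: inc_induct)
 case base
 show ?case using assms(1) by simp
next
 case (step j)
 have "drop j (map f [0..<m]) = f j # drop (Suc j) (map f [0..<m])"
  using step.hyps(2) by (subst Cons_nth_drop_Suc[symmetric]) simp_all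
 moreover have "drop j s = s ! j # drop (Suc j) s"
  using step.hyps(2) assms(1) by (simp add: Cons_nth_drop_Suc)
 moreover have "[j..<m] = j # [Suc j..<m]" using step.hyps(2) by (rule upt_conv_Cons)
 ultimately show ?case using step.IH by simp
qed

lemma ap_refl0:
 assumes j: "j < m - 1" and q: "Suc (Suc (length (fresh_list j))) <= q" and phi: "proj scr0 phi = phi" and z: "length z = W + m"
 shows "ap (refl0 j) (att W s phi) z = att W s (sgn_flip (%x. lv.Z j x & ~ x ! pos (Coin j)) phi) z"
proof -
 let ?wl = "Coin j # fresh_list j"
 let ?ws = "P ?wl" and ?sc = "P (map Scr [0..<Suc (length ?wl)])"
 have sub: "set (?wl @ map Scr [0..<Suc (length ?wl)]) <= wires" using j q by (auto simp del: upt_Suc)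
 have dis: "distinct (?wl @ map Scr [0..<Suc (length ?wl)])" by (auto simp: distinct_map inj_on_def simp del: upt_Suc)
 have P: "distinct (?ws @ ?sc)" "set (?ws @ ?sc) <= {..<W}"
  using distinct_P[OF dis sub] P_less[OF sub] unfolding map_append by simp_all
 have len: "length ?sc = Suc (length ?ws)" by simp
 have lastsc: "last ?sc < length z"
 proof -
  have "last ?sc : set ?sc" by (rule last_in_set) simp
  thus ?thesis using P(2) z by auto
 qed
 have r: "ap (refl0 j) (att W s phi) z = (if fold cact (ladder ?ws ?sc) z ! last ?sc then - att W s phi z else att W s phi z)"
 proof -
  have "cok (length z) c" if "c : set (ladder ?ws ?sc)" for c
   using cok_ladder[OF P len that] cok_mono[of W c "length z"] z by simp
  hence "ap (reflection (ladder ?ws ?sc) (last ?sc)) (att W s phi) z =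
    (if fold cact (ladder ?ws ?sc) z ! last ?sc then - att W s phi z else att W s phi z)"
   by (intro ap_reflection lastsc)
  thus ?thesis by (simp only: refl0_def Let_def length_map)
 qed
 show ?thesis
 proof (cases "att W s phi z = 0")
  case True
  hence "att W s (sgn_flip (%x. lv.Z j x & ~ x ! pos (Coin j)) phi) z = 0" by (auto simp: att_def sgn_flip_def)
  thus ?thesis using r True by simp
 next
  case False
  hence d: "drop W z = s" "phi (take W z) ~= 0" by (auto simp: att_def split: if_splits)
  have s0: "scr0 (take W z)" by (rule proj_eqD[OF phi d(2)])
  have tk: "z ! pos w = take W z ! pos w" if "w : wires" for w using pos_less[OF that] by simp
  have "fold cact (ladder ?ws ?sc) z ! last ?sc <-> (\<forall>w\<in>set ?ws. ~ z ! w)"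
  proof (rule fold_ladder[OF P(1) _ len])
   show "set (?ws @ ?sc) <= {..<length z}" using P(2) z by auto
   fix p assume "p : set ?sc"
   then obtain k where k: "p = pos (Scr k)" "k < q" using q by (auto simp del: upt_Suc)
   thus "~ z ! p" using s0 tk[of "Scr k"] by (auto simp: scr0_def)
  qed
  also have "... <-> (\<forall>w\<in>set ?wl. ~ take W z ! pos w)"
  proof -
   have "z ! pos w = take W z ! pos w" if "w : set ?wl" for w using tk[of w] sub that by auto
   hence "(\<forall>w\<in>set ?wl. ~ z ! pos w) <-> (\<forall>w\<in>set ?wl. ~ take W z ! pos w)" by (intro ball_cong refl arg_cong[where f = Not])
   moreover have "(\<forall>w\<in>pos ` S. ~ z ! w) <-> (\<forall>w\<in>S. ~ z ! pos w)" for S by blast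
   ultimately show ?thesis unfolding set_map by (simp only: )
  qed
  also have "... <-> lv.Z j (take W z) & ~ take W z ! pos (Coin j)"
   by (auto simp only: lv.Z_def freshp_def list.set insert_iff ball_simps image_iff)
  finally show ?thesis unfolding r using d by (simp add: att_def sgn_flip_def)
 qed
qed

lemma cok_hash: "j < m - 1 ==> c : set (hash_cg j) ==> tgt c = pos Par & cok (W + m) c"
proof -
 assume j: "j < m - 1" and c: "c : set (hash_cg j)"
 have p: "pos Par < W" "pos (Cw (Suc j)) < W" "pos Par ~= pos (Cw (Suc j))"
  using j by (simp_all add: pos_less pos_eq)
 have v: "pos (Vw j t) < W" "pos Par ~= pos (Vw j t)" if "t < m" for t
  using j that by (simp_all add: pos_less pos_eq)
 have "cok (W + m) (XG [pos (Vw j t), W + t] (pos Par))" if "t < m" for t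
  using v[OF that] p(1) that by (simp add: cok_def)
 moreover have "cok (W + m) (XG [pos (Cw (Suc j))] (pos Par))" "cok (W + m) (XG [W + j] (pos Par))"
  using p j by (simp_all add: cok_def)
 ultimately show ?thesis using c by (auto simp: hash_cg_def)
qed

lemma ap_reflg:
 assumes j: "j < m - 1" and q: "3 <= q" and phi: "proj scr0 phi = phi" and z: "length z = W + m" and s: "length s = m"
 shows "ap (reflg j) (att W s phi) z = att W s (sgn_flip (%x. hash_ok s j x & ~ x ! pos (Coin j)) phi) z"
proof -
 let ?wl = "[Par, Coin j]"
 let ?ws = "P ?wl" and ?sc = "P (map Scr [0..<3])"
 have sub: "set (?wl @ map Scr [0..<3]) <= wires" using j q by auto
 have dis: "distinct (?wl @ map Scr [0..<3])" by (auto simp: distinct_map inj_on_def)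
 have P: "distinct (?ws @ ?sc)" "set (?ws @ ?sc) <= {..<W}"
  using distinct_P[OF dis sub] P_less[OF sub] unfolding map_append by simp_all
 have len: "length ?sc = Suc (length ?ws)" by simp
 have lastsc: "last ?sc < length z"
 proof -
  have "last ?sc : set ?sc" by (rule last_in_set) simp
  thus ?thesis using P(2) z by auto
 qed
 have r: "ap (reflg j) (att W s phi) z = (if fold cact (hash_cg j @ ladder ?ws ?sc) z ! last ?sc then - att W s phi z else att W s phi z)"
 proof -
  have "cok (length z) c" if "c : set (hash_cg j @ ladder ?ws ?sc)" for c
  proof -
   have "cok W c" if "c : set (ladder ?ws ?sc)" using that P len by (intro cok_ladder) auto
   thus ?thesis using that cok_hash[OF j, of c] cok_mono[of W c "length z"] z by auto
  qed
  hence "ap (reflection (hash_cg j @ ladder ?ws ?sc) (last ?sc)) (att W s phi) z =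
    (if fold cact (hash_cg j @ ladder ?ws ?sc) z ! last ?sc then - att W s phi z else att W s phi z)"
   by (intro ap_reflection lastsc)
  thus ?thesis by (simp only: reflg_def Let_def list.map)
 qed
 show ?thesis
 proof (cases "att W s phi z = 0")
  case True
  hence "att W s (sgn_flip (%x. hash_ok s j x & ~ x ! pos (Coin j)) phi) z = 0" by (auto simp: att_def sgn_flip_def)
  thus ?thesis using r True by simp
 next
  case False
  hence d: "drop W z = s" "phi (take W z) ~= 0" by (auto simp: att_def split: if_splits)
  have s0: "scr0 (take W z)" by (rule proj_eqD[OF phi d(2)])
  have tk: "z ! pos w = take W z ! pos w" if "w : wires" for w using pos_less[OF that] by simp
  have zs: "z ! (W + t) = s ! t" for t using d(1) z by auto
  define v where "v = parity (map (%c. cval c z) (hash_cg j))"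
  have par0: "~ z ! pos Par" using s0 tk[of Par] by (auto simp: scr0_def)
  have f: "fold cact (hash_cg j) z = z[pos Par := v]"
  proof -
   have "fold cact (hash_cg j) z = z[pos Par := (z ! pos Par ~= parity (map (%c. cval c z) (hash_cg j)))]"
    by (rule fold_cact_target) (use cok_hash[OF j] z in auto)
   thus ?thesis using par0 by (simp add: v_def)
  qed
  have parW: "pos Par < W" by (rule pos_less) simp
  have v: "v <-> ~ hash_ok s j (take W z)"
  proof -
   have "map (%c. cval c z) (hash_cg j) = [z ! pos (Cw (Suc j)), s ! j] @ map (%t. z ! pos (Vw j t) & s ! t) [Suc j..<m]"
    by (simp add: hash_cg_def cval_def zs)
   hence "v <-> (z ! pos (Cw (Suc j)) ~= (s ! j ~= dot (drop (Suc j) (map (%t. z ! pos (Vw j t)) [0..<m])) (drop (Suc j) s)))"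
    using parity_dot[OF s, of "Suc j" "%t. z ! pos (Vw j t)"] j by (auto simp: v_def)
   moreover have "drop (Suc j) (map (%t. z ! pos (Vw j t)) [0..<m]) = map ((!) (take W z)) (drop (Suc j) (P (Vl j)))"
   proof -
    have "map (%t. z ! pos (Vw j t)) [0..<m] = map ((!) (take W z)) (P (Vl j))" using tk j by simp
    thus ?thesis by (simp only: drop_map)
   qed
   ultimately show ?thesis using tk[of "Cw (Suc j)"] j by (auto simp: hash_ok_def)
  qed
  have "fold cact (hash_cg j @ ladder ?ws ?sc) z ! last ?sc <-> (\<forall>w\<in>set ?ws. ~ z[pos Par := v] ! w)"
   unfolding fold_append o_apply f
  proof (rule fold_ladder[OF P(1) _ len])
   show "set (?ws @ ?sc) <= {..<length (z[pos Par := v])}" using P(2) z by auto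
   fix p assume p: "p : set ?sc"
   then obtain k where k: "p = pos (Scr k)" "k < q" using q by auto
   hence "p ~= pos Par" using pos_eq[of "Scr k" Par] by auto
   thus "~ z[pos Par := v] ! p" using k s0 tk[of "Scr k"] by (auto simp: scr0_def)
  qed
  also have "... <-> ~ v & ~ z ! pos (Coin j)"
   using parW z pos_eq[of Par "Coin j"] j by auto
  also have "... <-> hash_ok s j (take W z) & ~ take W z ! pos (Coin j)" using v tk[of "Coin j"] j by simp
  finally show ?thesis unfolding r using d by (simp add: att_def sgn_flip_def)
 qed
qed

lemma scr0_coin_st:
 assumes "j < m - 1" "proj scr0 phi = phi"
 shows "proj scr0 (ap (coin_st j) phi) = ap (coin_st j) phi" "proj scr0 (ap (inv_gates (coin_st j)) phi) = ap (inv_gates (coin_st j)) phi"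
proof -
 have jm: "j < m" using assms(1) by simp
 have u: "scr0 (x[i := b]) = scr0 x" if "i : targets (coin_st j)" for i x b
 proof -
  have "i ~= pos w" if w: "w : insert Par (Scr ` {..<q})" for w
  proof -
   have ww: "w : wires" using w by auto
   from \<open>i : targets (coin_st j)\<close> consider "i = pos (Coin j)" | "i : targets (st (Suc j))" by auto
   thus ?thesis
   proof cases
    case 1 thus ?thesis using w ww jm pos_eq[of "Coin j" w] by auto
   next
    case 2 thus ?thesis using w ww jm by (intro not_target[OF 2 jm ww]) (auto simp: set_pl)
   qed
  qed
  thus ?thesis by (auto simp: scr0_def)
 qed
 show "proj scr0 (ap (coin_st j) phi) = ap (coin_st j) phi"
  using ap_proj[of "coin_st j" scr0 phi, OF u] assms(2) by simp
 show "proj scr0 (ap (inv_gates (coin_st j)) phi) = ap (inv_gates (coin_st j)) phi"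
  using ap_proj[of "inv_gates (coin_st j)" scr0 phi, unfolded targets_inv, OF u] assms(2) by simp
qed

lemma scr0_sgn_flip: "proj scr0 phi = phi ==> proj scr0 (sgn_flip Q phi) = sgn_flip Q phi"
 by (simp only: proj_sgn_flip)

abbreviation level_op :: "bool list => bool => nat => qvec => qvec" where
 "level_op s b j phi == (if b then amplify (pos (Coin j)) (st (Suc j)) (lv.Z j) (hash_ok s j) phi else ap (coin_st j) phi)"

lemma ap_level_gates:
 assumes j: "j < m - 1" and q: "length (fresh_list j) + 3 <= q" and phi: "proj scr0 phi = phi"
  and z: "length z = W + m" and s: "length s = m"
 shows "ap (level_gates b j) (att W s phi) z = att W s (level_op s b j phi) z" "proj scr0 (level_op s b j phi) = level_op s b j phi"
proof -
 note c1 = scr0_coin_st(1)[OF j] and c2 = scr0_coin_st(2)[OF j]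
 define phi1 where "phi1 = ap (coin_st j) phi"
 define phi2 where "phi2 = sgn_flip (%x. hash_ok s j x & ~ x ! pos (Coin j)) phi1"
 define phi3 where "phi3 = ap (inv_gates (coin_st j)) phi2"
 define phi4 where "phi4 = sgn_flip (%x. lv.Z j x & ~ x ! pos (Coin j)) phi3"
 have p1: "proj scr0 phi1 = phi1" unfolding phi1_def by (rule c1[OF phi])
 have p2: "proj scr0 phi2 = phi2" unfolding phi2_def by (rule scr0_sgn_flip[OF p1])
 have p3: "proj scr0 phi3 = phi3" unfolding phi3_def by (rule c2[OF p2])
 have p4: "proj scr0 phi4 = phi4" unfolding phi4_def by (rule scr0_sgn_flip[OF p3])
 have am: "amplify (pos (Coin j)) (st (Suc j)) (lv.Z j) (hash_ok s j) phi = ap (coin_st j) phi4"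
  by (simp only: amplify_def phi4_def phi3_def phi2_def phi1_def)
 show "proj scr0 (level_op s b j phi) = level_op s b j phi" unfolding am using c1[OF phi] c1[OF p4] by simp
 have q': "3 <= q" "Suc (Suc (length (fresh_list j))) <= q" using q by simp_all
 have e1: "ap (trim W (coin_st j)) (att W s phi) y = att W s phi1 y" if "length y = W + m" for y
  using that by (simp only: phi1_def) (rule ap_att_trim, simp)
 have e2: "ap (reflg j) (att W s phi1) y = att W s phi2 y" if "length y = W + m" for y
  unfolding phi2_def by (rule ap_reflg[OF j q'(1) p1 that s])
 have e3: "ap (trim W (inv_gates (coin_st j))) (att W s phi2) y = att W s phi3 y" if "length y = W + m" for y
  using that by (simp only: phi3_def) (rule ap_att_trim, simp)
 have e4: "ap (refl0 j) (att W s phi3) y = att W s phi4 y" if "length y = W + m" for y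
  unfolding phi4_def by (rule ap_refl0[OF j q'(2) p3 that])
 have e5: "ap (trim W (coin_st j)) (att W s phi4) y = att W s (ap (coin_st j) phi4) y" if "length y = W + m" for y
  using that by (intro ap_att_trim) simp
 show "ap (level_gates b j) (att W s phi) z = att W s (level_op s b j phi) z"
 proof (cases b)
  case False
  thus ?thesis using e1[OF z] by (simp only: level_gates_def if_False phi1_def)
 next
  case True
  have "ap (level_gates b j) (att W s phi) z = ap (trim W (coin_st j)) (ap (refl0 j) (ap (trim W (inv_gates (coin_st j)))
    (ap (reflg j) (ap (trim W (coin_st j)) (att W s phi))))) z"
   using True by (simp only: level_gates_def if_True fold_append o_apply)
  also have "... = ap (trim W (coin_st j)) (att W s phi4) z"
   by (intro ap_cong[OF _ z]) (simp only: e1 e2 e3 e4 ap_cong[where n = "W + m" and phi = "ap (reflg j) _"]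
    ap_cong[where n = "W + m" and phi = "ap (trim W (coin_st j)) (att W s phi)" and psi = "att W s phi1"]
    ap_cong[where n = "W + m" and phi = "ap (reflg j) (ap (trim W (coin_st j)) (att W s phi))" and psi = "att W s phi2"]
    ap_cong[where n = "W + m" and phi = "ap (trim W (inv_gates (coin_st j))) (ap (reflg j) (ap (trim W (coin_st j)) (att W s phi)))" and psi = "att W s phi3"])
  also have "... = att W s (level_op s b j phi) z" using e5[OF z] True by (simp only: if_True am)
  finally show ?thesis .
 qed
qed

end

context sim
begin

text \<open>The gates of all levels, and of the whole inverter.\<close>

fun levels_gates :: "nat => bool list => gate list" where
 "levels_gates j [] = []"
| "levels_gates j (b # bs) = level_gates b j @ levels_gates (Suc j) bs"

definition full :: "bool list => gate list" where
 "full bs = trim W (st 0) @ levels_gates 0 bs @ trim W (st m @ op)"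

lemma ap_levels_gates:
 assumes "j + length bs <= m - 1" and q: "!!j. j < m - 1 ==> length (fresh_list j) + 3 <= q"
  and "proj scr0 phi = phi" "length z = W + m" "length s = m"
 shows "ap (levels_gates j bs) (att W s phi) z = att W s (lv.circ s j bs phi) z"
 using assms(1,3)
proof (induction bs arbitrary: j phi)
 case (Cons b bs)
 have j: "j < m - 1" using Cons.prems by simp
 note lg1 = ap_level_gates(1)[OF j q[OF j] Cons.prems(2) _ assms(5), of _ b]
  and lg2 = ap_level_gates(2)[OF j q[OF j] Cons.prems(2) assms(4,5), of b]
 have "ap (levels_gates j (b # bs)) (att W s phi) z = ap (levels_gates (Suc j) bs) (ap (level_gates b j) (att W s phi)) z"
  by (simp only: levels_gates.simps fold_append o_apply)
 also have "... = ap (levels_gates (Suc j) bs) (att W s (level_op s b j phi)) z"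
  by (rule ap_cong[OF lg1 assms(4)])
 also have "... = att W s (lv.circ s (Suc j) bs (level_op s b j phi)) z"
  using Cons.prems by (intro Cons.IH lg2) (simp_all)
 finally show ?case by (simp only: lv.circ.simps)
qed simp

lemma scr0_Th: "proj scr0 (Th 0) = Th 0"
proof (rule proj_eqI)
 fix x assume "Th 0 x ~= 0"
 hence "~ x ! pos w" if "w : insert Par (Scr ` {..<q})" for w
  using that by (intro Th_nonzero(1)) auto
 thus "scr0 x" unfolding scr0_def by blast
qed

lemma ap_full:
 assumes "length bs = m - 1" and q: "!!j. j < m - 1 ==> length (fresh_list j) + 3 <= q"
  and z: "length z = W + m" and s: "length s = m"
 shows "ap (full bs) (att W s (ket (zeros W))) z = att W s (ap (st m @ op) (lv.circ s 0 bs (Th 0))) z"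
proof -
 let ?k = "ket (zeros W)"
 have e1: "ap (trim W (st 0)) (att W s ?k) y = att W s (Th 0) y" if "length y = W + m" for y
  unfolding Th.simps using that by (intro ap_att_trim) simp
 have e2: "ap (levels_gates 0 bs) (att W s (Th 0)) y = att W s (lv.circ s 0 bs (Th 0)) y" if "length y = W + m" for y
  by (rule ap_levels_gates) (use assms that scr0_Th in auto)
 have "ap (full bs) (att W s ?k) z = ap (trim W (st m @ op)) (ap (levels_gates 0 bs) (ap (trim W (st 0)) (att W s ?k))) z"
  by (simp only: full_def fold_append o_apply)
 also have "... = ap (trim W (st m @ op)) (ap (levels_gates 0 bs) (att W s (Th 0))) z"
  by (rule ap_cong[OF _ z], rule ap_cong[OF _], erule e1)
 also have "... = ap (trim W (st m @ op)) (att W s (lv.circ s 0 bs (Th 0))) z"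
  by (rule ap_cong[OF e2 z])
 also have "... = att W s (ap (st m @ op) (lv.circ s 0 bs (Th 0))) z"
  using z by (intro ap_att_trim) simp
 finally show ?thesis .
qed

lemma run_full:
 assumes "length bs = m - 1" and q: "!!j. j < m - 1 ==> length (fresh_list j) + 3 <= q"
  and s: "length s = m" and W: "W = l + aa" and out: "!!t. t < l ==> pos (Out t) = t"
 shows "(\<Sum>k\<in>bits l. pmf (run (Circuit l aa (full bs)) s) k * v k) =
  (\<Sum>x\<in>bits W. v (key x) * (cmod (ap (st m @ op) (lv.circ s 0 bs (Th 0)) x))\<^sup>2)"
proof -
 let ?Phi = "ap (full bs) (load (l + aa) s empty_state)" and ?psi = "ap (st m @ op) (lv.circ s 0 bs (Th 0))"
 have l: "load (l + aa) s empty_state = att W s (ket (zeros W))"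
 proof
  fix z
  have "z = zeros W @ s <-> drop W z = s & take W z = zeros W"
   by (metis append_take_drop_id length_replicate append_eq_conv_conj)
  thus "load (l + aa) s empty_state z = att W s (ket (zeros W)) z"
   unfolding load_empty W[symmetric] by (auto simp: ket_def att_def)
 qed
 have key: "key (k @ u) = k" if "length k = l" for k u
  using that out by (intro nth_equalityI) (auto simp: nth_append)
 have "(\<Sum>k\<in>bits l. pmf (run (Circuit l aa (full bs)) s) k * v k) = (\<Sum>k\<in>bits l. norm_sq (aa + m) (slice k ?Phi) * v k)"
  using s by (intro sum.cong refl) (simp add: pmf_run)
 also have "... = (\<Sum>k\<in>bits l. \<Sum>u\<in>bits aa. v (key (k @ u)) * (cmod (?psi (k @ u)))\<^sup>2)"
 proof (rule sum.cong[OF refl])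
  fix k assume "k : bits l"
  hence k: "length k = l" by simp
  have "norm_sq (aa + m) (slice k ?Phi) = (\<Sum>u\<in>bits aa. \<Sum>t\<in>bits m. (cmod (?Phi (k @ u @ t)))\<^sup>2)"
   unfolding norm_sq_def sum_bits_append slice_def ..
  also have "... = (\<Sum>u\<in>bits aa. \<Sum>t\<in>bits m. if t = s then (cmod (?psi (k @ u)))\<^sup>2 else 0)"
  proof (intro sum.cong refl)
   fix u t :: "bool list" assume "u : bits aa" "t : bits m"
   hence "length (k @ u) = W" "length ((k @ u) @ t) = W + m" using k W by simp_all
   thus "(cmod (?Phi (k @ u @ t)))\<^sup>2 = (if t = s then (cmod (?psi (k @ u)))\<^sup>2 else 0)"
    using ap_full[OF assms(1) q _ s, of "(k @ u) @ t"] unfolding l by (auto simp: att_def)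
  qed
  also have "... = (\<Sum>u\<in>bits aa. (cmod (?psi (k @ u)))\<^sup>2)" using s by (simp add: sum.delta)
  finally show "norm_sq (aa + m) (slice k ?Phi) * v k = (\<Sum>u\<in>bits aa. v (key (k @ u)) * (cmod (?psi (k @ u)))\<^sup>2)"
   using key[OF k] by (simp add: sum_distrib_left mult.commute)
 qed
 also have "... = (\<Sum>x\<in>bits W. v (key x) * (cmod (?psi x))\<^sup>2)" unfolding W sum_bits_append ..
 finally show ?thesis .
qed

lemma length_copy: "length (cg (map2 (%a t. XG [a] t) src dst)) <= length dst"
proof (induction src dst rule: list_induct2')
qed simp_all

lemma length_stage: "length (stage W hs src dst ws C) <= length hs + length dst + length (gates C)"
 using length_copy[of src dst] by (simp add: stage_def)

lemma length_inv: "length (inv_gates gs) <= 7 * length gs"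
proof (induction gs)
 case (Cons g gs)
 have "length (inv_gate g) <= 7" by (cases g) simp_all
 thus ?case using Cons by (simp add: inv_gates_def)
qed (simp add: inv_gates_def)

lemma length_full:
 assumes S: "m <= S" "!!j. j <= m ==> n_anc (D j) <= S & length (gates (D j)) <= S" "length (gates E) <= S"
  and bs: "length bs = m - 1"
 shows "length (full bs) <= 2000 * (S + 2)\<^sup>2"
proof -
 have st: "length (st (Suc j)) <= 3 * S" if "j < m" for j
  unfolding st.simps by (rule order_trans[OF length_stage]) (use S(1) S(2)[of "Suc j"] that in simp)
 have lev: "length (level_gates b j) <= 1000 * (S + 1)" if j: "j < m - 1" for b j
 proof -
  have c: "length (coin_st j) <= 3 * S + 1" using st[of j] j by simp
  have i: "length (inv_gates (coin_st j)) <= 21 * S + 7" using length_inv[of "coin_st j"] c by simp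
  have "length (ladder (P (Coin j # fresh_list j)) sc) <= 6 * S + 5" for sc
  proof -
   have "n_anc (D (Suc j)) <= S" using S(2)[of "Suc j"] j by simp
   thus ?thesis using S(1) by (simp add: ladder_def)
  qed
  hence r0: "length (refl0 j) <= 74 * (6 * S + 5) + 4"
   unfolding refl0_def Let_def by (meson add_le_mono1 length_reflection mult_le_mono2 order_trans)
  have "length (hash_cg j @ ladder [pos Par, pos (Coin j)] sc) <= S + 7" for sc
   using S(1) j by (simp add: ladder_def hash_cg_def)
  hence rg: "length (reflg j) <= 74 * (S + 7) + 4"
   unfolding reflg_def Let_def by (meson add_le_mono1 length_reflection mult_le_mono2 order_trans)
  have t: "length (trim W gs) <= length gs" for gs by simp
  show ?thesis
  proof -
   have "length (level_gates b j) <= (3 * S + 1) + ((74 * (S + 7) + 4) + ((21 * S + 7) + ((74 * (6 * S + 5) + 4) + (3 * S + 1))))"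
    unfolding level_gates_def length_append if_distrib[of length]
    using order_trans[OF t c] order_trans[OF t i] r0 rg by (auto intro!: add_mono)
   thus ?thesis by simp
  qed
 qed
 have levs: "length (levels_gates j bs) <= length bs * (1000 * (S + 1))" if "j + length bs <= m - 1" for j bs
  using that
 proof (induction bs arbitrary: j)
  case (Cons b bs)
  have "length (level_gates b j) <= 1000 * (S + 1)" "length (levels_gates (Suc j) bs) <= length bs * (1000 * (S + 1))"
   using Cons.prems by (auto intro: lev[of j b, simplified] Cons.IH[simplified])
  thus ?case by simp
 qed simp
 have "length (levels_gates 0 bs) <= (m - 1) * (1000 * (S + 1))" using levs[of 0 bs] bs by simp
 also have "... <= S * (1000 * (S + 1))" using S(1) by (intro mult_right_mono) auto
 finally have 1: "length (levels_gates 0 bs) <= S * (1000 * (S + 1))" .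
 have "length (st 0) <= S" unfolding st.simps by (rule order_trans[OF length_stage]) (use S(2)[of 0] in simp)
 moreover have "length (st m) <= 3 * S" using st[of "m - 1"] m by simp
 moreover have "length op <= Suc m + Suc (Suc m * Suc m) + S"
  unfolding op_def by (rule order_trans[OF length_stage]) (use S(3) in simp)
 moreover have "Suc m * Suc m <= Suc S * Suc S" using S(1) by (intro mult_le_mono) auto
 moreover have "length (full bs) <= length (st 0) + length (levels_gates 0 bs) + (length (st m) + length op)"
  unfolding full_def length_append
  by (simp add: add_mono)
 ultimately have "length (full bs) <= S + S * (1000 * (S + 1)) + (3 * S + (Suc S + Suc (Suc S * Suc S) + S))"
  using 1 S(1) by linarith
 also have "... <= 2000 * (S + 2)\<^sup>2" by (simp add: power2_eq_square algebra_simps)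
 finally show ?thesis .
qed

lemma in_range_full:
 assumes q: "!!j. j < m - 1 ==> length (fresh_list j) + 3 <= q" and bs: "length bs = m - 1" and g: "g : set (full bs)"
 shows "in_range (W + m) g"
proof -
 have t: "in_range (W + m) g" if "g : set (trim W gs)" for gs g
  using that in_range_mono[of W g "W + m"] by simp
 have lev: "in_range (W + m) g" if j: "j < m - 1" and g: "g : set (level_gates b j)" for g j b
 proof -
  have r0: "in_range (W + m) g" if "g : set (refl0 j)"
  proof -
   let ?wl = "Coin j # fresh_list j"
   let ?ws = "P ?wl"
   let ?sc = "P (map Scr [0..<Suc (length ?ws)])"
   have sub: "set (?wl @ map Scr [0..<Suc (length ?ws)]) <= wires" using j q[OF j] by (auto simp del: upt_Suc)
   have dis: "distinct (?wl @ map Scr [0..<Suc (length ?ws)])" by (auto simp: distinct_map inj_on_def simp del: upt_Suc)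
   have P: "distinct (?ws @ ?sc)" "set (?ws @ ?sc) <= {..<W}"
    using distinct_P[OF dis sub] P_less[OF sub] unfolding map_append by simp_all
   have len: "length ?sc = Suc (length ?ws)" by simp
   have "last ?sc : set ?sc" by (rule last_in_set) simp
   hence "last ?sc < W" using P(2) by auto
   hence "in_range W g"
    using that cok_ladder[OF P len] unfolding refl0_def Let_def by (intro in_range_reflection) auto
   thus ?thesis by (rule in_range_mono) simp
  qed
  have rg: "in_range (W + m) g" if "g : set (reflg j)"
  proof -
   let ?wl = "[Par, Coin j]"
   let ?ws = "P ?wl"
   let ?sc = "P (map Scr [0..<3])"
   have sub: "set (?wl @ map Scr [0..<3]) <= wires" using j q[OF j] by auto
   have dis: "distinct (?wl @ map Scr [0..<3])" by (auto simp: distinct_map inj_on_def)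
   have P: "distinct (?ws @ ?sc)" "set (?ws @ ?sc) <= {..<W}"
    using distinct_P[OF dis sub] P_less[OF sub] unfolding map_append by simp_all
   have len: "length ?sc = Suc (length ?ws)" by simp
   have "last ?sc : set ?sc" by (rule last_in_set) simp
   hence "last ?sc < W + m" using P(2) by auto
   moreover have "cok (W + m) c" if "c : set (hash_cg j @ ladder ?ws ?sc)" for c
    using that cok_hash[OF j, of c] cok_ladder[OF P len, of c] cok_mono[of W c "W + m"] by auto
   ultimately show ?thesis
    using that unfolding reflg_def Let_def by (intro in_range_reflection) auto
  qed
  show ?thesis using g t r0 rg by (cases b) (auto simp only: level_gates_def if_True if_False set_append Un_iff)
 qed
 have "in_range (W + m) g" if "g : set (levels_gates j bs)" "j + length bs <= m - 1" for j bs
  using that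
 proof (induction bs arbitrary: j)
  case (Cons b bs)
  thus ?case using lev[of j g b] Cons.IH[of "Suc j"] by auto
 qed simp
 thus ?thesis using g t bs unfolding full_def by fastforce
qed

end

text \<open>
 A committer that wins the binding game with probability noticeably above 1/2 yields an inverter for
 uniformly random puzzles, whose size is polynomial in that of the committer.
\<close>

theorem inverter_exists:
 fixes D :: "nat => circuit" and E :: circuit and ver :: "bool list => bool list => real"
 assumes m: "m > 0" and D: "!!j. j <= m ==> n_out (D j) = 1" and E: "n_out E = Suc l"
  and S: "m <= S" "!!j. j <= m ==> n_anc (D j) <= S & length (gates (D j)) <= S" "n_anc E <= S" "length (gates E) <= S"
  and aa: "20 * (S + 2)\<^sup>2 <= aa"
  and v: "!!s k. 0 <= ver s k & ver s k <= 1"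
  and dl: "0 < dl" "dl <= 1" and r: "2 * (4/5) ^ r <= dl / 8"
  and win: "(1 + dl) / 2 <= value_from m E (%t b. ver (solve m t b)) (map D [0..<Suc m]) [] [] 0 empty_state"
 shows "\<exists>gs. length gs <= 2000 * (S + 2)\<^sup>2 & (\<forall>g\<in>set gs. in_range (l + aa + m) g) &
  dl\<^sup>2 / (40 * 4 ^ r) <= (\<Sum>s\<in>bits m. 1 / 2 ^ m * (\<Sum>k\<in>bits l. pmf (run (Circuit l aa gs) s) k * ver s k))"
proof -
 \<comment> \<open>scratch wires for a ladder over the coin, 2m + 1 further wires and the ancillas\<close>
 define q where "q = 3 * S + 4"
 let ?other = "(\<Union>j\<in>{..m}. round_wires m D j) Un
   {Bw, OB, Par} Un OAn ` {..<n_anc E} Un Zc ` {..<Suc (Suc m * Suc m)} Un Scr ` {..<q}"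
 define wires where "wires = (\<Union>j\<in>{..m}. round_wires m D j) Un
   {Bw, OB, Par} Un Out ` {..<l} Un OAn ` {..<n_anc E} Un Zc ` {..<Suc (Suc m * Suc m)} Un Scr ` {..<q}"
 have fin: "finite ?other" by auto
 have ci: "card (f ` {..<n}) <= n" for f :: "nat => wire" and n using card_image_le[of "{..<n}" f] by simp
 have cu: "card (A Un B) <= a + b" if "card A <= a" "card B <= b" for A B :: "wire set" and a b
  using card_Un_le[of A B] that by linarith
 have "card (round_wires m D j) <= S + S + 2 + S" if "j <= m" for j
  using S(1) S(2)[OF that] ci[of "Vw j" m] ci[of "Vc j" m] ci[of "An j" "n_anc (D j)"]
  by (intro cu) auto
 hence "card (\<Union>j\<in>{..m}. round_wires m D j) <= Suc S * (3 * S + 2)"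
 proof -
  assume c: "!!j. j <= m ==> card (round_wires m D j) <= S + S + 2 + S"
  have "card (\<Union>j\<in>{..m}. round_wires m D j) <=
    (\<Sum>j\<in>{..m}. card (round_wires m D j))"
   by (rule card_UN_le) simp
  also have "... <= (\<Sum>j\<in>{..m}. S + S + 2 + S)" by (rule sum_mono) (use c in simp)
  also have "... = Suc m * (3 * S + 2)" by simp
  also have "... <= Suc S * (3 * S + 2)" using S(1) by (intro mult_right_mono) auto
  finally show ?thesis .
 qed
 hence "card ?other <= Suc S * (3 * S + 2) + 3 + S + Suc (Suc S * Suc S) + q"
  using S(1,3) ci[of OAn "n_anc E"] ci[of Zc "Suc (Suc m * Suc m)"] ci[of Scr q] mult_le_mono[of "Suc m" "Suc S" "Suc m" "Suc S"]
  by (intro cu) auto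
 also have "... <= 20 * (S + 2)\<^sup>2" by (simp add: q_def power2_eq_square algebra_simps)
 finally have "card ?other <= card {l..<l + aa}" using aa by simp
 then obtain f where f: "f ` ?other <= {l..<l + aa}" "inj_on f ?other"
  using card_le_inj[OF fin, of "{l..<l + aa}"] by blast
 \<comment> \<open>the key is the output of the inverter, so its wires come first\<close>
 define pos where "pos w = (case w of Out t => t | _ => f w)" for w
 define oth where "oth = ?other"
 have f: "f ` oth <= {l..<l + aa}" "inj_on f oth" unfolding oth_def by (fact f)+
 have no: "Out t ~: oth" for t unfolding oth_def by auto
 have pos_other: "pos w = f w" if "w : oth" for w using that no by (cases w) (auto simp: pos_def)
 have w_split: "wires = oth Un Out ` {..<l}" unfolding wires_def oth_def by (simp only: Un_ac)
 interpret sim m l "l + aa" q D E pos wires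
 proof
  show "inj_on pos wires"
  proof (rule inj_onI)
   fix v w assume vw: "v : wires" "w : wires" "pos v = pos w"
   have o: "~ pos w < l" if "w : oth" for w using f(1) pos_other[OF that] that by force
   from vw(1,2) consider "v : oth" "w : oth" | t where "v = Out t" "t < l" | t where "w = Out t" "t < l"
    unfolding w_split by blast
   thus "v = w"
   proof cases
    case 1 thus ?thesis using vw(3) f(2) pos_other by (metis inj_onD)
   next
    case 2
    hence "~ w : oth" using o[of w] vw(3) by (auto simp: pos_def)
    thus ?thesis using vw 2 unfolding w_split by (auto simp: pos_def)
   next
    case 3
    hence "~ v : oth" using o[of v] vw(3) by (auto simp: pos_def)
    thus ?thesis using vw 3 unfolding w_split by (auto simp: pos_def)
   qed
  qed
 next
  fix w assume "w : wires"
  thus "pos w < l + aa" unfolding w_split using f(1) pos_other by (force simp: pos_def)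
 qed (use m D E wires_def in auto)
 have q: "length (fresh_list j) + 3 <= q" if "j < m - 1" for j
 proof -
  have "n_anc (D (Suc j)) <= S" using S(2)[of "Suc j"] that by simp
  thus ?thesis using S(1) by (simp add: q_def)
 qed
 obtain bs where bs: "length bs = m - 1" "2 ^ (m - 1) / 4 ^ r * (dl\<^sup>2 / 20) <=
  (\<Sum>s\<in>bits m. \<Sum>x\<in>bits (l + aa). ver s (key x) * (cmod (ap (st m @ op) (lv.circ s 0 bs (Th 0)) x))\<^sup>2)"
  using sim_success[OF v dl r win] by blast
 have "(\<Sum>s\<in>bits m. \<Sum>x\<in>bits (l + aa). ver s (key x) * (cmod (ap (st m @ op) (lv.circ s 0 bs (Th 0)) x))\<^sup>2) =
   (\<Sum>s\<in>bits m. \<Sum>k\<in>bits l. pmf (run (Circuit l aa (full bs)) s) k * ver s k)"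
 proof (rule sum.cong[OF refl])
  fix s assume "s : bits m"
  hence s: "length s = m" by simp
  show "(\<Sum>x\<in>bits (l + aa). ver s (key x) * (cmod (ap (st m @ op) (lv.circ s 0 bs (Th 0)) x))\<^sup>2) =
   (\<Sum>k\<in>bits l. pmf (run (Circuit l aa (full bs)) s) k * ver s k)"
   by (rule run_full[OF bs(1) q s refl, symmetric]) (simp_all add: pos_def)
 qed
 hence 1: "2 ^ (m - 1) / 4 ^ r * (dl\<^sup>2 / 20) <= (\<Sum>s\<in>bits m. \<Sum>k\<in>bits l. pmf (run (Circuit l aa (full bs)) s) k * ver s k)"
  using bs(2) by simp
 have "dl\<^sup>2 / (40 * 4 ^ r) = 1 / 2 ^ m * (2 ^ (m - 1) / 4 ^ r * (dl\<^sup>2 / 20))"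
  using m by (cases m) (simp_all add: field_simps)
 also have "... <= 1 / 2 ^ m * (\<Sum>s\<in>bits m. \<Sum>k\<in>bits l. pmf (run (Circuit l aa (full bs)) s) k * ver s k)"
  using 1 by (rule mult_left_mono) simp
 finally have "dl\<^sup>2 / (40 * 4 ^ r) <= (\<Sum>s\<in>bits m. 1 / 2 ^ m * (\<Sum>k\<in>bits l. pmf (run (Circuit l aa (full bs)) s) k * ver s k))"
  by (simp only: sum_distrib_left)
 moreover have "length (full bs) <= 2000 * (S + 2)\<^sup>2" by (rule length_full[OF S(1,2,4) bs(1)])
 ultimately show ?thesis using in_range_full[OF q bs(1)] by (intro exI[of _ "full bs"]) auto
qed

section \<open>Polynomial-time programs\<close>

text \<open>
 Stores as lists of the contents of the first stacks, the others being empty, and their total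
 length.
\<close>

definition stk :: "bool list list => store" where
 "stk e i = (if i < length e then e ! i else [])"

definition esize :: "bool list list => nat" where
 "esize e = sum_list (map length e)"

lemma esize_simps [simp]: "esize [] = 0" "esize (x # e) = length x + esize e" "esize (e @ e') = esize e + esize e'"
 by (simp_all add: esize_def)

lemma length_le_esize: "i < length e ==> length (e ! i) <= esize e"
 by (auto simp: esize_def intro!: member_le_sum_list)

text \<open>
 A program moved to other stacks, and the store s moved in the same way while r supplies the
 remaining stacks.
\<close>

primrec rename :: "(nat => nat) => com => com" where
 "rename \<pi> (Push x b) = Push (\<pi> x) b"
| "rename \<pi> (Pop x) = Pop (\<pi> x)"
| "rename \<pi> (Seq c d) = Seq (rename \<pi> c) (rename \<pi> d)"
| "rename \<pi> (Case x c d e) = Case (\<pi> x) (rename \<pi> c) (rename \<pi> d) (rename \<pi> e)"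
| "rename \<pi> (While x c) = While (\<pi> x) (rename \<pi> c)"

definition put :: "(nat => nat) => store => store => store" where
 "put \<pi> s r j = (if j : range \<pi> then s (inv \<pi> j) else r j)"

lemma put_at: "inj \<pi> ==> put \<pi> s r (\<pi> i) = s i"
 by (simp add: put_def)

lemma put_upd: "inj \<pi> ==> put \<pi> (s(x := v)) r = (put \<pi> s r)(\<pi> x := v)"
 by (auto simp: put_def fun_eq_iff)

lemma exec_rename:
 assumes "exec c s t s'" and \<pi>: "inj \<pi>"
 shows "exec (rename \<pi> c) (put \<pi> s r) t (put \<pi> s' r)"
 using assms(1)
proof (induction)
 case (Push x b s)
 show ?case using exec.Push[of "\<pi> x" b "put \<pi> s r"] by (simp only: put_upd[OF \<pi>] put_at[OF \<pi>] rename.simps)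
next
 case (Pop x s)
 show ?case using exec.Pop[of "\<pi> x" "put \<pi> s r"] by (simp only: put_upd[OF \<pi>] put_at[OF \<pi>] rename.simps)
qed (auto simp: put_at[OF \<pi>] simp del: One_nat_def intro: exec.intros)

lemma exec_length: "exec c s t s' ==> length (s' i) <= length (s i) + t"
 by (induction rule: exec.induct) auto

text \<open>Stacks from \<open>top c\<close> on are not touched by c.\<close>

primrec top :: "com => nat" where
 "top (Push x b) = Suc x"
| "top (Pop x) = Suc x"
| "top (Seq c d) = max (top c) (top d)"
| "top (Case x c d e) = Max {Suc x, top c, top d, top e}"
| "top (While x c) = max (Suc x) (top c)"

lemma exec_above: "exec c s t s' ==> top c <= i ==> s' i = s i"
 by (induction rule: exec.induct) auto

text \<open>c reaches the store in at most T steps.\<close>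

definition runs :: "com => store => nat => store => bool" where
 "runs c s T s' <-> (\<exists>t\<le>T. exec c s t s')"

lemma runs_le: "runs c s T s' ==> T <= T' ==> runs c s T' s'"
 by (meson runs_def le_trans)

lemma runsI: "exec c s t s' ==> t <= T ==> runs c s T s'"
 by (auto simp: runs_def)

lemma runs_Seq: "runs c s T s' ==> runs d s' T' s'' ==> runs (Seq c d) s (T + T') s''"
 by (meson runs_def add_le_mono exec.Seq)

lemma runs_length: "runs c s T s' ==> length (s' i) <= length (s i) + T"
 using exec_length unfolding runs_def by (meson add_left_mono le_trans)

lemma runs_step: "runs c s T s' ==> (!!t. exec c s t s' ==> exec d s (Suc t) s') ==> runs d s (Suc T) s'"
 unfolding runs_def by (meson Suc_le_mono)

text \<open>
 Empties stack i onto each of the given stacks, which reverses it; a copy is made by pouring twice.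
\<close>

definition pour :: "nat => nat list => com" where
 "pour i js = While i (Case i (Pop i) (foldr (%j. Seq (Push j False)) js (Pop i)) (foldr (%j. Seq (Push j True)) js (Pop i)))"

definition clear :: "nat => com" where
 "clear i = While i (Pop i)"

lemma exec_Pop': "s' = s(x := tl (s x)) ==> exec (Pop x) s 1 s'"
 by (simp only: exec.Pop)

lemma exec_pushes:
 "i ~: set js ==> distinct js ==> exec (foldr (%j. Seq (Push j b)) js (Pop i)) s (Suc (length js))
  (%k. if k : set js then b # s k else if k = i then tl (s k) else s k)"
proof (induction js arbitrary: s)
 case Nil
 show ?case using exec_Pop'[of _ s i] by (auto simp: fun_eq_iff)
next
 case (Cons j js)
 let ?s = "s(j := b # s j)"
 have "exec (foldr (%j. Seq (Push j b)) (j # js) (Pop i)) s (1 + Suc (length js))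
   (%k. if k : set js then b # ?s k else if k = i then tl (?s k) else ?s k)"
  unfolding foldr.simps o_apply by (rule exec.Seq[OF exec.Push Cons.IH]) (use Cons.prems in auto)
 moreover have "(%k. if k : set js then b # ?s k else if k = i then tl (?s k) else ?s k) =
   (%k. if k : set (j # js) then b # s k else if k = i then tl (s k) else s k)"
  using Cons.prems by (auto simp: fun_eq_iff)
 ultimately show ?case by simp
qed

lemma exec_pour: "i ~: set js ==> distinct js ==> exec (pour i js) s (1 + (3 + length js) * length (s i))
 (%k. if k : set js then rev (s i) @ s k else if k = i then [] else s k)"
proof (induction "s i" arbitrary: s)
 case Nil
 hence "(%k. if k : set js then rev (s i) @ s k else if k = i then [] else s k) = s" by (auto simp: fun_eq_iff)
 thus ?case using Nil exec.While_Nil[of s i] by (simp add: pour_def)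
next
 case (Cons b xs)
 let ?s = "%k. if k : set js then b # s k else if k = i then tl (s k) else s k"
 have si: "s i = b # xs" using Cons by simp
 have "exec (Case i (Pop i) (foldr (%j. Seq (Push j False)) js (Pop i)) (foldr (%j. Seq (Push j True)) js (Pop i)))
   s (Suc (Suc (length js))) ?s"
  using si exec_pushes[OF Cons.prems, of b s] by (cases b) (auto intro: exec.Case_True exec.Case_False)
 moreover have "exec (pour i js) ?s (1 + (3 + length js) * length (?s i))
   (%k. if k : set js then rev (?s i) @ ?s k else if k = i then [] else ?s k)"
  by (rule Cons.hyps(1)) (use Cons.prems si in auto)
 ultimately have "exec (pour i js) s (Suc (Suc (Suc (length js)) + (1 + (3 + length js) * length (?s i))))
   (%k. if k : set js then rev (?s i) @ ?s k else if k = i then [] else ?s k)"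
  unfolding pour_def using si by (intro exec.While_Cons) auto
 moreover have "(%k. if k : set js then rev (?s i) @ ?s k else if k = i then [] else ?s k) =
   (%k. if k : set js then rev (s i) @ s k else if k = i then [] else s k)"
  using Cons.prems si by (auto simp: fun_eq_iff)
 ultimately show ?case using Cons.prems si by (simp add: eval_nat_numeral)
qed

lemma exec_clear: "exec (clear i) s (1 + 2 * length (s i)) (s(i := []))"
proof (induction "s i" arbitrary: s)
 case Nil
 thus ?case unfolding clear_def using exec.While_Nil[of s i "Pop i"] by (simp add: fun_upd_idem)
next
 case (Cons b xs)
 let ?s = "s(i := tl (s i))"
 have "exec (clear i) s (Suc (1 + (1 + 2 * length (?s i)))) (?s(i := []))"
  using Cons(1)[of ?s] Cons(2)[symmetric] unfolding clear_def by (intro exec.While_Cons[OF _ exec_Pop']) auto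
 thus ?case using Cons(2)[symmetric] by simp
qed

text \<open>
 An environment lists the functions of a parameter p whose values are on the stacks. Time bounds
 are polynomial in the total length of these values.
\<close>

abbreviation vals :: "('p => bool list) list => 'p => bool list list" where
 "vals E p == map (%f. f p) E"

definition pbound :: "('p => bool list) list => ('p => nat) => bool" where
 "pbound E T <-> (\<exists>k. \<forall>p. T p <= (esize (vals E p) + 2) ^ k)"

lemma pbound_le: "pbound E T ==> (!!p. T' p <= T p) ==> pbound E T'"
 unfolding pbound_def by (meson le_trans)

lemma pow2_mono: "j <= k ==> (x + 2) ^ j <= (x + 2 :: nat) ^ k"
 by (rule power_increasing) auto

lemma le_pow2: "c <= (x + 2 :: nat) ^ c"
proof -
 have "c < 2 ^ c" by (rule less_exp)
 also have "... <= (x + 2) ^ c" by (rule power_mono) auto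
 finally show ?thesis by simp
qed

lemma pbound_const: "pbound E (%_. c)"
 unfolding pbound_def by (rule exI[of _ c]) (rule allI, rule le_pow2)

lemma pbound_esize: "pbound E (%p. esize (vals E p))"
 unfolding pbound_def by (rule exI[of _ 1]) simp

lemma pbound_add: "pbound E S ==> pbound E T ==> pbound E (%p. S p + T p)"
proof -
 assume "pbound E S" "pbound E T"
 then obtain j k where jk: "!!p. S p <= (esize (vals E p) + 2) ^ j" "!!p. T p <= (esize (vals E p) + 2) ^ k"
  unfolding pbound_def by blast
 have "S p + T p <= (esize (vals E p) + 2) ^ Suc (max j k)" for p
 proof -
  let ?x = "esize (vals E p)"
  have "S p + T p <= (?x + 2) ^ max j k + (?x + 2) ^ max j k"
   by (intro add_mono order_trans[OF jk(1)] order_trans[OF jk(2)] pow2_mono) simp_all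
  thus ?thesis by simp
 qed
 thus ?thesis unfolding pbound_def by blast
qed

lemma pbound_mult: "pbound E S ==> pbound E T ==> pbound E (%p. S p * T p)"
proof -
 assume "pbound E S" "pbound E T"
 then obtain j k where jk: "!!p. S p <= (esize (vals E p) + 2) ^ j" "!!p. T p <= (esize (vals E p) + 2) ^ k"
  unfolding pbound_def by blast
 have "S p * T p <= (esize (vals E p) + 2) ^ (j + k)" for p
  using mult_le_mono[OF jk(1) jk(2)] by (simp only: power_add)
 thus ?thesis unfolding pbound_def by blast
qed

lemma pbound_power: "pbound E S ==> pbound E (%p. S p ^ k)"
 by (induction k) (auto intro: pbound_const pbound_mult)

lemma pbound_trans:
 assumes "pbound F T" "pbound E (%p. esize (vals F p))"
 shows "pbound E T"
proof -
 obtain k where k: "!!p. T p <= (esize (vals F p) + 2) ^ k" using assms(1) unfolding pbound_def by blast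
 have "pbound E (%p. (esize (vals F p) + 2) ^ k)" by (intro pbound_power pbound_add assms(2) pbound_const)
 thus ?thesis using k by (rule pbound_le)
qed

text \<open>From the values of E on the stacks, a program computes those of F in polynomial time.\<close>

definition ptrans :: "('p => bool list) list => ('p => bool list) list => bool" where
 "ptrans E F <-> (\<exists>c T. pbound E T & (\<forall>p. runs c (stk (vals E p)) (T p) (stk (vals F p))))"

lemma ptransI: "pbound E T ==> (!!p. runs c (stk (vals E p)) (T p) (stk (vals F p))) ==> ptrans E F"
 unfolding ptrans_def by blast

lemma ptrans_esize:
 assumes "ptrans E F"
 shows "pbound E (%p. esize (vals F p))"
proof -
 obtain T c where T: "pbound E T" "!!p. runs c (stk (vals E p)) (T p) (stk (vals F p))" using assms unfolding ptrans_def by blast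
 have "esize (vals F p) <= length F * (esize (vals E p) + T p)" for p
 proof -
  have "length (vals F p ! i) <= esize (vals E p) + T p" if "i < length (vals F p)" for i
  proof -
   have "length (vals F p ! i) = length (stk (vals F p) i)" using that by (simp add: stk_def)
   also have "... <= length (stk (vals E p) i) + T p" by (rule runs_length[OF T(2)])
   also have "... <= esize (vals E p) + T p"
    using length_le_esize[of i "vals E p"] by (auto simp: stk_def)
   finally show ?thesis .
  qed
  hence "sum_list (map length (vals F p)) <= sum_list (map (%_. esize (vals E p) + T p) (vals F p))"
   by (intro sum_list_mono) (metis in_set_conv_nth)
  thus ?thesis by (simp add: esize_def sum_list_triv)
 qed
 thus ?thesis by (rule pbound_le[rotated]) (intro pbound_mult pbound_add pbound_const pbound_esize T(1))
qed

lemma ptrans_trans: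
 assumes "ptrans E F" "ptrans F G"
 shows "ptrans E G"
proof -
 obtain T c where 1: "pbound E T" "!!p. runs c (stk (vals E p)) (T p) (stk (vals F p))" using assms(1) unfolding ptrans_def by blast
 obtain T' d where 2: "pbound F T'" "!!p. runs d (stk (vals F p)) (T' p) (stk (vals G p))" using assms(2) unfolding ptrans_def by blast
 have "pbound E (%p. T p + T' p)" by (intro pbound_add 1 pbound_trans[OF 2(1) ptrans_esize[OF assms(1)]])
 thus ?thesis by (rule ptransI) (rule runs_Seq[OF 1(2) 2(2)])
qed

lemma ptrans_single: "(!!p. exec c (stk (vals E p)) t (stk (vals F p))) ==> ptrans E F"
 by (rule ptransI[of _ "%_. t" c]) (auto simp: pbound_const intro: runsI)

lemma ptrans_refl: "ptrans E E"
proof (rule ptrans_single)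
 show "exec (Seq (Push 0 True) (Pop 0)) (stk (vals E p)) (1 + 1) (stk (vals E p))" for p
  by (rule exec.Seq[OF exec.Push exec_Pop']) simp
qed

lemma ptrans_copy:
 assumes "f : set E"
 shows "ptrans E (E @ [f])"
proof -
 obtain i where i: "i < length E" "E ! i = f" using assms by (metis in_set_conv_nth)
 let ?a = "length E"
 let ?c = "Seq (pour i [?a + 1, ?a + 2]) (Seq (pour (?a + 1) [i]) (pour (?a + 2) [?a]))"
 let ?T = "%x. (1 + (3 + 2) * x) + ((1 + (3 + 1) * x) + (1 + (3 + 1) * x :: nat))"
 have "runs ?c (stk (vals E p)) (?T (esize (vals E p))) (stk (vals (E @ [f]) p))" for p
 proof -
  have x: "length (f p) <= esize (vals E p)" using length_le_esize[of i "vals E p"] i by simp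
  let ?s1 = "(stk (vals E p))(i := [], ?a + 1 := rev (f p), ?a + 2 := rev (f p))"
  let ?s2 = "?s1(?a + 1 := [], i := f p)" and ?s3 = "stk (vals (E @ [f]) p)"
  have m: "exec c s t s'" if "exec c s t' s''" "t' = t" "s'' = s'" for c s t s' t' s'' using that by simp
  have 1: "exec (pour i [?a + 1, ?a + 2]) (stk (vals E p)) (1 + (3 + 2) * length (f p)) ?s1"
   by (rule m[OF exec_pour]) (use i in \<open>auto simp: stk_def fun_eq_iff\<close>)
  have 2: "exec (pour (?a + 1) [i]) ?s1 (1 + (3 + 1) * length (f p)) ?s2"
   by (rule m[OF exec_pour]) (use i in \<open>auto simp: fun_eq_iff\<close>)
  have 3: "exec (pour (?a + 2) [?a]) ?s2 (1 + (3 + 1) * length (f p)) ?s3"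
   by (rule m[OF exec_pour]) (use i in \<open>auto simp: stk_def fun_eq_iff nth_append\<close>)
  show ?thesis by (rule runs_Seq[OF runsI[OF 1] runs_Seq[OF runsI[OF 2] runsI[OF 3]]]) (use x in simp_all)
 qed
 thus ?thesis by (intro ptransI[of _ "%p. ?T (esize (vals E p))"] pbound_add pbound_mult pbound_const pbound_esize)
qed

lemma runs_remove:
 "\<exists>c. \<forall>e x g. length e = a --> length g = b -->
   runs c (stk (e @ x # g)) (8 * esize (x # g) + 3 * b + 1) (stk (e @ g))"
proof (induction b arbitrary: a)
 case 0
 have "runs (clear a) (stk (e @ [x])) (8 * length x + 1) (stk e)" if "length e = a" for e x
 proof -
  have "exec (clear a) (stk (e @ [x])) (1 + 2 * length x) ((stk (e @ [x]))(a := []))"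
   using exec_clear[of a "stk (e @ [x])"] that by (simp add: stk_def nth_append)
  moreover have "(stk (e @ [x]))(a := []) = stk e" using that by (auto simp: stk_def fun_eq_iff nth_append)
  ultimately show ?thesis by (auto intro: runsI)
 qed
 thus ?case by (intro exI[of _ "clear a"]) auto
next
 case (Suc b)
 obtain d where d: "!!e x g. length e = Suc a ==> length g = b ==>
   runs d (stk (e @ x # g)) (8 * esize (x # g) + 3 * b + 1) (stk (e @ g))" using Suc[of "Suc a"] by blast
 let ?t = "a + b + 2"
 let ?c = "Seq (clear a) (Seq (pour (Suc a) [?t]) (Seq (pour ?t [a]) d))"
 have "runs ?c (stk (e @ x # g)) (8 * esize (x # g) + 3 * Suc b + 1) (stk (e @ g))"
  if e: "length e = a" and g: "length g = Suc b" for e x g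
 proof -
  obtain y g' where gy: "g = y # g'" using g by (cases g) auto
  let ?s = "stk (e @ x # g)"
  let ?s1 = "?s(a := [])"
  let ?s2 = "?s1(Suc a := [], ?t := rev y)" and ?s3 = "stk ((e @ [y]) @ [] # g')"
  have m: "exec c s t s'" if "exec c s t' s''" "t' = t" "s'' = s'" for c s t s' t' s'' using that by simp
  have 1: "exec (clear a) ?s (1 + 2 * length x) ?s1"
   using exec_clear[of a ?s] e by (simp add: stk_def nth_append)
  have 2: "exec (pour (Suc a) [?t]) ?s1 (1 + 4 * length y) ?s2"
   by (rule m[OF exec_pour]) (use e g gy in \<open>auto simp: stk_def fun_eq_iff nth_append\<close>)
  have 3: "exec (pour ?t [a]) ?s2 (1 + 4 * length y) ?s3"
   by (rule m[OF exec_pour]) (use e g gy in \<open>auto simp: stk_def fun_eq_iff nth_append nth_Cons split: nat.splits\<close>)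
  have 4: "runs d ?s3 (8 * esize ([] # g') + 3 * b + 1) (stk ((e @ [y]) @ g'))"
   using e g gy by (intro d) auto
  have "runs ?c ?s ((1 + 2 * length x) + ((1 + 4 * length y) + ((1 + 4 * length y) + (8 * esize ([] # g') + 3 * b + 1)))) (stk ((e @ [y]) @ g'))"
   by (rule runs_Seq[OF runsI[OF 1] runs_Seq[OF runsI[OF 2] runs_Seq[OF runsI[OF 3] 4]]]) simp_all
  hence "runs ?c ?s (8 * esize (x # g) + 3 * Suc b + 1) (stk ((e @ [y]) @ g'))" by (rule runs_le) (simp add: gy)
  thus ?thesis by (simp add: gy)
 qed
 thus ?case by blast
qed

lemma ptrans_remove: "ptrans (E @ H @ G) (E @ G)"
proof (induction H)
 case (Cons x H)
 obtain c where c: "!!e x g. length e = length E ==> length g = length (H @ G) ==>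
   runs c (stk (e @ x # g)) (8 * esize (x # g) + 3 * length (H @ G) + 1) (stk (e @ g))"
  using runs_remove[of "length E" "length (H @ G)"] by blast
 let ?T = "%p. 8 * esize (vals (E @ (x # H) @ G) p) + 3 * length (H @ G) + 1"
 have "runs c (stk (vals (E @ (x # H) @ G) p)) (?T p) (stk (vals (E @ H @ G) p))" for p
  using c[of "vals E p" "vals (H @ G) p" "x p"] by (simp add: runs_le)
 hence "ptrans (E @ (x # H) @ G) (E @ H @ G)"
  by (intro ptransI[of _ ?T] pbound_add pbound_mult pbound_const pbound_esize)
 thus ?case using Cons by (rule ptrans_trans)
qed (simp add: ptrans_refl)

text \<open>A program leaves all stacks alone that it does not mention, and it can be moved to other stacks.\<close>

lemma ptrans_frame:
 assumes "ptrans E (H @ X)" "length H = length E"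
 shows "ptrans (F @ E @ G) (F @ H @ G @ X)"
proof -
 let ?a = "length E" and ?b = "length F" and ?c = "length G"
 obtain T d where d: "pbound E T" "!!p. runs d (stk (vals E p)) (T p) (stk (vals (H @ X) p))" using assms(1) unfolding ptrans_def by blast
 define \<pi> where "\<pi> i = (if i < ?a then i + ?b else i + ?b + ?c)" for i
 have inj: "inj \<pi>" by (auto simp: inj_on_def \<pi>_def split: if_splits)
 have put: "put \<pi> (stk (e @ x)) (stk (vals (F @ E @ G) p)) = stk (vals F p @ e @ vals G p @ x)" if e: "length e = ?a" for e x p
 proof
  fix j
  show "put \<pi> (stk (e @ x)) (stk (vals (F @ E @ G) p)) j = stk (vals F p @ e @ vals G p @ x) j"
  proof (cases "j : range \<pi>")
   case True
   then obtain i where j: "j = \<pi> i" by blast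
   show ?thesis unfolding j put_at[OF inj] using e by (auto simp: stk_def nth_append \<pi>_def)
  next
   case False
   have "~ (?b <= j & j < ?b + ?a)"
   proof
    assume "?b <= j & j < ?b + ?a"
    hence "j = \<pi> (j - ?b)" by (auto simp: \<pi>_def)
    thus False using False by blast
   qed
   moreover have "~ j \<ge> ?a + ?b + ?c"
   proof
    assume "j \<ge> ?a + ?b + ?c"
    hence "j = \<pi> (j - ?b - ?c)" by (auto simp: \<pi>_def)
    thus False using False by blast
   qed
   ultimately show ?thesis using False e by (auto simp: put_def stk_def nth_append)
  qed
 qed
 have "runs (rename \<pi> d) (stk (vals (F @ E @ G) p)) (T p) (stk (vals (F @ H @ G @ X) p))" for p
  using d(2)[of p] exec_rename[OF _ inj, of d "stk (vals E p)" _ "stk (vals (H @ X) p)" "stk (vals (F @ E @ G) p)"]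
   put[of "vals E p" "[]" p] put[of "vals H p" "vals X p" p] assms(2)
  unfolding runs_def by auto
 moreover have "pbound (F @ E @ G) T"
  by (rule pbound_trans[OF d(1)], rule pbound_le[OF pbound_esize]) simp
 ultimately show ?thesis by (rule ptransI[rotated])
qed

text \<open>f is computable in polynomial time from the values in the environment.\<close>

definition pcomp :: "('p => bool list) list => ('p => bool list) => bool" where
 "pcomp E f <-> ptrans E (E @ [f])"

lemma pcomp_append_list: "(!!g. g : set gs ==> pcomp E g) ==> ptrans E (E @ gs)"
proof (induction gs rule: rev_induct)
 case (snoc g gs)
 have "ptrans ([] @ E @ gs) ([] @ E @ gs @ [g])"
  by (rule ptrans_frame) (use snoc.prems in \<open>simp_all add: pcomp_def\<close>)
 thus ?case using snoc by (auto intro: ptrans_trans)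
qed (simp add: ptrans_refl)

text \<open>Whatever is computable from computable values is computable.\<close>

lemma pcomp_via:
 assumes "!!g. g : set gs ==> pcomp E g" "pcomp gs f"
 shows "pcomp E f"
proof -
 have 1: "ptrans E (E @ gs)" using assms(1) by (rule pcomp_append_list)
 have 2: "ptrans (E @ gs @ []) (E @ gs @ [] @ [f])"
  by (rule ptrans_frame) (use assms(2) in \<open>simp_all add: pcomp_def\<close>)
 show ?thesis unfolding pcomp_def
  by (rule ptrans_trans[OF 1]) (use ptrans_trans[OF 2[simplified] ptrans_remove[of E gs "[f]"]] in simp)
qed

lemma pcomp_proj: "f : set E ==> pcomp E f"
 unfolding pcomp_def by (rule ptrans_copy)

lemma pcomp_weaken: "pcomp E f ==> set E <= set F ==> pcomp F f"
 by (rule pcomp_via[of E F f]) (auto intro: pcomp_proj)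

lemma pcomp_reparam:
 assumes "pcomp E f"
 shows "pcomp (map (%g p. g (h p)) E) (%p. f (h p))"
proof -
 obtain T c where "pbound E T" "!!p. runs c (stk (vals E p)) (T p) (stk (vals (E @ [f]) p))"
  using assms unfolding pcomp_def ptrans_def by blast
 thus ?thesis
  unfolding pcomp_def by (intro ptransI[of _ "%p. T (h p)" c]) (auto simp: pbound_def o_def)
qed

lemma pcomp_last:
 assumes "pcomp E f" "ptrans (E @ [f]) (E @ [g])"
 shows "pcomp E g"
 using ptrans_trans assms unfolding pcomp_def by blast

lemma pcomp_let:
 assumes "pcomp E g" "pcomp (E @ [g]) f"
 shows "pcomp E f"
 by (rule pcomp_last[OF assms(1)])
  (use ptrans_trans[OF assms(2)[unfolded pcomp_def], of "E @ [f]"] ptrans_remove[of E "[g]" "[f]"] in simp)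

lemma pcomp_Nil: "pcomp E (%_. [])"
 unfolding pcomp_def
 by (rule ptrans_single[where c = "Pop (length E)"], rule exec_Pop') (auto simp: stk_def fun_eq_iff nth_append)

lemma pcomp_Cons: "pcomp E f ==> pcomp E (%p. b # f p)"
proof (erule pcomp_last, rule ptrans_single)
 fix p
 have "stk (vals (E @ [%p. b # f p]) p) = (stk (vals (E @ [f]) p))(length E := b # stk (vals (E @ [f]) p) (length E))"
  by (auto simp: stk_def fun_eq_iff nth_append)
 thus "exec (Push (length E) b) (stk (vals (E @ [f]) p)) 1 (stk (vals (E @ [%p. b # f p]) p))"
  using exec.Push by simp
qed

lemma pcomp_tl: "pcomp E f ==> pcomp E (%p. tl (f p))"
 by (erule pcomp_last, rule ptrans_single[where c = "Pop (length E)"], rule exec_Pop')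
  (auto simp: stk_def fun_eq_iff nth_append)

lemma pcomp_const: "pcomp E (%_. xs)"
 by (induction xs) (auto intro: pcomp_Nil pcomp_Cons)

lemma pcomp_case:
 assumes "pcomp E x" "pcomp E f" "pcomp E g" "pcomp E h"
 shows "pcomp E (%p. case x p of [] => f p | b # _ => if b then g p else h p)"
proof (rule pcomp_let[OF assms(1)])
 let ?r = "%p. case x p of [] => f p | b # _ => if b then g p else h p"
 let ?E = "E @ [x]" and ?a = "length E"
 have w: "ptrans ?E (?E @ [u])" if "pcomp E u" for u using pcomp_weaken[OF that, of ?E] by (auto simp: pcomp_def)
 obtain Tf cf where cf: "pbound ?E Tf" "!!p. runs cf (stk (vals ?E p)) (Tf p) (stk (vals (?E @ [f]) p))"
  using w[OF assms(2)] unfolding ptrans_def by blast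
 obtain Tg cg where cg: "pbound ?E Tg" "!!p. runs cg (stk (vals ?E p)) (Tg p) (stk (vals (?E @ [g]) p))"
  using w[OF assms(3)] unfolding ptrans_def by blast
 obtain Th ch where ch: "pbound ?E Th" "!!p. runs ch (stk (vals ?E p)) (Th p) (stk (vals (?E @ [h]) p))"
  using w[OF assms(4)] unfolding ptrans_def by blast
 have "runs (Case ?a cf ch cg) (stk (vals ?E p)) (1 + (Tf p + (Tg p + Th p))) (stk (vals (?E @ [?r]) p))" for p
 proof -
  have s: "stk (vals ?E p) ?a = x p" by (simp add: stk_def nth_append)
  show ?thesis
  proof (cases "x p")
   case Nil
   have "runs (Case ?a cf ch cg) (stk (vals ?E p)) (Suc (Tf p)) (stk (vals (?E @ [f]) p))"
    by (rule runs_step[OF cf(2)], rule exec.Case_Nil) (use s Nil in simp_all)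
   thus ?thesis using Nil by (auto intro: runs_le)
  next
   case (Cons b bs)
   have "runs (Case ?a cf ch cg) (stk (vals ?E p)) (Suc (Tg p)) (stk (vals (?E @ [g]) p))" if b
    by (rule runs_step[OF cg(2)], rule exec.Case_True) (use s Cons that in simp_all)
   moreover have "runs (Case ?a cf ch cg) (stk (vals ?E p)) (Suc (Th p)) (stk (vals (?E @ [h]) p))" if "~ b"
    by (rule runs_step[OF ch(2)], rule exec.Case_False) (use s Cons that in simp_all)
   ultimately show ?thesis using Cons by (cases b) (auto intro: runs_le)
  qed
 qed
 thus "pcomp ?E ?r" unfolding pcomp_def
  by (rule ptransI[rotated]) (intro pbound_add pbound_const cf cg ch)
qed

lemma pcomp_cong: "(!!p. f p = g p) ==> pcomp E f ==> pcomp E g"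
 by (simp add: pcomp_def ptrans_def)

lemma runs_While:
 assumes L: "!!p b xs s. runs c (stk (vals E p @ (b # xs) # enc s))
   ((esize (vals E p @ (b # xs) # enc s) + 2) ^ k) (stk (vals E p @ xs # enc (step p b s)))"
  and B: "!!i. i <= length xs ==> esize (enc (fold (step p) (take i xs) s)) <= B"
 shows "runs (While (length E) c) (stk (vals E p @ xs # enc s)) (1 + length xs * (1 + (esize (vals E p) + length xs + B + 2) ^ k))
   (stk (vals E p @ [] # enc (fold (step p) xs s)))"
proof -
 have "runs (While (length E) c) (stk (vals E p @ xs # enc s)) (1 + length xs * (1 + (esize (vals E p) + N + B + 2) ^ k))
   (stk (vals E p @ [] # enc (fold (step p) xs s)))"
  if "length xs <= N" "!!i. i <= length xs ==> esize (enc (fold (step p) (take i xs) s)) <= B" for xs s N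
  using that
 proof (induction xs arbitrary: s)
  case Nil
  have "exec (While (length E) c) (stk (vals E p @ [] # enc s)) 1 (stk (vals E p @ [] # enc s))"
   by (rule exec.While_Nil) (simp add: stk_def nth_append)
  thus ?case by (simp add: runsI)
 next
  case (Cons b xs)
  have "esize (vals E p @ (b # xs) # enc s) + 2 <= esize (vals E p) + N + B + 2"
   using Cons.prems(1) Cons.prems(2)[of 0] by simp
  hence "(esize (vals E p @ (b # xs) # enc s) + 2) ^ k <= (esize (vals E p) + N + B + 2) ^ k" by (rule power_mono) simp
  then obtain t1 where t1: "t1 <= (esize (vals E p) + N + B + 2) ^ k"
    "exec c (stk (vals E p @ (b # xs) # enc s)) t1 (stk (vals E p @ xs # enc (step p b s)))"
   using L[of p b xs s] unfolding runs_def by (meson le_trans)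
  have "esize (enc (fold (step p) (take i xs) (step p b s))) <= B" if "i <= length xs" for i
   using Cons.prems(2)[of "Suc i"] that by simp
  then obtain t2 where t2: "t2 <= 1 + length xs * (1 + (esize (vals E p) + N + B + 2) ^ k)"
    "exec (While (length E) c) (stk (vals E p @ xs # enc (step p b s))) t2 (stk (vals E p @ [] # enc (fold (step p) xs (step p b s))))"
   using Cons.IH[of "step p b s"] Cons.prems(1) unfolding runs_def by auto
  have "exec (While (length E) c) (stk (vals E p @ (b # xs) # enc s)) (Suc (t1 + t2)) (stk (vals E p @ [] # enc (fold (step p) xs (step p b s))))"
   by (rule exec.While_Cons[OF _ t1(2) t2(2)]) (simp add: stk_def nth_append)
  moreover have "Suc (t1 + t2) <= 1 + length (b # xs) * (1 + P)" if "t1 <= P" "t2 <= 1 + length xs * (1 + P)" for P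
  proof -
   have "length (b # xs) * (1 + P) = length xs * (1 + P) + (1 + P)" by simp
   thus ?thesis using that by linarith
  qed
  ultimately show ?case using t1(1) t2(1) by (simp only: fold.simps o_apply runsI)
 qed
 from this[OF order_refl B] show ?thesis .
qed

text \<open>
 Iteration over the bits of a string. The state of type 's is held on three stacks. The step is
 computed from the parameters, the current bit and the state.
\<close>

definition fenv :: "('p => bool list) list => ('s => bool list) => ('s => bool list) => ('s => bool list) =>
  ('p \<times> bool \<times> 's => bool list) list" where
 "fenv E e1 e2 e3 = map (%g q. g (fst q)) E @ [%q. [fst (snd q)], %q. e1 (snd (snd q)), %q. e2 (snd (snd q)), %q. e3 (snd (snd q))]"

lemma fold_inv:
 assumes "I 0 s" "!!i b s. i < length xs ==> I i s ==> I (Suc i) (step b s)"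
 shows "i <= length xs ==> I i (fold step (take i xs) s)"
proof (induction i)
 case (Suc i)
 thus ?case using assms(2)[of i _ "xs ! i"] by (simp add: take_Suc_conv_app_nth)
qed (use assms(1) in simp)

text \<open>The invariant I, which may depend on the number of steps, bounds the size of the state.\<close>

lemma pcomp_iter:
 fixes e1 e2 e3 :: "'s => bool list" and step :: "'p => bool => 's => 's"
 assumes X: "pcomp E X"
  and init: "pcomp E (%p. e1 (init p))" "pcomp E (%p. e2 (init p))" "pcomp E (%p. e3 (init p))"
  and step: "pcomp (fenv E e1 e2 e3) (%q. e1 (step (fst q) (fst (snd q)) (snd (snd q))))"
   "pcomp (fenv E e1 e2 e3) (%q. e2 (step (fst q) (fst (snd q)) (snd (snd q))))"
   "pcomp (fenv E e1 e2 e3) (%q. e3 (step (fst q) (fst (snd q)) (snd (snd q))))"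
  and B: "pbound E B" "!!p. I p 0 (init p)" "!!p i b s. i < length (X p) ==> I p i s ==> I p (Suc i) (step p b s)"
   "!!p i s. i <= length (X p) ==> I p i s ==> length (e1 s) + length (e2 s) + length (e3 s) <= B p"
 shows "pcomp E (%p. e1 (fold (step p) (X p) (init p)))"
proof -
 define enc where "enc s = [e1 s, e2 s, e3 s]" for s
 \<comment> \<open>the parameters of the loop body: p, current bit, remaining bits, state\<close>
 let ?E = "map (%g (q :: 'p \<times> bool \<times> bool list \<times> 's). g (fst q)) E"
 let ?s = "%q. snd (snd (snd q))" and ?S = "%q. step (fst q) (fst (snd q)) (snd (snd (snd q)))"
 let ?old = "[%q. fst (snd q) # fst (snd (snd q)), %q. e1 (?s q), %q. e2 (?s q), %q. e3 (?s q)]"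
 let ?new = "[%q. fst (snd (snd q)), %q. e1 (?S q), %q. e2 (?S q), %q. e3 (?S q)]"
 let ?L = "?E @ ?old"
 have p: "pcomp ?L (%q. fst (snd q) # fst (snd (snd q)))" by (rule pcomp_proj) simp
 have bit: "pcomp ?L (%q. [fst (snd q)])"
  by (rule pcomp_cong[OF _ pcomp_case[OF p pcomp_const[of _ "[]"] pcomp_const[of _ "[True]"] pcomp_const[of _ "[False]"]]]) simp
 have new: "pcomp ?L (%q. f (fst q, fst (snd q), ?s q))" if f: "pcomp (fenv E e1 e2 e3) f" for f
 proof (rule pcomp_via)
  show "pcomp (map (%g q. g (fst q, fst (snd q), ?s q)) (fenv E e1 e2 e3)) (%q. f (fst q, fst (snd q), ?s q))"
   by (rule pcomp_reparam[OF f])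
  show "pcomp ?L g" if "g : set (map (%g q. g (fst q, fst (snd q), ?s q)) (fenv E e1 e2 e3))" for g
  proof -
   have "g = (%q. [fst (snd q)]) | g : set ?L" using that by (auto simp: fenv_def)
   thus ?thesis using bit pcomp_proj[of g ?L] by blast
  qed
 qed
 have "pcomp ?L g" if "g : set ?new" for g
  using that new[OF step(1)] new[OF step(2)] new[OF step(3)] pcomp_tl[OF p] by auto
 hence "ptrans ?L (?E @ ?new)"
  using ptrans_trans[OF pcomp_append_list[of ?new ?L] ptrans_remove[of ?E ?old ?new, simplified append_assoc[symmetric]]]
  by (simp only: append_assoc)
 then obtain T c where T: "pbound ?L T" "!!q. runs c (stk (vals ?L q)) (T q) (stk (vals (?E @ ?new) q))" unfolding ptrans_def by blast
 then obtain k where k: "!!q. T q <= (esize (vals ?L q) + 2) ^ k" unfolding pbound_def by blast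
 have L: "runs c (stk (vals E p @ (b # xs) # enc s)) ((esize (vals E p @ (b # xs) # enc s) + 2) ^ k) (stk (vals E p @ xs # enc (step p b s)))" for p b xs s
  using runs_le[OF T(2) k, of "(p, b, xs, s)"] by (simp add: enc_def o_def)
 let ?i = "[X, %p. e1 (init p), %p. e2 (init p), %p. e3 (init p)]" and ?f = "%p. fold (step p) (X p) (init p)"
 let ?r = "[%p. [], %p. e1 (?f p), %p. e2 (?f p), %p. e3 (?f p)]"
 have 1: "ptrans E (E @ ?i)" by (rule pcomp_append_list) (use X init in auto)
 have XB: "pbound E (%p. length (X p))" by (rule pbound_le[OF ptrans_esize[OF 1]]) simp
 obtain T' c' where c': "pbound E T'" "!!p. runs c' (stk (vals E p)) (T' p) (stk (vals (E @ ?i) p))" using 1 unfolding ptrans_def by blast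
 have W: "runs (While (length E) c) (stk (vals (E @ ?i) p)) (1 + length (X p) * (1 + (esize (vals E p) + length (X p) + B p + 2) ^ k))
   (stk (vals (E @ ?r) p))" for p
 proof -
  have "esize (enc (fold (step p) (take i (X p)) (init p))) <= B p" if i: "i <= length (X p)" for i
  proof -
   have "I p i (fold (step p) (take i (X p)) (init p))" by (rule fold_inv[of "I p", OF B(2,3) i])
   from B(4)[OF i this] show ?thesis by (simp add: enc_def)
  qed
  from runs_While[OF L this] show ?thesis by (simp add: enc_def)
 qed
 have "pbound E (%p. T' p + (1 + length (X p) * (1 + (esize (vals E p) + length (X p) + B p + 2) ^ k)))"
  by (intro pbound_add pbound_mult pbound_power pbound_const pbound_esize c' XB B)
 hence 2: "ptrans E (E @ ?r)" by (rule ptransI) (rule runs_Seq[OF c'(2) W])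
 have 3: "ptrans (E @ ?r) (E @ tl ?r)" using ptrans_remove[of E "[hd ?r]" "tl ?r"] by simp
 have 4: "ptrans (E @ tl ?r) (E @ [%p. e1 (?f p)])" using ptrans_remove[of "E @ [%p. e1 (?f p)]" "tl (tl ?r)" "[]"] by simp
 show ?thesis unfolding pcomp_def by (rule ptrans_trans[OF 2 ptrans_trans[OF 3 4]])
qed

text \<open>The security parameter, in unary, is the only input of \<open>poly_time\<close> functions.\<close>

abbreviation una :: "nat => bool list" where
 "una n == replicate n True"

abbreviation base :: "(nat => bool list) list" where
 "base == [una]"

lemma stk_una: "(%_. [])(0 := una n) = stk [una n]"
 by (auto simp: stk_def fun_eq_iff)

lemma pbound_poly: "pbound base (%n. poly p n)"
proof (induction p)
 case (pCons a p)
 have "pbound base (%n. n)" by (rule pbound_le[OF pbound_esize]) simp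
 thus ?case using pCons by (auto intro!: pbound_add pbound_mult pbound_const)
qed (auto intro: pbound_const)

lemma poly_time_pcomp:
 assumes "poly_time f"
 shows "pcomp base f"
proof -
 obtain c p where cp: "!!n. \<exists>t s. exec c (stk [una n]) t s & t <= poly p n & s 0 = f n"
  using assms unfolding poly_time_def stk_una by blast
 then obtain t s where ts: "!!n. exec c (stk [una n]) (t n) (s n)" "!!n. t n <= poly p n" "!!n. s n 0 = f n" by metis
 define K where "K = max 1 (top c)"
 let ?r = "map (%i n. s n i) [1..<K]"
 have s: "s n = stk (vals ([f] @ ?r) n)" for n
 proof
  fix i
  have "s n i = []" if "i \<ge> K"
  proof -
   have "s n i = stk [una n] i" using that by (intro exec_above[OF ts(1)]) (simp add: K_def)
   thus ?thesis using that by (simp add: stk_def K_def)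
  qed
  thus "s n i = stk (vals ([f] @ ?r) n) i"
   using ts(3)[of n] by (cases i) (auto simp: stk_def K_def not_less)
 qed
 have "runs c (stk (vals base n)) (poly p n) (stk (vals ([f] @ ?r) n))" for n
  unfolding s[of n, symmetric] using runsI[OF ts(1,2)[of n]] by simp
 hence "ptrans base ([f] @ ?r)" by (rule ptransI[OF pbound_poly])
 hence "ptrans (base @ base @ []) (base @ [f] @ [] @ ?r)" by (rule ptrans_frame) simp
 moreover have "ptrans base (base @ base)" by (rule ptrans_copy) simp
 ultimately have "ptrans base ((base @ [f]) @ ?r @ [])" using ptrans_trans by fastforce
 thus ?thesis unfolding pcomp_def using ptrans_trans[OF _ ptrans_remove[of "base @ [f]" ?r "[]"]] by simp
qed

lemma pcomp_poly_time:
 assumes "pcomp base f"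
 shows "poly_time f"
proof -
 have "ptrans base [f]"
  using ptrans_trans[OF assms[unfolded pcomp_def], of "[f]"] ptrans_remove[of "[]" base "[f]"] by simp
 then obtain T c where T: "pbound base T" "!!n. runs c (stk [una n]) (T n) (stk [f n])"
  unfolding ptrans_def by auto
 then obtain k where k: "!!n. T n <= (n + 2) ^ k" unfolding pbound_def by auto
 show ?thesis unfolding poly_time_def stk_una
 proof (intro exI[of _ c] exI[of _ "[:2, 1:] ^ k :: nat poly"] allI)
  fix n
  obtain t where t: "t <= T n" "exec c (stk [una n]) t (stk [f n])" using T(2)[of n] unfolding runs_def by blast
  have "t <= poly ([:2, 1:] ^ k) n" using t(1) k[of n] by (simp add: poly_power add.commute)
  thus "\<exists>t s. exec c (stk [una n]) t s & t <= poly ([:2, 1:] ^ k) n & s 0 = f n"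
   using t by (intro exI[of _ t] exI[of _ "stk [f n]"]) (simp add: stk_def)
 qed
qed

abbreviation pnat :: "('p => bool list) list => ('p => nat) => bool" where
 "pnat E f == pcomp E (%p. una (f p))"

abbreviation pbool :: "('p => bool list) list => ('p => bool) => bool" where
 "pbool E f == pcomp E (%p. [f p])"

lemma pcomp_len: "pcomp E f ==> pbound E (%p. length (f p))"
 unfolding pcomp_def by (rule pbound_le[OF ptrans_esize]) auto

lemma pnat_bound: "pnat E f ==> pbound E f"
 by (drule pcomp_len) simp

lemma fenv_proj:
 "pbool (fenv E e1 e2 e3) (%q. fst (snd q))" "pcomp (fenv E e1 e2 e3) (%q. e1 (snd (snd q)))"
 "pcomp (fenv E e1 e2 e3) (%q. e2 (snd (snd q)))" "pcomp (fenv E e1 e2 e3) (%q. e3 (snd (snd q)))"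
 by (rule pcomp_proj; simp add: fenv_def)+

lemma fenv_param: "pcomp E g ==> pcomp (fenv E e1 e2 e3) (%q. g (fst q))"
 by (rule pcomp_weaken[OF pcomp_reparam[where h = fst]]) (auto simp: fenv_def)

lemma pcomp_iter1:
 assumes X: "pcomp E X" and init: "pcomp E init"
  and step: "pcomp (fenv E (%s. s) (%s. []) (%s. [])) (%q. step (fst q) (fst (snd q)) (snd (snd q)))"
  and B: "!!p b s. length (step p b s) <= Suc (length s)"
 shows "pcomp E (%p. fold (step p) (X p) (init p))"
proof -
 have b: "pbound E (%p. length (init p) + length (X p))" by (intro pbound_add pcomp_len X init)
 show ?thesis
  by (rule pcomp_iter[where ?e1.0 = "%s. s" and ?e2.0 = "%_. []" and ?e3.0 = "%_. []" and
     I = "%p i s. length s <= length (init p) + i", OF X init pcomp_Nil pcomp_Nil step pcomp_Nil pcomp_Nil b])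
   (auto intro: le_trans[OF B])
qed

lemma pcomp_if: "pbool E P ==> pcomp E f ==> pcomp E g ==> pcomp E (%p. if P p then f p else g p)"
 using pcomp_case[of E "%p. [P p]" f f g] by simp

lemma pcomp_rev: "pcomp E f ==> pcomp E (%p. rev (f p))"
 and pcomp_append: "pcomp E f ==> pcomp E g ==> pcomp E (%p. f p @ g p)"
proof -
 have 1: "pcomp E (%p. fold (#) (f p) (g p))" if fg: "pcomp E f" "pcomp E g" for f g
 proof -
  let ?E = "fenv E (%s. s) (%s. []) (%s. [])"
  have "pcomp ?E (%q. if fst (snd q) then True # snd (snd q) else False # snd (snd q))"
   by (intro pcomp_if pcomp_Cons fenv_proj)
  hence "pcomp ?E (%q. fst (snd q) # snd (snd q))" by (rule pcomp_cong[rotated]) simp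
  thus ?thesis by (intro pcomp_iter1[of E f g "%_. (#)"] fg) simp_all
 qed
 have f: "fold (#) xs ys = rev xs @ ys" for xs ys :: "bool list" by (induction xs arbitrary: ys) auto
 show r: "pcomp E f ==> pcomp E (%p. rev (f p))" for f
  using 1[of f "%_. []"] pcomp_Nil[of E] by (auto simp: f)
 show "pcomp E f ==> pcomp E g ==> pcomp E (%p. f p @ g p)"
  using 1[OF r, of f g] by (simp add: f)
qed

lemma pnat_const: "pnat E (%_. c)" by (rule pcomp_const)

lemma pnat_Suc: "pnat E f ==> pnat E (%p. Suc (f p))"
 using pcomp_Cons[of E "%p. una (f p)" True] by simp

lemma pnat_add: "pnat E f ==> pnat E g ==> pnat E (%p. f p + g p)"
 by (simp add: replicate_add pcomp_append)

lemma pcomp_drop: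
 assumes "pnat E n" "pcomp E f"
 shows "pcomp E (%p. drop (n p) (f p))"
proof -
 have "pcomp E (%p. fold (%_. tl) (una (n p)) (f p))"
  by (rule pcomp_iter1[OF assms]) (use pcomp_tl[OF fenv_proj(2)[of E "%s. s"]] in auto)
 moreover have "fold (%_. tl) (una k) xs = drop k xs" for k and xs :: "bool list"
  by (induction k arbitrary: xs) (simp_all add: drop_Suc)
 ultimately show ?thesis by simp
qed

lemma pnat_diff: "pnat E f ==> pnat E g ==> pnat E (%p. f p - g p)"
 using pcomp_drop[of E g "%p. una (f p)"] by simp

lemma pbool_less: "pnat E f ==> pnat E g ==> pbool E (%p. f p < g p)"
proof -
 assume fg: "pnat E f" "pnat E g"
 have "pcomp E (%p. case una (g p - f p) of [] => [False] | b # _ => if b then [True] else [False])"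
  by (intro pcomp_case pnat_diff fg pcomp_const)
 moreover have "(case una (j - i) of [] => [False] | b # _ => if b then [True] else [False]) = [i < j]" for i j
  by (cases "j - i") auto
 ultimately show ?thesis by simp
qed

lemma pbool_not: "pbool E P ==> pbool E (%p. ~ P p)"
proof -
 assume P: "pbool E P"
 have "pcomp E (%p. if P p then [False] else [True])" by (intro pcomp_if P pcomp_const)
 thus ?thesis by (rule pcomp_cong[rotated]) auto
qed

lemma pbool_conj: "pbool E P ==> pbool E Q ==> pbool E (%p. P p & Q p)"
proof -
 assume P: "pbool E P" "pbool E Q"
 have "pcomp E (%p. if P p then [Q p] else [False])" by (intro pcomp_if P pcomp_const)
 thus ?thesis by (rule pcomp_cong[rotated]) auto
qed

lemma pbool_eq: "pnat E f ==> pnat E g ==> pbool E (%p. f p = g p)"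
 by (rule pcomp_cong[OF _ pbool_conj[OF pbool_not[OF pbool_less[of E f g]] pbool_not[OF pbool_less[of E g f]]]]) auto

lemma pnat_if: "pbool E P ==> pnat E f ==> pnat E g ==> pnat E (%p. if P p then f p else g p)"
 by (rule pcomp_cong[OF _ pcomp_if[of E P "%p. una (f p)" "%p. una (g p)"]]) simp_all

lemma pnat_length: "pcomp E f ==> pnat E (%p. length (f p))"
proof -
 assume f: "pcomp E f"
 have "pcomp E (%p. fold (%_. (#) True) (f p) [])"
  by (rule pcomp_iter1[OF f pcomp_Nil]) (use pcomp_Cons[OF fenv_proj(2)[of E "%s. s"]] in auto)
 moreover have "fold (%_. (#) True) xs (una k) = una (length xs + k)" for xs :: "bool list" and k
  by (induction xs arbitrary: k) (simp_all flip: replicate_Suc add: replicate_app_Cons_same)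
 from this[of _ 0] have "fold (%_. (#) True) xs [] = una (length xs)" for xs :: "bool list" by simp
 ultimately show ?thesis by simp
qed

text \<open>Loops: the loop variable is a further parameter.\<close>

definition ext :: "('p => bool list) list => ('p \<times> nat => bool list) list" where
 "ext E = map (%g q. g (fst q)) E @ [%q. una (snd q)]"

lemma ext_fst: "pcomp E g ==> pcomp (ext E) (%q. g (fst q))"
 by (rule pcomp_weaken[OF pcomp_reparam[where h = fst]]) (auto simp: ext_def)

lemma ext_snd: "pnat (ext E) (%q. snd q)"
 by (rule pcomp_proj) (simp add: ext_def)

lemma pcomp_subst_ext:
 assumes "pcomp (ext E) g" "pnat F i" and "!!g. pcomp E g ==> pcomp F (%q. g (h q))"
 shows "pcomp F (%q. g (h q, i q))"
proof (rule pcomp_via)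
 show "pcomp (map (%g q. g (h q, i q)) (ext E)) (%q. g (h q, i q))" by (rule pcomp_reparam[OF assms(1)])
 show "pcomp F g" if "g : set (map (%g q. g (h q, i q)) (ext E))" for g
  using that assms(2,3) by (auto simp: ext_def intro: pcomp_proj)
qed

lemma ext_bound:
 assumes "pcomp (ext E) (%q. g (fst q) (snd q))"
 shows "\<exists>k. \<forall>p i N. i <= N --> length (g p i) <= (esize (vals E p) + N + 2) ^ k"
proof -
 obtain k where k: "!!q. length (g (fst q) (snd q)) <= (esize (vals (ext E) q) + 2) ^ k"
  using pcomp_len[OF assms] unfolding pbound_def by blast
 have "length (g p i) <= (esize (vals E p) + N + 2) ^ k" if "i <= N" for p i N
 proof -
  have "length (g p i) <= (esize (vals E p) + i + 2) ^ k" using k[of "(p, i)"] by (simp add: ext_def o_def)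
  also have "... <= (esize (vals E p) + N + 2) ^ k" using that by (intro power_mono) auto
  finally show ?thesis .
 qed
 thus ?thesis by blast
qed

lemma pcomp_concat:
 assumes n: "pnat E n" and g: "pcomp (ext E) (%q. g (fst q) (snd q))"
 shows "pcomp E (%p. concat (map (g p) [0..<n p]))"
proof -
 obtain k where k: "!!p i N. i <= N ==> length (g p i) <= (esize (vals E p) + N + 2) ^ k" using ext_bound[OF g] by blast
 define step where "step p b s = (fst s @ g p (snd s), Suc (snd s))" for p and b :: bool and s
 let ?D = "%p. (esize (vals E p) + n p + 2) ^ k"
 let ?E = "fenv E fst (%s. una (snd s)) (%_. [])"
 have "pcomp ?E (%q. g (fst (fst q, snd (snd (snd q)))) (snd (fst q, snd (snd (snd q)))))"
  by (rule pcomp_subst_ext[OF g fenv_proj(3) fenv_param])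
 hence s1: "pcomp ?E (%q. fst (snd (snd q)) @ g (fst q) (snd (snd (snd q))))"
  by (intro pcomp_append fenv_proj(2)) simp
 have s2: "pnat ?E (%q. Suc (snd (snd (snd q))))" by (rule pnat_Suc[OF fenv_proj(3)])
 have "pcomp E (%p. fst (fold (step p) (una (n p)) ([], 0)))"
 proof (rule pcomp_iter[where ?e2.0 = "%s. una (snd s)" and ?e3.0 = "%_. []" and
   I = "%p i s. snd s = i & length (fst s) <= i * ?D p" and B = "%p. n p * ?D p + n p"])
  show "pbound E (%p. n p * ?D p + n p)"
   by (intro pbound_add pbound_mult pbound_power pbound_const pbound_esize pnat_bound[OF n])
  show "length (fst s) + length (una (snd s)) + length [] <= n p * ?D p + n p"
   if "i <= length (una (n p))" "snd s = i & length (fst s) <= i * ?D p" for p i and s :: "bool list \<times> nat"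
  proof -
   have "i * ?D p <= n p * ?D p" using that by (intro mult_right_mono) auto
   hence 1: "length (fst s) <= n p * ?D p" using that(2) by (meson le_trans)
   have 2: "snd s <= n p" using that by simp
   show ?thesis using add_mono[OF 1 2] by simp
  qed
  show "snd (step p b s) = Suc i & length (fst (step p b s)) <= Suc i * ?D p"
   if "i < length (una (n p))" "snd s = i & length (fst s) <= i * ?D p" for p i b s
   using that k[of i "n p" p] by (simp add: step_def)
 qed (use n s1 s2 in \<open>simp_all add: step_def pcomp_Nil\<close>)
 moreover have "fold (step p) (una m) (xs, i) = (xs @ concat (map (g p) [i..<i + m]), i + m)" for p xs i m
 proof (induction m arbitrary: xs i)
  case (Suc m)
  have "[i..<i + Suc m] = i # [Suc i..<Suc i + m]" by (simp add: upt_conv_Cons)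
  thus ?case using Suc[of "xs @ g p i" "Suc i"] by (simp add: step_def del: upt_Suc)
 qed simp
 ultimately show ?thesis by simp
qed

lemma pnat_mult: "pnat E f ==> pnat E g ==> pnat E (%p. f p * g p)"
proof -
 assume "pnat E f" "pnat E g"
 hence "pcomp E (%p. concat (map ((%p i. una (g p)) p) [0..<f p]))"
  by (intro pcomp_concat ext_fst)
 moreover have "concat (map (%i. una b) [0..<a]) = una (a * b)" for a b :: nat
  by (induction a) (simp_all add: replicate_add[symmetric] add.commute)
 ultimately show ?thesis by simp
qed

lemma pnat_power: "pnat E f ==> pnat E (%p. f p ^ k)"
proof (induction k)
 case 0
 thus ?case using pnat_const[of E 1] by simp
next
 case (Suc k)
 thus ?case using pnat_mult[of E f "%p. f p ^ k"] by simp
qed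

text \<open>The number of leading ones.\<close>

definition lead :: "bool list => nat" where
 "lead xs = length (takeWhile (%b. b) xs)"

lemma lead_enc_nat [simp]: "lead (enc_nat k @ xs) = k"
 by (induction k) (simp_all add: lead_def enc_nat_def)

lemma pnat_lead: "pcomp E f ==> pnat E (%p. lead (f p))"
proof -
 assume f: "pcomp E f"
 define step where "step b s = (if snd s & b then Suc (fst s) else fst s, snd s & b)" for b s
 let ?E = "fenv E (%s. una (fst s)) (%s. [snd s]) (%_. [])"
 have flag: "pbool ?E (%q. snd (snd (snd q)) & fst (snd q))" by (intro pbool_conj fenv_proj)
 have "pnat E (%p. fst (fold step (f p) (0, True)))"
 proof (rule pcomp_iter[where ?e1.0 = "%s. una (fst s)" and ?e2.0 = "%s. [snd s]" and ?e3.0 = "%_. []" and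
   I = "%p i s. fst s <= i" and B = "%p. length (f p) + 1" and step = "%_. step"])
  show "pcomp ?E (%q. una (fst (step (fst (snd q)) (snd (snd q)))))"
   unfolding step_def fst_conv by (intro pnat_if flag pnat_Suc fenv_proj(2))
  show "pbound E (%p. length (f p) + 1)" by (intro pbound_add pbound_const pcomp_len f)
 qed (use f flag in \<open>auto simp: step_def pcomp_Nil intro!: pcomp_const\<close>)
 moreover have "fold step xs (k, False) = (k, False)" for xs k by (induction xs) (simp_all add: step_def)
 hence "fst (fold step xs (k, True)) = k + lead xs" for xs k
  by (induction xs arbitrary: k) (auto simp: step_def lead_def)
 ultimately show ?thesis by simp
qed

text \<open>
 Gate lists are represented without the end marker of \<open>enc_list\<close>, so that they can be
 concatenated.
\<close>

definition genc :: "gate list => bool list" where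
 "genc gs = concat (map (%g. True # enc_gate g) gs)"

lemma genc_simps [simp]: "genc [] = []" "genc (g # gs) = True # enc_gate g @ genc gs" "genc (gs @ hs) = genc gs @ genc hs"
 by (simp_all add: genc_def)

lemma genc_concat: "genc (concat gss) = concat (map genc gss)"
 by (induction gss) simp_all

abbreviation pgate :: "('p => bool list) list => ('p => gate list) => bool" where
 "pgate E gs == pcomp E (%p. genc (gs p))"

lemma pcomp_enc_nat: "pnat E i ==> pcomp E (%p. enc_nat (i p))"
proof -
 assume i: "pnat E i"
 show ?thesis unfolding enc_nat_def by (intro pcomp_append i pcomp_const)
qed

lemma pgate_Nil: "pgate E (%_. [])"
 by (simp add: pcomp_Nil)

lemma pgate_append: "pgate E gs ==> pgate E hs ==> pgate E (%p. gs p @ hs p)"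
 by (simp add: pcomp_append)

lemma pgate_H: "pnat E i ==> pgate E gs ==> pgate E (%p. Hadamard (i p) # gs p)"
 and pgate_T: "pnat E i ==> pgate E gs ==> pgate E (%p. TGate (i p) # gs p)"
 and pgate_CNOT: "pnat E i ==> pnat E j ==> pgate E gs ==> pgate E (%p. CNOT (i p) (j p) # gs p)"
 by (simp_all add: pcomp_append pcomp_Cons pcomp_enc_nat)

lemma pgate_if: "pbool E P ==> pgate E f ==> pgate E g ==> pgate E (%p. if P p then f p else g p)"
 by (rule pcomp_cong[OF _ pcomp_if[of E P "%p. genc (f p)" "%p. genc (g p)"]]) simp_all

lemma pgate_concat:
 "pnat E n ==> pgate (ext E) (%q. g (fst q) (snd q)) ==> pgate E (%p. concat (map (g p) [0..<n p]))"
 by (rule pcomp_cong[OF _ pcomp_concat[of E n "%p i. genc (g p i)"]]) (simp_all add: genc_concat o_def)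

lemma pgate_map:
 "pnat E n ==> pgate (ext E) (%q. [g (fst q) (snd q)]) ==> pgate E (%p. map (g p) [0..<n p])"
 by (rule pcomp_cong[OF _ pgate_concat[of E n "%p i. [g p i]"]]) simp_all

text \<open>
 Renaming the wires of an encoded gate list. The second state component is the position
 inside the encoding of a gate: 0 marker, 1 first bit, 2 and 3 second bit, 4 last and 5 first of two wires.
\<close>

definition scan :: "(nat => nat) => bool => bool list \<times> nat \<times> nat => bool list \<times> nat \<times> nat" where
 "scan phi b s = (case s of (ys, k, i) =>
   (if k < 4 then ys @ [b] else if b then ys else ys @ enc_nat (phi i),
   if k = 0 then 1 else if k = 1 then (if b then 3 else 2) else if k = 2 then 4 else if k = 3 then 5
    else if b then k else if k = 4 then 0 else 4,
   if k < 4 then 0 else if b then Suc i else 0))"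

lemma scan_una: "k = 4 | k = 5 ==> fold (scan phi) (una j) (ys, k, i) = (ys, k, i + j)"
 by (induction j arbitrary: i) (auto simp: scan_def)

lemma scan_enc_nat: "k = 4 | k = 5 ==> fold (scan phi) (enc_nat j) (ys, k, 0) = (ys @ enc_nat (phi j), if k = 4 then 0 else 4, 0)"
 unfolding enc_nat_def[of j] fold_append o_apply by (subst scan_una) (auto simp: scan_def)

lemma scan_gate: "fold (scan phi) (True # enc_gate g) (ys, 0, 0) = (ys @ True # enc_gate (rn phi g), 0, 0)"
proof -
 have a: "fold f (x # xs) s = fold f xs (f x s)" for f x xs and s :: 's by simp
 show ?thesis
  by (cases g) (simp_all only: enc_gate.simps rn.simps append_Cons append_Nil a fold_append o_apply,
   simp_all add: scan_def[of _ True "(_, 0, _)"] scan_def[of _ _ "(_, Suc 0, _)"] scan_def[of _ _ "(_, 1, _)"]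
    scan_def[of _ _ "(_, 2, _)"] scan_def[of _ _ "(_, 3, _)"] scan_enc_nat)
qed

lemma scan_genc: "fold (scan phi) (genc gs) (ys, 0, 0) = (ys @ genc (map (rn phi) gs), 0, 0)"
proof (induction gs arbitrary: ys)
 case (Cons g gs)
 have "fold (scan phi) (genc (g # gs)) (ys, 0, 0) = fold (scan phi) (genc gs) (fold (scan phi) (True # enc_gate g) (ys, 0, 0))"
  by (simp only: genc_simps append_Cons[symmetric] fold_append o_apply)
 thus ?case unfolding scan_gate Cons.IH by simp
qed simp

lemma pgate_rn:
 assumes gs: "pgate E gs" and phi: "pnat (ext E) (%q. phi (fst q) (snd q))"
 shows "pgate E (%p. map (rn (phi p)) (gs p))"
proof -
 obtain k where k: "!!p i N. i <= N ==> phi p i <= (esize (vals E p) + N + 2) ^ k" using ext_bound[OF phi] by auto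
 let ?N = "%p. length (genc (gs p))"
 let ?D = "%p. 2 + (esize (vals E p) + ?N p + 2) ^ k"
 let ?E = "fenv E fst (%s. una (fst (snd s))) (%s. una (snd (snd s)))"
 let ?s = "%q. snd (snd q)"
 have b: "pbool ?E (%q. fst (snd q))" and ys: "pcomp ?E (%q. fst (?s q))"
  and m: "pnat ?E (%q. fst (snd (?s q)))" and i: "pnat ?E (%q. snd (snd (?s q)))"
  using fenv_proj by blast+
 have c: "pnat ?E (%_. c)" for c by (rule pnat_const)
 have "pnat ?E (%q. phi (fst (fst q, snd (snd (?s q)))) (snd (fst q, snd (snd (?s q)))))"
  by (rule pcomp_subst_ext[OF phi i fenv_param])
 hence f: "pnat ?E (%q. phi (fst q) (snd (snd (?s q))))" by simp
 have "pcomp E (%p. fst (fold (scan (phi p)) (genc (gs p)) ([], 0, 0)))"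
 proof (rule pcomp_iter[where ?e1.0 = fst and ?e2.0 = "%s. una (fst (snd s))" and ?e3.0 = "%s. una (snd (snd s))" and
   I = "%p i s. fst (snd s) <= 5 & snd (snd s) <= i & length (fst s) <= i * ?D p" and
   B = "%p. ?N p * ?D p + 5 + ?N p"])
  have "pcomp ?E (%q. if fst (snd (?s q)) < 4 then fst (?s q) @ [fst (snd q)]
    else if fst (snd q) then fst (?s q) else fst (?s q) @ enc_nat (phi (fst q) (snd (snd (?s q)))))"
   by (intro pcomp_if pbool_less pcomp_append pcomp_enc_nat b ys m c f)
  thus "pcomp ?E (%q. fst (scan (phi (fst q)) (fst (snd q)) (?s q)))" by (rule pcomp_cong[rotated]) (simp add: scan_def case_prod_unfold)
  have "pnat ?E (%q. if fst (snd (?s q)) = 0 then 1 else if fst (snd (?s q)) = 1 then (if fst (snd q) then 3 else 2)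
    else if fst (snd (?s q)) = 2 then 4 else if fst (snd (?s q)) = 3 then 5
    else if fst (snd q) then fst (snd (?s q)) else if fst (snd (?s q)) = 4 then 0 else 4)"
   by (intro pnat_if pbool_eq b m c)
  thus "pnat ?E (%q. fst (snd (scan (phi (fst q)) (fst (snd q)) (?s q))))" by (rule pcomp_cong[rotated]) (simp add: scan_def case_prod_unfold)
  have "pnat ?E (%q. if fst (snd (?s q)) < 4 then 0 else if fst (snd q) then Suc (snd (snd (?s q))) else 0)"
   by (intro pnat_if pbool_less b m c i pnat_Suc)
  thus "pnat ?E (%q. snd (snd (scan (phi (fst q)) (fst (snd q)) (?s q))))" by (rule pcomp_cong[rotated]) (simp add: scan_def case_prod_unfold)
  show "pbound E (%p. ?N p * ?D p + 5 + ?N p)"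
   by (intro pbound_add pbound_mult pbound_power pbound_const pbound_esize pcomp_len[OF gs])
  show "fst (snd (scan (phi p) b s)) <= 5 & snd (snd (scan (phi p) b s)) <= Suc i & length (fst (scan (phi p) b s)) <= Suc i * ?D p"
   if "i < ?N p" "fst (snd s) <= 5 & snd (snd s) <= i & length (fst s) <= i * ?D p" for p i b s
  proof -
   obtain ys m j where s: "s = (ys, m, j)" by (cases s)
   have "phi p j <= (esize (vals E p) + ?N p + 2) ^ k" using that s by (intro k) simp
   thus ?thesis using that(2) unfolding s by (auto simp: scan_def enc_nat_def)
  qed
  show "length (fst s) + length (una (fst (snd s))) + length (una (snd (snd s))) <= ?N p * ?D p + 5 + ?N p"
   if "i <= ?N p" "fst (snd s) <= 5 & snd (snd s) <= i & length (fst s) <= i * ?D p" for p i s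
  proof -
   have "i * ?D p <= ?N p * ?D p" using that by (intro mult_right_mono) auto
   hence "length (fst s) <= ?N p * ?D p" using that(2) by (meson le_trans)
   thus ?thesis using that unfolding length_replicate by linarith
  qed
 qed (use gs c pcomp_Nil in \<open>simp_all\<close>)
 thus ?thesis unfolding scan_genc by simp
qed

lemma enc_gates: "enc_list enc_gate gs = genc gs @ [False]"
 by (simp add: enc_list_def genc_def)

lemma pcomp_circuit:
 assumes "pnat E a" "pnat E b" "pgate E gs"
 shows "pcomp E (%p. enc_circuit (Circuit (a p) (b p) (gs p)))"
 unfolding enc_circuit_def circuit.sel enc_gates
  by (intro pcomp_append pcomp_enc_nat assms pcomp_const)

text \<open>Lists of circuits, again without an end marker.\<close>

definition cenc :: "circuit list => bool list" where
 "cenc Cs = concat (map (%C. True # enc_circuit C) Cs)"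

abbreviation pcircs :: "('p => bool list) list => ('p => circuit list) => bool" where
 "pcircs E Cs == pcomp E (%p. cenc (Cs p))"

lemma pcircs_append: "pcircs E Cs ==> pcircs E Ds ==> pcircs E (%p. Cs p @ Ds p)"
 by (simp add: cenc_def pcomp_append)

lemma pcircs_single:
 assumes "pnat E a" "pnat E b" "pgate E gs"
 shows "pcircs E (%p. [Circuit (a p) (b p) (gs p)])"
 using pcomp_Cons[OF pcomp_circuit[OF assms], of True] by (simp add: cenc_def)

lemma pcircs_map:
 assumes "pnat E n" "pcircs (ext E) (%q. [g (fst q) (snd q)])"
 shows "pcircs E (%p. map (g p) [0..<n p])"
 by (rule pcomp_cong[OF _ pcomp_concat[of E n "%p i. cenc [g p i]"]]) (use assms in \<open>simp_all add: cenc_def o_def\<close>)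

lemma QPT_machine_iff: "QPT_machine M <-> pcircs base M"
proof -
 have e: "enc_list enc_circuit (M n) = cenc (M n) @ [False]" for n by (simp add: enc_list_def cenc_def)
 show ?thesis
 proof
  assume "QPT_machine M"
  hence "pcomp base (%n. cenc (M n) @ [False])" using poly_time_pcomp unfolding QPT_machine_def e by blast
  hence "pcomp base (%n. rev (tl (rev (cenc (M n) @ [False]))))" by (intro pcomp_rev pcomp_tl)
  thus "pcircs base M" by simp
 next
  assume "pcircs base M"
  hence "pcomp base (%n. cenc (M n) @ [False])" by (intro pcomp_append pcomp_const)
  thus "QPT_machine M" using pcomp_poly_time unfolding QPT_machine_def e by blast
 qed
qed

lemma QPT_parts:
 assumes "QPT C"
 shows "pnat base (%n. n_out (C n))" "pnat base (%n. n_anc (C n))" "pgate base (%n. gates (C n))"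
proof -
 let ?e = "%n. enc_nat (n_out (C n)) @ enc_nat (n_anc (C n)) @ genc (gates (C n)) @ [False]"
 have "pcircs base (%n. [C n])" using assms by (simp add: QPT_def QPT_machine_iff)
 hence "pcomp base (%n. tl (cenc [C n]))" by (rule pcomp_tl)
 moreover have "tl (cenc [C n]) = ?e n" for n by (simp add: cenc_def enc_circuit_def enc_gates)
 ultimately have 1: "pcomp base ?e" by simp
 from pnat_lead[OF this] show o: "pnat base (%n. n_out (C n))" by simp
 have d: "drop (Suc k) (enc_nat k @ xs) = xs" for k xs by (simp add: enc_nat_def)
 from pcomp_drop[OF pnat_Suc[OF o] 1]
 have 2: "pcomp base (%n. enc_nat (n_anc (C n)) @ genc (gates (C n)) @ [False])" unfolding d .
 from pnat_lead[OF this] show a: "pnat base (%n. n_anc (C n))" by simp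
 from pcomp_drop[OF pnat_Suc[OF a] 2] have "pcomp base (%n. genc (gates (C n)) @ [False])" unfolding d .
 hence "pcomp base (%n. rev (tl (rev (genc (gates (C n)) @ [False]))))" by (intro pcomp_rev pcomp_tl)
 thus "pgate base (%n. gates (C n))" by simp
qed

lemma length_genc: "length gs <= length (genc gs)"
 by (induction gs) simp_all

lemma QPT_machine_bound:
 assumes "QPT_machine M"
 shows "\<exists>k. \<forall>n. \<forall>C\<in>set (M n). n_out C <= (n + 2) ^ k & n_anc C <= (n + 2) ^ k & length (gates C) <= (n + 2) ^ k"
proof -
 have "pbound base (%n. length (cenc (M n)))" using assms unfolding QPT_machine_iff by (rule pcomp_len)
 then obtain k where k: "!!n. length (cenc (M n)) <= (n + 2) ^ k" unfolding pbound_def by auto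
 have "n_out C <= (n + 2) ^ k & n_anc C <= (n + 2) ^ k & length (gates C) <= (n + 2) ^ k" if "C : set (M n)" for n C
 proof -
  have "length (enc_circuit C) <= length (cenc (M n))"
   using that by (induction "M n" arbitrary: M) (auto simp: cenc_def split_list dest!: split_list)
  moreover have "n_out C + n_anc C + length (genc (gates C)) <= length (enc_circuit C)"
   by (simp add: enc_circuit_def enc_nat_def enc_gates)
  ultimately show ?thesis using k[of n] length_genc[of "gates C"] by linarith
 qed
 thus ?thesis by blast
qed

section \<open>A universal circuit\<close>

text \<open>An H gate controlled by c: conjugation by \<open>conj_gates\<close> turns NOT into H.\<close>

definition conj_gates :: "nat => gate list" where
 "conj_gates i = replicate 2 (TGate i) @ Hadamard i # replicate 1 (TGate i)"

definition cH :: "nat => nat => gate list" where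
 "cH c i = conj_gates i @ [CNOT c i] @ replicate 7 (TGate i) @ Hadamard i # replicate 6 (TGate i)"

lemma ap_THT:
 assumes "i < length x"
 shows "ap (replicate a (TGate i) @ Hadamard i # replicate b (TGate i)) psi x =
  (if x ! i then cis (pi/4) ^ b else 1) * (psi (x[i := False]) + (if x ! i then -1 else 1) * cis (pi/4) ^ a * psi (x[i := True]))
   / rt2"
proof -
 have "ap (replicate a (TGate i) @ Hadamard i # replicate b (TGate i)) psi x =
   ap (replicate b (TGate i)) (apply_gate (Hadamard i) (ap (replicate a (TGate i)) psi)) x"
  by (simp only: fold_append fold_simps o_apply)
 thus ?thesis using assms by (simp add: ap_T_power del: replicate.simps fold_replicate)
qed

lemma ap_cH:
 assumes "i < length x" "c < length x" "c ~= i"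
 shows "ap (cH c i) psi x = (if x ! c then apply_gate (Hadamard i) psi x else psi x)"
proof -
 let ?w = "cis (pi/4)" and ?s = "rt2"
 define \<alpha> where "\<alpha> = ap (conj_gates i) psi"
 have \<alpha>: "\<alpha> y = (if y ! i then ?w else 1) * (psi (y[i := False]) + (if y ! i then -1 else 1) * ?w\<^sup>2 * psi (y[i := True])) / ?s"
  if "i < length y" for y
  unfolding \<alpha>_def conj_gates_def ap_THT[OF that] by simp
 have "ap (cH c i) psi x = ap (replicate 7 (TGate i) @ Hadamard i # replicate 6 (TGate i)) (apply_gate (CNOT c i) \<alpha>) x"
  by (simp only: cH_def fold_append fold_simps o_apply \<alpha>_def append.simps)
 also have "... = (if x ! i then ?w ^ 6 else 1) * (\<alpha> (x[i := x ! c]) + (if x ! i then -1 else 1) * ?w ^ 7 * \<alpha> (x[i := ~ x ! c])) / ?s"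
  unfolding ap_THT[OF assms(1)] apply_gate.simps using assms by auto
 finally have 1: "ap (cH c i) psi x = ..." .
 have w4: "?w ^ 4 = -1" by (rule cis_pi4_pow)
 have s: "?s * ?s = 2" by (simp flip: of_real_mult)
 have w: "?w = (1 + \<i>) / ?s" by (simp add: complex_eq_iff cos_45 sin_45 Re_divide Im_divide power2_eq_square real_div_sqrt)
 have w2: "?w * ?w = \<i>" unfolding w using s by (simp add: field_simps)
 have p: "?w ^ 6 = - \<i>" "?w ^ 7 = - \<i> * ?w" "?w\<^sup>2 = \<i>"
 proof -
  have "?w ^ 6 = (?w * ?w) * ((?w * ?w) * (?w * ?w))" "?w ^ 7 = (?w * ?w) * ((?w * ?w) * (?w * ?w)) * ?w"
   by (simp_all add: eval_nat_numeral mult_ac)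
  thus "?w ^ 6 = - \<i>" "?w ^ 7 = - \<i> * ?w" "?w\<^sup>2 = \<i>" unfolding w2 by (simp_all add: power2_eq_square w2)
 qed
 have w3: "?w - \<i> * ?w = ?s" unfolding w using s by (simp add: field_simps)
 show ?thesis
 proof (cases "x ! c")
  case True
  define a b where "a = psi (x[i := False])" and "b = psi (x[i := True])"
  have e: "\<alpha> (x[i := True]) = ?w * (a - \<i> * b) / ?s" "\<alpha> (x[i := False]) = (a + \<i> * b) / ?s"
   using assms by (simp_all add: \<alpha> p a_def b_def)
  have "?w * (a - \<i> * b) / ?s + - \<i> * ?w * ((a + \<i> * b) / ?s) = (?w - \<i> * ?w) * (a + b) / ?s"
   by (simp add: field_simps)
  hence f: "?w * (a - \<i> * b) / ?s + - \<i> * ?w * ((a + \<i> * b) / ?s) = a + b" unfolding w3 by simp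
  have "?w * (a - \<i> * b) / ?s - - \<i> * ?w * ((a + \<i> * b) / ?s) = \<i> * ((?w - \<i> * ?w) * (a - b) / ?s)"
   by (simp add: field_simps)
  hence g: "?w * (a - \<i> * b) / ?s - - \<i> * ?w * ((a + \<i> * b) / ?s) = \<i> * (a - b)" unfolding w3 by simp
  have "ap (cH c i) psi x = (if x ! i then - \<i> * (?w * (a - \<i> * b) / ?s - - \<i> * ?w * ((a + \<i> * b) / ?s))
    else ?w * (a - \<i> * b) / ?s + - \<i> * ?w * ((a + \<i> * b) / ?s)) / ?s"
   unfolding 1 p using True by (simp add: e)
  thus ?thesis unfolding f g using True assms by (simp add: a_def[symmetric] b_def[symmetric])
 next
  case False
  define a b where "a = psi (x[i := False])" and "b = psi (x[i := True])"
  have e: "\<alpha> (x[i := True]) = ?w * (a - \<i> * b) / ?s" "\<alpha> (x[i := False]) = (a + \<i> * b) / ?s"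
   using assms by (simp_all add: \<alpha> p a_def b_def)
  have g: "- \<i> * ?w * (?w * z) = z" for z
  proof -
   have "- \<i> * ?w * (?w * z) = - \<i> * (?w * ?w) * z" by (simp add: mult_ac)
   thus ?thesis unfolding w2 by simp
  qed
  have "- \<i> * ?w * (?w * (a - \<i> * b) / ?s) = (- \<i> * ?w * (?w * (a - \<i> * b))) / ?s" by simp
  hence g': "- \<i> * ?w * (?w * (a - \<i> * b) / ?s) = (a - \<i> * b) / ?s" unfolding g .
  have "psi x = (if x ! i then b else a)" using assms by (simp add: a_def b_def)
  moreover have "((a + \<i> * b) / ?s + (a - \<i> * b) / ?s) / ?s = a" "- \<i> * ((a + \<i> * b) / ?s - (a - \<i> * b) / ?s) / ?s = b"
   using s by (simp_all add: field_simps)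
  moreover have "ap (cH c i) psi x = (if x ! i then - \<i> * ((a + \<i> * b) / ?s - - \<i> * ?w * (?w * (a - \<i> * b) / ?s))
    else (a + \<i> * b) / ?s + - \<i> * ?w * (?w * (a - \<i> * b) / ?s)) / ?s"
   unfolding 1 p using False by (simp add: e)
  ultimately show ?thesis unfolding g' using False by simp
 qed
qed

text \<open>A T gate controlled by c, with z as an ancilla.\<close>

definition cT :: "nat => nat => nat => gate list" where
 "cT c i z = ccx_gates c i z @ [TGate z] @ ccx_gates c i z"

lemma ap_cT:
 assumes "i < length x" "c < length x" "z < length x" "c ~= i" "c ~= z" "i ~= z" "x ! z ==> psi x = 0"
 shows "ap (cT c i z) psi x = (if x ! c then apply_gate (TGate i) psi x else psi x)"
proof -
 have "ap (cT c i z) psi x = ap (ccx_gates c i z) (apply_gate (TGate z) (ap (ccx_gates c i z) psi)) x"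
  by (simp only: cT_def fold_append fold_simps o_apply append.simps)
 thus ?thesis using assms by (cases "x ! z") (auto simp: ap_ccx)
qed

text \<open>F acts on the wires below W like G while the wires from W on hold the string w.\<close>

definition acts :: "nat => bool list => gate list => gate list => bool" where
 "acts W w F G <-> (\<forall>psi z. length z = W + length w --> ap F (att W w psi) z = att W w (ap G psi) z)"

lemma acts_append: "acts W w F G ==> acts W w F' G' ==> acts W w (F @ F') (G @ G')"
 unfolding acts_def
proof (intro allI impI)
 fix psi :: qvec and z :: "bool list"
 assume 1: "\<forall>psi z. length z = W + length w --> ap F (att W w psi) z = att W w (ap G psi) z"
  and 2: "\<forall>psi z. length z = W + length w --> ap F' (att W w psi) z = att W w (ap G' psi) z"
  and z: "length z = W + length w"
 have "ap (F @ F') (att W w psi) z = ap F' (ap F (att W w psi)) z" by (simp only: fold_append o_apply)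
 also have "... = ap F' (att W w (ap G psi)) z" by (rule ap_cong[OF _ z]) (use 1 in blast)
 also have "... = att W w (ap (G @ G') psi) z" using 2 z by (simp only: fold_append o_apply)
 finally show "ap (F @ F') (att W w psi) z = att W w (ap (G @ G') psi) z" .
qed

lemma acts_Nil: "acts W w [] []"
 by (simp add: acts_def)

lemma acts_concat: "(!!i. i < k ==> acts W w (F i) (G i)) ==> acts W w (concat (map F [0..<k])) (concat (map G [0..<k]))"
 by (induction k) (simp_all add: acts_Nil acts_append)

lemma acts_controlled:
 assumes "!!psi z. length z = W + length w ==> (!!y. psi y ~= 0 ==> drop W y = w) ==> ap F psi z = (if z ! (W + k) then apply_gate g psi z else psi z)"
  and k: "k < length w" and g: "in_range W g"
 shows "acts W w F (if w ! k then [g] else [])"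
 unfolding acts_def
proof (intro allI impI)
 fix psi :: qvec and z :: "bool list" assume z: "length z = W + length w"
 have "ap F (att W w psi) z = (if z ! (W + k) then apply_gate g (att W w psi) z else att W w psi z)"
  using z by (rule assms(1)) (auto simp: att_def split: if_splits)
 moreover have "apply_gate g (att W w psi) z = att W w (apply_gate g psi) z"
  using ap_att[of "[g]" W z w psi] g z by simp
 moreover have "z ! (W + k) = w ! k" if "drop W z = w" using that z k by auto
 ultimately show "ap F (att W w psi) z = att W w (ap (if w ! k then [g] else []) psi) z"
  by (auto simp: att_def)
qed

text \<open>
 The universal circuit contains, in each of G steps, every gate on W wires controlled by its own
 advice bit. The first bit of the advice, on wire W, is 0 and serves as an ancilla;
 \<open>ctl\<close> is the position of a control bit after it.
\<close>

definition ctl :: "nat => nat => nat => nat => nat => nat" where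
 "ctl W t i j r = ((t * W + i) * W + j) * 3 + r"

definition slot :: "nat => nat => nat => nat => gate list" where
 "slot W t i j = cH (W + Suc (ctl W t i j 0)) i @ cT (W + Suc (ctl W t i j 1)) i W @
   (if i = j then [] else ccx_gates (W + Suc (ctl W t i j 2)) i j)"

definition universal :: "nat => nat => gate list" where
 "universal G W = concat (map (%t. concat (map (%i. concat (map (%j. slot W t i j) [0..<W])) [0..<W])) [0..<G])"

text \<open>
 Bit r for the wires i and j at a step is set if g is the corresponding gate; gates with one wire
 use j = 0.
\<close>

definition selects :: "gate => nat => nat => nat => bool" where
 "selects g i j r = (case g of Hadamard a => i = a & j = 0 & r = 0 | TGate a => i = a & j = 0 & r = 1
   | CNOT a b => i = a & j = b & r = 2)"

definition advice :: "nat => nat => gate list => bool list" where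
 "advice G W gs = False # map (%k. let t = k div 3 div W div W in
   t < length gs & selects (gs ! t) (k div 3 div W mod W) (k div 3 mod W) (k mod 3)) [0..<G * W * W * 3]"

lemma ctl_less:
 assumes "t < G" "i < W" "j < W" "r < 3"
 shows "ctl W t i j r < G * W * W * 3"
proof -
 have s: "a * n + b < A * n" if "a < A" "b < n" for a b n A :: nat
 proof -
  have "a * n + b < Suc a * n" using that by simp
  also have "... <= A * n" using that by (intro mult_right_mono) auto
  finally show ?thesis .
 qed
 show ?thesis unfolding ctl_def by (intro s assms)
qed

lemma advice_ctl:
 assumes "t < G" "i < W" "j < W" "r < 3"
 shows "advice G W gs ! Suc (ctl W t i j r) <-> t < length gs & selects (gs ! t) i j r"
proof -
 have q: "(a * n + b) div n = a" "(a * n + b) mod n = b" if "b < n" for a b n :: nat using that by simp_all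
 have "ctl W t i j r div 3 = (t * W + i) * W + j" "ctl W t i j r mod 3 = r"
  unfolding ctl_def by (rule q[OF assms(4)])+
 thus ?thesis using ctl_less[OF assms] by (simp add: advice_def Let_def q[OF assms(2)] q[OF assms(3)] assms(2,3) del: mult_Suc div_mult_self1 div_mult_self2)
qed

lemma acts_slot:
 assumes "t < G" "i < W" "j < W"
 shows "acts W (advice G W gs) (slot W t i j)
  (if t < length gs & (selects (gs ! t) i j 0 | selects (gs ! t) i j 1 | i ~= j & selects (gs ! t) i j 2) then [gs ! t] else [])"
proof -
 let ?w = "advice G W gs"
 let ?k = "%r. Suc (ctl W t i j r)"
 let ?s = "%r. t < length gs & selects (gs ! t) i j r"
 have len: "length ?w = Suc (G * W * W * 3)" by (simp add: advice_def)
 have k: "?k r < length ?w" if "r < 3" for r using ctl_less[OF assms that] len by simp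
 have w0: "~ ?w ! 0" by (simp add: advice_def)
 have 1: "acts W ?w (cH (W + ?k 0) i) (if ?w ! ?k 0 then [Hadamard i] else [])"
  by (rule acts_controlled) (use k[of 0] assms in \<open>auto simp: ap_cH\<close>)
 have 2: "acts W ?w (cT (W + ?k 1) i W) (if ?w ! ?k 1 then [TGate i] else [])"
 proof (rule acts_controlled)
  fix psi :: qvec and z :: "bool list" assume z: "length z = W + length ?w" and psi: "!!y. psi y ~= 0 ==> drop W y = ?w"
  have "z ! W = ?w ! 0" if "drop W z = ?w" using z that by (metis add.right_neutral le_add1 nth_drop)
  thus "ap (cT (W + ?k 1) i W) psi z = (if z ! (W + ?k 1) then apply_gate (TGate i) psi z else psi z)"
   using k[of 1] assms w0 z len psi[of z] by (intro ap_cT) auto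
 qed (use k[of 1] assms in auto)
 have 3: "acts W ?w (if i = j then [] else ccx_gates (W + ?k 2) i j) (if i ~= j & ?w ! ?k 2 then [CNOT i j] else [])"
 proof (cases "i = j")
  case False
  have "acts W ?w (ccx_gates (W + ?k 2) i j) (if ?w ! ?k 2 then [CNOT i j] else [])"
   by (rule acts_controlled) (use k[of 2] assms False in \<open>auto simp: ap_ccx\<close>)
  thus ?thesis using False by simp
 qed (simp add: acts_Nil)
 have c: "?w ! ?k 0 <-> ?s 0" "?w ! ?k 1 <-> ?s 1" "?w ! ?k 2 <-> ?s 2"
  by (rule advice_ctl[OF assms], simp)+
 have eq: "(if ?w ! ?k 0 then [Hadamard i] else []) @ (if ?w ! ?k 1 then [TGate i] else []) @ (if i ~= j & ?w ! ?k 2 then [CNOT i j] else []) =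
   (if t < length gs & (selects (gs ! t) i j 0 | selects (gs ! t) i j 1 | i ~= j & selects (gs ! t) i j 2) then [gs ! t] else [])"
  unfolding c
  by (cases "gs ! t") (auto simp: selects_def)
 show ?thesis unfolding eq[symmetric] slot_def by (intro acts_append 1 2 3)
qed

lemma concat_single: "concat (map (%i. if i = a & P then xs else []) [0..<k]) = (if a < k & P then xs else [])"
 by (induction k) auto

lemma concat_upt_nth:
 fixes gs :: "'a list"
 shows "length gs <= k ==> concat (map (%t. if t < length gs then [gs ! t] else []) [0..<k]) = gs"
proof (induction k arbitrary: gs)
 case (Suc k)
 show ?case
 proof (cases "length gs = Suc k")
  case True
  hence gs: "gs = take k gs @ [gs ! k]" by (metis lessI take_Suc_conv_app_nth take_all_iff order_refl)
  have "concat (map (%t. if t < length (take k gs) then [take k gs ! t] else []) [0..<k]) = take k gs"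
   by (rule Suc.IH) simp
  moreover have "map (%t. if t < length (take k gs) then [take k gs ! t] else []) [0..<k] =
    map (%t. if t < length gs then [gs ! t] else []) [0..<k]"
   using True by (intro map_cong) auto
  ultimately have "concat (map (%t. if t < length gs then [gs ! t] else []) [0..<k]) = take k gs" by (simp only:)
  moreover have c: "concat (map f [0..<Suc k]) = concat (map f [0..<k]) @ f k" for f :: "nat => 'a list" by simp
  ultimately have "concat (map (%t. if t < length gs then [gs ! t] else []) [0..<Suc k]) = take k gs @ [gs ! k]"
   unfolding c using True by (simp only: lessI if_True)
  thus ?thesis using gs by (rule trans[OF _ sym])
 qed (use Suc in simp)
qed simp

lemma universal_acts:
 assumes "length gs <= G" "!!g. g : set gs ==> in_range W g"
 shows "acts W (advice G W gs) (universal G W) gs"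
proof -
 let ?c = "%t i j. t < length gs & (selects (gs ! t) i j 0 | selects (gs ! t) i j 1 | i ~= j & selects (gs ! t) i j 2)"
 let ?G = "%t. concat (map (%i. concat (map (%j. if ?c t i j then [gs ! t] else []) [0..<W])) [0..<W])"
 have "acts W (advice G W gs) (universal G W) (concat (map ?G [0..<G]))"
  unfolding universal_def by (intro acts_concat acts_slot)
 moreover have "?G t = (if t < length gs then [gs ! t] else [])" for t
 proof (cases "t < length gs")
  case True
  hence r: "in_range W (gs ! t)" using assms(2) by simp
  have "\<exists>a b. a < W & b < W & (\<forall>i j. ?c t i j <-> j = b & i = a)"
  proof (cases "gs ! t")
   case (Hadamard a)
   thus ?thesis using r True by (intro exI[of _ a] exI[of _ 0]) (auto simp: selects_def)
  next
   case (TGate a)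
   thus ?thesis using r True by (intro exI[of _ a] exI[of _ 0]) (auto simp: selects_def)
  next
   case (CNOT a b)
   thus ?thesis using r True by (intro exI[of _ a] exI[of _ b]) (auto simp: selects_def)
  qed
  then obtain a b where ab: "a < W" "b < W" and c: "!!i j. ?c t i j <-> j = b & i = a" by blast
  have "concat (map (%i. if i = a then [gs ! t] else []) [0..<W]) = [gs ! t]"
   using concat_single[of a True "[gs ! t]" W] ab by simp
  thus ?thesis unfolding c concat_single using ab True by simp
 next
  case False
  hence "?G t = concat (map (%i. concat (map (%j. []) [0..<W])) [0..<W])" by simp
  thus ?thesis using False by (simp add: concat_eq_Nil_conv)
 qed
 ultimately show ?thesis using concat_upt_nth[OF assms(1)] by simp
qed

lemma run_universal:
 assumes "length gs <= G" "!!g. g : set gs ==> in_range (l + aa + length s) g"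
 shows "run (Circuit l aa (universal G (l + aa + length s))) (s @ advice G (l + aa + length s) gs) = run (Circuit l aa gs) s"
proof (rule pmf_eqI)
 fix y
 let ?W = "l + aa + length s"
 let ?w = "advice G ?W gs"
 let ?psi = "ket (zeros (l + aa) @ s)"
 have l: "ket (zeros (l + aa) @ s @ ?w) = att ?W ?w ?psi"
 proof
  fix z
  have "z = (zeros (l + aa) @ s) @ ?w <-> drop ?W z = ?w & take ?W z = zeros (l + aa) @ s"
   by (metis append_take_drop_id length_replicate length_append append_eq_conv_conj)
  thus "ket (zeros (l + aa) @ s @ ?w) z = att ?W ?w ?psi z"
   by (auto simp: ket_def att_def)
 qed
 have "norm_sq (aa + length (s @ ?w)) (slice y (ap (universal G ?W) (att ?W ?w ?psi))) = norm_sq (aa + length s) (slice y (ap gs ?psi))"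
  if y: "length y = l"
 proof -
  have "norm_sq (aa + length (s @ ?w)) (slice y (ap (universal G ?W) (att ?W ?w ?psi))) =
   norm_sq ((aa + length s) + length ?w) (slice y (ap (universal G ?W) (att ?W ?w ?psi)))" by (simp add: add.assoc)
  also have "... = (\<Sum>u\<in>bits (aa + length s). \<Sum>v\<in>bits (length ?w). (cmod (ap (universal G ?W) (att ?W ?w ?psi) (y @ u @ v)))\<^sup>2)"
   unfolding norm_sq_def sum_bits_append slice_def ..
  also have "... = (\<Sum>u\<in>bits (aa + length s). \<Sum>v\<in>bits (length ?w). if v = ?w then (cmod (ap gs ?psi (y @ u)))\<^sup>2 else 0)"
  proof (intro sum.cong refl)
   fix u v :: "bool list" assume "u : bits (aa + length s)" "v : bits (length ?w)"
   hence uv: "length (y @ u) = ?W" "length ((y @ u) @ v) = ?W + length ?w" using y by simp_all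
   have "ap (universal G ?W) (att ?W ?w ?psi) ((y @ u) @ v) = att ?W ?w (ap gs ?psi) ((y @ u) @ v)"
    using universal_acts[OF assms(1), of ?W] assms(2) uv(2) unfolding acts_def by blast
   thus "(cmod (ap (universal G ?W) (att ?W ?w ?psi) (y @ u @ v)))\<^sup>2 = (if v = ?w then (cmod (ap gs ?psi (y @ u)))\<^sup>2 else 0)"
    using uv by (auto simp: att_def)
  qed
  also have "... = norm_sq (aa + length s) (slice y (ap gs ?psi))"
   unfolding norm_sq_def slice_def by (simp add: sum.delta)
  finally show ?thesis .
 qed
 thus "pmf (run (Circuit l aa (universal G ?W)) (s @ ?w)) y = pmf (run (Circuit l aa gs) s) y"
  unfolding pmf_run circuit.sel load_empty l by simp
qed

lemma pgate_T_power: "pnat E i ==> pgate E (%p. replicate k (TGate (i p)))"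
proof (induction k)
 case 0
 thus ?case using pgate_Nil[of E] by simp
next
 case (Suc k)
 thus ?case unfolding replicate.simps by (intro pgate_T)
qed

lemma pgate_ccx:
 assumes "pnat E a" "pnat E b" "pnat E c"
 shows "pgate E (%p. ccx_gates (a p) (b p) (c p))"
 unfolding ccx_gates_def ccz_gates_def parity_phase_def append.simps
  by (intro pgate_append pgate_T_power pgate_H pgate_T pgate_CNOT assms pgate_Nil)

lemma pgate_cH:
 assumes "pnat E c" "pnat E i"
 shows "pgate E (%p. cH (c p) (i p))"
 unfolding cH_def conj_gates_def append.simps
  by (intro pgate_append pgate_T_power pgate_H pgate_T pgate_CNOT assms pgate_Nil)

lemma pgate_cT:
 assumes "pnat E c" "pnat E i" "pnat E z"
 shows "pgate E (%p. cT (c p) (i p) (z p))"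
 unfolding cT_def append.simps
  by (intro pgate_append pgate_ccx pgate_T assms pgate_Nil)

lemma pgate_universal:
 assumes "pnat E G" "pnat E W"
 shows "pgate E (%p. universal (G p) (W p))"
proof -
 let ?E = "ext (ext (ext E))"
 have W: "pnat ?E (%q. W (fst (fst (fst q))))" by (intro ext_fst[where g = "%q. una (W (fst (fst q)))"] ext_fst[where g = "%q. una (W (fst q))"] ext_fst assms)
 have t: "pnat ?E (%q. snd (fst (fst q)))" by (intro ext_fst[where g = "%q. una (snd (fst q))"] ext_fst[where g = "%q. una (snd q)"] ext_snd)
 have i: "pnat ?E (%q. snd (fst q))" by (intro ext_fst[where g = "%q. una (snd q)"] ext_snd)
 have j: "pnat ?E (%q. snd q)" by (rule ext_snd)
 have c: "pnat ?E (%q. W (fst (fst (fst q))) + Suc (ctl (W (fst (fst (fst q)))) (snd (fst (fst q))) (snd (fst q)) (snd q) r))" for r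
  unfolding ctl_def by (intro pnat_add pnat_Suc pnat_mult W t i j pnat_const)
 have "pgate ?E (%q. slot (W (fst (fst (fst q)))) (snd (fst (fst q))) (snd (fst q)) (snd q))"
  unfolding slot_def by (intro pgate_append pgate_if pgate_cH pgate_cT pgate_ccx pbool_eq pgate_Nil c W i j)
 hence 1: "pgate (ext (ext E)) (%q. concat (map (%j. slot (W (fst (fst q))) (snd (fst q)) (snd q) j) [0..<W (fst (fst q))]))"
  by (intro pgate_concat) (intro ext_fst[where g = "%q. una (W (fst q))"] ext_fst assms)
 hence 2: "pgate (ext E) (%q. concat (map (%i. concat (map (%j. slot (W (fst q)) (snd q) i j) [0..<W (fst q)])) [0..<W (fst q)]))"
  by (intro pgate_concat[where g = "%q i. concat (map (%j. slot (W (fst q)) (snd q) i j) [0..<W (fst q)])"] ext_fst assms)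
 show ?thesis
  unfolding universal_def
  by (rule pgate_concat[where g = "%p t. concat (map (%i. concat (map (%j. slot (W p) t i j) [0..<W p])) [0..<W p])", OF assms(1) 2])
qed

lemma pbound_base_poly:
 assumes "pbound base f"
 shows "\<exists>p :: nat poly. \<forall>n. f n <= poly p n"
proof -
 obtain k where "!!n. f n <= (n + 2) ^ k" using assms unfolding pbound_def by auto
 thus ?thesis by (intro exI[of _ "[:2, 1:] ^ k"]) (simp add: poly_power add.commute)
qed

lemma puzzle_lengths:
 assumes "EV_OWPuzz m l Samp Ver"
 shows "pnat base m" "pnat base l"
proof -
 show m: "pnat base m" using assms poly_time_pcomp by (auto simp: EV_OWPuzz_def)
 have "pnat base (%n. n_out (Samp n) - m n)"
  using assms by (intro pnat_diff QPT_parts(1) m) (simp add: EV_OWPuzz_def)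
 thus "pnat base l" using assms by (simp add: EV_OWPuzz_def)
qed

lemma set_samp_dist:
 assumes "(s, k) : set_pmf (samp_dist m Samp n)" "n_out (Samp n) = m n + l n"
 shows "length s = m n" "length k = l n"
proof -
 obtain y where y: "y : set_pmf (run (Samp n) [])" "s = take (m n) y" "k = drop (m n) y"
  using assms(1) by (auto simp: samp_dist_def)
 have "length y = n_out (Samp n)" using y(1) by (auto simp: set_pmf_iff pmf_run split: if_splits)
 thus "length s = m n" "length k = l n" using y assms(2) by simp_all
qed

text \<open>
 Since circuits can be evaluated by a universal one, the puzzle is secure against families of
 polynomial-size circuits that need not be uniform.
\<close>

theorem nonuniform_security:
 assumes P: "EV_OWPuzz m l Samp Ver" and "pnat base aa" "pnat base G" "!!n. length (gs n) <= G n"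
  and "!!n g. g : set (gs n) ==> in_range (l n + aa n + m n) g"
 shows "negl (%n. pmf (do {
  (s, k) <- samp_dist m Samp n; k' <- run (Circuit (l n) (aa n) (gs n)) s; verify Ver n s k'}) True)"
proof -
 let ?W = "%n. l n + aa n + m n"
 define A where "A n = Circuit (l n) (aa n) (universal (G n) (?W n))" for n
 define c where "c n = advice (G n) (?W n) (gs n)" for n
 have W: "pnat base ?W" by (intro pnat_add assms puzzle_lengths[OF P])
 have "QPT A"
  unfolding QPT_def QPT_machine_iff A_def
  by (intro pcircs_single pgate_universal puzzle_lengths[OF P] assms W)
 moreover have "poly_length c"
 proof -
  have "pbound base (%n. 1 + G n * ?W n * ?W n * 3)"
   by (intro pbound_add pbound_mult pbound_const pnat_bound[OF assms(3)] pnat_bound[OF W])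
  moreover have "length (c n) = 1 + G n * ?W n * ?W n * 3" for n by (simp add: c_def advice_def)
  ultimately show ?thesis unfolding poly_length_def using pbound_base_poly by simp
 qed
 moreover have "n_out (A n) = l n" for n by (simp add: A_def)
 ultimately have "negl (%n. pmf (do {(s, k) <- samp_dist m Samp n; k' <- run (A n) (s @ c n); verify Ver n s k'}) True)"
  using P unfolding EV_OWPuzz_def by blast
 moreover have "(do {(s, k) <- samp_dist m Samp n; k' <- run (A n) (s @ c n); verify Ver n s k'}) =
  (do {(s, k) <- samp_dist m Samp n; k' <- run (Circuit (l n) (aa n) (gs n)) s; verify Ver n s k'})" for n
 proof (rule bind_pmf_cong[OF refl])
  fix sk assume sk: "sk : set_pmf (samp_dist m Samp n)"
  obtain s k where [simp]: "sk = (s, k)" by (cases sk)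
  have s: "length s = m n" using set_samp_dist(1)[of s k m Samp n l] sk P by (simp add: EV_OWPuzz_def)
  have "run (A n) (s @ c n) = run (Circuit (l n) (aa n) (gs n)) s"
   using run_universal[of "gs n" "G n" "l n" "aa n" s] assms(4,5) unfolding A_def c_def s by blast
  thus "(case sk of (s, k) => bind_pmf (run (A n) (s @ c n)) (%k'. verify Ver n s k')) =
    (case sk of (s, k) => bind_pmf (run (Circuit (l n) (aa n) (gs n)) s) (%k'. verify Ver n s k'))" by simp
 qed
 ultimately show ?thesis by simp
qed

section \<open>Measuring commutes with classical computation\<close>

text \<open>A circuit without ancillas that adds f of the input and the private state to its output wires.\<close>

definition classical :: "circuit => nat => (bool list => bool list) => bool" where
 "classical C N f <-> n_anc C = 0 & (\<forall>w. length w = N --> length (f w) = n_out C) &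
   (\<forall>phi y w. length y = n_out C --> length w = N --> ap (gates C) phi (y @ w) = phi (map2 (~=) y (f w) @ w))"

lemma map2_neq_False: "length y = length v ==> map2 (~=) y v = zeros (length v) <-> y = v"
 by (induction y v rule: list_induct2) auto

lemma slice_classical:
 assumes C: "classical C (length x + n) f" and y: "length y = n_out C" and w: "length w = length x + n"
 shows "slice y (ap (gates C) (load (n_out C + n_anc C) x psi)) w =
  (if y = f w & take (length x) w = x then psi (drop (length x) w) else 0)"
proof -
 have a: "n_anc C = 0" and f: "length (f w) = n_out C" and
  g: "ap (gates C) phi (y @ w) = phi (map2 (~=) y (f w) @ w)" for phi
  using C y w unfolding classical_def by blast+
 have "slice y (ap (gates C) (load (n_out C + n_anc C) x psi)) w = load (n_out C) x psi (map2 (~=) y (f w) @ w)"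
  by (simp add: slice_def g a)
 also have "... = (if map2 (~=) y (f w) = zeros (n_out C) & take (length x) w = x then psi (drop (length x) w) else 0)"
  using f y by (simp add: load_def)
 also have "map2 (~=) y (f w) = zeros (n_out C) <-> y = f w"
  using map2_neq_False[of y "f w"] f y by simp
 finally show ?thesis .
qed

lemma activate_classical_ket:
 assumes C: "classical C (length x + length u) f"
 shows "activate (act C) x (ket u) = return_pmf (f (x @ u), ket (x @ u))"
proof -
 let ?k = "n_out C" and ?n = "length x + length u"
 define Phi where "Phi = ap (gates C) (load (?k + n_anc C) x (ket u))"
 have a: "n_anc C = 0" and f: "length (f (x @ u)) = ?k" using C by (auto simp: classical_def)
 have st: "Phi : qspace (?k + ?n)" "norm_sq (?k + ?n) Phi = 1"
  using circuit_state[OF ket_state[of u], where gs = "gates C" and k = ?k and j = "n_anc C" and x = x] by (simp_all add: Phi_def a)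
 have sl: "slice y Phi w = (if y = f (x @ u) then ket (x @ u) w else 0)" if "length y = ?k" "length w = ?n" for y w
 proof -
  have "take (length x) w = x & drop (length x) w = u <-> w = x @ u"
   by (metis append_eq_conv_conj append_take_drop_id)
  thus ?thesis unfolding Phi_def slice_classical[OF C that] by (auto simp: ket_def)
 qed
 have n: "norm_sq ?n (slice y Phi) = (if y = f (x @ u) then 1 else 0)" if "length y = ?k" for y
 proof -
  have "norm_sq ?n (slice y Phi) = norm_sq ?n (%w. if y = f (x @ u) then ket (x @ u) w else 0)"
   by (rule norm_sq_cong) (rule sl[OF that])
  thus ?thesis using ket_state(2)[of "x @ u"] by (simp add: norm_sq_def)
 qed
 have p: "map_pmf (take ?k) (born Phi) = return_pmf (f (x @ u))"
  by (rule pmf_eqI) (auto simp: pmf_take_born[OF st] n f)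
 have r: "renorm ?n (slice (f (x @ u)) Phi) = ket (x @ u)"
 proof
  fix w
  show "renorm ?n (slice (f (x @ u)) Phi) w = ket (x @ u) w"
  proof (cases "length w = ?n")
   case True thus ?thesis by (simp add: renorm_def n f sl)
  next
   case False
   have "slice (f (x @ u)) Phi : qspace ?n" by (rule slice_qspace[OF st(1) f])
   thus ?thesis using False by (auto simp: renorm_def ket_def qspace_def)
  qed
 qed
 have "activate (act C) x (ket u) = measure_wires ?k Phi" by (simp add: activate_circuit Phi_def)
 thus ?thesis unfolding measure_wires_alt[OF st] p by (simp add: r)
qed

text \<open>F behaves as if its state were measured first.\<close>

definition meas :: "nat => (qvec => 'a pmf) => bool" where
 "meas n F <-> (\<forall>psi\<in>qspace n. norm_sq n psi = 1 -->
   (\<forall>v. pmf (F psi) v = (\<Sum>u\<in>bits n. (cmod (psi u))\<^sup>2 * pmf (F (ket u)) v)))"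

lemma meas_const: "meas n (%_. p)"
 by (auto simp: meas_def norm_sq_def sum_distrib_right[symmetric])

lemma meas_bind:
 assumes "!!r. r : set_pmf p ==> meas n (F r)"
 shows "meas n (%psi. bind_pmf p (%r. F r psi))"
 unfolding meas_def
proof (intro ballI impI allI)
 fix psi v assume psi: "psi : qspace n" "norm_sq n psi = 1"
 have i: "integrable (measure_pmf p) (%r. a * pmf (F r (ket u)) v)" for u and a :: real
  by (intro integrable_mult_right measure_pmf.integrable_const_bound[where B = 1]) (auto simp: pmf_le_1)
 have "pmf (bind_pmf p (%r. F r psi)) v = (\<integral>r. pmf (F r psi) v \<partial>measure_pmf p)" by (rule pmf_bind)
 also have "... = (\<integral>r. (\<Sum>u\<in>bits n. (cmod (psi u))\<^sup>2 * pmf (F r (ket u)) v) \<partial>measure_pmf p)"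
  by (intro integral_cong_AE) (use assms psi in \<open>auto simp: AE_measure_pmf_iff meas_def\<close>)
 also have "... = (\<Sum>u\<in>bits n. \<integral>r. (cmod (psi u))\<^sup>2 * pmf (F r (ket u)) v \<partial>measure_pmf p)"
  by (rule Bochner_Integration.integral_sum) (rule i)
 also have "... = (\<Sum>u\<in>bits n. (cmod (psi u))\<^sup>2 * pmf (bind_pmf p (%r. F r (ket u))) v)" by (simp add: pmf_bind)
 finally show "pmf (bind_pmf p (%r. F r psi)) v = (\<Sum>u\<in>bits n. (cmod (psi u))\<^sup>2 * pmf (bind_pmf p (%r. F r (ket u))) v)" .
qed

lemma meas_activate:
 assumes C: "classical C (length x + n) f" and G: "!!c. length c = n_out C ==> meas (length x + n) (G c)"
 shows "meas n (%psi. activate (act C) x psi \<bind> (%(c, psi'). G c psi'))"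
proof -
 let ?k = "n_out C" and ?n = "length x + n"
 have fl: "length (f w) = ?k" if "length w = ?n" for w using C that by (auto simp: classical_def)
 have main: "pmf (activate (act C) x psi \<bind> (%(c, psi'). G c psi')) v =
  (\<Sum>u\<in>bits n. (cmod (psi u))\<^sup>2 * pmf (G (f (x @ u)) (ket (x @ u))) v)"
  if psi: "psi : qspace n" "norm_sq n psi = 1" for psi v
 proof -
  define Phi where "Phi = ap (gates C) (load (?k + n_anc C) x psi)"
  have a: "n_anc C = 0" using C by (auto simp: classical_def)
  have st: "Phi : qspace (?k + ?n)" "norm_sq (?k + ?n) Phi = 1"
   using circuit_state[OF psi, where gs = "gates C" and k = ?k and j = "n_anc C" and x = x] by (simp_all add: Phi_def a)
  have 1: "norm_sq ?n (slice y Phi) * pmf (G y (renorm ?n (slice y Phi))) v =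
    (\<Sum>w\<in>bits ?n. (cmod (slice y Phi w))\<^sup>2 * pmf (G y (ket w)) v)" if y: "length y = ?k" for y
  proof (cases "norm_sq ?n (slice y Phi) = 0")
   case True
   hence "\<forall>w\<in>bits ?n. (cmod (slice y Phi w))\<^sup>2 = 0"
    unfolding norm_sq_def by (subst (asm) sum_nonneg_eq_0_iff) auto
   thus ?thesis using True by simp
  next
   case False
   have q: "slice y Phi : qspace ?n" by (rule slice_qspace[OF st(1) y])
   have "pmf (G y (renorm ?n (slice y Phi))) v = (\<Sum>w\<in>bits ?n. (cmod (renorm ?n (slice y Phi) w))\<^sup>2 * pmf (G y (ket w)) v)"
    using G[OF y] renorm_state[OF q False] unfolding meas_def by blast
   moreover have "norm_sq ?n (slice y Phi) * (cmod (renorm ?n (slice y Phi) w))\<^sup>2 = (cmod (slice y Phi w))\<^sup>2" for w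
    using False norm_sq_nonneg[of ?n "slice y Phi"] by (simp add: renorm_def norm_divide power_divide)
   ultimately show ?thesis by (simp add: sum_distrib_left mult.assoc[symmetric])
  qed
  have 2: "(\<Sum>w\<in>bits ?n. (cmod (slice y Phi w))\<^sup>2 * pmf (G y (ket w)) v) =
    (\<Sum>u\<in>bits n. (if y = f (x @ u) then (cmod (psi u))\<^sup>2 * pmf (G y (ket (x @ u))) v else 0))" if y: "length y = ?k" for y
  proof -
   have "(\<Sum>w\<in>bits ?n. (cmod (slice y Phi w))\<^sup>2 * pmf (G y (ket w)) v) =
     (\<Sum>x'\<in>bits (length x). \<Sum>u\<in>bits n. if x' = x then (if y = f (x @ u) then (cmod (psi u))\<^sup>2 * pmf (G y (ket (x @ u))) v else 0) else 0)"
    unfolding sum_bits_append by (intro sum.cong refl) (auto simp: Phi_def slice_classical[OF C y])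
   also have "... = (\<Sum>x'\<in>bits (length x). if x' = x then (\<Sum>u\<in>bits n. if y = f (x @ u) then (cmod (psi u))\<^sup>2 * pmf (G y (ket (x @ u))) v else 0) else 0)"
    by (intro sum.cong refl) auto
   finally show ?thesis by (simp add: sum.delta)
  qed
  have "pmf (activate (act C) x psi \<bind> (%(c, psi'). G c psi')) v =
    (\<Sum>y\<in>bits ?k. norm_sq ?n (slice y Phi) * pmf (G y (renorm ?n (slice y Phi))) v)"
   using pmf_activate_bind[OF psi, of ?n C x "%(c, psi'). G c psi'" v] by (simp add: a Phi_def)
  also have "... = (\<Sum>y\<in>bits ?k. \<Sum>u\<in>bits n. (if y = f (x @ u) then (cmod (psi u))\<^sup>2 * pmf (G y (ket (x @ u))) v else 0))"
   by (intro sum.cong refl) (simp add: 1 2)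
  also have "... = (\<Sum>u\<in>bits n. \<Sum>y\<in>bits ?k. (if y = f (x @ u) then (cmod (psi u))\<^sup>2 * pmf (G y (ket (x @ u))) v else 0))"
   by (rule sum.swap)
  also have "... = (\<Sum>u\<in>bits n. (cmod (psi u))\<^sup>2 * pmf (G (f (x @ u)) (ket (x @ u))) v)"
   by (intro sum.cong refl) (simp add: sum.delta fl)
  finally show ?thesis .
 qed
 have "pmf (activate (act C) x (ket u) \<bind> (%(c, psi'). G c psi')) v = pmf (G (f (x @ u)) (ket (x @ u))) v" if "length u = n" for u v
  using activate_classical_ket[of C x u f] C that by (simp add: bind_return_pmf)
 thus ?thesis unfolding meas_def by (simp add: main)
qed

text \<open>A pure state on some number of wires.\<close>

definition valid :: "qvec => bool" where
 "valid psi <-> (\<exists>n. psi : qspace n & norm_sq n psi = 1)"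

lemma activate_valid:
 assumes "unitary_op (act_op A)" "valid psi" "(r, psi') : set_pmf (activate A x psi)"
 shows "length r = act_out A" "valid psi'"
proof -
 obtain n where n: "psi : qspace n" "norm_sq n psi = 1" using assms(2) unfolding valid_def by blast
 let ?N = "act_out A + act_anc A + length x + n"
 have "act_op A (load (act_out A + act_anc A) x psi) : qspace ?N" "norm_sq ?N (act_op A (load (act_out A + act_anc A) x psi)) = 1"
  using assms(1) load_state[OF n, of "act_out A + act_anc A" x] by (simp_all add: unitary_op_def)
 moreover have "?N = act_out A + (act_anc A + length x + n)" by simp
 ultimately show "length r = act_out A" "valid psi'"
  using measure_state[of _ "act_out A" "act_anc A + length x + n"] assms(3) unfolding activate_def valid_def by metis+
qed

lemma meas_interact:
 assumes "!!i. i < length Cs ==> \<exists>f. classical (Cs ! i) (n + (length x + i * m)) f"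
  and "!!A. A : set Rs ==> unitary_op (act_op A) & act_out A = m" "length Rs = length Cs" "valid psiR"
  and "!!z phiR. valid phiR ==> length (concat z) = (\<Sum>C\<leftarrow>Cs. n_out C + m) ==> meas (n + (if Cs = [] then 0 else length x + (length Cs - 1) * m)) (%phi. Q (z, phi, phiR))"
 shows "meas n (%psi. interact (map act Cs) Rs x y psi psiR \<bind> Q)"
 using assms
proof (induction Cs arbitrary: Rs x y n psiR Q)
 case Nil
 thus ?case using Nil.prems(5)[of psiR "[]"] by (simp add: bind_return_pmf)
next
 case (Cons C Cs)
 obtain R Rs' where Rs: "Rs = R # Rs'" using Cons.prems(3) by (cases Rs) auto
 obtain f where f: "classical C (length x + n) f" using Cons.prems(1)[of 0] by (auto simp: add.commute)
 let ?G = "%c psi'. activate R (y @ c) psiR \<bind> (%rp. interact (map act Cs) Rs' (fst rp) [] psi' (snd rp) \<bind>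
  (%w. Q (c # fst rp # fst w, snd w)))"
 have "meas (length x + n) (?G c)" if lc: "length c = n_out C" for c
 proof (rule meas_bind)
  fix rp assume rp: "rp : set_pmf (activate R (y @ c) psiR)"
  have R: "length (fst rp) = m" "valid (snd rp)"
   using activate_valid[of R psiR "fst rp" "snd rp"] Cons.prems(2,4) rp Rs by auto
  show "meas (length x + n) (%psi'. interact (map act Cs) Rs' (fst rp) [] psi' (snd rp) \<bind> (%w. Q (c # fst rp # fst w, snd w)))"
  proof (rule Cons.IH)
   show "\<exists>f. classical (Cs ! i) (length x + n + (length (fst rp) + i * m)) f" if "i < length Cs" for i
    using Cons.prems(1)[of "Suc i"] that R(1) by (simp add: add_ac)
   show "meas (length x + n + (if Cs = [] then 0 else length (fst rp) + (length Cs - 1) * m))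
     (%phi. Q (c # fst rp # fst (z, phi, phiR), snd (z, phi, phiR)))"
    if "valid phiR" "length (concat z) = (\<Sum>C\<leftarrow>Cs. n_out C + m)" for z phiR
   proof -
    have l: "length (concat (c # fst rp # z)) = (\<Sum>C\<leftarrow>C # Cs. n_out C + m)" using that(2) R(1) lc by simp
    have "n + (if C # Cs = [] then 0 else length x + (length (C # Cs) - 1) * m) =
     length x + n + (if Cs = [] then 0 else length (fst rp) + (length Cs - 1) * m)"
     using R(1) by (cases Cs) (auto simp: add_ac)
    from Cons.prems(5)[OF that(1) l, unfolded this] show ?thesis by simp
   qed
  qed (use Cons.prems Rs R in auto)
 qed
 from meas_activate[OF f this] show ?case
  by (simp add: Rs bind_assoc_pmf case_prod_unfold bind_return_pmf)
qed

section \<open>The honest committer\<close>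

lemma classical_target:
 assumes "!!c. c : set cs ==> tgt c = 0 & cok (Suc N) c"
 shows "classical (Circuit 1 0 (cg cs)) N (%w. [parity (map (%c. cval c (False # w)) cs)])"
 unfolding classical_def circuit.sel
proof (intro conjI allI impI)
 fix phi :: qvec and y w :: "bool list" assume "length y = 1" and w: "length w = N"
 then obtain b where y: "y = [b]" by (auto simp: length_Suc_conv)
 have v: "cval c (b # w) = cval c (False # w)" if "c : set cs" for c
 proof -
  have "0 ~: set (ctrls c)" using assms[OF that] by (auto simp: cok_def)
  hence "(b # w) ! a = (False # w) ! a" if "a : set (ctrls c)" for a using that by (cases a) auto
  thus ?thesis by (auto simp: cval_def)
 qed
 have "ap (cg cs) phi (b # w) = phi (foldr cact cs (b # w))"
  by (rule ap_cg) (use assms w in simp)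
 also have "foldr cact cs (b # w) = (b # w)[0 := ((b # w) ! 0 ~= parity (map (%c. cval c (b # w)) cs))]"
  by (rule foldr_cact_target) (use assms w in simp)
 also have "map (%c. cval c (b # w)) cs = map (%c. cval c (False # w)) cs" using v by simp
 finally show "ap (cg cs) phi (y @ w) = phi (map2 (~=) y [parity (map (%c. cval c (False # w)) cs)] @ w)" by (simp add: y)
qed simp_all

lemma dot_parity: "length xs = n ==> length ys = n ==> dot xs ys = parity (map (%t. xs ! t & ys ! t) [0..<n])"
proof (induction n arbitrary: xs ys)
 case (Suc n)
 then obtain x xs' y ys' where xy: "xs = x # xs'" "ys = y # ys'" by (cases xs; cases ys) auto
 thus ?case using Suc by (simp add: map_upt_Suc del: upt_Suc)
qed simp

text \<open>
 In the round with challenge i the wires are the answer, the challenges i down to 0, the K wires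
 of the sampler, which start with the puzzle, and the committed bit.
\<close>

definition answer :: "nat => nat => nat => cgate list" where
 "answer m K i = XG [1 + m * Suc i + i] 0 #
   map (%t. XG [1 + (Suc i + t), 1 + m * Suc i + (Suc i + t)] 0) [0..<m - Suc i] @
   (if Suc i = m then [XG [1 + m * Suc i + K] 0] else [])"

definition answer_circuit :: "nat => nat => nat => circuit" where
 "answer_circuit m K i = Circuit 1 0 (cg (answer m K i))"

abbreviation resp :: "nat => nat => nat => bool list => bool" where
 "resp m K i w == parity (map (%c. cval c (False # w)) (answer m K i))"

lemma classical_answer:
 assumes "i < m" "m <= K"
 shows "classical (answer_circuit m K i) (m + m * i + (K + 1)) (%w. [resp m K i w])"
 unfolding answer_circuit_def
proof (rule classical_target)
 fix c assume "c : set (answer m K i)"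
 thus "tgt c = 0 & cok (Suc (m + m * i + (K + 1))) c"
  using assms by (auto simp: answer_def cok_def split: if_splits)
qed

lemma resp_eq:
 assumes "i < m" "m <= K" "length v = m" "length old = m * i" "length y = K"
 shows "resp m K i (v @ old @ y @ [b]) = ((y ! i ~= dot (drop (Suc i) v) (drop (Suc i) (take m y))) ~= (Suc i = m & b))"
proof -
 let ?w = "False # v @ old @ y @ [b]"
 have y: "?w ! (1 + m * Suc i + t) = y ! t" if "t < K" for t
  using assms that by (simp add: nth_append)
 have v: "?w ! (1 + t) = v ! t" if "t < m" for t using assms that by (simp add: nth_append)
 have b: "?w ! (1 + m * Suc i + K) = b" using assms by (simp add: nth_append)
 have "map (%t. ?w ! (1 + (Suc i + t)) & ?w ! (1 + m * Suc i + (Suc i + t))) [0..<m - Suc i] =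
   map (%t. drop (Suc i) v ! t & drop (Suc i) (take m y) ! t) [0..<m - Suc i]"
 proof (rule map_cong[OF refl])
  fix t assume "t : set [0..<m - Suc i]"
  hence t: "Suc i + t < m" by auto
  thus "(?w ! (1 + (Suc i + t)) & ?w ! (1 + m * Suc i + (Suc i + t))) =
    (drop (Suc i) v ! t & drop (Suc i) (take m y) ! t)"
   using v[OF t] y[of "Suc i + t"] assms by simp
 qed
 moreover have "dot (drop (Suc i) v) (drop (Suc i) (take m y)) =
   parity (map (%t. drop (Suc i) v ! t & drop (Suc i) (take m y) ! t) [0..<m - Suc i])"
  using assms by (intro dot_parity) simp_all
 ultimately have d: "dot (drop (Suc i) v) (drop (Suc i) (take m y)) =
   parity (map (%t. ?w ! (1 + (Suc i + t)) & ?w ! (1 + m * Suc i + (Suc i + t))) [0..<m - Suc i])" by (simp only:)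
 have e: "map (%c. cval c ?w) (answer m K i) = ?w ! (1 + m * Suc i + i) #
   map (%t. ?w ! (1 + (Suc i + t)) & ?w ! (1 + m * Suc i + (Suc i + t))) [0..<m - Suc i] @
   (if Suc i = m then [?w ! (1 + m * Suc i + K)] else [])"
  by (simp add: answer_def cval_def o_def del: nth_Cons_Suc append_Cons mult_Suc_right)
 have "resp m K i (v @ old @ y @ [b]) = ((y ! i ~= dot (drop (Suc i) v) (drop (Suc i) (take m y))) ~= (if Suc i = m then b else False))"
  unfolding e d b y[OF less_le_trans[OF assms(1,2)]] by (simp del: nth_Cons_Suc append_Cons mult_Suc_right)
 thus ?thesis by auto
qed

text \<open>The committer as a classical party that knows the rest of the puzzle.\<close>

fun committer :: "nat => bool => bool list => bool list => activation list => qvec => bool list list pmf" where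
 "committer m b v (x # t) (R # Rs) psi =
   bind_pmf (activate R [(x ~= dot (drop (m - length t) v) t) ~= (t = [] & b)] psi) (%(r, psi').
   bind_pmf (committer m b r t Rs psi') (%z.
   return_pmf ([(x ~= dot (drop (m - length t) v) t) ~= (t = [] & b)] # r # z)))"
| "committer m b v _ _ psi = return_pmf []"

abbreviation answers :: "nat => nat => nat => activation list" where
 "answers m K i == map act (map (answer_circuit m K) [i..<m])"

lemma activate_answer:
 assumes "i < m" "m <= K" "length v = m" "length old = m * i" "length y = K"
 shows "activate (act (answer_circuit m K i)) v (ket (old @ y @ [b])) =
  return_pmf ([(y ! i ~= dot (drop (Suc i) v) (drop (Suc i) (take m y))) ~= (Suc i = m & b)], ket ((v @ old) @ y @ [b]))"
 using activate_classical_ket[of "answer_circuit m K i" v "old @ y @ [b]"] classical_answer[OF assms(1,2)] assms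
 by (simp add: resp_eq add.assoc)

lemma interact_committer:
 assumes "i <= m" "m <= K" "length Rs = m - i" "!!A. A : set Rs ==> unitary_op (act_op A) & act_out A = m" "valid psiR"
  "length v = m" "length old = m * i" "length y = K"
 shows "map_pmf fst (interact (answers m K i) Rs v [] (ket (old @ y @ [b])) psiR) =
  committer m b v (drop i (take m y)) Rs psiR"
 using assms(1,3-)
proof (induction Rs arbitrary: i v old psiR)
 case Nil
 thus ?case by simp
next
 case (Cons R Rs)
 hence i: "i < m" by simp
 let ?s = "take m y"
 let ?c = "(y ! i ~= dot (drop (Suc i) v) (drop (Suc i) ?s)) ~= (Suc i = m & b)"
 have d: "drop i ?s = y ! i # drop (Suc i) ?s"
  using i Cons.prems assms(2) by (simp add: Cons_nth_drop_Suc[symmetric])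
 have l: "m - length (drop (Suc i) ?s) = Suc i" "drop (Suc i) ?s = [] <-> Suc i = m"
  using i Cons.prems assms(2) by auto
 have "answers m K i = act (answer_circuit m K i) # answers m K (Suc i)"
  using i by (simp add: upt_conv_Cons)
 hence "map_pmf fst (interact (answers m K i) (R # Rs) v [] (ket (old @ y @ [b])) psiR) =
  bind_pmf (activate R [?c] psiR) (%rp. bind_pmf (map_pmf fst (interact (answers m K (Suc i)) Rs (fst rp) [] (ket ((v @ old) @ y @ [b])) (snd rp)))
   (%z. return_pmf ([?c] # fst rp # z)))"
  using activate_answer[OF i assms(2) Cons.prems(5,6,7), of b]
  by (simp add: bind_return_pmf map_bind_pmf bind_map_pmf case_prod_unfold map_pmf_def[symmetric] map_pmf_comp)
 also have "... = bind_pmf (activate R [?c] psiR) (%rp. bind_pmf (committer m b (fst rp) (drop (Suc i) ?s) Rs (snd rp))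
   (%z. return_pmf ([?c] # fst rp # z)))"
 proof (rule bind_pmf_cong[OF refl])
  fix rp assume rp: "rp : set_pmf (activate R [?c] psiR)"
  have R: "length (fst rp) = m" "valid (snd rp)"
   using activate_valid[of R psiR "fst rp" "snd rp"] Cons.prems rp by auto
  have "map_pmf fst (interact (answers m K (Suc i)) Rs (fst rp) [] (ket ((v @ old) @ y @ [b])) (snd rp)) =
    committer m b (fst rp) (drop (Suc i) ?s) Rs (snd rp)"
   by (rule Cons.IH) (use Cons.prems R i in auto)
  thus "bind_pmf (map_pmf fst (interact (answers m K (Suc i)) Rs (fst rp) [] (ket ((v @ old) @ y @ [b])) (snd rp)))
    (%z. return_pmf ([?c] # fst rp # z)) =
   bind_pmf (committer m b (fst rp) (drop (Suc i) ?s) Rs (snd rp)) (%z. return_pmf ([?c] # fst rp # z))" by simp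
 qed
 also have "... = committer m b v (drop i ?s) (R # Rs) psiR"
  unfolding d committer.simps l case_prod_unfold by (rule refl)
 finally show ?case .
qed

text \<open>For a uniformly random puzzle all answers are random, whatever the committed bit is.\<close>

fun random_answers :: "activation list => qvec => bool list list pmf" where
 "random_answers [] psi = return_pmf []"
| "random_answers (R # Rs) psi = bind_pmf (pmf_of_set UNIV) (%c. bind_pmf (activate R [c] psi) (%(r, psi').
   bind_pmf (random_answers Rs psi') (%z. return_pmf ([c] # r # z))))"

lemma uniform_Cons:
 "pmf_of_set (bits (Suc n)) = bind_pmf (pmf_of_set (bits n)) (%t. map_pmf (%x. x # t) (pmf_of_set UNIV))"
proof -
 have "bij_betw (%(t, x). x # t) (bits n \<times> (UNIV :: bool set)) (bits (Suc n))"
  by (rule bij_betw_byWitness[where f' = "%w. (tl w, hd w)"]) (auto simp: length_Suc_conv)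
 hence "map_pmf (%(t, x). x # t) (pmf_of_set (bits n \<times> UNIV)) = pmf_of_set (bits (Suc n))"
  by (rule map_pmf_of_set_bij_betw) (auto intro: Ex_list_of_length)
 moreover have "pmf_of_set (bits n \<times> (UNIV :: bool set)) = pair_pmf (pmf_of_set (bits n)) (pmf_of_set UNIV)"
 proof (rule pmf_eqI)
  fix tx :: "bool list \<times> bool"
  have ne: "bits n \<times> (UNIV :: bool set) ~= {}" using bits_nonempty[of n] by blast
  show "pmf (pmf_of_set (bits n \<times> UNIV)) tx = pmf (pair_pmf (pmf_of_set (bits n)) (pmf_of_set UNIV)) tx"
   by (cases tx) (simp add: pmf_pair pmf_of_set[OF ne] pmf_of_set[OF bits_nonempty finite_bits] indicator_def card_cartesian_product)
 qed
 ultimately show ?thesis by (simp add: pair_pmf_def map_bind_pmf map_pmf_def bind_return_pmf bind_assoc_pmf)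
qed

lemma coin_shift: "bind_pmf (pmf_of_set UNIV) (%x. F (x ~= a)) = bind_pmf (pmf_of_set UNIV) F" for a :: bool
proof -
 have "bij_betw (%x. x ~= a) UNIV UNIV" by (rule bij_betw_byWitness[where f' = "%x. x ~= a"]) auto
 hence "map_pmf (%x. x ~= a) (pmf_of_set UNIV) = pmf_of_set UNIV" by (rule map_pmf_of_set_bij_betw) auto
 thus ?thesis using bind_map_pmf[of "%x. x ~= a" "pmf_of_set UNIV" F] by simp
qed

lemma committer_uniform:
 "length Rs = n ==> bind_pmf (pmf_of_set (bits n)) (%t. committer m b v t Rs psi) = random_answers Rs psi"
proof (induction n arbitrary: Rs v psi)
 case (Suc n)
 then obtain R Rs' where Rs: "Rs = R # Rs'" "length Rs' = n" by (cases Rs) auto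
 let ?F = "%t c. bind_pmf (activate R [c] psi) (%rp. bind_pmf (committer m b (fst rp) t Rs' (snd rp)) (%z. return_pmf ([c] # fst rp # z)))"
 have c: "committer m b v (x # t) Rs psi = ?F t (x ~= (dot (drop (m - length t) v) t ~= (t = [] & b)))" for x t
 proof -
  have "((x ~= dot (drop (m - length t) v) t) ~= (t = [] & b)) = (x ~= (dot (drop (m - length t) v) t ~= (t = [] & b)))" by blast
  thus ?thesis unfolding Rs committer.simps case_prod_unfold by (simp only:)
 qed
 have "bind_pmf (pmf_of_set (bits (Suc n))) (%t. committer m b v t Rs psi) =
   bind_pmf (pmf_of_set (bits n)) (%t. bind_pmf (pmf_of_set UNIV) (%x. ?F t (x ~= (dot (drop (m - length t) v) t ~= (t = [] & b)))))"
  unfolding uniform_Cons bind_assoc_pmf bind_map_pmf c ..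
 also have "... = bind_pmf (pmf_of_set (bits n)) (%t. bind_pmf (pmf_of_set UNIV) (?F t))"
  unfolding coin_shift[where F = "?F _"] ..
 also have "... = bind_pmf (pmf_of_set UNIV) (%c. bind_pmf (pmf_of_set (bits n)) (%t. ?F t c))"
  by (rule bind_commute_pmf)
 also have "... = bind_pmf (pmf_of_set UNIV) (%c. bind_pmf (activate R [c] psi) (%rp. bind_pmf (pmf_of_set (bits n))
   (%t. bind_pmf (committer m b (fst rp) t Rs' (snd rp)) (%z. return_pmf ([c] # fst rp # z)))))"
  by (subst bind_commute_pmf[of "pmf_of_set (bits n)"]) (rule refl)
 also have "... = bind_pmf (pmf_of_set UNIV) (%c. bind_pmf (activate R [c] psi) (%rp. bind_pmf (random_answers Rs' (snd rp))
   (%z. return_pmf ([c] # fst rp # z))))"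
  unfolding bind_assoc_pmf[symmetric] Suc.IH[OF Rs(2)] ..
 finally show ?case unfolding Rs random_answers.simps case_prod_unfold .
qed simp

text \<open>In the first round the sampler is run on the committer's private wires.\<close>

definition sample_circuit :: "nat => gate list => circuit" where
 "sample_circuit K gs = Circuit 1 K (map (rn (%i. if i < K then i + 1 else i + 2)) gs)"

lemma att_state:
 assumes "psi : qspace n" "norm_sq n psi = 1"
 shows "att n w psi : qspace (n + length w)" "norm_sq (n + length w) (att n w psi) = 1"
proof -
 have "length x = n + length w" if "drop n x = w" "length (take n x) = n" for x :: "bool list"
  using that append_take_drop_id[of n x] by (metis length_append)
 thus "att n w psi : qspace (n + length w)" using assms(1) by (auto simp: att_def qspace_def)
 have "norm_sq (n + length w) (att n w psi) = (\<Sum>u\<in>bits n. \<Sum>v\<in>bits (length w). if v = w then (cmod (psi u))\<^sup>2 else 0)"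
  unfolding norm_sq_def sum_bits_append by (intro sum.cong refl) (auto simp: att_def)
 thus "norm_sq (n + length w) (att n w psi) = 1" using assms(2) by (simp add: norm_sq_def)
qed

lemma born_att:
 assumes "psi : qspace n" "norm_sq n psi = 1"
 shows "born (att n w psi) = map_pmf (%y. y @ w) (born psi)"
proof (rule pmf_eqI)
 fix z
 show "pmf (born (att n w psi)) z = pmf (map_pmf (%y. y @ w) (born psi)) z"
 proof (cases "drop n z = w & length (take n z) = n")
  case True
  have inj: "inj (%y. y @ w)" by (simp add: inj_on_def)
  have z: "z = take n z @ w" using True append_take_drop_id[of n z] by simp
  have "pmf (map_pmf (%y. y @ w) (born psi)) z = pmf (born psi) (take n z)"
   by (subst z, subst pmf_map_inj'[OF inj]) simp
  thus ?thesis using True by (simp add: pmf_born[OF att_state[OF assms]] pmf_born[OF assms] att_def)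
 next
  case False
  have "z ~: (%y. y @ w) ` set_pmf (born psi)"
  proof
   assume "z : (%y. y @ w) ` set_pmf (born psi)"
   then obtain y where y: "z = y @ w" "psi y ~= 0" by (auto simp: set_pmf_iff pmf_born[OF assms])
   hence "length y = n" using assms(1) by (auto simp: qspace_def)
   thus False using False y by simp
  qed
  moreover have "att n w psi z = 0"
   using False assms(1) by (auto simp: att_def qspace_def)
  ultimately show ?thesis by (simp add: pmf_born[OF att_state[OF assms]] pmf_eq_0_set_pmf)
 qed
qed

lemma meas_born:
 assumes "meas n F" "psi : qspace n" "norm_sq n psi = 1"
 shows "F psi = bind_pmf (born psi) (%u. F (ket u))"
proof (rule pmf_eqI)
 fix v
 have "set_pmf (born psi) <= bits n" using assms(2) by (auto simp: set_pmf_iff pmf_born[OF assms(2,3)] qspace_def)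
 hence "pmf (bind_pmf (born psi) (%u. F (ket u))) v = (\<Sum>u\<in>bits n. pmf (born psi) u * pmf (F (ket u)) v)"
  by (intro pmf_bind_finite) simp
 thus "pmf (F psi) v = pmf (bind_pmf (born psi) (%u. F (ket u))) v"
  using assms unfolding meas_def by (simp add: pmf_born[OF assms(2,3)])
qed

lemma activate_sample:
 fixes gs :: "gate list" and K :: nat
 defines "psi == ap gs (ket (zeros K))"
 shows "activate (act (sample_circuit K gs)) [b] empty_state = return_pmf ([False], att K [b] psi)"
  and "psi : qspace K" "norm_sq K psi = 1"
proof -
 show psi: "psi : qspace K" "norm_sq K psi = 1"
  unfolding psi_def norm_ap using ket_state[of "zeros K"] by (simp_all add: ap_qspace)
 note \<alpha> = att_state[OF psi, of "[b]"]
 let ?rho = "%i. if i < K then i + 1 else i + 2 :: nat"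
 define Phi where "Phi = ap (map (rn ?rho) gs) (ket (zeros (1 + K) @ [b]))"
 have st: "Phi : qspace (1 + (K + 1))" "norm_sq (1 + (K + 1)) Phi = 1"
  unfolding Phi_def norm_ap using ket_state[of "zeros (1 + K) @ [b]"] by (simp_all add: ap_qspace)
 interpret embedding ?rho K "K + 2" by unfold_locales (auto simp: inj_on_def)
 have val: "Phi (c # w) = (if c then 0 else att K [b] psi w)" if w: "length w = K + 1" for c w
 proof -
  have p: "pick ?rho K (c # w) = take K w"
   using w by (intro nth_equalityI) (auto simp: pick_def)
  have o: "overlay ?rho K (c # w) x = c # x @ drop K w" if "length x = K" for x
  proof (rule overlay_eqI)
   fix q assume q: "q < K + 2" "q ~: ?rho ` {..<K}"
   have "q = 0 | q = K + 1"
   proof (rule ccontr)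
    assume "~ ?thesis"
    hence "q = ?rho (q - 1)" "q - 1 < K" using q(1) by auto
    thus False using q(2) by blast
   qed
   thus "(c # x @ drop K w) ! q = (c # w) ! q" using w that by (auto simp: nth_append)
  qed (use w that in \<open>auto simp: nth_append\<close>)
  have "Phi (c # w) = ap gs (%x. ket (zeros (1 + K) @ [b]) (overlay ?rho K (c # w) x)) (take K w)"
   unfolding Phi_def by (subst ap_rename) (use w p in simp_all)
  also have "... = ap gs (%x. (if ~ c & drop K w = [b] then 1 else 0) * ket (zeros K) x + 0 * ket [] x) (take K w)"
  proof (rule ap_cong[of K])
   fix x :: "bool list" assume x: "length x = K"
   have "x @ drop K w = zeros K @ [b] <-> x = zeros K & drop K w = [b]"
    using x by (intro append_eq_append_conv) simp
   thus "ket (zeros (1 + K) @ [b]) (overlay ?rho K (c # w) x) =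
     (if ~ c & drop K w = [b] then 1 else 0) * ket (zeros K) x + 0 * ket [] x"
    unfolding o[OF x] by (auto simp: ket_def)
  qed (use w in simp)
  also have "... = (if ~ c & drop K w = [b] then 1 else 0) * psi (take K w)"
   unfolding ap_lin psi_def by simp
  finally show ?thesis by (auto simp: att_def)
 qed
 have s: "slice [c] Phi w = (if c then 0 else att K [b] psi w)" if "length w = K + 1" for c w
  using val[OF that] by (simp add: slice_def)
 have n: "norm_sq (K + 1) (slice [c] Phi) = (if c then 0 else 1)" for c
 proof -
  have "norm_sq (K + 1) (slice [c] Phi) = norm_sq (K + 1) (%w. if c then 0 else att K [b] psi w)"
   by (rule norm_sq_cong) (rule s)
  thus ?thesis using \<alpha>(2) by (simp add: norm_sq_def)
 qed
 have "map_pmf (take 1) (born Phi) = return_pmf [False]"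
 proof (rule pmf_eqI)
  fix y
  have "y = [False] | y = [True]" if "length y = 1" using that by (auto simp: length_Suc_conv)
  thus "pmf (map_pmf (take 1) (born Phi)) y = pmf (return_pmf [False]) y"
   unfolding pmf_take_born[OF st] using n[of False] n[of True] by (auto simp: indicator_def)
 qed
 moreover have "renorm (K + 1) (slice [False] Phi) = att K [b] psi"
 proof
  fix w
  show "renorm (K + 1) (slice [False] Phi) w = att K [b] psi w"
  proof (cases "length w = K + 1")
   case True thus ?thesis using s[OF True, of False] n[of False] by (simp add: renorm_def)
  next
   case False
   have "slice [False] Phi : qspace (K + 1)" using slice_qspace[OF st(1), of "[False]"] by simp
   thus ?thesis using False \<alpha>(1) by (auto simp: renorm_def qspace_def)
  qed
 qed
 moreover have "activate (act (sample_circuit K gs)) [b] empty_state = measure_wires 1 Phi"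
  by (simp add: activate_circuit sample_circuit_def load_empty Phi_def)
 ultimately show "activate (act (sample_circuit K gs)) [b] empty_state = return_pmf ([False], att K [b] psi)"
  unfolding measure_wires_alt[OF st] by simp
qed

section \<open>Hiding\<close>

text \<open>The committer with the puzzle s, including the constant first message.\<close>

fun full_committer :: "nat => bool => bool list => activation list => bool list list pmf" where
 "full_committer m b s (R # Rs) = bind_pmf (activate R [False] empty_state) (%(r, psi).
   bind_pmf (committer m b r s Rs psi) (%z. return_pmf ([False] # r # z)))"
| "full_committer m b s [] = return_pmf []"

abbreviation committer_circuits :: "nat => circuit => circuit list" where
 "committer_circuits m C == sample_circuit (n_out C + n_anc C) (gates C) # map (answer_circuit m (n_out C + n_anc C)) [0..<m]"

lemma valid_empty: "valid empty_state"
 unfolding valid_def using empty_state by blast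

lemma run_no_input: "run C [] = map_pmf (take (n_out C)) (born (ap (gates C) (ket (zeros (n_out C + n_anc C)))))"
 unfolding run_def activate_circuit load_empty by (simp add: measure_wires_def Let_def map_pmf_comp)

text \<open>
 The committer never measures the sampled puzzle, but its answers would not be distributed
 differently if it did so at the start.
\<close>

lemma commit_stage_eq:
 fixes Q :: "bool list list \<times> qvec \<times> qvec => 'a pmf"
 defines "psi C == ap (gates C) (ket (zeros (n_out C + n_anc C)))"
 assumes m: "m <= n_out C" and Rs: "length Rs = m" "!!A. A : set (R # Rs) ==> unitary_op (act_op A) & act_out A = m"
  and Q: "!!z phiR. valid phiR ==> length (concat z) = Suc m * Suc m ==> meas (n_out C + n_anc C + 1 + m * m) (%phi. Q (z, phi, phiR))"
 shows "bind_pmf (commit_stage (map act (committer_circuits m C)) (R # Rs) [b]) Q =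
  bind_pmf (born (psi C)) (%y. bind_pmf (activate R [False] empty_state) (%(r, psiR).
   bind_pmf (interact (answers m (n_out C + n_anc C) 0) Rs r [] (ket (y @ [b])) psiR) (%(z, w). Q ([False] # r # z, w))))"
proof -
 let ?K = "n_out C + n_anc C"
 note s = activate_sample(1)[where K = ?K and gs = "gates C" and b = b, folded psi_def]
  activate_sample(2,3)[where K = ?K and gs = "gates C", folded psi_def]
 let ?F = "%rp phi. bind_pmf (interact (answers m ?K 0) Rs (fst rp) [] phi (snd rp)) (%w. Q ([False] # fst rp # fst w, snd w))"
 have "bind_pmf (commit_stage (map act (committer_circuits m C)) (R # Rs) [b]) Q =
   bind_pmf (activate R [False] empty_state) (%rp. ?F rp (att ?K [b] (psi C)))"
  using s(1) by (simp add: commit_stage_def bind_return_pmf bind_assoc_pmf case_prod_unfold)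
 also have "... = bind_pmf (activate R [False] empty_state) (%rp. bind_pmf (born (psi C)) (%y. ?F rp (ket (y @ [b]))))"
 proof (rule bind_pmf_cong[OF refl])
  fix rp assume rp: "rp : set_pmf (activate R [False] empty_state)"
  have v: "length (fst rp) = m" "valid (snd rp)"
   using activate_valid[of R empty_state "fst rp" "snd rp"] Rs(2)[of R] valid_empty rp by auto
  have "meas (?K + 1) (?F rp)"
  proof (rule meas_interact)
   fix i assume "i < length (map (answer_circuit m ?K) [0..<m])"
   thus "\<exists>f. classical (map (answer_circuit m ?K) [0..<m] ! i) (?K + 1 + (length (fst rp) + i * m)) f"
    using classical_answer[of i m ?K] m v(1) by (auto simp: add_ac mult.commute)
  next
   fix z :: "bool list list" and phiR assume "valid phiR" "length (concat z) = (\<Sum>C\<leftarrow>map (answer_circuit m ?K) [0..<m]. n_out C + m)"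
   moreover from this(2) have "length (concat ([False] # fst rp # z)) = Suc m * Suc m"
    using v(1) by (simp add: o_def answer_circuit_def sum_list_triv)
   moreover have "?K + 1 + (if map (answer_circuit m ?K) [0..<m] = [] then 0
     else length (fst rp) + (length (map (answer_circuit m ?K) [0..<m]) - 1) * m) = ?K + 1 + m * m"
    using v(1) by (cases m) auto
   ultimately show "meas (?K + 1 + (if map (answer_circuit m ?K) [0..<m] = [] then 0
     else length (fst rp) + (length (map (answer_circuit m ?K) [0..<m]) - 1) * m)) (%phi. Q ([False] # fst rp # fst (z, phi, phiR), snd (z, phi, phiR)))"
    using Q[of phiR "[False] # fst rp # z"] by simp
  qed (use Rs v in auto)
  hence "?F rp (att ?K [b] (psi C)) = bind_pmf (born (att ?K [b] (psi C))) (%u. ?F rp (ket u))"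
   by (rule meas_born) (use att_state[OF s(2,3), of "[b]"] in simp_all)
  thus "?F rp (att ?K [b] (psi C)) = bind_pmf (born (psi C)) (%y. ?F rp (ket (y @ [b])))"
   unfolding born_att[OF s(2,3)] bind_map_pmf .
 qed
 also have "... = bind_pmf (born (psi C)) (%y. bind_pmf (activate R [False] empty_state) (%rp. ?F rp (ket (y @ [b]))))"
  by (rule bind_commute_pmf)
 finally show ?thesis by (simp add: case_prod_unfold)
qed

lemma commit_transcript_eq:
 assumes m: "m <= n_out C" and Rs: "length Rs = Suc m" "!!A. A : set Rs ==> unitary_op (act_op A) & act_out A = m"
 shows "map_pmf fst (commit_stage (map act (committer_circuits m C)) Rs [b]) =
  bind_pmf (map_pmf (take m) (run C [])) (%s. full_committer m b s Rs)"
proof -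
 obtain R Rs' where R: "Rs = R # Rs'" "length Rs' = m" using Rs(1) by (cases Rs) auto
 let ?K = "n_out C + n_anc C" and ?psi = "ap (gates C) (ket (zeros (n_out C + n_anc C)))"
 note s = activate_sample(2,3)[where K = ?K and gs = "gates C"]
 have "map_pmf fst (commit_stage (map act (committer_circuits m C)) Rs [b]) =
   bind_pmf (commit_stage (map act (committer_circuits m C)) (R # Rs') [b]) (%w. return_pmf (fst w))"
  by (simp only: R map_pmf_def)
 also have "... = bind_pmf (born ?psi) (%y. bind_pmf (activate R [False] empty_state) (%(r, psiR).
   bind_pmf (interact (answers m ?K 0) Rs' r [] (ket (y @ [b])) psiR) (%(z, w). return_pmf (fst ([False] # r # z, w)))))"
  by (rule commit_stage_eq[OF m R(2)]) (use Rs R in \<open>auto simp: meas_const\<close>)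
 also have "... = bind_pmf (born ?psi) (%y. full_committer m b (take m y) Rs)"
 proof (rule bind_pmf_cong[OF refl])
  fix y assume "y : set_pmf (born ?psi)"
  hence y: "length y = ?K" using s by (auto simp: set_pmf_iff pmf_born[OF s] qspace_def)
  show "bind_pmf (activate R [False] empty_state) (%(r, psiR).
   bind_pmf (interact (answers m ?K 0) Rs' r [] (ket (y @ [b])) psiR) (%(z, w). return_pmf (fst ([False] # r # z, w)))) =
   full_committer m b (take m y) Rs"
   unfolding R full_committer.simps
  proof (rule bind_pmf_cong[OF refl])
   fix rp assume rp: "rp : set_pmf (activate R [False] empty_state)"
   obtain r psiR where [simp]: "rp = (r, psiR)" by (cases rp)
   have v: "length r = m" "valid psiR"
    using activate_valid[of R empty_state r psiR] Rs(2)[of R] R valid_empty rp by auto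
   have "map_pmf fst (interact (answers m ?K 0) Rs' r [] (ket ([] @ y @ [b])) psiR) = committer m b r (drop 0 (take m y)) Rs' psiR"
    by (rule interact_committer) (use R Rs m v y in auto)
   hence "committer m b r (take m y) Rs' psiR = map_pmf fst (interact (answers m ?K 0) Rs' r [] (ket (y @ [b])) psiR)" by simp
   thus "(case rp of (r, psiR) => bind_pmf (interact (answers m ?K 0) Rs' r [] (ket (y @ [b])) psiR) (%(z, w). return_pmf (fst ([False] # r # z, w)))) =
     (case rp of (r, psiR) => bind_pmf (committer m b r (take m y) Rs' psiR) (%z. return_pmf ([False] # r # z)))"
    by (simp add: bind_map_pmf case_prod_unfold)
  qed
 qed
 also have "... = bind_pmf (map_pmf (take m) (run C [])) (%s. full_committer m b s Rs)"
  unfolding run_no_input bind_map_pmf using m by (simp add: min_def)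
 finally show ?thesis .
qed

lemma full_committer_uniform:
 assumes "length Rs = Suc m"
 shows "bind_pmf (pmf_of_set (bits m)) (%s. full_committer m False s Rs) = bind_pmf (pmf_of_set (bits m)) (%s. full_committer m True s Rs)"
proof -
 obtain R Rs' where R: "Rs = R # Rs'" "length Rs' = m" using assms by (cases Rs) auto
 have "bind_pmf (pmf_of_set (bits m)) (%s. full_committer m b s Rs) =
   bind_pmf (activate R [False] empty_state) (%rp. bind_pmf (random_answers Rs' (snd rp)) (%z. return_pmf ([False] # fst rp # z)))" for b
 proof -
  have "bind_pmf (pmf_of_set (bits m)) (%s. full_committer m b s Rs) =
   bind_pmf (activate R [False] empty_state) (%rp. bind_pmf (pmf_of_set (bits m)) (%s. bind_pmf (committer m b (fst rp) s Rs' (snd rp)) (%z. return_pmf ([False] # fst rp # z))))"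
   unfolding R full_committer.simps case_prod_unfold by (rule bind_commute_pmf)
  thus ?thesis unfolding bind_assoc_pmf[symmetric] committer_uniform[OF R(2)] .
 qed
 thus ?thesis by simp
qed

lemma infsum_bound:
 fixes f :: "'a => real"
 assumes "!!F. finite F ==> sum f F <= B" "0 <= B"
 shows "infsum f UNIV <= B"
proof (cases "f summable_on UNIV")
 case True
 thus ?thesis by (rule infsum_le_finite_sums) (use assms in auto)
next
 case False
 thus ?thesis using assms(2) by (simp add: infsum_not_exists)
qed

lemma stat_dist_finite:
 assumes "finite S" "set_pmf p <= S" "set_pmf q <= S"
 shows "stat_dist p q = (\<Sum>x\<in>S. \<bar>pmf p x - pmf q x\<bar>) / 2"
proof -
 have "pmf p x = 0" "pmf q x = 0" if "x ~: S" for x using assms(2,3) that by (auto simp: set_pmf_iff)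
 hence "(\<Sum>\<^sub>\<infinity>x. \<bar>pmf p x - pmf q x\<bar>) = (\<Sum>\<^sub>\<infinity>x\<in>S. \<bar>pmf p x - pmf q x\<bar>)"
  by (intro infsum_cong_neutral) auto
 thus ?thesis using assms(1) by (simp add: stat_dist_def)
qed

text \<open>Two kernels that agree on a distribution q differ little on one that is close to q.\<close>

lemma stat_dist_kernels:
 assumes S: "finite S" "set_pmf p <= S" "set_pmf q <= S" and eq: "bind_pmf q f = bind_pmf q g"
 shows "stat_dist (bind_pmf p f) (bind_pmf p g) <= 2 * stat_dist p q"
proof -
 let ?d = "%s. \<bar>pmf p s - pmf q s\<bar>"
 have one: "(\<Sum>z\<in>F. pmf r z) <= 1" if "finite F" for F and r :: "'b pmf"
  using that by (metis measure_measure_pmf_finite measure_pmf.prob_le_1)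
 have b: "\<bar>pmf (bind_pmf p h) z - pmf (bind_pmf q h) z\<bar> <= (\<Sum>s\<in>S. ?d s * pmf (h s) z)" for h :: "'a => 'b pmf" and z
 proof -
  have "pmf (bind_pmf p h) z - pmf (bind_pmf q h) z = (\<Sum>s\<in>S. (pmf p s - pmf q s) * pmf (h s) z)"
   unfolding pmf_bind_finite[OF S(1,2)] pmf_bind_finite[OF S(1,3)] by (simp add: sum_subtractf left_diff_distrib)
  also have "\<bar>...\<bar> <= (\<Sum>s\<in>S. \<bar>(pmf p s - pmf q s) * pmf (h s) z\<bar>)" by (rule sum_abs)
  finally show ?thesis by (simp add: abs_mult)
 qed
 have "(\<Sum>\<^sub>\<infinity>z. \<bar>pmf (bind_pmf p f) z - pmf (bind_pmf p g) z\<bar>) <= 2 * (\<Sum>s\<in>S. ?d s)"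
 proof (rule infsum_bound)
  fix F :: "'b set" assume F: "finite F"
  have "(\<Sum>z\<in>F. \<bar>pmf (bind_pmf p f) z - pmf (bind_pmf p g) z\<bar>) <= (\<Sum>z\<in>F. \<Sum>s\<in>S. ?d s * (pmf (f s) z + pmf (g s) z))"
  proof (rule sum_mono)
   fix z
   have "\<bar>pmf (bind_pmf p f) z - pmf (bind_pmf p g) z\<bar> <= (\<Sum>s\<in>S. ?d s * pmf (f s) z) + (\<Sum>s\<in>S. ?d s * pmf (g s) z)"
    using b[of f z] b[of g z] by (simp add: eq)
   thus "\<bar>pmf (bind_pmf p f) z - pmf (bind_pmf p g) z\<bar> <= (\<Sum>s\<in>S. ?d s * (pmf (f s) z + pmf (g s) z))"
    by (simp add: sum.distrib distrib_left)
  qed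
  also have "... = (\<Sum>s\<in>S. ?d s * ((\<Sum>z\<in>F. pmf (f s) z) + (\<Sum>z\<in>F. pmf (g s) z)))"
   by (subst sum.swap) (simp add: sum.distrib sum_distrib_left distrib_left)
  also have "... <= (\<Sum>s\<in>S. ?d s * 2)"
  proof (intro sum_mono mult_left_mono)
   fix s
   show "(\<Sum>z\<in>F. pmf (f s) z) + (\<Sum>z\<in>F. pmf (g s) z) <= 2"
    using one[OF F, of "f s"] one[OF F, of "g s"] by simp
  qed simp
  finally show "(\<Sum>z\<in>F. \<bar>pmf (bind_pmf p f) z - pmf (bind_pmf p g) z\<bar>) <= 2 * (\<Sum>s\<in>S. ?d s)"
   by (simp add: sum_distrib_left mult.commute)
 qed (simp add: sum_nonneg)
 thus ?thesis unfolding stat_dist_finite[OF S] by (simp add: stat_dist_def)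
qed

section \<open>Correctness\<close>

text \<open>The honest interaction: a record of answers that satisfy the equations of the puzzle.\<close>

abbreviation record_of :: "(nat => bool) => (nat => bool list) => nat list => bool list list" where
 "record_of c vs js == concat (map (%j. [[c j], vs j]) js)"

lemma interact_honest:
 assumes "i <= m" "m <= K" "length v = m" "length old = m * i" "length y = K"
  and "(z, phiC, phiR) : set_pmf (interact (answers m K i) (replicate (m - i) (act (coins m))) v [] (ket (old @ y @ [b])) (ket w))"
 shows "\<exists>c vs. z = record_of c vs [Suc i..<Suc m] & vs i = v & (\<forall>j. i <= j --> j <= m --> length (vs j) = m) &
  (\<forall>j. i <= j --> j < m --> c (Suc j) = ((y ! j ~= dot (drop (Suc j) (vs j)) (drop (Suc j) (take m y))) ~= (Suc j = m & b))) &
  (\<exists>old'. length old' = m * m & phiC = ket (old' @ y @ [b])) & (\<exists>w'. length w' = length w + (m - i) & phiR = ket w')"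
 using assms(1,3-)
proof (induction "m - i" arbitrary: i v old w z)
 case 0
 hence "i = m" by simp
 thus ?case using 0 by (intro exI[of _ "%_. False"] exI[of _ "%_. v"]) auto
next
 case (Suc k)
 hence i: "i < m" by simp
 let ?c = "(y ! i ~= dot (drop (Suc i) v) (drop (Suc i) (take m y))) ~= (Suc i = m & b)"
 have 1: "answers m K i = act (answer_circuit m K i) # answers m K (Suc i)" using i by (simp add: upt_conv_Cons)
 have 2: "replicate (m - i) (act (coins m)) = act (coins m) # replicate (m - Suc i) (act (coins m))"
  unfolding Suc_diff_Suc[OF i, symmetric] by (rule replicate_Suc)
 let ?I = "%r. interact (answers m K (Suc i)) (replicate (m - Suc i) (act (coins m))) r [] (ket ((v @ old) @ y @ [b])) (ket ([?c] @ w))"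
 have "interact (answers m K i) (replicate (m - i) (act (coins m))) v [] (ket (old @ y @ [b])) (ket w) =
   bind_pmf (pmf_of_set (bits m)) (%r. bind_pmf (?I r) (%(z, phiC, phiR). return_pmf ([?c] # r # z, phiC, phiR)))"
  by (simp only: 1 2 interact_coins activate_answer[OF i assms(2) Suc.prems(2,3,4), of b] bind_return_pmf prod.case)
 then obtain r q where r: "r : bits m" and q: "q : set_pmf (?I r)" "(z, phiC, phiR) = (case q of (z, phiC, phiR) => ([?c] # r # z, phiC, phiR))"
  using Suc.prems(5) unfolding case_prod_unfold by (simp only: set_bind_pmf set_pmf_of_set[OF bits_nonempty finite_bits] UN_iff set_return_pmf singleton_iff) blast
 then obtain z' where z: "z = [?c] # r # z'" and in': "(z', phiC, phiR) : set_pmf (?I r)" by (cases q) auto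
 have r: "length r = m" using r by simp
 have "\<exists>c vs. z' = record_of c vs [Suc (Suc i)..<Suc m] & vs (Suc i) = r & (\<forall>j. Suc i <= j --> j <= m --> length (vs j) = m) &
  (\<forall>j. Suc i <= j --> j < m --> c (Suc j) = ((y ! j ~= dot (drop (Suc j) (vs j)) (drop (Suc j) (take m y))) ~= (Suc j = m & b))) &
  (\<exists>old'. length old' = m * m & phiC = ket (old' @ y @ [b])) & (\<exists>w'. length w' = length ([?c] @ w) + (m - Suc i) & phiR = ket w')"
  by (rule Suc.hyps(1)[OF _ _ r _ Suc.prems(4) in']) (use Suc.hyps(2) Suc.prems(2,3) i in auto)
 then obtain c vs where IH: "z' = record_of c vs [Suc (Suc i)..<Suc m]" "vs (Suc i) = r" "!!j. Suc i <= j ==> j <= m ==> length (vs j) = m"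
  "!!j. Suc i <= j ==> j < m ==> c (Suc j) = ((y ! j ~= dot (drop (Suc j) (vs j)) (drop (Suc j) (take m y))) ~= (Suc j = m & b))"
  "\<exists>old'. length old' = m * m & phiC = ket (old' @ y @ [b])" "\<exists>w'. length w' = length ([?c] @ w) + (m - Suc i) & phiR = ket w'"
  by blast
 let ?c' = "c(Suc i := ?c)" and ?vs = "vs(i := v)"
 have "z = record_of ?c' ?vs [Suc i..<Suc m]"
 proof -
  have "[Suc i..<Suc m] = Suc i # [Suc (Suc i)..<Suc m]" using i by (simp add: upt_conv_Cons del: upt_Suc)
  moreover have "record_of ?c' ?vs [Suc (Suc i)..<Suc m] = record_of c vs [Suc (Suc i)..<Suc m]"
   by (rule arg_cong[where f = concat], rule map_cong) auto
  ultimately have "record_of ?c' ?vs [Suc i..<Suc m] = [[?c' (Suc i)], ?vs (Suc i)] @ record_of c vs [Suc (Suc i)..<Suc m]"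
   by (simp only: list.map concat.simps)
  thus ?thesis using z IH(1,2) by simp
 qed
 moreover have "\<forall>j. i <= j --> j <= m --> length (?vs j) = m" using IH(3) Suc.prems(2) by (auto simp: le_Suc_eq Suc_le_eq)
 moreover have "\<forall>j. i <= j --> j < m --> ?c' (Suc j) = ((y ! j ~= dot (drop (Suc j) (?vs j)) (drop (Suc j) (take m y))) ~= (Suc j = m & b))"
  using IH(4) by (auto simp: Suc_le_eq)
 moreover have "\<exists>w'. length w' = length w + (m - i) & phiR = ket w'"
 proof -
  have "length ([?c] @ w) + (m - Suc i) = length w + (m - i)" using i by simp
  thus ?thesis using IH(6) by (simp only:)
 qed
 ultimately show ?case using IH(5)
  by (intro exI[of _ ?c'] exI[of _ ?vs]) (simp del: upt_Suc)
qed

lemma record_nth: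
 assumes "!!j. j < n ==> length (vs j) = m" "j < n"
 shows "concat (record_of c vs [0..<n]) ! (j * Suc m) = c j"
  "k < m ==> concat (record_of c vs [0..<n]) ! (j * Suc m + Suc k) = vs j ! k"
  "length (concat (record_of c vs [0..<n])) = n * Suc m"
proof -
 have len: "length (concat (record_of c vs [0..<n'])) = n' * Suc m" if "n' <= n" for n'
  using that assms(1) by (induction n') simp_all
 show "length (concat (record_of c vs [0..<n])) = n * Suc m" using len by simp
 have "[0..<n] = [0..<j] @ j # [Suc j..<n]" using assms(2) by (metis less_imp_add_positive upt_add_eq_append upt_conv_Cons zero_le add.commute le_add1 less_add_same_cancel1)
 hence "concat (record_of c vs [0..<n]) = concat (record_of c vs [0..<j]) @ c j # vs j @ concat (record_of c vs [Suc j..<n])"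
  by simp
 thus "concat (record_of c vs [0..<n]) ! (j * Suc m) = c j"
  "k < m ==> concat (record_of c vs [0..<n]) ! (j * Suc m + Suc k) = vs j ! k"
  using len[of j] assms by (simp_all add: nth_append)
qed

lemma solve_record:
 assumes "!!j. j <= m ==> length (vs j) = m" "length s = m"
  and "!!j. j < m ==> c (Suc j) = ((s ! j ~= dot (drop (Suc j) (vs j)) (drop (Suc j) s)) ~= (Suc j = m & b))"
 shows "solve m (concat (record_of c vs [0..<Suc m])) b = s"
proof -
 let ?t = "concat (record_of c vs [0..<Suc m])"
 have a: "ans m ?t j = c j" if "j <= m" for j
  unfolding ans_def by (rule record_nth(1)) (use assms(1) that in auto)
 have v: "chal m ?t j = vs j" if "j <= m" for j
 proof (rule nth_equalityI)
  show "length (chal m ?t j) = length (vs j)" using assms(1)[OF that] by (simp add: chal_def)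
  fix k assume "k < length (chal m ?t j)"
  hence k: "k < m" by (simp add: chal_def)
  have "?t ! (j * Suc m + Suc k) = vs j ! k" by (rule record_nth(2)[OF _ _ k]) (use assms(1) that in auto)
  thus "chal m ?t j ! k = vs j ! k" using k by (simp add: chal_def)
 qed
 have "s = backsub (%i tl. (ans m ?t (Suc i) ~= dot (drop (Suc i) (chal m ?t i)) tl) ~= (Suc i = m & b)) m []"
  by (rule iffD1[OF backsub_iff[OF assms(2)]]) (use assms(3) a v in \<open>auto simp del: concat_map_singleton\<close>)
 thus ?thesis unfolding solve_def by (rule sym)
qed

section \<open>The opening stage\<close>

lemma foldr_copies:
 assumes "j <= k" "!!t. t < j ==> k <= src t" "k <= length x" "p < length x"
 shows "foldr cact (map (%t. XG [src t] t) [0..<j]) x ! p = (if p < j then x ! p ~= x ! src p else x ! p)"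
 using assms
proof (induction j arbitrary: x)
 case (Suc j)
 let ?x = "cact (XG [src j] j) x"
 have x: "?x ! q = (if q = j then x ! j ~= x ! src j else x ! q)" if "q < length x" for q
  using that by (auto simp: cact_def cval_def)
 have o: "?x ! q = x ! q" if "k <= q" for q using that Suc.prems(1) by (auto simp: cact_def)
 have "foldr cact (map (%t. XG [src t] t) [0..<Suc j]) x ! p = foldr cact (map (%t. XG [src t] t) [0..<j]) ?x ! p" by simp
 also have "... = (if p < j then ?x ! p ~= ?x ! src p else ?x ! p)"
  by (rule Suc.IH) (use Suc.prems in auto)
 also have "... = (if p < Suc j then x ! p ~= x ! src p else x ! p)"
  using x[OF Suc.prems(4)] o Suc.prems(2) by (auto simp: less_Suc_eq)
 finally show ?case .
qed simp

lemma classical_copy: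
 assumes "!!t. t < k ==> k <= src t & src t < k + N"
 shows "classical (Circuit k 0 (cg (map (%t. XG [src t] t) [0..<k]))) N (%w. map (%t. w ! (src t - k)) [0..<k])"
 unfolding classical_def circuit.sel
proof (intro conjI allI impI)
 fix phi :: qvec and y w :: "bool list" assume y: "length y = k" and w: "length w = N"
 have "ap (cg (map (%t. XG [src t] t) [0..<k])) phi (y @ w) = phi (foldr cact (map (%t. XG [src t] t) [0..<k]) (y @ w))"
  by (rule ap_cg) (use assms y w in \<open>fastforce simp: cok_def\<close>)
 also have "foldr cact (map (%t. XG [src t] t) [0..<k]) (y @ w) = map2 (~=) y (map (%t. w ! (src t - k)) [0..<k]) @ w"
 proof (rule nth_equalityI)
  fix p assume p: "p < length (foldr cact (map (%t. XG [src t] t) [0..<k]) (y @ w))"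
  have "foldr cact (map (%t. XG [src t] t) [0..<k]) (y @ w) ! p = (if p < k then (y @ w) ! p ~= (y @ w) ! src p else (y @ w) ! p)"
   by (rule foldr_copies) (use assms y p in auto)
  thus "foldr cact (map (%t. XG [src t] t) [0..<k]) (y @ w) ! p = (map2 (~=) y (map (%t. w ! (src t - k)) [0..<k]) @ w) ! p"
   using assms[of p] y by (auto simp: nth_append)
 qed (use y in simp)
 finally show "ap (cg (map (%t. XG [src t] t) [0..<k])) phi (y @ w) = phi (map2 (~=) y (map (%t. w ! (src t - k)) [0..<k]) @ w)" .
qed simp_all

text \<open>To open, the committer sends its bit and the key.\<close>

definition reveal_circuit :: "nat => nat => nat => circuit" where
 "reveal_circuit m l K = Circuit (Suc l) 0 (cg (map (%t. XG [Suc l + Suc m * Suc m + m * m + (if t = 0 then K else m + (t - 1))] t) [0..<Suc l]))"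

lemma classical_reveal:
 assumes "m + l <= K"
 shows "classical (reveal_circuit m l K) (Suc m * Suc m + m * m + K + 1)
  (%w. map (%t. w ! (Suc l + Suc m * Suc m + m * m + (if t = 0 then K else m + (t - 1)) - Suc l)) [0..<Suc l])"
 unfolding reveal_circuit_def by (rule classical_copy) (use assms in auto)

lemma activate_reveal:
 assumes "m + l <= K" "length z = Suc m * Suc m" "length old = m * m" "length y = K"
 shows "map_pmf fst (activate (act (reveal_circuit m l K)) z (ket (old @ y @ [b]))) = return_pmf (b # take l (drop m y))"
proof -
 let ?w = "z @ old @ y @ [b]"
 have "activate (act (reveal_circuit m l K)) z (ket (old @ y @ [b])) =
  return_pmf (map (%t. ?w ! (Suc l + Suc m * Suc m + m * m + (if t = 0 then K else m + (t - 1)) - Suc l)) [0..<Suc l], ket ?w)"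
  using classical_reveal[OF assms(1)] assms by (intro activate_classical_ket) (simp add: add.assoc)
 moreover have "map (%t. ?w ! (Suc l + Suc m * Suc m + m * m + (if t = 0 then K else m + (t - 1)) - Suc l)) [0..<Suc l] = b # take l (drop m y)"
  using assms by (intro nth_equalityI) (auto simp: nth_append nth_Cons split: nat.splits simp del: upt_Suc)
 ultimately show ?thesis by simp
qed

text \<open>
 The receiver solves for the puzzle on the wires from \<open>2 + nV\<close> on, copies the key next to it and the
 bit to output wire 1, and runs the verifier, whose wires except for the output are shifted by one.
\<close>

definition eqn :: "nat => nat => nat => nat => cgate list" where
 "eqn m nV B i = XG [B + Suc i * Suc m] (2 + nV + i) #
   map (%t. XG [B + i * Suc m + Suc (Suc i + t), 2 + nV + (Suc i + t)] (2 + nV + i)) [0..<m - Suc i] @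
   (if Suc i = m then [XG [B + Suc m * Suc m] (2 + nV + i)] else [])"

definition decode :: "nat => nat => nat => cgate list" where
 "decode m l nV = (let B = 2 + nV + m + l in
   concat (map (%i. eqn m nV B (m - Suc i)) [0..<m]) @
   map (%t. XG [B + Suc m * Suc m + 1 + t] (2 + nV + m + t)) [0..<l] @ [XG [B + Suc m * Suc m] 1])"

definition verify_map :: "nat => nat => nat => nat => nat" where
 "verify_map m l nV i = (if i = 0 then 0 else if i < 1 + nV + m + l then i + 1 else i + (Suc m * Suc m + l + m + 3))"

definition open_receiver :: "nat => nat => circuit => circuit" where
 "open_receiver m l V = Circuit 2 (n_anc V + m + l) (cg (decode m l (n_anc V)) @ map (rn (verify_map m l (n_anc V))) (gates V))"

lemma ap_cg_ket:
 assumes "!!c. c : set cs ==> cok (length x) c"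
 shows "ap (cg cs) (ket x) z = ket (fold cact cs x) z"
proof (cases "length z = length x")
 case True
 have "ap (cg cs) (ket x) z = ket x (foldr cact cs z)" by (rule ap_cg) (use assms True in simp)
 moreover have "foldr cact cs z = x <-> z = fold cact cs x"
 proof
  assume "foldr cact cs z = x"
  hence "fold cact cs x = fold cact cs (foldr cact cs z)" by simp
  also have "... = foldr cact (rev cs) (fold cact (rev cs) z)" by (simp add: foldr_conv_fold)
  also have "... = z" by (rule foldr_fold_cact) (use assms True in simp)
  finally show "z = fold cact cs x" by simp
 next
  assume "z = fold cact cs x"
  thus "foldr cact cs z = x" using foldr_fold_cact[of cs x] assms by simp
 qed
 ultimately show ?thesis by (simp add: ket_def)
next
 case False
 have "ket x : qspace (length x)" by (rule ket_state)
 hence "ap (cg cs) (ket x) : qspace (length x)" by (rule ap_qspace)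
 hence "ap (cg cs) (ket x) z = 0" using False by (auto simp: qspace_def)
 moreover have "z ~= fold cact cs x" using False by auto
 ultimately show ?thesis by (simp add: ket_def)
qed

lemma solve_eq:
 assumes "i < m"
 shows "solve m t b ! i = ((ans m t (Suc i) ~= dot (drop (Suc i) (chal m t i)) (drop (Suc i) (solve m t b))) ~= (Suc i = m & b))"
proof -
 have "length (solve m t b) = m" by (simp add: solve_def)
 from iffD2[OF backsub_iff[OF this, of "[]"], OF solve_def[of m t b]]
 show ?thesis using assms by simp
qed

lemma length_solve [simp]: "length (solve m t b) = m"
 by (simp add: solve_def)

lemma fold_eqn:
 fixes b :: bool
 assumes i: "i < m" and len: "length pre = 2 + nV" "length t = Suc m * Suc m" "length post = l"
 defines "B == 2 + nV + m + l" and "s == solve m t b"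
 shows "fold cact (eqn m nV B i) (pre @ (zeros (Suc i) @ drop (Suc i) s) @ post @ t @ b # u) =
  pre @ (zeros i @ drop i s) @ post @ t @ b # u"
  and "c : set (eqn m nV B i) ==> cok (B + Suc m * Suc m + Suc (length u)) c"
proof -
 let ?x = "pre @ (zeros (Suc i) @ drop (Suc i) s) @ post @ t @ b # u"
 let ?S = "%j. 2 + nV + j"
 have ls: "length s = m" by (simp add: s_def)
 have lx: "length ?x = B + Suc m * Suc m + Suc (length u)" using len ls i by (simp add: B_def)
 have T: "?x ! (B + k) = t ! k" if "k < Suc m * Suc m" for k
 proof -
  have "?x = (pre @ (zeros (Suc i) @ drop (Suc i) s) @ post) @ t @ b # u" by simp
  moreover have "length (pre @ (zeros (Suc i) @ drop (Suc i) s) @ post) = B" using len ls i by (simp add: B_def)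
  ultimately show ?thesis using that len(2) by (metis nth_append nth_append_length_plus)
 qed
 have Bb: "?x ! (B + Suc m * Suc m) = b"
 proof -
  have "?x = (pre @ (zeros (Suc i) @ drop (Suc i) s) @ post @ t) @ b # u" by simp
  moreover have "length (pre @ (zeros (Suc i) @ drop (Suc i) s) @ post @ t) = B + Suc m * Suc m" using len ls i by (simp add: B_def)
  ultimately show ?thesis by (metis nth_append_length)
 qed
 have S: "?x ! ?S j = s ! j" if "i < j" "j < m" for j using that len ls by (auto simp: nth_append)
 have S0: "~ ?x ! ?S i" using len by (simp add: nth_append del: replicate.simps)
 have bnd: "j * Suc m + k < Suc m * Suc m" if "j <= m" "k <= m" for j k
 proof -
  have "j * Suc m <= m * Suc m" using that(1) by (rule mult_le_mono1)
  thus ?thesis using that(2) by simp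
 qed
 show ok: "cok (B + Suc m * Suc m + Suc (length u)) c" if "c : set (eqn m nV B i)" for c
 proof -
  have "Suc i * Suc m < Suc m * Suc m" using bnd[of "Suc i" 0] i by simp
  moreover have "i * Suc m + Suc (Suc i + t') < Suc m * Suc m" if "t' < m - Suc i" for t'
   using bnd[of i "Suc (Suc i + t')"] that by simp
  ultimately show ?thesis
   using that i unfolding eqn_def B_def cok_def by (fastforce split: if_splits)
 qed
 have "map (%k. ?x ! (B + i * Suc m + Suc (Suc i + k)) & ?x ! ?S (Suc i + k)) [0..<m - Suc i] =
   map (%k. drop (Suc i) (chal m t i) ! k & drop (Suc i) s ! k) [0..<m - Suc i]"
 proof (rule map_cong[OF refl])
  fix k assume "k : set [0..<m - Suc i]"
  hence k: "Suc i + k < m" by auto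
  have "?x ! (B + (i * Suc m + Suc (Suc i + k))) = t ! (i * Suc m + Suc (Suc i + k))"
   by (rule T) (use k bnd[of i "Suc (Suc i + k)"] in simp)
  thus "(?x ! (B + i * Suc m + Suc (Suc i + k)) & ?x ! ?S (Suc i + k)) = (drop (Suc i) (chal m t i) ! k & drop (Suc i) s ! k)"
   using S[of "Suc i + k"] k ls by (simp add: chal_def add.assoc)
 qed
 hence d: "dot (drop (Suc i) (chal m t i)) (drop (Suc i) s) =
   parity (map (%k. ?x ! (B + i * Suc m + Suc (Suc i + k)) & ?x ! ?S (Suc i + k)) [0..<m - Suc i])"
  using dot_parity[of "drop (Suc i) (chal m t i)" "m - Suc i" "drop (Suc i) s"] ls by (simp only: length_drop) (simp add: chal_def)
 have a: "?x ! (B + Suc i * Suc m) = ans m t (Suc i)"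
  unfolding ans_def by (rule T) (use bnd[of "Suc i" 0] i in simp)
 have e: "map (%c. cval c ?x) (eqn m nV B i) = ?x ! (B + Suc i * Suc m) #
   map (%k. ?x ! (B + i * Suc m + Suc (Suc i + k)) & ?x ! ?S (Suc i + k)) [0..<m - Suc i] @
   (if Suc i = m then [?x ! (B + Suc m * Suc m)] else [])"
  by (simp add: eqn_def cval_def o_def del: mult_Suc mult_Suc_right replicate.simps append.simps append_assoc)
 have si: "s ! i = ((ans m t (Suc i) ~= dot (drop (Suc i) (chal m t i)) (drop (Suc i) s)) ~= (Suc i = m & b))"
  unfolding s_def by (rule solve_eq[OF i])
 have "parity (map (%c. cval c ?x) (eqn m nV B i)) = s ! i"
  unfolding e a Bb si d
  by (simp del: mult_Suc mult_Suc_right replicate.simps append.simps append_assoc)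
 moreover have "tgt c = ?S i & cok (length ?x) c" if "c : set (eqn m nV B i)" for c
 proof
  show "tgt c = ?S i" using that by (auto simp: eqn_def)
  show "cok (length ?x) c" unfolding lx by (rule ok[OF that])
 qed
 hence "fold cact (eqn m nV B i) ?x = ?x[?S i := (?x ! ?S i ~= parity (map (%c. cval c ?x) (eqn m nV B i)))]"
  by (rule fold_cact_target)
 ultimately have "fold cact (eqn m nV B i) ?x = ?x[?S i := s ! i]" using S0 by (simp only: not_False_eq_True simp_thms)
 also have "... = pre @ (zeros i @ drop i s) @ post @ t @ b # u"
 proof -
  have "zeros (Suc i) = zeros i @ [False]" by (simp add: replicate_append_same)
  hence "?x = (pre @ zeros i) @ False # (drop (Suc i) s @ post @ t @ b # u)" by simp
  moreover have "length (pre @ zeros i) = ?S i" using len by simp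
  ultimately have "?x[?S i := s ! i] = (pre @ zeros i) @ s ! i # (drop (Suc i) s @ post @ t @ b # u)"
   by (metis list_update_length)
  moreover have "drop i s = s ! i # drop (Suc i) s" using i ls by (simp add: Cons_nth_drop_Suc)
  ultimately show ?thesis by simp
 qed
 finally show "fold cact (eqn m nV B i) ?x = pre @ (zeros i @ drop i s) @ post @ t @ b # u" .
qed

lemma fold_decode:
 assumes len: "length t = Suc m * Suc m" "length k = l"
 shows "fold cact (decode m l nV) (zeros (2 + nV + m + l) @ t @ b # k @ w) =
  [False, b] @ zeros nV @ solve m t b @ k @ t @ b # k @ w"
  and "c : set (decode m l nV) ==> cok (2 + nV + m + l + Suc m * Suc m + Suc (length (k @ w))) c"
proof -
 let ?B = "2 + nV + m + l" and ?s = "solve m t b"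
 let ?pre = "zeros (2 + nV)" and ?post = "zeros l"
 let ?row = "%i. eqn m nV ?B (m - Suc i)"
 have 1: "fold cact (concat (map ?row [0..<j])) (?pre @ (zeros m @ drop m ?s) @ ?post @ t @ b # k @ w) =
   ?pre @ (zeros (m - j) @ drop (m - j) ?s) @ ?post @ t @ b # k @ w" if "j <= m" for j
  using that
 proof (induction j)
  case (Suc j)
  have "Suc (m - Suc j) = m - j" using Suc.prems by simp
  moreover have "fold cact (eqn m nV ?B (m - Suc j)) (?pre @ (zeros (Suc (m - Suc j)) @ drop (Suc (m - Suc j)) ?s) @ ?post @ t @ b # k @ w) =
    ?pre @ (zeros (m - Suc j) @ drop (m - Suc j) ?s) @ ?post @ t @ b # k @ w"
   by (rule fold_eqn(1)) (use Suc.prems len in auto)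
  moreover have "fold cact (concat (map ?row [0..<Suc j])) x = fold cact (?row j) (fold cact (concat (map ?row [0..<j])) x)" for x by simp
  ultimately show ?case using Suc.IH Suc.prems by (simp only:)
 qed simp
 let ?z1 = "?pre @ ?s @ ?post @ t @ b # k @ w"
 have z0: "zeros ?B @ t @ b # k @ w = ?pre @ (zeros m @ drop m ?s) @ ?post @ t @ b # k @ w"
  by (simp add: replicate_add[symmetric])
 have r: "fold cact (concat (map ?row [0..<m])) (zeros ?B @ t @ b # k @ w) = ?z1"
  unfolding z0 using 1[of m] by simp
 have 2: "fold cact (map (%i. XG [?B + Suc m * Suc m + 1 + i] (2 + nV + m + i)) [0..<j]) ?z1 =
   ?pre @ ?s @ (take j k @ zeros (l - j)) @ t @ b # k @ w" if "j <= l" for j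
  using that
 proof (induction j)
  case (Suc j)
  let ?x = "?pre @ ?s @ (take j k @ zeros (l - j)) @ t @ b # k @ w"
  have lk: "length (take j k) = j" using Suc.prems len by simp
  have c: "?x ! (?B + Suc m * Suc m + 1 + j) = k ! j"
  proof -
   have "?x = (?pre @ ?s @ (take j k @ zeros (l - j)) @ t @ [b]) @ k @ w" by simp
   moreover have "length (?pre @ ?s @ (take j k @ zeros (l - j)) @ t @ [b]) = ?B + Suc m * Suc m + 1"
    using lk len Suc.prems by simp
   ultimately show ?thesis using len Suc.prems by (metis Suc_le_lessD nth_append nth_append_length_plus)
  qed
  have "zeros (l - j) = False # zeros (l - Suc j)"
   using Suc.prems by (metis Suc_diff_Suc Suc_le_lessD replicate_Suc)
  hence x: "?x = (?pre @ ?s @ take j k) @ False # (zeros (l - Suc j) @ t @ b # k @ w)" by simp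
  have lp: "length (?pre @ ?s @ take j k) = 2 + nV + m + j" using lk by simp
  have f: "?x ! (2 + nV + m + j) = False" unfolding x lp[symmetric] by (rule nth_append_length)
  have "cact (XG [?B + Suc m * Suc m + 1 + j] (2 + nV + m + j)) ?x = ?x[2 + nV + m + j := k ! j]"
   using c f by (cases "k ! j") (simp_all add: cact_def cval_def del: mult_Suc append_assoc append.simps)
  also have "... = (?pre @ ?s @ take j k) @ k ! j # (zeros (l - Suc j) @ t @ b # k @ w)"
   unfolding x lp[symmetric] by (rule list_update_length)
  also have "... = ?pre @ ?s @ (take (Suc j) k @ zeros (l - Suc j)) @ t @ b # k @ w"
   using Suc.prems len by (simp add: take_Suc_conv_app_nth)
  finally show ?case using Suc.IH Suc.prems by simp
 qed simp
 let ?z2 = "?pre @ ?s @ k @ t @ b # k @ w"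
 have "cact (XG [?B + Suc m * Suc m] 1) ?z2 = ?z2[1 := b]"
 proof -
  have "?z2 = (?pre @ ?s @ k @ t) @ b # k @ w" by simp
  moreover have "length (?pre @ ?s @ k @ t) = ?B + Suc m * Suc m" using len by simp
  ultimately have "?z2 ! (?B + Suc m * Suc m) = b" by (metis nth_append_length)
  moreover have "~ ?z2 ! 1" by (simp add: nth_append)
  ultimately show ?thesis by (cases b) (simp_all add: cact_def cval_def del: mult_Suc append_assoc append.simps replicate.simps)
 qed
 also have "?z2[1 := b] = [False, b] @ zeros nV @ ?s @ k @ t @ b # k @ w"
  by (simp add: numeral_2_eq_2)
 finally show "fold cact (decode m l nV) (zeros ?B @ t @ b # k @ w) = [False, b] @ zeros nV @ ?s @ k @ t @ b # k @ w"
  using 2[of l] r len by (simp add: decode_def Let_def del: mult_Suc replicate_Suc)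
 show "cok (?B + Suc m * Suc m + Suc (length (k @ w))) c" if c: "c : set (decode m l nV)"
 proof -
  from c consider i where "i < m" "c : set (?row i)" | i where "i < l" "c = XG [?B + Suc m * Suc m + 1 + i] (2 + nV + m + i)"
   | "c = XG [?B + Suc m * Suc m] 1" unfolding decode_def Let_def by auto
  thus ?thesis
  proof cases
   case 1
   thus ?thesis using fold_eqn(2)[of "m - Suc i" m "zeros (2 + nV)" nV t "zeros l" l c "k @ w"] len by simp
  next
   case 2
   thus ?thesis using len by (simp add: cok_def)
  next
   case 3
   thus ?thesis by (simp add: cok_def)
  qed
 qed
qed

lemma embedding_verify_map:
 "embedding (verify_map m l nV) (1 + nV + m + l) (2 + nV + m + l + Suc m * Suc m + Suc l + Suc m)"
 by unfold_locales (auto simp: inj_on_def verify_map_def)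

lemma open_receiver_spec:
 assumes V: "n_out V = 1" and len: "length t = Suc m * Suc m" "length k = Suc l" "length w = Suc m"
 shows "pmf (map_pmf decision (run (open_receiver m l V) (t @ k @ w))) (Some b) =
  (if hd k = b then pmf (run V (solve m t b @ tl k)) [True] else 0)"
proof -
 obtain b0 key where k: "k = b0 # key" "length key = l" using len(2) by (cases k) auto
 let ?nV = "n_anc V" and ?s = "solve m t b0"
 let ?q = "1 + ?nV + m + l" and ?a = "?nV + m + l" and ?in = "t @ b0 # key @ w" and ?rho = "verify_map m l ?nV"
 let ?R = "Suc m * Suc m + Suc l + Suc m" and ?W = "2 + ?nV + m + l + Suc m * Suc m + Suc l + Suc m"
 define v where "v = ap (gates V) (ket (zeros (1 + ?nV) @ ?s @ key))"
 interpret embedding ?rho ?q ?W by (rule embedding_verify_map)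
 let ?Z = "[False, b0] @ zeros ?nV @ ?s @ key @ ?in"
 have lin: "length ?in = ?R" using len k by simp
 have lZ: "length ?Z = ?W" using lin k by simp
 define Phi where "Phi = ap (gates (open_receiver m l V)) (load (2 + ?a) ?in empty_state)"
 have "load (2 + ?a) ?in empty_state = ket (zeros (2 + ?nV + m + l) @ t @ b0 # key @ w)"
  by (simp add: load_empty add.assoc)
 moreover have "ap (cg (decode m l ?nV)) (ket (zeros (2 + ?nV + m + l) @ t @ b0 # key @ w)) = ket ?Z"
 proof
  fix z
  let ?z0 = "zeros (2 + ?nV + m + l) @ t @ b0 # key @ w"
  have l0: "length ?z0 = 2 + ?nV + m + l + Suc m * Suc m + Suc (length (key @ w))" using len(1) by simp
  have "ap (cg (decode m l ?nV)) (ket ?z0) z = ket (fold cact (decode m l ?nV) ?z0) z"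
   by (rule ap_cg_ket) (unfold l0, rule fold_decode(2)[OF len(1) k(2)])
  thus "ap (cg (decode m l ?nV)) (ket ?z0) z = ket ?Z z" unfolding fold_decode(1)[OF len(1) k(2)] .
 qed
 ultimately have Phi: "Phi = ap (map (rn ?rho) (gates V)) (ket ?Z)"
  by (simp only: Phi_def open_receiver_def circuit.sel fold_append o_apply)
 have nth: "(x # c' # u @ r) ! ?rho i = (x # u) ! i" if "i < ?q" "length u = ?a" for x c' i and u r :: "bool list"
  using that by (cases i) (simp_all add: verify_map_def nth_append)
 have amp: "Phi (c # c' # u @ r) = (if c' = b0 & r = ?in then v (c # u) else 0)" if "length u = ?a" "length r = ?R" for c c' u r
 proof -
  let ?z = "c # c' # u @ r"
  have lz: "length ?z = ?W" using that by simp
  have p: "pick ?rho ?q ?z = c # u"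
   using that by (intro nth_equalityI) (simp_all add: pick_def nth del: upt_Suc)
  have o: "overlay ?rho ?q ?z (x # x') = x # c' # x' @ r" if x': "length x' = ?a" for x x'
  proof (rule overlay_eqI[OF lz])
   show "length (x # c' # x' @ r) = ?W" using x' \<open>length r = ?R\<close> by simp
   show "(x # c' # x' @ r) ! ?rho i = (x # x') ! i" if "i < ?q" for i
    using that x' by (rule nth)
   fix p assume p: "p < ?W" "p ~: ?rho ` {..<?q}"
   have "p = 1 | ?q < p"
   proof (rule ccontr)
    assume "~ ?thesis"
    hence "p = ?rho (if p = 0 then 0 else p - 1)" "(if p = 0 then 0 else p - 1) < ?q" by (auto simp: verify_map_def)
    thus False using p(2) by blast
   qed
   thus "(x # c' # x' @ r) ! p = ?z ! p"
    using x' \<open>length u = ?a\<close> by (auto simp: nth_append nth_Cons split: nat.splits)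
  qed
  have "Phi ?z = ap (gates V) (%x. ket ?Z (overlay ?rho ?q ?z x)) (c # u)"
   unfolding Phi by (subst ap_rename[OF lz]) (simp only: p)
  also have "... = ap (gates V) (%x. (if c' = b0 & r = ?in then 1 else 0) * ket (zeros (1 + ?nV) @ ?s @ key) x + 0 * ket [] x) (c # u)"
  proof (rule ap_cong[of ?q])
   fix y :: "bool list" assume "length y = ?q"
   then obtain x x' where y: "y = x # x'" "length x' = ?a" by (cases y) auto
   have "x # c' # x' @ r = ?Z <-> ~ x & c' = b0 & x' @ r = (zeros ?nV @ ?s @ key) @ ?in" by auto
   also have "x' @ r = (zeros ?nV @ ?s @ key) @ ?in <-> x' = zeros ?nV @ ?s @ key & r = ?in"
    by (rule append_eq_append_conv) (use y k in simp)
   finally show "ket ?Z (overlay ?rho ?q ?z y) =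
     (if c' = b0 & r = ?in then 1 else 0) * ket (zeros (1 + ?nV) @ ?s @ key) y + 0 * ket [] y"
    unfolding y(1) o[OF y(2)] by (auto simp: ket_def)
  qed (use that in simp)
  finally show ?thesis unfolding ap_lin v_def by simp
 qed
 have "norm_sq (?a + ?R) (slice [True, b] Phi) = (\<Sum>u\<in>bits ?a. \<Sum>r\<in>bits ?R. if r = ?in then (if b = b0 then (cmod (v (True # u)))\<^sup>2 else 0) else 0)"
  unfolding norm_sq_def slice_def sum_bits_append[where k = ?a and n = ?R]
 proof (rule sum.cong[OF refl], rule sum.cong[OF refl])
  fix u r :: "bool list" assume "u : bits ?a" "r : bits ?R"
  hence "Phi (True # b # u @ r) = (if b = b0 & r = ?in then v (True # u) else 0)" by (intro amp) simp_all
  thus "(cmod (Phi ([True, b] @ u @ r)))\<^sup>2 = (if r = ?in then (if b = b0 then (cmod (v (True # u)))\<^sup>2 else 0) else 0)" by simp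
 qed
 also have "... = (\<Sum>u\<in>bits ?a. if b = b0 then (cmod (v (True # u)))\<^sup>2 else 0)"
  using lin by (intro sum.cong refl) (simp add: sum.delta)
 also have "... = (if b = b0 then norm_sq ?a (slice [True] v) else 0)" by (simp add: norm_sq_def slice_def)
 finally have n: "norm_sq (?a + ?R) (slice [True, b] Phi) = (if b = b0 then norm_sq ?a (slice [True] v) else 0)" .
 have r: "pmf (run V (?s @ key)) [True] = norm_sq ?a (slice [True] v)"
  using k V by (simp add: pmf_run load_empty v_def add.assoc)
 have d: "decision -` {Some b} = {[True, b]}"
  by (auto simp: decision_def split: list.splits if_splits)
 have o: "n_out (open_receiver m l V) = 2" "n_anc (open_receiver m l V) = ?a" by (simp_all add: open_receiver_def)
 have "pmf (map_pmf decision (run (open_receiver m l V) (t @ k @ w))) (Some b) = pmf (run (open_receiver m l V) ?in) [True, b]"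
  unfolding pmf_map d by (simp add: pmf.rep_eq k)
 also have "... = norm_sq (?a + ?R) (slice [True, b] Phi)"
  unfolding pmf_run o Phi_def lin by simp
 finally show ?thesis unfolding n using r k by auto
qed

text \<open>
 The game as played, with measurements after each message, has the value computed by
 \<open>value_from\<close>.
\<close>

lemma game_value:
 assumes psi: "psi : qspace n" "norm_sq n psi = 1"
  and R: "!!z b k w. length k = n_out E ==> length (concat z) = L ==> length w = Lw ==>
   pmf (map_pmf decision (run Rc (concat z @ k @ w))) (Some b)
   = (if hd k = b then vr (concat z) b (tl k) else 0)"
  and L: "L = length (concat zs) + (\<Sum>C\<leftarrow>Cs. n_out C + m)" "Lw = length w + (\<Sum>C\<leftarrow>Cs. n_out C)"
 shows "pmf (interact (map act Cs) (replicate (length Cs) (act (coins m))) x [] psi (ket w) \<bind>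
   (%(z, phiC, phiR). pmf_of_set UNIV \<bind> (%b. open_stage [act E] [act Rc] [b] (zs @ z, phiC, phiR) \<bind>
   (%v. return_pmf (v = Some b))))) True = value_from m E vr Cs (concat zs) x n psi"
 using psi L
proof (induction Cs arbitrary: zs x n psi w)
 case Nil
 show ?case using Nil.prems open_value[OF Nil.prems(1,2), where m = m and x = x and z = zs and w = w and Rc = Rc and vr = vr and E = E] R
  by (simp add: bind_return_pmf del: value_from.simps)
next
 case (Cons C Cs)
 let ?n = "n_anc C + length x + n"
 let ?s = "%c. slice c (ap (gates C) (load (n_out C + n_anc C) x psi))"
 let ?F = "%zs (z, phiC, phiR). pmf_of_set UNIV \<bind> (%b. open_stage [act E] [act Rc] [b] (zs @ z, phiC, phiR) \<bind>
   (%v. return_pmf (v = Some b)))"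
 let ?I = "%c r phi. interact (map act Cs) (replicate (length Cs) (act (coins m))) r [] phi (ket (c @ w)) \<bind> ?F (zs @ [c, r])"
 have i: "interact (map act (C # Cs)) (replicate (length (C # Cs)) (act (coins m))) x [] psi (ket w) \<bind> ?F zs =
   activate (act C) x psi \<bind> (%(c, psi'). pmf_of_set (bits m) \<bind> (%r. ?I c r psi'))"
  by (simp only: list.map length_Cons replicate_Suc interact_coins bind_assoc_pmf case_prod_unfold bind_return_pmf
    fst_conv snd_conv append_assoc append_Cons append_Nil)
 have "pmf (interact (map act (C # Cs)) (replicate (length (C # Cs)) (act (coins m))) x [] psi (ket w) \<bind> ?F zs) True =
   (\<Sum>c\<in>bits (n_out C). norm_sq ?n (?s c) * (\<Sum>r\<in>bits m. 1 / 2 ^ m * pmf (?I c r (renorm ?n (?s c))) True))"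
  unfolding i pmf_activate_bind[OF Cons.prems(1,2) refl] case_prod_conv pmf_bind_bits by (rule refl)
 also have "... = (\<Sum>c\<in>bits (n_out C). \<Sum>r\<in>bits m. 1 / 2 ^ m *
   value_from m E vr Cs (concat zs @ c @ r) r ?n (?s c))"
 proof (rule sum.cong[OF refl])
  fix c assume "c : bits (n_out C)"
  hence c: "length c = n_out C" by simp
  have q: "?s c : qspace ?n"
   using slice_qspace[OF circuit_state(1)[OF Cons.prems(1,2), of "gates C" "n_out C" "n_anc C" x] c]
   by (simp add: add.assoc)
  have "norm_sq ?n (?s c) * pmf (?I c r (renorm ?n (?s c))) True =
    value_from m E vr Cs (concat zs @ c @ r) r ?n (?s c)" if r: "length r = m" for r
  proof (cases "norm_sq ?n (?s c) = 0")
   case True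
   thus ?thesis using value_from_renorm[OF q, of m E vr Cs "concat zs @ c @ r" r ?n] by simp
  next
   case False
   have "pmf (?I c r (renorm ?n (?s c))) True = value_from m E vr Cs (concat (zs @ [c, r])) r ?n (renorm ?n (?s c))"
    by (rule Cons.IH) (use renorm_state[OF q False] Cons.prems(3,4) c r in auto)
   thus ?thesis using value_from_renorm[OF q, of m E vr Cs "concat zs @ c @ r" r ?n] by simp
  qed
  thus "norm_sq ?n (?s c) * (\<Sum>r\<in>bits m. 1 / 2 ^ m * pmf (?I c r (renorm ?n (?s c))) True) =
   (\<Sum>r\<in>bits m. 1 / 2 ^ m * value_from m E vr Cs (concat zs @ c @ r) r ?n (?s c))"
   unfolding sum_distrib_left by (intro sum.cong refl) (simp add: mult.left_commute)
 qed
 finally show ?case by (simp only: value_from.simps)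
qed

lemma pmf_bind_const_on:
 assumes "!!x. x : set_pmf p ==> pmf (f x) v = a"
 shows "pmf (bind_pmf p f) v = a"
proof -
 have "pmf (bind_pmf p f) v = (\<integral>x. a \<partial>measure_pmf p)"
  unfolding pmf_bind by (rule integral_cong_AE) (use assms in \<open>auto simp: AE_measure_pmf_iff\<close>)
 thus ?thesis by simp
qed

lemma open_stage_single:
 "open_stage [act E] [act Rc] x (z, phi, ket w) =
  bind_pmf (activate (act E) (concat z @ x) phi) (%(k, _). map_pmf decision (run Rc (concat z @ k @ w)))"
proof -
 have "open_stage [act E] [act Rc] x (z, phi, ket w) =
   activate (act E) (concat z @ x) phi \<bind> (%(k, _). map_pmf decision (map_pmf fst (activate (act Rc) (concat z @ k) (ket w))))"
  by (simp add: open_stage_def map_bind_pmf case_prod_unfold map_pmf_def[symmetric] map_pmf_comp bind_return_pmf bind_assoc_pmf)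
 thus ?thesis unfolding fst_activate_ket run_def by simp
qed

lemma honest_success:
 assumes C: "n_out C = m + l" and V: "n_out V = 1"
 shows "pmf (bind_pmf (commit_stage (map act (committer_circuits m C)) (map act (replicate (Suc m) (coins m))) [b])
   (open_stage (map act [reveal_circuit m l (n_out C + n_anc C)]) (map act [open_receiver m l V]) [])) (Some b) =
  pmf (bind_pmf (run C []) (run V)) [True]"
proof -
 let ?K = "n_out C + n_anc C"
 let ?psi = "ap (gates C) (ket (zeros ?K))"
 let ?E = "reveal_circuit m l ?K" and ?Rc = "open_receiver m l V"
 let ?Q = "open_stage [act ?E] [act ?Rc] []"
 note s = activate_sample(2,3)[where K = ?K and gs = "gates C"]
 have coins: "unitary_op (act_op (act (coins m)))" "act_out (act (coins m)) = m"
  by (rule unitary_circuit) (simp add: act_def coins_def)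
 have meas: "meas (?K + 1 + m * m) (%phi. ?Q (z, phi, phiR))" if z: "length (concat z) = Suc m * Suc m" for z phiR
 proof -
  let ?G = "%c (phi' :: qvec). map_pmf (%(r, _). decision r) (activate (act ?Rc) (concat z @ c) phiR)"
  have "classical ?E (Suc m * Suc m + m * m + ?K + 1)
    (%w. map (%t. w ! (Suc l + Suc m * Suc m + m * m + (if t = 0 then ?K else m + (t - 1)) - Suc l)) [0..<Suc l])"
   by (rule classical_reveal) (simp add: C)
  also have "Suc m * Suc m + m * m + ?K + 1 = length (concat z) + (?K + 1 + m * m)" unfolding z by simp
  finally have "meas (?K + 1 + m * m) (%phi. activate (act ?E) (concat z) phi \<bind> (%(c, phi'). ?G c phi'))"
   by (rule meas_activate) (rule meas_const)
  moreover have "?Q (z, phi, phiR) = activate (act ?E) (concat z) phi \<bind> (%(c, phi'). ?G c phi')" for phi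
   by (simp add: open_stage_def map_bind_pmf case_prod_unfold map_pmf_def[symmetric] map_pmf_comp bind_return_pmf bind_assoc_pmf)
  ultimately show ?thesis by (simp only:)
 qed
 have "bind_pmf (commit_stage (map act (committer_circuits m C)) (act (coins m) # replicate m (act (coins m))) [b]) ?Q =
  bind_pmf (born ?psi) (%y. bind_pmf (activate (act (coins m)) [False] empty_state) (%(r, psiR).
   bind_pmf (interact (answers m ?K 0) (replicate m (act (coins m))) r [] (ket (y @ [b])) psiR) (%(z, w). ?Q ([False] # r # z, w))))"
  by (rule commit_stage_eq) (use C coins meas in auto)
 moreover have "pmf (bind_pmf (activate (act (coins m)) [False] empty_state) (%(r, psiR).
   bind_pmf (interact (answers m ?K 0) (replicate m (act (coins m))) r [] (ket (y @ [b])) psiR) (%(z, w). ?Q ([False] # r # z, w)))) (Some b) =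
   pmf (run V (take (m + l) y)) [True]" if "y : set_pmf (born ?psi)" for y
 proof (rule pmf_bind_const_on)
  have y: "length y = ?K" using s that by (auto simp: set_pmf_iff pmf_born[OF s] qspace_def)
  fix rp assume "rp : set_pmf (activate (act (coins m)) [False] empty_state)"
  then obtain r where r: "length r = m" "rp = (r, ket [False])"
   using activate_coins[of m "[False]" "[]"] by (auto simp: ket_Nil set_pmf_of_set[OF bits_nonempty finite_bits])
  show "pmf (case rp of (r, psiR) => bind_pmf (interact (answers m ?K 0) (replicate m (act (coins m))) r [] (ket (y @ [b])) psiR)
    (%(z, w). ?Q ([False] # r # z, w))) (Some b) = pmf (run V (take (m + l) y)) [True]"
   unfolding r prod.case
  proof (rule pmf_bind_const_on)
   fix w assume w: "w : set_pmf (interact (answers m ?K 0) (replicate m (act (coins m))) r [] (ket (y @ [b])) (ket [False]))"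
   obtain z phiC phiR where [simp]: "w = (z, phiC, phiR)" by (cases w)
   have "(z, phiC, phiR) : set_pmf (interact (answers m ?K 0) (replicate (m - 0) (act (coins m))) r [] (ket ([] @ y @ [b])) (ket [False]))"
    using w by simp
   from interact_honest[OF _ _ r(1) _ y this] C obtain c vs old w' where
    z: "z = record_of c vs [Suc 0..<Suc m]" "vs 0 = r" "!!j. j <= m ==> length (vs j) = m"
     "!!j. j < m ==> c (Suc j) = ((y ! j ~= dot (drop (Suc j) (vs j)) (drop (Suc j) (take m y))) ~= (Suc j = m & b))"
    and old: "length old = m * m" "phiC = ket (old @ y @ [b])" and w': "length w' = Suc m" "phiR = ket w'"
    by (auto simp del: upt_Suc)
   let ?c = "c(0 := False)"
   let ?z = "[False] # r # z"
   have z': "?z = record_of ?c vs [0..<Suc m]"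
   proof -
    have "record_of ?c vs [Suc 0..<Suc m] = record_of c vs [Suc 0..<Suc m]"
     by (rule arg_cong[where f = concat], rule map_cong) auto
    moreover have "[0..<Suc m] = 0 # [Suc 0..<Suc m]" by (simp add: upt_conv_Cons del: upt_Suc)
    ultimately show ?thesis using z(1,2) by (simp del: upt_Suc)
   qed
   have solve: "solve m (concat ?z) b = take m y"
    unfolding z' by (rule solve_record) (use z(3,4) y C in auto)
   have lz: "length (concat ?z) = Suc m * Suc m"
    unfolding z' by (rule record_nth(3)) (use z(3) in auto)
   have "?Q (?z, phiC, phiR) = map_pmf decision (run ?Rc (concat ?z @ (b # take l (drop m y)) @ w'))"
   proof -
    have "?Q (?z, phiC, phiR) = bind_pmf (map_pmf fst (activate (act ?E) (concat ?z) (ket (old @ y @ [b]))))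
      (%k. map_pmf decision (run ?Rc (concat ?z @ k @ w')))"
     unfolding old w' open_stage_single by (simp add: bind_map_pmf case_prod_unfold)
    also have "map_pmf fst (activate (act ?E) (concat ?z) (ket (old @ y @ [b]))) = return_pmf (b # take l (drop m y))"
     by (rule activate_reveal) (use C lz old y in auto)
    finally show ?thesis by (simp add: bind_return_pmf)
   qed
   moreover have "pmf (map_pmf decision (run ?Rc (concat ?z @ (b # take l (drop m y)) @ w'))) (Some b) =
     (if hd (b # take l (drop m y)) = b then pmf (run V (solve m (concat ?z) b @ tl (b # take l (drop m y)))) [True] else 0)"
    by (rule open_receiver_spec[OF V lz]) (use w' y C in auto)
   ultimately show "pmf (case w of (z, w) => ?Q ([False] # r # z, w)) (Some b) = pmf (run V (take (m + l) y)) [True]"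
    unfolding solve by (simp add: take_add)
  qed
 qed
 ultimately show ?thesis
  unfolding run_no_input bind_map_pmf C
  by (simp add: pmf_bind) (intro integral_cong_AE, auto simp: AE_measure_pmf_iff)
qed

section \<open>Efficiency\<close>

lemma pcircs_sample:
 assumes "pnat E K" "pgate E gs"
 shows "pcircs E (%p. [sample_circuit (K p) (gs p)])"
proof -
 have "pgate E (%p. map (rn (%i. if i < K p then i + 1 else i + 2)) (gs p))"
  by (rule pgate_rn[OF assms(2)])
   (intro pnat_if pbool_less pnat_add ext_snd ext_fst[OF assms(1)] pnat_const)
 thus ?thesis unfolding sample_circuit_def by (intro pcircs_single pnat_const assms)
qed

lemma cg_answer: "cg (answer m K i) = CNOT (1 + m * Suc i + i) 0 #
   concat (map (%t. ccx_gates (1 + (Suc i + t)) (1 + m * Suc i + (Suc i + t)) 0) [0..<m - Suc i]) @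
   (if Suc i = m then [CNOT (1 + m * Suc i + K) 0] else [])"
 by (simp add: answer_def o_def del: mult_Suc_right)

lemma pgate_answer:
 assumes "pnat E m" "pnat E K" "pnat E i"
 shows "pgate E (%p. cg (answer (m p) (K p) (i p)))"
proof -
 have "pgate (ext E) (%q. ccx_gates (1 + (Suc (i (fst q)) + snd q)) (1 + m (fst q) * Suc (i (fst q)) + (Suc (i (fst q)) + snd q)) 0)"
  by (intro pgate_ccx pnat_add pnat_mult pnat_Suc ext_snd ext_fst[OF assms(1)] ext_fst[OF assms(3)] pnat_const)
 hence "pgate E (%p. concat (map (%t. ccx_gates (1 + (Suc (i p) + t)) (1 + m p * Suc (i p) + (Suc (i p) + t)) 0) [0..<m p - Suc (i p)]))"
  by (intro pgate_concat[where g = "%p t. ccx_gates (1 + (Suc (i p) + t)) (1 + m p * Suc (i p) + (Suc (i p) + t)) 0"]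
   pnat_diff pnat_Suc assms)
 thus ?thesis unfolding cg_answer
  by (intro pgate_append pgate_CNOT pgate_if pbool_eq pnat_add pnat_mult pnat_Suc assms pnat_const pgate_Nil)
qed

lemma pcircs_committer:
 assumes "pnat E m" "pnat E K" "pgate E gs"
 shows "pcircs E (%p. sample_circuit (K p) (gs p) # map (answer_circuit (m p) (K p)) [0..<m p])"
proof -
 have "pcircs (ext E) (%q. [answer_circuit (m (fst q)) (K (fst q)) (snd q)])"
  unfolding answer_circuit_def
  by (intro pcircs_single pgate_answer ext_snd ext_fst[OF assms(1)] ext_fst[OF assms(2)] pnat_const)
 hence "pcircs E (%p. map (answer_circuit (m p) (K p)) [0..<m p])"
  by (intro pcircs_map[where g = "%p. answer_circuit (m p) (K p)"] assms)
 from pcircs_append[OF pcircs_sample[OF assms(2,3)] this] show ?thesis by simp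
qed

lemma pcircs_coins:
 assumes "pnat E m"
 shows "pcircs E (%p. replicate (Suc (m p)) (coins (m p)))"
proof -
 have "pgate E (%p. map Hadamard [0..<m p])"
  by (rule pgate_map[where g = "%_. Hadamard", OF assms])
   (intro pgate_H ext_snd pgate_Nil)
 hence "pcircs E (%p. [coins (m p)])" unfolding coins_def by (intro pcircs_single assms pnat_const)
 hence "pcircs (ext E) (%q. [coins (m (fst q))])" by (rule ext_fst)
 hence "pcircs E (%p. map (%i. coins (m p)) [0..<Suc (m p)])"
  by (intro pcircs_map[where g = "%p i. coins (m p)"] pnat_Suc assms)
 thus ?thesis by (simp add: map_replicate_const del: upt_Suc replicate_Suc)
qed

lemma pcircs_reveal:
 assumes "pnat E m" "pnat E l" "pnat E K"
 shows "pcircs E (%p. [reveal_circuit (m p) (l p) (K p)])"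
proof -
 have cg: "cg (map (%t. XG [f t] t) ts) = concat (map (%t. [CNOT (f t) t]) ts)" for f ts by (induction ts) simp_all
 have "pgate E (%p. concat (map (%t. [CNOT (Suc (l p) + Suc (m p) * Suc (m p) + m p * m p + (if t = 0 then K p else m p + (t - 1))) t]) [0..<Suc (l p)]))"
  by (rule pgate_concat[where g = "%p t. [CNOT (Suc (l p) + Suc (m p) * Suc (m p) + m p * m p + (if t = 0 then K p else m p + (t - 1))) t]"])
   (intro pgate_CNOT pnat_add pnat_mult pnat_Suc pnat_diff pnat_if pbool_eq assms ext_snd
    ext_fst[OF assms(1)] ext_fst[OF assms(2)] ext_fst[OF assms(3)] pnat_const pgate_Nil)+
 thus ?thesis unfolding reveal_circuit_def cg by (intro pcircs_single assms pnat_Suc pnat_const)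
qed

lemma cg_eqn: "cg (eqn m nV B i) = CNOT (B + Suc i * Suc m) (2 + nV + i) #
   concat (map (%t. ccx_gates (B + i * Suc m + Suc (Suc i + t)) (2 + nV + (Suc i + t)) (2 + nV + i)) [0..<m - Suc i]) @
   (if Suc i = m then [CNOT (B + Suc m * Suc m) (2 + nV + i)] else [])"
 by (simp add: eqn_def o_def del: mult_Suc mult_Suc_right)

lemma pgate_eqn:
 assumes "pnat E m" "pnat E nV" "pnat E B" "pnat E i"
 shows "pgate E (%p. cg (eqn (m p) (nV p) (B p) (i p)))"
proof -
 let ?g = "%p t. ccx_gates (B p + i p * Suc (m p) + Suc (Suc (i p) + t)) (2 + nV p + (Suc (i p) + t)) (2 + nV p + i p)"
 have "pgate (ext E) (%q. ?g (fst q) (snd q))"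
  by (intro pgate_ccx pnat_add pnat_mult pnat_Suc ext_snd ext_fst[OF assms(1)] ext_fst[OF assms(2)]
   ext_fst[OF assms(3)] ext_fst[OF assms(4)] pnat_const)
 hence "pgate E (%p. concat (map (?g p) [0..<m p - Suc (i p)]))"
  by (intro pgate_concat[where g = ?g] pnat_diff pnat_Suc assms)
 thus ?thesis unfolding cg_eqn
  by (intro pgate_append pgate_CNOT pgate_if pbool_eq pnat_add pnat_mult pnat_Suc assms pnat_const pgate_Nil)
qed

lemma cg_decode: "cg (decode m l nV) = concat (map (%i. cg (eqn m nV (2 + nV + m + l) (m - Suc i))) [0..<m]) @
   concat (map (%t. [CNOT (2 + nV + m + l + Suc m * Suc m + 1 + t) (2 + nV + m + t)]) [0..<l]) @
   [CNOT (2 + nV + m + l + Suc m * Suc m) 1]"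
proof -
 have "cg (concat xss) = concat (map (%xs. cg xs) xss)" for xss by (induction xss) simp_all
 thus ?thesis by (simp add: decode_def Let_def o_def del: mult_Suc mult_Suc_right)
qed

lemma pcircs_open_receiver:
 assumes "pnat E m" "pnat E l" "pnat E (%p. n_anc (V p))" "pgate E (%p. gates (V p))"
 shows "pcircs E (%p. [open_receiver (m p) (l p) (V p)])"
proof -
 let ?nV = "%p. n_anc (V p)"
 note e = ext_snd ext_fst[OF assms(1)] ext_fst[OF assms(2)] ext_fst[OF assms(3)]
 have "pgate E (%p. concat (map (%i. cg (eqn (m p) (?nV p) (2 + ?nV p + m p + l p) (m p - Suc i))) [0..<m p]))"
  by (rule pgate_concat[where g = "%p i. cg (eqn (m p) (?nV p) (2 + ?nV p + m p + l p) (m p - Suc i))", OF assms(1)])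
   (intro pgate_eqn pnat_add pnat_diff pnat_Suc e pnat_const)
 moreover have "pgate E (%p. concat (map (%t. [CNOT (2 + ?nV p + m p + l p + Suc (m p) * Suc (m p) + 1 + t) (2 + ?nV p + m p + t)]) [0..<l p]))"
  by (rule pgate_concat[where g = "%p t. [CNOT (2 + ?nV p + m p + l p + Suc (m p) * Suc (m p) + 1 + t) (2 + ?nV p + m p + t)]", OF assms(2)])
   (intro pgate_CNOT pnat_add pnat_mult pnat_Suc e pnat_const pgate_Nil)
 moreover have "pgate E (%p. map (rn (verify_map (m p) (l p) (?nV p))) (gates (V p)))"
  unfolding verify_map_def
  by (rule pgate_rn[OF assms(4)]) (intro pnat_if pbool_eq pbool_less pnat_add pnat_mult pnat_Suc e pnat_const)
 ultimately have "pgate E (%p. cg (decode (m p) (l p) (?nV p)) @ map (rn (verify_map (m p) (l p) (?nV p))) (gates (V p)))"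
  unfolding cg_decode
  by (intro pgate_append pgate_CNOT pnat_add pnat_mult pnat_Suc assms pnat_const pgate_Nil)
 thus ?thesis unfolding open_receiver_def by (intro pcircs_single pnat_add assms pnat_const)
qed

section \<open>Binding\<close>

text \<open>The success probability of an inverter A on sampled puzzles, and on uniformly random ones.\<close>

abbreviation inverter_success :: "(nat => nat) => (nat => circuit) => (nat => circuit) => nat => circuit => real" where
 "inverter_success m Samp Ver n A == pmf (bind_pmf (samp_dist m Samp n) (%(s, k). bind_pmf (run A s) (verify Ver n s))) True"

abbreviation "uniform_success m l A V == (\<Sum>s\<in>bits m. 1 / 2 ^ m * (\<Sum>k\<in>bits l. pmf (run A s) k * pmf (run V (s @ k)) [True]))"

text \<open>
 The least number of rounds for the required accuracy; the exponent 7 is due to \<open>4 <=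
 (5/4)^7\<close>.
\<close>

lemma rounds_needed:
 fixes dl :: real
 assumes "0 < dl" "dl <= 1"
 shows "\<exists>r. 2 * (4/5) ^ r <= dl / 8 & dl ^ 9 / (160 * 16 ^ 7) <= dl\<^sup>2 / (40 * 4 ^ r)"
proof -
 define P where "P r <-> 2 * (4/5 :: real) ^ r <= dl / 8" for r
 obtain r0 where "(4/5 :: real) ^ r0 < dl / 16" using real_arch_pow_inv[of "dl / 16" "4/5"] assms by auto
 hence "P r0" unfolding P_def by simp
 define r where "r = (LEAST r. P r)"
 have r: "P r" unfolding r_def using \<open>P r0\<close> by (rule LeastI)
 have "r = 0 | ~ P (r - 1)" unfolding r_def using not_less_Least[of _ P] by (metis diff_less less_numeral_extra(1) neq0_conv)
 hence "4 ^ r <= 4 * (16 / dl) ^ 7"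
 proof
  assume "r = 0"
  have "1 <= (16 / dl) ^ 7" using assms by (intro one_le_power) (simp add: field_simps)
  thus ?thesis using \<open>r = 0\<close> by simp
 next
  assume np: "~ P (r - 1)"
  hence "r ~= 0" using r by (metis diff_0_eq_0)
  have "(5/4 :: real) ^ (r - 1) < 16 / dl"
  proof -
   have "dl / 8 < 2 * (4/5 :: real) ^ (r - 1)" using np by (simp add: P_def)
   moreover have "(4/5 :: real) ^ (r - 1) = 1 / (5/4) ^ (r - 1)" by (simp add: power_divide)
   ultimately show ?thesis using assms by (simp add: field_simps)
  qed
  hence "((5/4 :: real) ^ (r - 1)) ^ 7 <= (16 / dl) ^ 7" by (intro power_mono) auto
  moreover have "((5/4 :: real) ^ (r - 1)) ^ 7 = ((5/4) ^ 7) ^ (r - 1)" by (simp only: power_mult[symmetric] mult.commute)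
  moreover have "(4 :: real) ^ (r - 1) <= ((5/4) ^ 7) ^ (r - 1)" by (rule power_mono) (simp_all add: power_divide)
  ultimately have "(4 :: real) ^ (r - 1) <= (16 / dl) ^ 7" by linarith
  moreover have "(4 :: real) ^ r = 4 * 4 ^ (r - 1)" using \<open>r ~= 0\<close> by (cases r) simp_all
  ultimately show ?thesis by linarith
 qed
 hence "dl\<^sup>2 / (40 * (4 * (16 / dl) ^ 7)) <= dl\<^sup>2 / (40 * 4 ^ r)"
  using assms by (intro divide_left_mono mult_left_mono mult_pos_pos) auto
 moreover have "dl\<^sup>2 / (40 * (4 * (16 / dl) ^ 7)) = dl ^ 9 / (160 * 16 ^ 7)"
  using assms by (simp add: power_divide field_simps flip: power_add)
 ultimately show ?thesis using r unfolding P_def by (intro exI[of _ r]) simp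
qed

lemma negl_root:
 assumes f: "negl f" and "0 <= C" and dl: "!!n. 0 <= dl n" "eventually (%n. dl n ^ 9 <= C * f n) sequentially"
 shows "negl dl"
 unfolding negl_def
proof
 fix c
 have "eventually (%n. \<bar>f n\<bar> < 1 / real n ^ (9 * c + 1)) sequentially" using f unfolding negl_def by blast
 moreover have "eventually (%n. real n > C) sequentially"
  using filterlim_real_sequentially unfolding filterlim_at_top_dense by blast
 ultimately show "eventually (%n. \<bar>dl n\<bar> < 1 / real n ^ c) sequentially"
  using dl(2)
 proof eventually_elim
  case (elim n)
  have n: "real n > 0" using elim(2) assms(2) by linarith
  have "dl n ^ 9 <= C * (1 / real n ^ (9 * c + 1))"
   using elim(1,3) assms(2) by (meson abs_ge_self less_imp_le mult_left_mono order_trans)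
  also have "... < real n * (1 / real n ^ (9 * c + 1))" using elim(2) n by (intro mult_strict_right_mono) auto
  also have "... = (1 / real n ^ c) ^ 9" using n by (simp add: power_divide power_mult[symmetric] mult.commute)
  finally have "dl n < 1 / real n ^ c" by (rule power_less_imp_less_base) (use n in simp)
  thus ?case using dl(1)[of n] by simp
 qed
qed

lemma negl_add: "negl f ==> negl g ==> negl (%n. f n + g n)"
 unfolding negl_def
proof
 fix c
 assume f: "\<forall>c. \<forall>\<^sub>F n in sequentially. \<bar>f n\<bar> < 1 / real n ^ c" and g: "\<forall>c. \<forall>\<^sub>F n in sequentially. \<bar>g n\<bar> < 1 / real n ^ c"
 have "\<forall>\<^sub>F n in sequentially. \<bar>f n\<bar> < 1 / real n ^ Suc c" "\<forall>\<^sub>F n in sequentially. \<bar>g n\<bar> < 1 / real n ^ Suc c"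
  using f g by blast+
 thus "\<forall>\<^sub>F n in sequentially. \<bar>f n + g n\<bar> < 1 / real n ^ c"
  using eventually_ge_at_top[of 2]
 proof eventually_elim
  case (elim n)
  have "2 * (1 / real n ^ Suc c) <= 1 / real n ^ c" using elim(3) by (simp add: field_simps)
  thus ?case using elim(1,2) by linarith
 qed
qed

lemma pmf_verify: "pmf (verify Ver n s k) True = pmf (run (Ver n) (s @ k)) [True]"
proof -
 have "(%v. v = [True]) -` {True} = {[True]}" by auto
 thus ?thesis unfolding verify_def pmf_map by (simp add: pmf.rep_eq)
qed

lemma set_run: "set_pmf (run C x) <= bits (n_out C)"
 by (auto simp: set_pmf_iff pmf_run split: if_splits)

lemma inverter_uniform:
 fixes Samp Ver :: "nat => circuit"
 assumes "n_out (Samp n) = m n + l n" "n_out A = l n"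
  and "stat_dist (map_pmf fst (samp_dist m Samp n)) (pmf_of_set {s. length s = m n}) <= e"
 shows "uniform_success (m n) (l n) A (Ver n) <=
  inverter_success m Samp Ver n A + 2 * e"
proof -
 let ?p = "map_pmf fst (samp_dist m Samp n)" and ?u = "pmf_of_set (bits (m n))"
 let ?I = "%s. pmf (bind_pmf (run A s) (verify Ver n s)) True"
 have I: "?I s = (\<Sum>k\<in>bits (l n). pmf (run A s) k * pmf (run (Ver n) (s @ k)) [True])" for s
  using pmf_bind_finite[OF finite_bits, of "run A s" "l n" "verify Ver n s" True] set_run[of A s] assms(2)
  by (simp add: pmf_verify)
 have Sp: "set_pmf ?p <= bits (m n)" using set_samp_dist(1)[of _ _ m Samp n l] assms(1) by force
 have Su: "set_pmf ?u <= bits (m n)" by (simp add: set_pmf_of_set[OF bits_nonempty finite_bits])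
 have u: "pmf ?u s = 1 / 2 ^ m n" if "s : bits (m n)" for s
  using that by (simp add: pmf_of_set[OF bits_nonempty finite_bits] card_bits)
 have "(do {(s, k) <- samp_dist m Samp n; k' <- run A s; verify Ver n s k'}) = bind_pmf ?p (%s. bind_pmf (run A s) (verify Ver n s))"
  by (simp add: bind_map_pmf case_prod_unfold)
 hence P: "inverter_success m Samp Ver n A = (\<Sum>s\<in>bits (m n). pmf ?p s * ?I s)"
  by (simp only: pmf_bind_finite[OF finite_bits Sp])
 have "(\<Sum>s\<in>bits (m n). 1 / 2 ^ m n * ?I s) - (\<Sum>s\<in>bits (m n). pmf ?p s * ?I s) = (\<Sum>s\<in>bits (m n). (pmf ?u s - pmf ?p s) * ?I s)"
  by (simp add: u sum_subtractf left_diff_distrib)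
 also have "... <= (\<Sum>s\<in>bits (m n). \<bar>pmf ?p s - pmf ?u s\<bar>)"
 proof (rule sum_mono)
  fix s
  have "(pmf ?u s - pmf ?p s) * ?I s <= \<bar>pmf ?u s - pmf ?p s\<bar> * 1"
   by (intro mult_mono) (auto simp: pmf_le_1)
  thus "(pmf ?u s - pmf ?p s) * ?I s <= \<bar>pmf ?p s - pmf ?u s\<bar>" by (simp add: abs_minus_commute)
 qed
 also have "... = 2 * stat_dist ?p ?u" unfolding stat_dist_finite[OF finite_bits Sp Su] by simp
 also have "... <= 2 * e" using assms(3) by simp
 finally show ?thesis unfolding P I by simp
qed

text \<open>If puzzles of length 0 occurred infinitely often, the sampler itself would solve them.\<close>

lemma puzzle_nonempty:
 assumes P: "EV_OWPuzz m l Samp Ver"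
 shows "eventually (%n. m n > 0) sequentially"
proof -
 have o: "n_out (Samp n) = m n + l n" for n using P by (simp add: EV_OWPuzz_def)
 have Q: "QPT Samp" using P by (simp add: EV_OWPuzz_def)
 \<comment> \<open>for an empty puzzle, the sampler outputs just a key\<close>
 define gs where "gs n = (if m n = 0 then trim (l n + n_anc (Samp n)) (gates (Samp n)) else [])" for n
 let ?f = "%n. inverter_success m Samp Ver n (Circuit (l n) (n_anc (Samp n)) (gs n))"
 have lg: "length (gs n) <= length (genc (gates (Samp n)))" for n
  using order_trans[OF length_filter_le length_genc[of "gates (Samp n)"]] by (simp add: gs_def)
 have ir: "in_range (l n + n_anc (Samp n) + m n) g" if "g : set (gs n)" for n g
  using that by (auto simp: gs_def split: if_splits)
 have "negl ?f"
  by (rule nonuniform_security[OF P QPT_parts(2)[OF Q] pnat_length[OF QPT_parts(3)[OF Q]] lg ir])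
 moreover obtain \<nu> where \<nu>: "negl \<nu>" "!!n. pmf (do {(s, k) <- samp_dist m Samp n; verify Ver n s k}) True \<ge> 1 - \<nu> n"
  using P unfolding EV_OWPuzz_def by blast
 ultimately have "negl (%n. ?f n + \<nu> n)" by (intro negl_add)
 hence "eventually (%n. \<bar>?f n + \<nu> n\<bar> < 1 / real n ^ 0) sequentially" unfolding negl_def by blast
 thus ?thesis
 proof eventually_elim
  case (elim n)
  show ?case
  proof (rule ccontr)
   assume "~ m n > 0"
   hence m: "m n = 0" by simp
   have r: "run (Circuit (l n) (n_anc (Samp n)) (gs n)) [] = run (Samp n) []"
   proof (rule pmf_eqI)
    fix y
    have "norm_sq (n_anc (Samp n)) (slice y (ap (gs n) phi)) = norm_sq (n_anc (Samp n)) (slice y (ap (gates (Samp n)) phi))"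
     if "length y = l n" for phi
     by (rule norm_sq_cong) (use that m in \<open>simp add: slice_def gs_def ap_trim\<close>)
    thus "pmf (run (Circuit (l n) (n_anc (Samp n)) (gs n)) []) y = pmf (run (Samp n) []) y"
     using o[of n] m by (simp add: pmf_run)
   qed
   have sd: "samp_dist m Samp n = map_pmf (%y. ([], y)) (run (Samp n) [])" by (simp add: samp_dist_def m)
   have "(do {(s, k) <- samp_dist m Samp n; k' <- run (Circuit (l n) (n_anc (Samp n)) (gs n)) s; verify Ver n s k'}) =
     (do {(s, k) <- samp_dist m Samp n; verify Ver n s k})"
    unfolding sd bind_map_pmf prod.case r by simp
   thus False using elim \<nu>(2)[of n] by simp
  qed
 qed
qed

lemma binding_value:
 assumes E: "n_out E = Suc l" and Cs: "length Cs = Suc m" "!!C. C : set Cs ==> n_out C = 1" and V: "n_out V = 1"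
 shows "pmf (bind_pmf (commit_stage (map act Cs) (map act (replicate (Suc m) (coins m))) []) (%w.
   bind_pmf (pmf_of_set UNIV) (%b. bind_pmf (open_stage (map act [E]) (map act [open_receiver m l V]) [b] w)
    (%v. return_pmf (v = Some b))))) True =
  value_from m E (%t b k. pmf (run V (solve m t b @ k)) [True]) Cs [] [] 0 empty_state"
proof -
 have sum: "(\<Sum>C\<leftarrow>Cs. n_out C + m) = length Cs * Suc m" "(\<Sum>C\<leftarrow>Cs. n_out C) = length Cs"
  using Cs(2) by (induction Cs) auto
 have "pmf (interact (map act Cs) (replicate (length Cs) (act (coins m))) [] [] empty_state (ket []) \<bind>
   (%(z, phiC, phiR). pmf_of_set UNIV \<bind> (%b. open_stage [act E] [act (open_receiver m l V)] [b] ([] @ z, phiC, phiR) \<bind>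
   (%v. return_pmf (v = Some b))))) True =
   value_from m E (%t b k. pmf (run V (solve m t b @ k)) [True]) Cs (concat []) [] 0 empty_state"
 proof (rule game_value[OF empty_state, where L = "Suc m * Suc m" and Lw = "Suc m"])
  fix z :: "bool list list" and b and k w :: "bool list"
  assume "length k = n_out E" "length (concat z) = Suc m * Suc m" "length w = Suc m"
  thus "pmf (map_pmf decision (run (open_receiver m l V) (concat z @ k @ w))) (Some b) =
   (if hd k = b then pmf (run V (solve m (concat z) b @ tl k)) [True] else 0)"
   using E by (intro open_receiver_spec[OF V]) simp_all
 qed (use sum Cs in simp_all)
 thus ?thesis using Cs(1) by (simp add: commit_stage_def ket_Nil case_prod_unfold del: value_from.simps replicate.simps)
qed

text \<open>
 A committer that wins with probability \<open>(1 + dl) / 2\<close> yields an inverter that succeeds with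
 probability proportional to \<open>dl ^ 9\<close>.
\<close>

lemma inverter_of_committer:
 assumes m: "m > 0" and E: "n_out E = Suc l" and Cs: "length Cs = Suc m" "!!C. C : set Cs ==> n_out C = 1"
  and S: "m <= S" "!!C. C : set Cs ==> n_anc C <= S & length (gates C) <= S" "n_anc E <= S" "length (gates E) <= S"
  and aa: "aa = 20 * (S + 2)\<^sup>2"
  and w: "w = value_from m E (%t b k. pmf (run V (solve m t b @ k)) [True]) Cs [] [] 0 empty_state" "w <= 1"
 shows "\<exists>gs. length gs <= 2000 * (S + 2)\<^sup>2 & (\<forall>g\<in>set gs. in_range (l + aa + m) g) &
  (max 0 (2 * w - 1)) ^ 9 / (160 * 16 ^ 7) <=
   uniform_success m l (Circuit l aa gs) V"
proof (cases "2 * w - 1 > 0")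
 case True
 define dl where "dl = 2 * w - 1"
 have dl: "0 < dl" "dl <= 1" using True w(2) by (simp_all add: dl_def)
 obtain r where r: "2 * (4/5) ^ r <= dl / 8" "dl ^ 9 / (160 * 16 ^ 7) <= dl\<^sup>2 / (40 * 4 ^ r)"
  using rounds_needed[OF dl] by blast
 have map: "map (%j. Cs ! j) [0..<Suc m] = Cs" using Cs(1) by (metis map_nth)
 have nth: "Cs ! j : set Cs" if "j <= m" for j using Cs(1) that by simp
 have "\<exists>gs. length gs <= 2000 * (S + 2)\<^sup>2 & (\<forall>g\<in>set gs. in_range (l + aa + m) g) &
  dl\<^sup>2 / (40 * 4 ^ r) <= uniform_success m l (Circuit l aa gs) V"
 proof (rule inverter_exists[where D = "%j. Cs ! j" and ver = "%s k. pmf (run V (s @ k)) [True]", OF m _ E S(1) _ S(3,4) _ _ dl r(1)])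
  show "n_out (Cs ! j) = 1" if "j <= m" for j using Cs(2)[OF nth[OF that]] .
  show "n_anc (Cs ! j) <= S & length (gates (Cs ! j)) <= S" if "j <= m" for j using S(2)[OF nth[OF that]] .
  show "20 * (S + 2)\<^sup>2 <= aa" using aa by simp
  show "0 <= pmf (run V (s @ k)) [True] & pmf (run V (s @ k)) [True] <= 1" for s k by (simp add: pmf_le_1)
  show "(1 + dl) / 2 <= value_from m E (%t b k. pmf (run V (solve m t b @ k)) [True]) (map (%j. Cs ! j) [0..<Suc m]) [] [] 0 empty_state"
   unfolding map w(1)[symmetric] by (simp add: dl_def)
 qed
 then obtain gs where "length gs <= 2000 * (S + 2)\<^sup>2" "\<forall>g\<in>set gs. in_range (l + aa + m) g"
  "dl\<^sup>2 / (40 * 4 ^ r) <= uniform_success m l (Circuit l aa gs) V"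
  by blast
 moreover have "max 0 (2 * w - 1) = dl" using True by (simp add: dl_def)
 ultimately show ?thesis using r(2) by (intro exI[of _ gs]) simp
next
 case False
 hence "max 0 (2 * w - 1) = 0" by simp
 moreover have "0 <= uniform_success m l (Circuit l aa []) V"
  by (intro sum_nonneg mult_nonneg_nonneg) auto
 ultimately show ?thesis by (intro exI[of _ "[]"]) simp
qed

theorem theoremC2:
  fixes Samp Ver :: "nat \<Rightarrow> circuit" and m l :: "nat \<Rightarrow> nat" and \<epsilon> :: "nat \<Rightarrow> real"
  assumes "EV_OWPuzz m l Samp Ver"
    and "negl \<epsilon>"
    and "\<And>n. stat_dist (map_pmf fst (samp_dist m Samp n)) (pmf_of_set {s. length s = m n}) \<le> \<epsilon> n"
  shows "\<exists>S. QCCC_commitment S \<and> statistically_hiding (\<lambda>n. 2 * \<epsilon> n) S \<and>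
    computationally_sum_binding S"
proof -
 note P = assms(1)
 have QS: "QPT Samp" and QV: "QPT Ver" and out: "!!n. n_out (Samp n) = m n + l n" "!!n. n_out (Ver n) = 1"
  using P by (simp_all add: EV_OWPuzz_def)
 note len = puzzle_lengths[OF P]
 let ?K = "%n. n_out (Samp n) + n_anc (Samp n)"
 define S where "S = \<lparr>commit_C = %n. committer_circuits (m n) (Samp n),
  commit_R = %n. replicate (Suc (m n)) (coins (m n)),
  open_C = %n. [reveal_circuit (m n) (l n) (?K n)],
  open_R = %n. [open_receiver (m n) (l n) (Ver n)]\<rparr>"
 have eff: "efficient_protocol S"
 proof -
  have K: "pnat base ?K" by (intro pnat_add QPT_parts[OF QS])
  have "QPT_machine (commit_C S)" "QPT_machine (commit_R S)" "QPT_machine (open_C S)" "QPT_machine (open_R S)"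
   unfolding QPT_machine_iff S_def commitment.simps
   by (intro pcircs_committer pcircs_coins pcircs_reveal pcircs_open_receiver len K QPT_parts[OF QS] QPT_parts[OF QV])+
  thus ?thesis by (simp add: efficient_protocol_def S_def open_receiver_def)
 qed
 have cor: "correct S"
 proof -
  obtain \<nu> where \<nu>: "negl \<nu>" "!!n. pmf (do {(s, k) <- samp_dist m Samp n; verify Ver n s k}) True \<ge> 1 - \<nu> n"
   using P unfolding EV_OWPuzz_def by blast
  have "pmf (honest_output S n b) (Some b) \<ge> 1 - \<nu> n" for n b
  proof -
   have "pmf (honest_output S n b) (Some b) = pmf (bind_pmf (run (Samp n) []) (run (Ver n))) [True]"
    unfolding honest_output_def S_def commitment.simps by (rule honest_success[OF out])
   also have "... = pmf (do {(s, k) <- samp_dist m Samp n; verify Ver n s k}) True"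
    unfolding samp_dist_def bind_map_pmf prod.case pmf_bind pmf_verify append_take_drop_id ..
   finally show ?thesis using \<nu>(2)[of n] by simp
  qed
  thus ?thesis unfolding correct_def using \<nu>(1) by blast
 qed
 have hid: "statistically_hiding (%n. 2 * \<epsilon> n) S"
  unfolding statistically_hiding_def
 proof (intro allI impI)
  fix n R'
  assume "(\<forall>A\<in>set R'. unitary_op (act_op A)) & map act_out R' = map n_out (commit_R S n)"
  hence U: "!!A. A : set R' ==> unitary_op (act_op A)" and o: "map act_out R' = replicate (Suc (m n)) (m n)"
   by (simp_all add: S_def coins_def)
  have lR: "length R' = Suc (m n)" using arg_cong[OF o, of length] by simp
  have aR: "act_out A = m n" if "A : set R'" for A
  proof -
   have "act_out A : set (map act_out R')" using that by simp
   thus ?thesis unfolding o by (simp only: in_set_replicate)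
  qed
  let ?p = "map_pmf fst (samp_dist m Samp n)" and ?u = "pmf_of_set (bits (m n))"
  let ?T = "%b s. full_committer (m n) b s R'"
  have p: "?p = map_pmf (take (m n)) (run (Samp n) [])" by (simp add: samp_dist_def map_pmf_comp)
  have T: "commit_transcript S n R' b = bind_pmf ?p (?T b)" for b
   unfolding p commit_transcript_def S_def commitment.simps
   by (rule commit_transcript_eq) (use out U aR lR in auto)
  have Sp: "set_pmf ?p <= bits (m n)" using set_samp_dist(1)[of _ _ m Samp n l] out by force
  have Su: "set_pmf ?u <= bits (m n)" by (simp add: set_pmf_of_set[OF bits_nonempty finite_bits])
  have "stat_dist (bind_pmf ?p (?T False)) (bind_pmf ?p (?T True)) <= 2 * stat_dist ?p ?u"
   by (rule stat_dist_kernels[OF finite_bits Sp Su full_committer_uniform[OF lR]])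
  also have "... <= 2 * \<epsilon> n" using assms(3)[of n] by simp
  finally show "stat_dist (commit_transcript S n R' False) (commit_transcript S n R' True) <= 2 * \<epsilon> n" unfolding T .
 qed
 have bnd: "computationally_sum_binding S"
  unfolding computationally_sum_binding_def
 proof (intro allI impI, elim conjE)
  fix C' O'
  assume Q: "QPT_machine C'" "QPT_machine O'"
   and fmt: "\<forall>n. map n_out (C' n) = map n_out (commit_C S n) & map n_out (O' n) = map n_out (open_C S n)"
  have C: "map n_out (C' n) = replicate (Suc (m n)) 1" and O: "map n_out (O' n) = [Suc (l n)]" for n
   using fmt[rule_format, of n]
   by (simp_all add: S_def sample_circuit_def answer_circuit_def reveal_circuit_def o_def map_replicate_const)
  have lC: "length (C' n) = Suc (m n)" for n using arg_cong[OF C, of length] by simp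
  have oC: "n_out D = 1" if "D : set (C' n)" for D n
  proof -
   have "n_out D : set (map n_out (C' n))" using that by simp
   thus ?thesis unfolding C by (simp only: in_set_replicate)
  qed
  define E where "E n = hd (O' n)" for n
  have E: "O' n = [E n]" "n_out (E n) = Suc (l n)" for n using O[of n] by (auto simp: E_def)
  obtain k1 where k1: "!!n D. D : set (C' n) ==> n_anc D <= (n + 2) ^ k1 & length (gates D) <= (n + 2) ^ k1"
   using QPT_machine_bound[OF Q(1)] by blast
  obtain k2 where k2: "!!n D. D : set (O' n) ==> n_anc D <= (n + 2) ^ k2 & length (gates D) <= (n + 2) ^ k2"
   using QPT_machine_bound[OF Q(2)] by blast
  obtain k3 where k3: "!!n. m n <= (n + 2) ^ k3"
   using pnat_bound[OF len(1)] unfolding pbound_def by auto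
  define B where "B n = (n + 2) ^ (k1 + k2 + k3)" for n :: nat
  have B: "(n + 2) ^ k1 <= B n" "(n + 2) ^ k2 <= B n" "(n + 2) ^ k3 <= B n" for n
   unfolding B_def by (rule pow2_mono; simp)+
  define aa where "aa n = 20 * (B n + 2)\<^sup>2" for n
  define w where "w n = value_from (m n) (E n) (%t b k. pmf (run (Ver n) (solve (m n) t b @ k)) [True]) (C' n) [] [] 0 empty_state" for n
  have game: "pmf (binding_game S C' O' n) True = w n" for n
   unfolding binding_game_def S_def commitment.simps E(1) w_def
   by (rule binding_value) (use E(2) lC oC out in auto)
  have w1: "w n <= 1" for n unfolding game[symmetric] by (rule pmf_le_1)
  define dl where "dl n = max 0 (2 * w n - 1)" for n
  \<comment> \<open>if the puzzle is empty, there is nothing to invert; this happens for finitely many n only\<close>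
  define good where "good n gs <-> length gs <= 2000 * (B n + 2)\<^sup>2 & (\<forall>g\<in>set gs. in_range (l n + aa n + m n) g) &
   (m n > 0 --> dl n ^ 9 / (160 * 16 ^ 7) <=
    uniform_success (m n) (l n) (Circuit (l n) (aa n) gs) (Ver n))" for n gs
  have "\<exists>gs. good n gs" for n
  proof (cases "m n > 0")
   case True
   have "\<exists>gs. length gs <= 2000 * (B n + 2)\<^sup>2 & (\<forall>g\<in>set gs. in_range (l n + aa n + m n) g) &
    (max 0 (2 * w n - 1)) ^ 9 / (160 * 16 ^ 7) <=
    uniform_success (m n) (l n) (Circuit (l n) (aa n) gs) (Ver n)"
   proof (rule inverter_of_committer[OF True E(2) lC oC])
    show "m n <= B n" using k3[of n] B(3)[of n] by linarith
    show "n_anc D <= B n & length (gates D) <= B n" if "D : set (C' n)" for D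
     using k1[OF that] B(1)[of n] by linarith
    have "E n : set (O' n)" by (simp add: E(1))
    thus "n_anc (E n) <= B n" "length (gates (E n)) <= B n" using k2[of "E n" n] B(2)[of n] by linarith+
   qed (simp_all add: aa_def w_def w1[unfolded w_def])
   thus ?thesis using True unfolding good_def dl_def by blast
  next
   case False
   thus ?thesis unfolding good_def by (intro exI[of _ "[]"]) simp
  qed
  hence "\<forall>n. \<exists>gs. good n gs" by (rule allI)
  then obtain gs where "\<forall>n. good n (gs n)" by (rule choice[THEN exE])
  hence gs: "good n (gs n)" for n by (rule spec)
  let ?succ = "%n. inverter_success m Samp Ver n (Circuit (l n) (aa n) (gs n))"
  have base_id: "pnat base (%n. n)" by (rule pcomp_proj) simp
  have pB: "pnat base B" unfolding B_def by (intro pnat_power pnat_add base_id pnat_const)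
  have "negl ?succ"
  proof (rule nonuniform_security[OF P])
   show "pnat base aa" unfolding aa_def by (intro pnat_mult pnat_power pnat_add pB pnat_const)
   show "pnat base (%n. 2000 * (B n + 2)\<^sup>2)" by (intro pnat_mult pnat_power pnat_add pB pnat_const)
  qed (use gs[unfolded good_def] in blast)+
  hence neg: "negl (%n. ?succ n + (\<epsilon> n + \<epsilon> n))" by (intro negl_add assms(2))
  have "negl dl"
  proof (rule negl_root[OF neg, of "160 * 16 ^ 7"])
   show "eventually (%n. dl n ^ 9 <= 160 * 16 ^ 7 * (?succ n + (\<epsilon> n + \<epsilon> n))) sequentially"
    using puzzle_nonempty[OF P]
   proof eventually_elim
    case (elim n)
    have "dl n ^ 9 / (160 * 16 ^ 7) <= ?succ n + 2 * \<epsilon> n"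
     by (rule order_trans[OF _ inverter_uniform[OF out(1) _ assms(3)]]) (use gs[of n, unfolded good_def] elim in simp_all)
    thus ?case by (simp add: field_simps)
   qed
  qed (simp_all add: dl_def)
  moreover have "pmf (binding_game S C' O' n) True <= (1 + dl n) / 2" for n
   unfolding game by (simp add: dl_def max_def)
  ultimately show "\<exists>dl. negl dl & (\<forall>n. pmf (binding_game S C' O' n) True <= (1 + dl n) / 2)" by blast
 qed
 show ?thesis using eff cor hid bnd unfolding QCCC_commitment_def by blast
qed

end
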